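(* Let $\tau>0$, $q>0$, and let $\varepsilon_1,\varepsilon_2,c_1,c_2\in C([0,1])$ with $\varepsilon_1,\varepsilon_2>0$ on $[0,1]$. Consider, for $(x,t)\in[0,1]\times\mathbb R^+$, the system with (true) input delay $\tau$ $$\partial_tu_1(x,t)=-\varepsilon_1(x)\partial_xu_1(x,t)+c_1(x)u_2(x,t),$$ $$\partial_tu_2(x,t)=\varepsilon_2(x)\partial_xu_2(x,t)+c_2(x)u_1(x,t),$$ $$u_1(0,t)=q\,u_2(0,t),\qquad u_2(1,t)=v(0,t),$$ $$\tau\,\partial_tv(x,t)=\partial_xv(x,t),\qquad v(1,t)=U(t),$$ and, for $\bar\tau>0$, the control law $$U(t)=\int_0^1\bar p(1-y)v(y,t)\,dy+\int_0^1\bar\alpha_1(1,y)u_1(y,t)\,dy+\int_0^1\bar\alpha_2(1,y)u_2(y,t)\,dy,$$ where $\bar p,\bar\alpha_1,\bar\alpha_2$ are the kernel functions defined in the context with delay value $\bar\tau$. Then there exists $\Delta\tau_0>0$ such that, for every $\bar\tau>0$ with $|\bar\tau-\tau|\le\Delta\tau_0$, this control law robustly stabilizes the system, i.e. the closed-loop system is asymptotically stable.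
   Context: Kernels $K^{21},K^{22}$ on $\mathcal T_1=\{(x,y):0\le y\le x\le1\}$ (these depend only on $\varepsilon_i,c_i,q$, not on the delay): the continuous solution of $$\varepsilon_2(x)\partial_xK^{21}-\varepsilon_1(y)\partial_yK^{21}=\varepsilon_1'(y)K^{21}+c_2(y)K^{22},$$ $$\varepsilon_2(x)\partial_xK^{22}+\varepsilon_2(y)\partial_yK^{22}=-\varepsilon_2'(y)K^{22}+c_1(y)K^{21},$$ $$K^{21}(x,x)=-\frac{c_2(x)}{\varepsilon_1(x)+\varepsilon_2(x)},\qquad \varepsilon_2(0)K^{22}(x,0)=q\,\varepsilon_1(0)K^{21}(x,0).$$ Kernels $\bar\alpha_1,\bar\alpha_2$ on $[0,1]\times[0,1]$: the solution of $$\frac1{\bar\tau}\partial_x\bar\alpha_1-\varepsilon_1(y)\partial_y\bar\alpha_1=\varepsilon_1'(y)\bar\alpha_1+c_2(y)\bar\alpha_2,\qquad \frac1{\bar\tau}\partial_x\bar\alpha_2+\varepsilon_2(y)\partial_y\bar\alpha_2=-\varepsilon_2'(y)\bar\alpha_2+c_1(y)\bar\alpha_1,$$ $$\bar\alpha_1(x,1)=0,\qquad \varepsilon_2(0)\bar\alpha_2(x,0)=q\,\varepsilon_1(0)\bar\alpha_1(x,0),\qquad \bar\alpha_1(0,y)=K^{21}(1,y),\qquad \bar\alpha_2(0,y)=K^{22}(1,y).$$ Finally $\bar p(x)=\bar\tau\,\varepsilon_2(1)\,\bar\alpha_2(x,1)$ for $x\in[0,1]$. All kernel equations are understood in the sense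 of characteristics (integrated along characteristic curves, with the boundary data prescribed where these curves enter the domain). The derivatives $\varepsilon_i'$ appear only through the products $\partial_y(\varepsilon_iK^{2i})$ and $\partial_y(\varepsilon_i\bar\alpha_i)$, $i=1,2$, so the equations may be read in terms of those products. Solutions of the evolution system are mild solutions (integrated along characteristics) with initial data $u_1(\cdot,0),u_2(\cdot,0),v(\cdot,0)\in L^2([0,1])$, and asymptotic stability refers to the zero equilibrium in the $L^2([0,1])^3$ norm of the state $(u_1,u_2,v)$. *)

theory Defs
  imports "HOL-Analysis.Analysis"
begin

text \<open>
  Mild reading of \<open>a(x) \<partial>\<^sub>x w + b(y) \<partial>\<^sub>y w = f\<close> on \<open>D\<close>: along every characteristic segment
  contained in \<open>D\<close>, the increment of \<open>w\<close> is the integral of \<open>f\<close>. The speeds are only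
  continuous, and \<open>w\<close> need not be differentiable or even continuous across characteristics.
\<close>

definition mild_transport ::
  "(real \<times> real) set \<Rightarrow> (real \<Rightarrow> real) \<Rightarrow> (real \<Rightarrow> real) \<Rightarrow>
   (real \<Rightarrow> real \<Rightarrow> real) \<Rightarrow> (real \<Rightarrow> real \<Rightarrow> real) \<Rightarrow> bool" where
  "mild_transport D a b w f \<longleftrightarrow>
     (\<forall>X Y S. 0 \<le> S \<longrightarrow>
        (\<forall>s\<in>{0..S}. (X s, Y s) \<in> D \<and>
           (X has_real_derivative a (X s)) (at s within {0..S}) \<and>
           (Y has_real_derivative b (Y s)) (at s within {0..S})) \<longrightarrow>
        set_integrable lborel {0..S} (\<lambda>s. f (X s) (Y s)) \<and>
        w (X S) (Y S) - w (X 0) (Y 0) = (LBINT s:{0..S}. f (X s) (Y s)))"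

definition triangle :: "(real \<times> real) set" where
  "triangle = {(x, y). 0 \<le> y \<and> y \<le> x \<and> x \<le> 1}"

text \<open>
  The kernel equations are written for the products \<open>\<epsilon>\<^sub>i(y) K\<^sup>2\<^sup>i\<close> and \<open>\<epsilon>\<^sub>i(y) \<alpha>\<^sub>i\<close>, since
  \<open>\<epsilon>\<^sub>i\<close> need not be differentiable. For instance the first equation is
  \<open>\<epsilon>\<^sub>2(x) \<partial>\<^sub>x K\<^sup>2\<^sup>1 - \<partial>\<^sub>y (\<epsilon>\<^sub>1 K\<^sup>2\<^sup>1) = c\<^sub>2(y) K\<^sup>2\<^sup>2\<close>; multiplication by \<open>\<epsilon>\<^sub>1(y)\<close> turns it into a
  transport equation for \<open>\<epsilon>\<^sub>1(y) K\<^sup>2\<^sup>1\<close>.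
\<close>

definition K_kernels ::
  "(real \<Rightarrow> real) \<Rightarrow> (real \<Rightarrow> real) \<Rightarrow> (real \<Rightarrow> real) \<Rightarrow> (real \<Rightarrow> real) \<Rightarrow> real \<Rightarrow>
   (real \<Rightarrow> real \<Rightarrow> real) \<Rightarrow> (real \<Rightarrow> real \<Rightarrow> real) \<Rightarrow> bool" where
  "K_kernels \<epsilon>\<^sub>1 \<epsilon>\<^sub>2 c\<^sub>1 c\<^sub>2 q K21 K22 \<longleftrightarrow>
     continuous_on triangle (\<lambda>(x, y). K21 x y) \<and>
     continuous_on triangle (\<lambda>(x, y). K22 x y) \<and>
     mild_transport triangle \<epsilon>\<^sub>2 (\<lambda>y. - \<epsilon>\<^sub>1 y)
       (\<lambda>x y. \<epsilon>\<^sub>1 y * K21 x y) (\<lambda>x y. \<epsilon>\<^sub>1 y * (c\<^sub>2 y * K22 x y)) \<and>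
     mild_transport triangle \<epsilon>\<^sub>2 \<epsilon>\<^sub>2
       (\<lambda>x y. \<epsilon>\<^sub>2 y * K22 x y) (\<lambda>x y. \<epsilon>\<^sub>2 y * (c\<^sub>1 y * K21 x y)) \<and>
     (\<forall>x\<in>{0..1}. K21 x x = - c\<^sub>2 x / (\<epsilon>\<^sub>1 x + \<epsilon>\<^sub>2 x)) \<and>
     (\<forall>x\<in>{0..1}. \<epsilon>\<^sub>2 0 * K22 x 0 = q * \<epsilon>\<^sub>1 0 * K21 x 0)"

text \<open>
  The data \<open>\<alpha>\<^sub>1(x,1) = 0\<close> and \<open>\<alpha>\<^sub>1(0,y) = K\<^sup>2\<^sup>1(1,y)\<close> disagree at the corner \<open>(0,1)\<close> unless
  \<open>c\<^sub>2(1) = 0\<close>, so the solution is in general only bounded and measurable (it jumps across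
  the characteristics issuing from this corner), and no value is prescribed at the corner
  itself. This affects only one value of each function that enters the control law.
\<close>

definition \<alpha>_kernels ::
  "(real \<Rightarrow> real) \<Rightarrow> (real \<Rightarrow> real) \<Rightarrow> (real \<Rightarrow> real) \<Rightarrow> (real \<Rightarrow> real) \<Rightarrow> real \<Rightarrow>
   (real \<Rightarrow> real \<Rightarrow> real) \<Rightarrow> (real \<Rightarrow> real \<Rightarrow> real) \<Rightarrow> real \<Rightarrow>
   (real \<Rightarrow> real \<Rightarrow> real) \<Rightarrow> (real \<Rightarrow> real \<Rightarrow> real) \<Rightarrow> bool" where
  "\<alpha>_kernels \<epsilon>\<^sub>1 \<epsilon>\<^sub>2 c\<^sub>1 c\<^sub>2 q K21 K22 \<theta> \<alpha>\<^sub>1 \<alpha>\<^sub>2 \<longleftrightarrow>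
     set_borel_measurable borel ({0..1} \<times> {0..1}) (\<lambda>(x, y). \<alpha>\<^sub>1 x y) \<and>
     set_borel_measurable borel ({0..1} \<times> {0..1}) (\<lambda>(x, y). \<alpha>\<^sub>2 x y) \<and>
     bounded ((\<lambda>(x, y). \<alpha>\<^sub>1 x y) ` ({0..1} \<times> {0..1})) \<and>
     bounded ((\<lambda>(x, y). \<alpha>\<^sub>2 x y) ` ({0..1} \<times> {0..1})) \<and>
     mild_transport ({0..1} \<times> {0..1}) (\<lambda>x. 1 / \<theta>) (\<lambda>y. - \<epsilon>\<^sub>1 y)
       (\<lambda>x y. \<epsilon>\<^sub>1 y * \<alpha>\<^sub>1 x y) (\<lambda>x y. \<epsilon>\<^sub>1 y * (c\<^sub>2 y * \<alpha>\<^sub>2 x y)) \<and>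
     mild_transport ({0..1} \<times> {0..1}) (\<lambda>x. 1 / \<theta>) \<epsilon>\<^sub>2
       (\<lambda>x y. \<epsilon>\<^sub>2 y * \<alpha>\<^sub>2 x y) (\<lambda>x y. \<epsilon>\<^sub>2 y * (c\<^sub>1 y * \<alpha>\<^sub>1 x y)) \<and>
     (\<forall>x\<in>{0<..1}. \<alpha>\<^sub>1 x 1 = 0) \<and>
     (\<forall>x\<in>{0..1}. \<epsilon>\<^sub>2 0 * \<alpha>\<^sub>2 x 0 = q * \<epsilon>\<^sub>1 0 * \<alpha>\<^sub>1 x 0) \<and>
     (\<forall>y\<in>{0..<1}. \<alpha>\<^sub>1 0 y = K21 1 y) \<and>
     (\<forall>y\<in>{0..1}. \<alpha>\<^sub>2 0 y = K22 1 y)"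

definition p_kernel :: "(real \<Rightarrow> real) \<Rightarrow> real \<Rightarrow> (real \<Rightarrow> real \<Rightarrow> real) \<Rightarrow> real \<Rightarrow> real" where
  "p_kernel \<epsilon>\<^sub>2 \<theta> \<alpha>\<^sub>2 x = \<theta> * \<epsilon>\<^sub>2 1 * \<alpha>\<^sub>2 x 1"

definition control_law ::
  "(real \<Rightarrow> real) \<Rightarrow> real \<Rightarrow> (real \<Rightarrow> real \<Rightarrow> real) \<Rightarrow> (real \<Rightarrow> real \<Rightarrow> real) \<Rightarrow>
   (real \<Rightarrow> real \<Rightarrow> real) \<Rightarrow> (real \<Rightarrow> real \<Rightarrow> real) \<Rightarrow> (real \<Rightarrow> real \<Rightarrow> real) \<Rightarrow> real \<Rightarrow> real" where
  "control_law \<epsilon>\<^sub>2 \<theta> \<alpha>\<^sub>1 \<alpha>\<^sub>2 u\<^sub>1 u\<^sub>2 v t =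
     (LBINT y:{0..1}. p_kernel \<epsilon>\<^sub>2 \<theta> \<alpha>\<^sub>2 (1 - y) * v y t)
     + (LBINT y:{0..1}. \<alpha>\<^sub>1 1 y * u\<^sub>1 y t)
     + (LBINT y:{0..1}. \<alpha>\<^sub>2 1 y * u\<^sub>2 y t)"

definition L2_norm3 :: "(real \<Rightarrow> real) \<Rightarrow> (real \<Rightarrow> real) \<Rightarrow> (real \<Rightarrow> real) \<Rightarrow> real" where
  "L2_norm3 f g h = sqrt (LBINT x:{0..1}. (f x)\<^sup>2 + (g x)\<^sup>2 + (h x)\<^sup>2)"

text \<open>Arguments are ordered as \<open>w x t\<close>.\<close>

definition L2_trajectory ::
  "(real \<Rightarrow> real \<Rightarrow> real) \<Rightarrow> (real \<Rightarrow> real \<Rightarrow> real) \<Rightarrow> (real \<Rightarrow> real \<Rightarrow> real) \<Rightarrow> bool" where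
  "L2_trajectory u\<^sub>1 u\<^sub>2 v \<longleftrightarrow>
     (\<forall>w\<in>{u\<^sub>1, u\<^sub>2, v}.
        set_borel_measurable borel ({0..1} \<times> {0..}) (\<lambda>(x, t). w x t) \<and>
        (\<forall>t\<ge>0. set_integrable lborel {0..1} (\<lambda>x. (w x t)\<^sup>2))) \<and>
     (\<forall>t\<ge>0. ((\<lambda>s. L2_norm3 (\<lambda>x. u\<^sub>1 x s - u\<^sub>1 x t) (\<lambda>x. u\<^sub>2 x s - u\<^sub>2 x t) (\<lambda>x. v x s - v x t))
        \<longlongrightarrow> 0) (at t within {0..}))"

text \<open>
  Mild solutions are described by everywhere defined representatives: the initial data
  \<open>u\<^sub>1(\<cdot>,0)\<close>, \<open>u\<^sub>2(\<cdot>,0)\<close>, \<open>v(\<cdot>,0)\<close> are arbitrary representatives of \<open>L\<^sup>2\<close> classes, and integration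
  along characteristics then determines all values, including the traces at \<open>x = 0\<close> and
  \<open>x = 1\<close>. Since the initial data need not be compatible with the boundary conditions,
  the latter are imposed for \<open>t > 0\<close>.
\<close>

definition plant_solution ::
  "(real \<Rightarrow> real) \<Rightarrow> (real \<Rightarrow> real) \<Rightarrow> (real \<Rightarrow> real) \<Rightarrow> (real \<Rightarrow> real) \<Rightarrow> real \<Rightarrow> real \<Rightarrow>
   (real \<Rightarrow> real) \<Rightarrow>
   (real \<Rightarrow> real \<Rightarrow> real) \<Rightarrow> (real \<Rightarrow> real \<Rightarrow> real) \<Rightarrow> (real \<Rightarrow> real \<Rightarrow> real) \<Rightarrow> bool" where
  "plant_solution \<epsilon>\<^sub>1 \<epsilon>\<^sub>2 c\<^sub>1 c\<^sub>2 q \<tau> U u\<^sub>1 u\<^sub>2 v \<longleftrightarrow>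
     L2_trajectory u\<^sub>1 u\<^sub>2 v \<and>
     mild_transport ({0..1} \<times> {0..}) \<epsilon>\<^sub>1 (\<lambda>t. 1) u\<^sub>1 (\<lambda>x t. c\<^sub>1 x * u\<^sub>2 x t) \<and>
     mild_transport ({0..1} \<times> {0..}) (\<lambda>x. - \<epsilon>\<^sub>2 x) (\<lambda>t. 1) u\<^sub>2 (\<lambda>x t. c\<^sub>2 x * u\<^sub>1 x t) \<and>
     mild_transport ({0..1} \<times> {0..}) (\<lambda>x. - 1) (\<lambda>t. \<tau>) v (\<lambda>x t. 0) \<and>
     (\<forall>t>0. u\<^sub>1 0 t = q * u\<^sub>2 0 t \<and> u\<^sub>2 1 t = v 0 t \<and> v 1 t = U t)"

definition closed_loop_solution ::
  "(real \<Rightarrow> real) \<Rightarrow> (real \<Rightarrow> real) \<Rightarrow> (real \<Rightarrow> real) \<Rightarrow> (real \<Rightarrow> real) \<Rightarrow> real \<Rightarrow> real \<Rightarrow>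
   real \<Rightarrow> (real \<Rightarrow> real \<Rightarrow> real) \<Rightarrow> (real \<Rightarrow> real \<Rightarrow> real) \<Rightarrow>
   (real \<Rightarrow> real \<Rightarrow> real) \<Rightarrow> (real \<Rightarrow> real \<Rightarrow> real) \<Rightarrow> (real \<Rightarrow> real \<Rightarrow> real) \<Rightarrow> bool" where
  "closed_loop_solution \<epsilon>\<^sub>1 \<epsilon>\<^sub>2 c\<^sub>1 c\<^sub>2 q \<tau> \<theta> \<alpha>\<^sub>1 \<alpha>\<^sub>2 u\<^sub>1 u\<^sub>2 v \<longleftrightarrow>
     plant_solution \<epsilon>\<^sub>1 \<epsilon>\<^sub>2 c\<^sub>1 c\<^sub>2 q \<tau> (control_law \<epsilon>\<^sub>2 \<theta> \<alpha>\<^sub>1 \<alpha>\<^sub>2 u\<^sub>1 u\<^sub>2 v) u\<^sub>1 u\<^sub>2 v"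

text \<open>
  Lyapunov stability of the zero equilibrium together with attractivity, for a system given
  by its set of solutions. Attractivity is required of all solutions, which for a linear
  system is the same as attractivity near the equilibrium.
\<close>

definition asymptotically_stable ::
  "((real \<Rightarrow> real \<Rightarrow> real) \<Rightarrow> (real \<Rightarrow> real \<Rightarrow> real) \<Rightarrow> (real \<Rightarrow> real \<Rightarrow> real) \<Rightarrow> bool) \<Rightarrow> bool" where
  "asymptotically_stable sol \<longleftrightarrow>
     (\<forall>e>0. \<exists>d>0. \<forall>u\<^sub>1 u\<^sub>2 v. sol u\<^sub>1 u\<^sub>2 v \<longrightarrow>
        L2_norm3 (\<lambda>x. u\<^sub>1 x 0) (\<lambda>x. u\<^sub>2 x 0) (\<lambda>x. v x 0) < d \<longrightarrow>
        (\<forall>t\<ge>0. L2_norm3 (\<lambda>x. u\<^sub>1 x t) (\<lambda>x. u\<^sub>2 x t) (\<lambda>x. v x t) < e)) \<and>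
     (\<forall>u\<^sub>1 u\<^sub>2 v. sol u\<^sub>1 u\<^sub>2 v \<longrightarrow>
        ((\<lambda>t. L2_norm3 (\<lambda>x. u\<^sub>1 x t) (\<lambda>x. u\<^sub>2 x t) (\<lambda>x. v x t)) \<longlongrightarrow> 0) at_top)"

end

theory Submission
  imports Defs
begin

text \<open>
  In the variables given by travel times, every characteristic is a straight line of unit slope.
  Duality of the plant with the kernel system on the triangle gives the backstepping identity:
  with \<open>w = u\<^sub>2(1,\<cdot>)\<close>, the trace \<open>u\<^sub>2(0,\<cdot>)\<close> is the trace \<open>\<beta> = w - \<integral> K(1,y) u(y,\<cdot>) dy\<close> delayed by the
  travel time of \<open>u\<^sub>2\<close>. The kernels \<open>\<alpha>\<close> evolve \<open>K(1,\<cdot>)\<close> under the adjoint system, whence the control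
  law is the predicted value of \<open>\<integral> K(1,y) u(y,\<cdot>) dy\<close> after time \<open>\<theta>\<close>, except that the past input enters
  with the delay \<open>\<tau>\<close> in place of \<open>\<theta>\<close>. So for \<open>\<theta> = \<tau>\<close> the trace \<open>\<beta>\<close> vanishes after time \<open>\<tau>\<close>. In general it
  is bounded by the norm of the state on a bounded time interval, with a factor that tends to \<open>0\<close> as
  \<open>\<theta> \<longlongrightarrow> \<tau>\<close>: the kernels may jump, but translations and dilations act continuously on their
  traces in \<open>L\<^sup>1\<close>, uniformly in \<open>\<theta>\<close>. Because \<open>u\<^sub>1(0,\<cdot>) = q u\<^sub>2(0,\<cdot>)\<close>, an energy estimate in the direction of
  \<open>x\<close> bounds the state by \<open>u\<^sub>2(0,\<cdot>)\<close>, and the squared norm is contracted by \<open>1/4\<close> over a fixed time.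
\<close>

text \<open>Squared norms take values in the extended nonnegative reals, so energies are compared,
  added and interchanged by Tonelli before they are known to be finite. Gronwall's absorption does
  need finiteness in advance; for the plant it comes from continuity of the trajectory in
  \<open>L^2\<close>, for the kernels from their boundedness. Nothing is differentiable, so every
  identity is integrated along characteristics first and over the characteristics afterwards. Three
  features shape the robustness argument. The state is only square integrable, but the feedback is
  bounded pointwise by its norm, so after time \<open>\<tau>\<close> the input is a bounded
  function; against bounded functions, kernel errors count in \<open>L^1\<close>, where jumps are
  cheap. Constants must be uniform in \<open>\<theta>\<close>: with
  \<open>\<sigma> = \<theta> * x\<close> as time, the kernel problems for different
  \<open>\<theta>\<close> share equations and data and differ in their duration only. Finally, the
  estimate in the direction of \<open>x\<close> bounds a space-time integral and no single time
  slice, so the contraction averages over a time window and then applies the forward energy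
  bound.\<close>

definition sqn :: "real set \<Rightarrow> (real \<Rightarrow> real) \<Rightarrow> ennreal" where
  "sqn S f = (\<integral>\<^sup>+x\<in>S. ennreal ((f x)\<^sup>2) \<partial>lborel)"

lemma sqn_cong: "(\<And>x. x \<in> S \<Longrightarrow> f x = g x) \<Longrightarrow> sqn S f = sqn S g"
  unfolding sqn_def by (intro nn_integral_cong) (simp add: indicator_def)

lemma sqn_mono_set: "S \<subseteq> R \<Longrightarrow> sqn S f \<le> sqn R f"
  unfolding sqn_def by (intro nn_integral_mono) (auto simp: indicator_def)

lemma sqn_mono:
  "(\<And>x. x \<in> S \<Longrightarrow> \<bar>f x\<bar> \<le> \<bar>g x\<bar>) \<Longrightarrow> sqn S f \<le> sqn S g"
  unfolding sqn_def
  by (intro nn_integral_mono) (auto simp: indicator_def abs_le_square_iff intro!: ennreal_leI)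

lemma sqn_cmult:
  assumes [measurable]: "f \<in> borel_measurable borel" "S \<in> sets borel"
  shows "sqn S (\<lambda>x. c * f x) = ennreal (c\<^sup>2) * sqn S f"
  unfolding sqn_def
  by (subst nn_integral_cmult[symmetric]) (auto simp: power_mult_distrib ennreal_mult mult.assoc)

lemma sqn_le2:
  assumes [measurable]: "f \<in> borel_measurable borel" "g \<in> borel_measurable borel" "S \<in> sets borel"
    and h: "\<And>x. x \<in> S \<Longrightarrow> h x = f x + g x"
  shows "sqn S h \<le> 2 * sqn S f + 2 * sqn S g"
proof -
  have "sqn S h \<le> (\<integral>\<^sup>+x. 2 * (ennreal ((f x)\<^sup>2) * indicator S x) + 2 * (ennreal ((g x)\<^sup>2) * indicator S x) \<partial>lborel)"
    unfolding sqn_def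
  proof (intro nn_integral_mono)
    fix x :: real
    have "(f x + g x)\<^sup>2 \<le> 2 * (f x)\<^sup>2 + 2 * (g x)\<^sup>2"
      using sum_squares_bound[of "f x" "g x"] by (simp add: power2_sum)
    then have "ennreal ((f x + g x)\<^sup>2) \<le> 2 * ennreal ((f x)\<^sup>2) + 2 * ennreal ((g x)\<^sup>2)"
      by (simp add: ennreal_mult[symmetric] ennreal_plus[symmetric] ennreal_leI del: ennreal_plus flip: ennreal_numeral)
    then show "ennreal ((h x)\<^sup>2) * indicator S x
      \<le> 2 * (ennreal ((f x)\<^sup>2) * indicator S x) + 2 * (ennreal ((g x)\<^sup>2) * indicator S x)"
      using h by (auto simp: indicator_def)
  qed
  also have "\<dots> = 2 * sqn S f + 2 * sqn S g"
    unfolding sqn_def by (simp add: nn_integral_add nn_integral_cmult)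
  finally show ?thesis .
qed

lemma sqn_const: "a \<le> b \<Longrightarrow> (\<And>x. x \<in> {a..b} \<Longrightarrow> \<bar>f x\<bar> \<le> c) \<Longrightarrow> sqn {a..b} f \<le> ennreal (c\<^sup>2 * (b - a))"
proof -
  assume ab: "a \<le> b" and f: "\<And>x. x \<in> {a..b} \<Longrightarrow> \<bar>f x\<bar> \<le> c"
  have "sqn {a..b} f \<le> (\<integral>\<^sup>+x. ennreal (c\<^sup>2) * indicator {a..b} x \<partial>lborel)"
    unfolding sqn_def
  proof (intro nn_integral_mono)
    fix x :: real
    have "(f x)\<^sup>2 \<le> c\<^sup>2" if "x \<in> {a..b}"
      using power_mono[OF f[OF that], of 2] by simp
    then show "ennreal ((f x)\<^sup>2) * indicator {a..b} x \<le> ennreal (c\<^sup>2) * indicator {a..b} x"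
      by (auto simp: indicator_def intro!: ennreal_leI)
  qed
  also have "\<dots> = ennreal (c\<^sup>2 * (b - a))"
    using ab by (subst nn_integral_cmult_indicator) (auto simp: ennreal_mult)
  finally show ?thesis .
qed

text \<open>The inequality for nonnegative integrals presupposes no integrability, so finite
  majorants \<open>A\<close> and \<open>B\<close> yield integrability of the product together with
  both bounds.\<close>

lemma Cauchy_Schwarz_sqn:
  assumes [measurable]: "f \<in> borel_measurable borel" "g \<in> borel_measurable borel" "S \<in> sets borel"
    and A: "sqn S f \<le> ennreal A" and B: "sqn S g \<le> ennreal B" and AB: "0 \<le> A" "0 \<le> B"
  shows "set_integrable lborel S (\<lambda>x. f x * g x)"
    and "\<bar>LBINT x:S. f x * g x\<bar> \<le> sqrt (A * B)"
    and "(\<integral>\<^sup>+x\<in>S. ennreal \<bar>f x * g x\<bar> \<partial>lborel) \<le> ennreal (sqrt (A * B))"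
proof -
  let ?I = "\<integral>\<^sup>+x\<in>S. ennreal \<bar>f x * g x\<bar> \<partial>lborel"
  have "?I = (\<integral>\<^sup>+x. (ennreal \<bar>f x\<bar> * indicator S x) * (ennreal \<bar>g x\<bar> * indicator S x) \<partial>lborel)"
    by (intro nn_integral_cong) (auto simp: indicator_def abs_mult ennreal_mult)
  then have "?I\<^sup>2 \<le> (\<integral>\<^sup>+x. (ennreal \<bar>f x\<bar> * indicator S x)\<^sup>2 \<partial>lborel) * (\<integral>\<^sup>+x. (ennreal \<bar>g x\<bar> * indicator S x)\<^sup>2 \<partial>lborel)"
    using Cauchy_Schwarz_nn_integral[of "\<lambda>x. ennreal \<bar>f x\<bar> * indicator S x" lborel "\<lambda>x. ennreal \<bar>g x\<bar> * indicator S x"]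
    by simp
  also have "\<dots> = sqn S f * sqn S g"
    unfolding sqn_def
    by (intro arg_cong2[where f="(*)"] nn_integral_cong) (auto simp: indicator_def ennreal_power)
  also have "\<dots> \<le> ennreal A * ennreal B"
    by (intro mult_mono A B) auto
  also have "\<dots> = (ennreal (sqrt (A * B)))\<^sup>2"
    using AB by (simp add: ennreal_mult ennreal_power)
  finally have *: "?I\<^sup>2 \<le> (ennreal (sqrt (A * B)))\<^sup>2" .
  show le: "?I \<le> ennreal (sqrt (A * B))"
  proof (cases ?I rule: ennreal_cases)
    case (real r)
    have s0: "0 \<le> sqrt (A * B)" using AB by simp
    have "r\<^sup>2 \<le> (sqrt (A * B))\<^sup>2"
      using * real s0 by (simp add: ennreal_power)
    then have "r \<le> sqrt (A * B)" using s0 by (rule power2_le_imp_le)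
    then show ?thesis unfolding real by (rule ennreal_leI)
  next
    case top
    then show ?thesis using * by (simp add: top_unique power_eq_top_ennreal)
  qed
  have eq: "(\<integral>\<^sup>+x. ennreal (norm (indicator S x *\<^sub>R (f x * g x))) \<partial>lborel) = ?I"
    by (intro nn_integral_cong) (auto simp: indicator_def)
  show I: "set_integrable lborel S (\<lambda>x. f x * g x)"
    unfolding set_integrable_def using le eq
    by (intro integrableI_bounded) (auto intro: le_less_trans)
  have "ennreal \<bar>LBINT x:S. f x * g x\<bar> \<le> ?I"
    unfolding set_lebesgue_integral_def eq[symmetric]
    using integral_norm_bound_ennreal[OF I[unfolded set_integrable_def]] by simp
  then show "\<bar>LBINT x:S. f x * g x\<bar> \<le> sqrt (A * B)"
    using le AB by (meson ennreal_le_iff mult_nonneg_nonneg order_trans real_sqrt_ge_zero)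
qed

text \<open>Cauchy-Schwarz against the constant 1. \<open>set_integrable\<close> makes only the
  cut-off of \<open>G\<close> measurable, so the argument runs with the cut-off, which has the same
  \<open>sqn\<close> on the interval.\<close>

lemma set_integral_square_le:
  fixes G :: "real \<Rightarrow> real"
  assumes "set_integrable lborel {0..s} G" "0 \<le> s"
  shows "ennreal ((LBINT r:{0..s}. G r)\<^sup>2) \<le> ennreal s * sqn {0..s} G"
proof -
  let ?G = "\<lambda>r. indicator {0..s} r * G r"
  have m [measurable]: "?G \<in> borel_measurable borel"
    using assms(1) by (auto simp: set_integrable_def dest: borel_measurable_integrable)
  have eq: "sqn {0..s} ?G = sqn {0..s} G" by (intro sqn_cong) auto
  have eqi: "(LBINT r:{0..s}. 1 * ?G r) = (LBINT r:{0..s}. G r)"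
    by (intro set_lebesgue_integral_cong) auto
  show ?thesis
  proof (cases "sqn {0..s} G" rule: ennreal_cases)
    case (real B)
    have "sqn {0..s} (\<lambda>_. 1) \<le> ennreal s"
      using sqn_const[of 0 s "\<lambda>_. 1" 1] assms by simp
    then have "\<bar>LBINT r:{0..s}. 1 * ?G r\<bar> \<le> sqrt (s * B)"
      using real assms eq by (intro Cauchy_Schwarz_sqn(2)) auto
    then have "(LBINT r:{0..s}. G r)\<^sup>2 \<le> s * B"
      unfolding eqi by (rule sqrt_ge_absD)
    then show ?thesis using real assms by (simp add: ennreal_mult[symmetric] ennreal_leI)
  next
    case top
    show ?thesis
    \<comment> \<open>With infinite \<open>sqn\<close> the right-hand side is infinite unless
      \<open>s = 0\<close>. There \<open>0 * top = 0\<close>, and the left-hand side vanishes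
      because a one-point interval is null.\<close>
    proof (cases "s = 0")
      case True
      have "AE r in lborel. indicator {0..s} r *\<^sub>R G r = 0"
        using AE_lborel_singleton[of 0] by (rule eventually_mono) (use True in auto)
      then have "(LBINT r:{0..s}. G r) = 0"
        unfolding set_lebesgue_integral_def by (rule integral_eq_zero_AE)
      then show ?thesis by simp
    next
      case False
      then show ?thesis using top assms by (simp add: ennreal_mult_top)
    qed
  qed
qed

lemma nn_integral_shift:
  "h \<in> borel_measurable borel \<Longrightarrow> (\<integral>\<^sup>+x. h (c + x) \<partial>lborel) = (\<integral>\<^sup>+x. h x \<partial>lborel)" for c :: real
  using nn_integral_real_affine[of h 1 c] by simp

lemma nn_integral_reflect:
  "h \<in> borel_measurable borel \<Longrightarrow> (\<integral>\<^sup>+x. h (c - x) \<partial>lborel) = (\<integral>\<^sup>+x. h x \<partial>lborel)" for c :: real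
  using nn_integral_real_affine[of h "-1" c] by simp

section \<open>Transport along straight characteristics\<close>

text \<open>Mild transport in travel-time coordinates with source \<open>F\<close>. The
  characteristics are the lines of constant \<open>a - t\<close>, so each has a real number as
  label, and integrating over all of them is an integral over the label.\<close>

definition straight :: "real \<Rightarrow> real \<Rightarrow> (real \<Rightarrow> real \<Rightarrow> real) \<Rightarrow> (real \<Rightarrow> real \<Rightarrow> real) \<Rightarrow> bool" where
  "straight L T f F \<longleftrightarrow> (\<forall>a t s. 0 \<le> a \<longrightarrow> 0 \<le> t \<longrightarrow> 0 \<le> s \<longrightarrow> a + s \<le> L \<longrightarrow> t + s \<le> T \<longrightarrow>
     set_integrable lborel {0..s} (\<lambda>r. F (a + r) (t + r)) \<and>
     f (a + s) (t + s) - f a t = (LBINT r:{0..s}. F (a + r) (t + r)))"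

lemma straightD:
  assumes "straight L T f F" "0 \<le> a" "0 \<le> t" "0 \<le> s" "a + s \<le> L" "t + s \<le> T"
  shows "set_integrable lborel {0..s} (\<lambda>r. F (a + r) (t + r))"
    and "f (a + s) (t + s) - f a t = (LBINT r:{0..s}. F (a + r) (t + r))"
  using assms unfolding straight_def by blast+

text \<open>The value of \<open>f\<close> where the characteristic \<open>a - t = c\<close> enters the strip.\<close>

definition ent :: "(real \<Rightarrow> real \<Rightarrow> real) \<Rightarrow> real \<Rightarrow> real" where
  "ent f c = (if 0 \<le> c then f c 0 else f 0 (- c))"

definition dsq :: "real \<Rightarrow> real \<Rightarrow> (real \<Rightarrow> real \<Rightarrow> real) \<Rightarrow> ennreal" where
  "dsq L T F = (\<integral>\<^sup>+s\<in>{0..T}. sqn {0..L} (\<lambda>a. F a s) \<partial>lborel)"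

lemma ent_measurable [measurable]:
  assumes [measurable]: "case_prod f \<in> borel_measurable (borel \<Otimes>\<^sub>M borel)"
  shows "ent f \<in> borel_measurable borel"
  unfolding ent_def by measurable

text \<open>From its entry to \<open>(a, t)\<close> a characteristic needs at most time
  \<open>t\<close>. Enlarging the integral to all of \<open>{0..t}\<close>, with indicators for the
  strip, gives one formula for both places of entry, ready for Tonelli.\<close>

lemma straight_char:
  assumes st: "straight L T f F" and [measurable]: "case_prod F \<in> borel_measurable (borel \<Otimes>\<^sub>M borel)"
    and a: "0 \<le> a" "a \<le> L" and t: "0 \<le> t" "t \<le> T"
  shows "ennreal ((f a t - ent f (a - t))\<^sup>2) \<le>
    ennreal t * (\<integral>\<^sup>+s. ennreal ((F (a - t + s) s)\<^sup>2) * indicator {0..L} (a - t + s) * indicator {0..t} s \<partial>lborel)"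
    (is "_ \<le> _ * ?I")
proof (cases "t \<le> a")
  case True
  with a t have *: "set_integrable lborel {0..t} (\<lambda>r. F (a - t + r) (0 + r))"
    "f (a - t + t) (0 + t) - f (a - t) 0 = (LBINT r:{0..t}. F (a - t + r) (0 + r))"
    using straightD[OF st, of "a - t" 0 t] by auto
  have "ennreal ((f a t - ent f (a - t))\<^sup>2) \<le> ennreal t * sqn {0..t} (\<lambda>r. F (a - t + r) (0 + r))"
    using set_integral_square_le[OF *(1) t(1)] *(2) True by (simp add: ent_def)
  also have "sqn {0..t} (\<lambda>r. F (a - t + r) (0 + r)) \<le> ?I"
    unfolding sqn_def using True a by (intro nn_integral_mono) (auto simp: indicator_def)
  finally show ?thesis by (simp add: mult_left_mono)
next
  case False
  with a t have *: "set_integrable lborel {0..a} (\<lambda>r. F (0 + r) (t - a + r))"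
    "f (0 + a) (t - a + a) - f 0 (t - a) = (LBINT r:{0..a}. F (0 + r) (t - a + r))"
    using straightD[OF st, of 0 "t - a" a] by auto
  have "ennreal ((f a t - ent f (a - t))\<^sup>2) \<le> ennreal a * sqn {0..a} (\<lambda>r. F (0 + r) (t - a + r))"
    using set_integral_square_le[OF *(1) a(1)] *(2) False by (simp add: ent_def)
  also have "\<dots> \<le> ennreal t * ?I"
  proof (rule mult_mono)
    \<comment> \<open>Entry takes place at \<open>a = 0\<close> and time \<open>t - a\<close>;
      shifting the parameter by \<open>t - a\<close> lets it start from the entry.\<close>
    have "?I = (\<integral>\<^sup>+r. ennreal ((F (a - t + (t - a + r)) (t - a + r))\<^sup>2) *
        indicator {0..L} (a - t + (t - a + r)) * indicator {0..t} (t - a + r) \<partial>lborel)"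
      by (rule nn_integral_shift[symmetric]) measurable
    also have "sqn {0..a} (\<lambda>r. F (0 + r) (t - a + r)) \<le> \<dots>"
      unfolding sqn_def using False a by (intro nn_integral_mono) (auto simp: indicator_def)
    finally show "sqn {0..a} (\<lambda>r. F (0 + r) (t - a + r)) \<le> ?I" .
  qed (use False in \<open>auto intro: ennreal_leI\<close>)
  finally show ?thesis .
qed

lemma dsq_eq:
  "dsq L T F = (\<integral>\<^sup>+s. \<integral>\<^sup>+a. ennreal ((F a s)\<^sup>2) * indicator {0..L} a * indicator {0..T} s \<partial>lborel \<partial>lborel)"
  unfolding dsq_def sqn_def by (intro nn_integral_cong) (auto simp: indicator_def)

text \<open>Integrate \<open>straight_char\<close> over the slice and exchange the integrals: for
  fixed \<open>s\<close> the point \<open>a - t + s\<close> is a translate of \<open>a\<close>, so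
  the space-time norm of the source remains.\<close>

lemma straight_slice:
  assumes st: "straight L T f F" and [measurable]: "case_prod F \<in> borel_measurable (borel \<Otimes>\<^sub>M borel)"
    and t: "0 \<le> t" "t \<le> T"
  shows "sqn {0..L} (\<lambda>a. f a t - ent f (a - t)) \<le> ennreal t * dsq L t F"
proof -
  let ?P = "\<lambda>a s. ennreal ((F a s)\<^sup>2) * indicator {0..L} a * indicator {0..t} s"
  have "sqn {0..L} (\<lambda>a. f a t - ent f (a - t)) \<le> (\<integral>\<^sup>+a. ennreal t * (\<integral>\<^sup>+s. ?P (a - t + s) s \<partial>lborel) \<partial>lborel)"
    unfolding sqn_def using straight_char[OF st _ _ _ t]
    by (intro nn_integral_mono) (auto simp: indicator_def)
  also have "\<dots> = ennreal t * (\<integral>\<^sup>+a. (\<integral>\<^sup>+s. ?P (a - t + s) s \<partial>lborel) \<partial>lborel)"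
    by (rule nn_integral_cmult) measurable
  also have "(\<integral>\<^sup>+a. (\<integral>\<^sup>+s. ?P (a - t + s) s \<partial>lborel) \<partial>lborel) = (\<integral>\<^sup>+s. (\<integral>\<^sup>+a. ?P (a - t + s) s \<partial>lborel) \<partial>lborel)"
    by (rule lborel_pair.Fubini') measurable
  also have "\<dots> = (\<integral>\<^sup>+s. (\<integral>\<^sup>+a. ?P a s \<partial>lborel) \<partial>lborel)"
  proof (rule nn_integral_cong)
    fix s
    have "(\<integral>\<^sup>+a. ?P a s \<partial>lborel) = (\<integral>\<^sup>+a. ?P ((s - t) + a) s \<partial>lborel)"
      by (rule nn_integral_shift[symmetric]) measurable
    then show "(\<integral>\<^sup>+a. ?P (a - t + s) s \<partial>lborel) = (\<integral>\<^sup>+a. ?P a s \<partial>lborel)"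
      by (simp add: algebra_simps)
  qed
  finally show ?thesis unfolding dsq_eq .
qed

text \<open>The argument for a slice, except that the arrival time \<open>t\<close> now varies and
  \<open>L - t + s\<close> is a reflection in it.\<close>

lemma straight_trace:
  assumes st: "straight L T f F" and [measurable]: "case_prod F \<in> borel_measurable (borel \<Otimes>\<^sub>M borel)"
    and T: "0 \<le> T" "0 \<le> L"
  shows "sqn {0..T} (\<lambda>s. f L s - ent f (L - s)) \<le> ennreal T * dsq L T F"
proof -
  let ?P = "\<lambda>a s. ennreal ((F a s)\<^sup>2) * indicator {0..L} a * indicator {0..T} s"
  have "sqn {0..T} (\<lambda>s. f L s - ent f (L - s)) \<le> (\<integral>\<^sup>+t. ennreal T * (\<integral>\<^sup>+s. ?P (L - t + s) s \<partial>lborel) \<partial>lborel)"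
    unfolding sqn_def
  proof (intro nn_integral_mono)
    fix t
    show "ennreal ((f L t - ent f (L - t))\<^sup>2) * indicator {0..T} t \<le> ennreal T * (\<integral>\<^sup>+s. ?P (L - t + s) s \<partial>lborel)"
    proof (cases "t \<in> {0..T}")
      case True
      then have "ennreal ((f L t - ent f (L - t))\<^sup>2) \<le>
        ennreal t * (\<integral>\<^sup>+s. ennreal ((F (L - t + s) s)\<^sup>2) * indicator {0..L} (L - t + s) * indicator {0..t} s \<partial>lborel)"
        using T by (intro straight_char[OF st]) auto
      also have "\<dots> \<le> ennreal T * (\<integral>\<^sup>+s. ?P (L - t + s) s \<partial>lborel)"
        using True by (intro mult_mono ennreal_leI nn_integral_mono) (auto simp: indicator_def)
      finally show ?thesis using True by simp
    qed simp
  qed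
  also have "\<dots> = ennreal T * (\<integral>\<^sup>+t. (\<integral>\<^sup>+s. ?P (L - t + s) s \<partial>lborel) \<partial>lborel)"
    by (rule nn_integral_cmult) measurable
  also have "(\<integral>\<^sup>+t. (\<integral>\<^sup>+s. ?P (L - t + s) s \<partial>lborel) \<partial>lborel) = (\<integral>\<^sup>+s. (\<integral>\<^sup>+t. ?P (L - t + s) s \<partial>lborel) \<partial>lborel)"
    by (rule lborel_pair.Fubini') measurable
  also have "\<dots> = (\<integral>\<^sup>+s. (\<integral>\<^sup>+a. ?P a s \<partial>lborel) \<partial>lborel)"
  proof (rule nn_integral_cong)
    fix s
    have "(\<integral>\<^sup>+a. ?P a s \<partial>lborel) = (\<integral>\<^sup>+t. ?P ((L + s) - t) s \<partial>lborel)"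
      by (rule nn_integral_reflect[symmetric]) measurable
    then show "(\<integral>\<^sup>+t. ?P (L - t + s) s \<partial>lborel) = (\<integral>\<^sup>+a. ?P a s \<partial>lborel)"
      by (simp add: algebra_simps)
  qed
  finally show ?thesis unfolding dsq_eq .
qed

text \<open>The characteristics through the slice carry either initial values, translated by
  \<open>t\<close>, or boundary values, reflected; both maps preserve Lebesgue measure.\<close>

lemma ent_slice:
  assumes [measurable]: "case_prod f \<in> borel_measurable (borel \<Otimes>\<^sub>M borel)" and t: "0 \<le> t"
  shows "sqn {0..L} (\<lambda>a. ent f (a - t)) \<le> sqn {0..L} (\<lambda>a. f a 0) + sqn {0..t} (f 0)"
proof -
  let ?h = "\<lambda>a. ennreal ((f a 0)\<^sup>2) * indicator {0..L} a"
  let ?k = "\<lambda>s. ennreal ((f 0 s)\<^sup>2) * indicator {0..t} s"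
  have "sqn {0..L} (\<lambda>a. ent f (a - t)) \<le> (\<integral>\<^sup>+a. ?h (- t + a) + ?k (t - a) \<partial>lborel)"
    unfolding sqn_def using t by (intro nn_integral_mono) (auto simp: indicator_def ent_def)
  also have "\<dots> = (\<integral>\<^sup>+a. ?h (- t + a) \<partial>lborel) + (\<integral>\<^sup>+a. ?k (t - a) \<partial>lborel)"
    by (rule nn_integral_add) measurable
  also have "(\<integral>\<^sup>+a. ?h (- t + a) \<partial>lborel) = (\<integral>\<^sup>+a. ?h a \<partial>lborel)"
    by (rule nn_integral_shift) measurable
  also have "(\<integral>\<^sup>+a. ?k (t - a) \<partial>lborel) = (\<integral>\<^sup>+a. ?k a \<partial>lborel)"
    by (rule nn_integral_reflect) measurable
  finally show ?thesis unfolding sqn_def .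
qed

lemma ent_trace:
  assumes [measurable]: "case_prod f \<in> borel_measurable (borel \<Otimes>\<^sub>M borel)" and L: "0 \<le> L"
  shows "sqn {0..T} (\<lambda>s. ent f (L - s)) \<le> sqn {0..L} (\<lambda>a. f a 0) + sqn {0..T} (f 0)"
proof -
  let ?h = "\<lambda>a. ennreal ((f a 0)\<^sup>2) * indicator {0..L} a"
  let ?k = "\<lambda>s. ennreal ((f 0 s)\<^sup>2) * indicator {0..T} s"
  have "sqn {0..T} (\<lambda>s. ent f (L - s)) \<le> (\<integral>\<^sup>+s. ?h (L - s) + ?k (- L + s) \<partial>lborel)"
    unfolding sqn_def using L by (intro nn_integral_mono) (auto simp: indicator_def ent_def)
  also have "\<dots> = (\<integral>\<^sup>+s. ?h (L - s) \<partial>lborel) + (\<integral>\<^sup>+s. ?k (- L + s) \<partial>lborel)"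
    by (rule nn_integral_add) measurable
  also have "(\<integral>\<^sup>+s. ?h (L - s) \<partial>lborel) = (\<integral>\<^sup>+a. ?h a \<partial>lborel)"
    by (rule nn_integral_reflect) measurable
  also have "(\<integral>\<^sup>+s. ?k (- L + s) \<partial>lborel) = (\<integral>\<^sup>+a. ?k a \<partial>lborel)"
    by (rule nn_integral_shift) measurable
  finally show ?thesis unfolding sqn_def .
qed

lemma straight_energy:
  assumes st: "straight L T f F"
    and [measurable]: "case_prod f \<in> borel_measurable (borel \<Otimes>\<^sub>M borel)"
      "case_prod F \<in> borel_measurable (borel \<Otimes>\<^sub>M borel)"
    and T: "0 \<le> T" "0 \<le> L"
  shows "sqn {0..L} (\<lambda>a. f a T) \<le> 2 * (sqn {0..L} (\<lambda>a. f a 0) + sqn {0..T} (f 0)) + 2 * (ennreal T * dsq L T F)"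
    and "sqn {0..T} (f L) \<le> 2 * (sqn {0..L} (\<lambda>a. f a 0) + sqn {0..T} (f 0)) + 2 * (ennreal T * dsq L T F)"
proof -
  have "sqn {0..L} (\<lambda>a. f a T) \<le> 2 * sqn {0..L} (\<lambda>a. ent f (a - T)) + 2 * sqn {0..L} (\<lambda>a. f a T - ent f (a - T))"
    by (rule sqn_le2) auto
  also have "\<dots> \<le> 2 * (sqn {0..L} (\<lambda>a. f a 0) + sqn {0..T} (f 0)) + 2 * (ennreal T * dsq L T F)"
    using T by (intro add_mono mult_left_mono ent_slice straight_slice[OF st]) auto
  finally show "sqn {0..L} (\<lambda>a. f a T) \<le> \<dots>" .
  have "sqn {0..T} (f L) \<le> 2 * sqn {0..T} (\<lambda>s. ent f (L - s)) + 2 * sqn {0..T} (\<lambda>s. f L s - ent f (L - s))"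
    by (rule sqn_le2) auto
  also have "\<dots> \<le> 2 * (sqn {0..L} (\<lambda>a. f a 0) + sqn {0..T} (f 0)) + 2 * (ennreal T * dsq L T F)"
    using T by (intro add_mono mult_left_mono ent_trace straight_trace[OF st]) auto
  finally show "sqn {0..T} (f L) \<le> \<dots>" .
qed

text \<open>Gronwall's inequality, by absorbing the integral in the norm weighted with \<open>exp (- 2 C t)\<close>.\<close>

lemma gronwall_nn:
  fixes n :: "real \<Rightarrow> ennreal"
  assumes [measurable]: "n \<in> borel_measurable borel"
    and fin: "(\<integral>\<^sup>+t\<in>{0..T}. n t \<partial>lborel) < \<infinity>" and C: "0 < C" and T: "0 \<le> T"
    and le: "\<And>t. t \<in> {0..T} \<Longrightarrow> n t \<le> A + ennreal C * (\<integral>\<^sup>+s\<in>{0..t}. n s \<partial>lborel)"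
  shows "(\<integral>\<^sup>+t\<in>{0..T}. n t \<partial>lborel) \<le> ennreal (2 * T * exp (2 * C * T)) * A"
proof -
  let ?e = "\<lambda>t. ennreal (exp (- 2 * C * t)) * indicator {0..T} t"
  define J where "J = (\<integral>\<^sup>+t. ?e t * n t \<partial>lborel)"
  have Jle: "J \<le> (\<integral>\<^sup>+t\<in>{0..T}. n t \<partial>lborel)"
    unfolding J_def
  proof (intro nn_integral_mono)
    fix t
    have "ennreal (exp (- 2 * C * t)) * n t \<le> 1 * n t" if "t \<in> {0..T}"
      using that C by (intro mult_right_mono) auto
    then show "?e t * n t \<le> n t * indicator {0..T} t"
      by (auto simp: indicator_def)
  qed
  \<comment> \<open>Finiteness is what later allows half of \<open>J\<close> to be subtracted from
    both sides.\<close>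
  from Jle fin have Jfin: "J < \<infinity>" by (rule le_less_trans)
  \<comment> \<open>The weight decays at rate \<open>2 * C\<close>, so its tail gains
    \<open>1 / (2 * C)\<close>; against the factor \<open>C\<close> one half is left.\<close>
  have exp_tail: "(\<integral>\<^sup>+t. ?e t * indicator {s..} t \<partial>lborel) \<le> ennreal (1 / (2 * C)) * ?e s" if "s \<in> {0..T}" for s
  proof -
    have "(\<integral>\<^sup>+t. ?e t * indicator {s..} t \<partial>lborel) \<le> (\<integral>\<^sup>+t. ennreal (exp (- 2 * C * t)) * indicator {s..} t \<partial>lborel)"
      by (intro nn_integral_mono) (auto simp: indicator_def)
    also have "\<dots> = ennreal (0 - (- exp (- 2 * C * s) / (2 * C)))"
    proof (rule nn_integral_FTC_atLeast)
      show "((\<lambda>t. - exp (- 2 * C * t) / (2 * C)) \<longlongrightarrow> 0) at_top"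
      proof -
        have "filterlim (\<lambda>t. (2 * C) * t) at_top at_top"
          using C by (intro filterlim_tendsto_pos_mult_at_top[OF tendsto_const]) (auto simp: filterlim_ident)
        then have "((\<lambda>t. exp (- ((2 * C) * t))) \<longlongrightarrow> 0) at_top"
          by (intro filterlim_compose[OF exp_at_bot] filterlim_compose[OF filterlim_uminus_at_bot_at_top])
        then have "((\<lambda>t. - exp (- ((2 * C) * t)) / (2 * C)) \<longlongrightarrow> - 0 / (2 * C)) at_top"
          using C by (intro tendsto_intros) auto
        then show ?thesis by simp
      qed
    qed (use C in \<open>auto intro!: derivative_eq_intros\<close>)
    also have "\<dots> = ennreal (1 / (2 * C)) * ?e s"
      using that C by (simp add: ennreal_mult[symmetric])
    finally show ?thesis .
  qed
  have "J \<le> (\<integral>\<^sup>+t. ?e t * (A + ennreal C * (\<integral>\<^sup>+s\<in>{0..t}. n s \<partial>lborel)) \<partial>lborel)"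
    unfolding J_def using le
    by (intro nn_integral_mono) (auto simp: indicator_def intro!: mult_left_mono)
  also have "\<dots> = (\<integral>\<^sup>+t. ?e t * A + (\<integral>\<^sup>+s. ennreal C * (?e t * (n s * indicator {0..t} s)) \<partial>lborel) \<partial>lborel)"
  proof (intro nn_integral_cong)
    fix t
    have "(\<integral>\<^sup>+s. ennreal C * (?e t * (n s * indicator {0..t} s)) \<partial>lborel)
        = ennreal C * (\<integral>\<^sup>+s. ?e t * (n s * indicator {0..t} s) \<partial>lborel)"
      by (rule nn_integral_cmult) measurable
    also have "(\<integral>\<^sup>+s. ?e t * (n s * indicator {0..t} s) \<partial>lborel) = ?e t * (\<integral>\<^sup>+s\<in>{0..t}. n s \<partial>lborel)"
      by (rule nn_integral_cmult) measurable
    finally show "?e t * (A + ennreal C * (\<integral>\<^sup>+s\<in>{0..t}. n s \<partial>lborel))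
        = ?e t * A + (\<integral>\<^sup>+s. ennreal C * (?e t * (n s * indicator {0..t} s)) \<partial>lborel)"
      by (simp only: distrib_left mult_ac)
  qed
  also have "\<dots> = (\<integral>\<^sup>+t. ?e t * A \<partial>lborel) + (\<integral>\<^sup>+t. (\<integral>\<^sup>+s. ennreal C * (?e t * (n s * indicator {0..t} s)) \<partial>lborel) \<partial>lborel)"
    unfolding indicator_def atLeastAtMost_iff by (rule nn_integral_add) measurable
  also have "(\<integral>\<^sup>+t. (\<integral>\<^sup>+s. ennreal C * (?e t * (n s * indicator {0..t} s)) \<partial>lborel) \<partial>lborel)
     = (\<integral>\<^sup>+s. (\<integral>\<^sup>+t. ennreal C * (?e t * (n s * indicator {0..t} s)) \<partial>lborel) \<partial>lborel)"
    unfolding indicator_def atLeastAtMost_iff by (rule lborel_pair.Fubini') measurable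
  also have "\<dots> \<le> (\<integral>\<^sup>+s. ennreal (1 / 2) * (?e s * n s) \<partial>lborel)"
  proof (intro nn_integral_mono)
    fix s
    show "(\<integral>\<^sup>+t. ennreal C * (?e t * (n s * indicator {0..t} s)) \<partial>lborel) \<le> ennreal (1 / 2) * (?e s * n s)"
    proof (cases "s \<in> {0..T}")
      case True
      have "(\<integral>\<^sup>+t. ennreal C * (?e t * (n s * indicator {0..t} s)) \<partial>lborel)
        = (\<integral>\<^sup>+t. (ennreal C * n s) * (?e t * indicator {s..} t) \<partial>lborel)"
        using True by (intro nn_integral_cong) (auto simp: indicator_def mult_ac)
      also have "\<dots> = (ennreal C * n s) * (\<integral>\<^sup>+t. ?e t * indicator {s..} t \<partial>lborel)"
        by (rule nn_integral_cmult) measurable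
      also have "\<dots> \<le> (ennreal C * n s) * (ennreal (1 / (2 * C)) * ?e s)"
        by (intro mult_left_mono exp_tail True) auto
      also have "\<dots> = (ennreal C * ennreal (1 / (2 * C))) * (?e s * n s)"
        by (simp add: mult_ac)
      also have "ennreal C * ennreal (1 / (2 * C)) = ennreal (1 / 2)"
        using C by (simp add: ennreal_mult[symmetric])
      finally show ?thesis .
    next
      case False
      have "ennreal C * (?e t * (n s * indicator {0..t} s)) = 0" for t
        using False by (auto simp: indicator_def)
      then show ?thesis by (simp only: nn_integral_const) simp
    qed
  qed
  also have "\<dots> = ennreal (1 / 2) * J"
    unfolding J_def by (rule nn_integral_cmult) measurable
  also have "(\<integral>\<^sup>+t. ?e t * A \<partial>lborel) \<le> (\<integral>\<^sup>+t. A * indicator {0..T} t \<partial>lborel)"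
  proof (intro nn_integral_mono)
    fix t
    have "ennreal (exp (- 2 * C * t)) * A \<le> 1 * A" if "t \<in> {0..T}"
      using that C by (intro mult_right_mono) auto
    then show "?e t * A \<le> A * indicator {0..T} t"
      by (auto simp: indicator_def)
  qed
  also have "(\<integral>\<^sup>+t. A * indicator {0..T} t \<partial>lborel) = A * ennreal T"
    using T by (simp add: nn_integral_cmult_indicator)
  finally have J1: "J \<le> A * ennreal T + ennreal (1 / 2) * J" by simp
  have J2: "J \<le> 2 * (A * ennreal T)"
  proof (cases "A * ennreal T" rule: ennreal_cases)
    case (real r)
    obtain j where j: "J = ennreal j" "0 \<le> j" using Jfin by (cases J rule: ennreal_cases) auto
    have "ennreal j \<le> ennreal (r + j / 2)"
    proof -
      have "ennreal (1 / 2) * ennreal j = ennreal (j / 2)"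
        using j by (subst ennreal_mult[symmetric]) auto
      then have "A * ennreal T + ennreal (1 / 2) * J = ennreal (r + j / 2)"
        unfolding real(2) j(1) using real(1) j(2) by (simp only: ennreal_plus)
      then show ?thesis using J1 j(1) by simp
    qed
    then have "j \<le> r + j / 2" using real(1) j(2) by (subst (asm) ennreal_le_iff) auto
    then have "j \<le> 2 * r" by simp
    then show ?thesis
      unfolding real j(1) using real(1)
      by (simp add: ennreal_mult[symmetric] ennreal_leI flip: ennreal_numeral)
  next
    case top
    then show ?thesis by (simp add: ennreal_mult_top)
  qed
  have "(\<integral>\<^sup>+t\<in>{0..T}. n t \<partial>lborel) \<le> (\<integral>\<^sup>+t. ennreal (exp (2 * C * T)) * (?e t * n t) \<partial>lborel)"
  proof (intro nn_integral_mono)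
    fix t
    have "1 * n t \<le> ennreal (exp (2 * C * T) * exp (- 2 * C * t)) * n t" if "t \<in> {0..T}"
    proof (rule mult_right_mono)
      have "exp (2 * C * T) * exp (- 2 * C * t) = exp (2 * C * (T - t))"
        by (simp add: exp_add[symmetric] algebra_simps)
      then show "1 \<le> ennreal (exp (2 * C * T) * exp (- 2 * C * t))"
        using that C by simp
    qed simp
    then show "n t * indicator {0..T} t \<le> ennreal (exp (2 * C * T)) * (?e t * n t)"
      by (auto simp: indicator_def ennreal_mult mult.assoc)
  qed
  also have "\<dots> = ennreal (exp (2 * C * T)) * J"
    unfolding J_def by (rule nn_integral_cmult) measurable
  also have "\<dots> \<le> ennreal (exp (2 * C * T)) * (2 * (A * ennreal T))"
    by (intro mult_left_mono J2) auto
  also have "\<dots> = ennreal (2 * T * exp (2 * C * T)) * A"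
    using T by (simp add: ennreal_mult mult_ac)
  finally show ?thesis .
qed

lemma sqn_reflect:
  assumes [measurable]: "h \<in> borel_measurable borel"
  shows "sqn {0..L} (\<lambda>b. h (L - b)) = sqn {0..L} h"
proof -
  have "sqn {0..L} (\<lambda>b. h (L - b)) = (\<integral>\<^sup>+b. ennreal ((h (L - b))\<^sup>2) * indicator {0..L} (L - b) \<partial>lborel)"
    unfolding sqn_def by (intro nn_integral_cong) (auto simp: indicator_def)
  also have "\<dots> = (\<integral>\<^sup>+b. ennreal ((h b)\<^sup>2) * indicator {0..L} b \<partial>lborel)"
    by (rule nn_integral_reflect) measurable
  finally show ?thesis unfolding sqn_def .
qed

section \<open>Travel times\<close>

text \<open>\<open>\<phi>\<close> is the travel time from 0 and \<open>\<psi>\<close> its inverse.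
  Having the speed on the whole line, with bounds valid everywhere, makes both of them bijections of
  the reals with two-sided derivatives.\<close>

locale speed =
  fixes e \<phi> \<psi> :: "real \<Rightarrow> real" and m M :: real
  assumes cont: "continuous_on UNIV e" and m: "0 < m" "\<And>x. m \<le> e x" "\<And>x. e x \<le> M"
    and \<phi>0: "\<phi> 0 = 0" and d\<phi>: "\<And>x. (\<phi> has_real_derivative 1 / e x) (at x)"
    and \<psi>\<phi> [simp]: "\<And>x. \<psi> (\<phi> x) = x" and \<phi>\<psi> [simp]: "\<And>a. \<phi> (\<psi> a) = a"
begin

definition "L = \<phi> 1"

lemma epos: "0 < e x" using m by (meson less_le_trans)

lemma M_pos: "0 < M" using m epos by (meson less_le_trans)

lemma \<phi>_mono: "x < y \<Longrightarrow> \<phi> x < \<phi> y"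
  by (rule DERIV_pos_imp_increasing) (use d\<phi> epos in \<open>auto intro!: exI\<close>)

lemma \<phi>_less_iff [simp]: "\<phi> x < \<phi> y \<longleftrightarrow> x < y"
  using \<phi>_mono[of x y] \<phi>_mono[of y x] by (metis less_asym linorder_less_linear)

lemma \<phi>_le_iff [simp]: "\<phi> x \<le> \<phi> y \<longleftrightarrow> x \<le> y"
  by (meson \<phi>_less_iff linorder_not_less)

lemma \<psi>_le_iff [simp]: "\<psi> a \<le> \<psi> b \<longleftrightarrow> a \<le> b"
  using \<phi>_le_iff[of "\<psi> a" "\<psi> b"] by simp

lemma \<psi>0 [simp]: "\<psi> 0 = 0" using \<psi>\<phi>[of 0] \<phi>0 by simp

lemma \<psi>L [simp]: "\<psi> L = 1" by (simp add: L_def)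

lemma L_pos: "0 < L" unfolding L_def using \<phi>_mono[of 0 1] \<phi>0 by simp

lemma \<psi>_in: "0 \<le> a \<Longrightarrow> a \<le> L \<Longrightarrow> \<psi> a \<in> {0..1}"
  using \<psi>_le_iff[of 0 a] \<psi>_le_iff[of a L] by auto

lemma \<phi>_in: "0 \<le> x \<Longrightarrow> x \<le> 1 \<Longrightarrow> \<phi> x \<in> {0..L}"
  using \<phi>_le_iff[of 0 x] \<phi>_le_iff[of x 1] \<phi>0 by (auto simp: L_def simp del: \<phi>_le_iff)

lemma d\<psi>: "(\<psi> has_real_derivative e (\<psi> a)) (at a)"
proof -
  have "isCont \<psi> (\<phi> (\<psi> a))"
    by (rule isCont_inverse_function[where d=1]) (use d\<phi> in \<open>auto intro: DERIV_isCont\<close>)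
  then have "(\<psi> has_real_derivative inverse (1 / e (\<psi> a))) (at a)"
    using epos[of "\<psi> a"]
    by (intro DERIV_inverse_function[where f=\<phi> and a="a - 1" and b="a + 1"] d\<phi>) auto
  then show ?thesis by simp
qed

lemma \<psi>_cont: "continuous_on S \<psi>"
  by (meson DERIV_isCont continuous_at_imp_continuous_on d\<psi>)

lemma \<phi>_cont: "continuous_on S \<phi>"
  by (meson DERIV_isCont continuous_at_imp_continuous_on d\<phi>)

lemma e_cont: "continuous_on S e" using cont continuous_on_subset by blast

lemma measurable_speed [measurable]:
  "e \<in> borel_measurable borel" "\<phi> \<in> borel_measurable borel" "\<psi> \<in> borel_measurable borel"
  by (auto intro: borel_measurable_continuous_onI cont \<psi>_cont \<phi>_cont)

lemma nn_integral_coord: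
  fixes h :: "real \<Rightarrow> ennreal"
  assumes [measurable]: "h \<in> borel_measurable borel"
  shows "(\<integral>\<^sup>+x\<in>{0..1}. h x \<partial>lborel) = (\<integral>\<^sup>+a\<in>{0..L}. h (\<psi> a) * ennreal (e (\<psi> a)) \<partial>lborel)"
proof -
  have "(\<integral>\<^sup>+x. h x * indicator {\<psi> 0..\<psi> L} x \<partial>lborel) =
     (\<integral>\<^sup>+a. h (\<psi> a) * ennreal (e (\<psi> a)) * indicator {0..L} a \<partial>lborel)"
    using L_pos epos
    by (intro nn_integral_substitution_aux d\<psi> continuous_on_compose2[OF cont] \<psi>_cont) (auto intro: less_imp_le)
  then show ?thesis by simp
qed

text \<open>The Jacobian \<open>e\<close> lies between \<open>m\<close> and \<open>M\<close>; this
  estimate and its converse make the norms in \<open>x\<close> and in travel time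
  equivalent.\<close>

lemma sqn_coord_le:
  assumes [measurable]: "u \<in> borel_measurable borel"
  shows "sqn {0..1} u \<le> ennreal M * sqn {0..L} (\<lambda>a. u (\<psi> a))"
proof -
  have "sqn {0..1} u = (\<integral>\<^sup>+a\<in>{0..L}. ennreal ((u (\<psi> a))\<^sup>2) * ennreal (e (\<psi> a)) \<partial>lborel)"
    unfolding sqn_def by (rule nn_integral_coord) measurable
  also have "\<dots> \<le> (\<integral>\<^sup>+a. ennreal M * (ennreal ((u (\<psi> a))\<^sup>2) * indicator {0..L} a) \<partial>lborel)"
    by (intro nn_integral_mono)
      (auto simp: indicator_def mult.commute[of "ennreal M"] intro!: mult_left_mono ennreal_leI m)
  also have "\<dots> = ennreal M * sqn {0..L} (\<lambda>a. u (\<psi> a))"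
    unfolding sqn_def by (rule nn_integral_cmult) measurable
  finally show ?thesis .
qed

lemma sqn_coord_ge:
  assumes [measurable]: "u \<in> borel_measurable borel"
  shows "sqn {0..L} (\<lambda>a. u (\<psi> a)) \<le> ennreal (1 / m) * sqn {0..1} u"
proof -
  have "sqn {0..L} (\<lambda>a. u (\<psi> a)) \<le> (\<integral>\<^sup>+a. ennreal (1 / m) * (ennreal ((u (\<psi> a))\<^sup>2) * ennreal (e (\<psi> a)) * indicator {0..L} a) \<partial>lborel)"
    unfolding sqn_def
  proof (intro nn_integral_mono)
    fix a
    have "(u (\<psi> a))\<^sup>2 * 1 \<le> (u (\<psi> a))\<^sup>2 * (e (\<psi> a) / m)"
      using m(1) m(2)[of "\<psi> a"] by (intro mult_left_mono) auto
    then have "ennreal ((u (\<psi> a))\<^sup>2) \<le> ennreal (1 / m * ((u (\<psi> a))\<^sup>2 * e (\<psi> a)))"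
      by (intro ennreal_leI) simp
    also have "\<dots> = ennreal (1 / m) * (ennreal ((u (\<psi> a))\<^sup>2) * ennreal (e (\<psi> a)))"
      using m(1) epos[of "\<psi> a"] by (simp only: ennreal_mult zero_le_power2 less_imp_le mult_nonneg_nonneg divide_nonneg_nonneg zero_le_one)
    finally show "ennreal ((u (\<psi> a))\<^sup>2) * indicator {0..L} a
      \<le> ennreal (1 / m) * (ennreal ((u (\<psi> a))\<^sup>2) * ennreal (e (\<psi> a)) * indicator {0..L} a)"
      by (auto simp: indicator_def)
  qed
  also have "\<dots> = ennreal (1 / m) * (\<integral>\<^sup>+a\<in>{0..L}. ennreal ((u (\<psi> a))\<^sup>2) * ennreal (e (\<psi> a)) \<partial>lborel)"
    by (rule nn_integral_cmult) measurable
  also have "(\<integral>\<^sup>+a\<in>{0..L}. ennreal ((u (\<psi> a))\<^sup>2) * ennreal (e (\<psi> a)) \<partial>lborel) = sqn {0..1} u"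
    unfolding sqn_def by (rule nn_integral_coord[symmetric]) measurable
  finally show ?thesis .
qed

lemma sqn_coord_ge':
  assumes [measurable]: "u \<in> borel_measurable borel"
  shows "sqn {0..L} (\<lambda>b. u (\<psi> (L - b))) \<le> ennreal (1 / m) * sqn {0..1} u"
  using sqn_reflect[of "\<lambda>a. u (\<psi> a)" L] sqn_coord_ge[OF assms] by simp

lemma sqn_coord_le':
  assumes [measurable]: "u \<in> borel_measurable borel"
  shows "sqn {0..1} u \<le> ennreal M * sqn {0..L} (\<lambda>b. u (\<psi> (L - b)))"
  using sqn_reflect[of "\<lambda>a. u (\<psi> a)" L] sqn_coord_le[OF assms] by simp

text \<open>The curve \<open>\<psi> (a + r)\<close>, \<open>t + r\<close> is a characteristic
  because \<open>\<psi>\<close> has derivative \<open>e (\<psi> a)\<close>.\<close>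

lemma straight_right:
  assumes "mild_transport ({0..1} \<times> {0..T}) e (\<lambda>t. 1) u f"
  shows "straight L T (\<lambda>a t. u (\<psi> a) t) (\<lambda>a t. f (\<psi> a) t)"
  unfolding straight_def
proof (intro allI impI)
  fix a t s :: real
  assume *: "0 \<le> a" "0 \<le> t" "0 \<le> s" "a + s \<le> L" "t + s \<le> T"
  have "(\<forall>r\<in>{0..s}. (\<psi> (a + r), t + r) \<in> {0..1} \<times> {0..T} \<and>
      ((\<lambda>r. \<psi> (a + r)) has_real_derivative e (\<psi> (a + r))) (at r within {0..s}) \<and>
      ((\<lambda>r. t + r) has_real_derivative 1) (at r within {0..s}))"
  proof
    fix r assume r: "r \<in> {0..s}"
    have "((\<lambda>r. \<psi> (a + r)) has_real_derivative e (\<psi> (a + r)) * 1) (at r within {0..s})"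
      by (rule DERIV_chain2[OF d\<psi>]) (auto intro!: derivative_eq_intros)
    moreover have "\<psi> (a + r) \<in> {0..1}" using * r by (intro \<psi>_in) auto
    ultimately show "(\<psi> (a + r), t + r) \<in> {0..1} \<times> {0..T} \<and>
      ((\<lambda>r. \<psi> (a + r)) has_real_derivative e (\<psi> (a + r))) (at r within {0..s}) \<and>
      ((\<lambda>r. t + r) has_real_derivative 1) (at r within {0..s})"
      using * r by (auto intro!: derivative_eq_intros)
  qed
  from assms[unfolded mild_transport_def, rule_format, OF *(3) this[rule_format]]
  show "set_integrable lborel {0..s} (\<lambda>r. f (\<psi> (a + r)) (t + r)) \<and>
       u (\<psi> (a + s)) (t + s) - u (\<psi> a) t = (LBINT r:{0..s}. f (\<psi> (a + r)) (t + r))"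
    by simp
qed

text \<open>For waves moving to the left the coordinate \<open>b\<close> is the travel time from
  \<open>x = 1\<close>. So both families enter at coordinate 0 and have slope one.\<close>

lemma straight_left:
  assumes "mild_transport ({0..1} \<times> {0..T}) (\<lambda>x. - e x) (\<lambda>t. 1) u f"
  shows "straight L T (\<lambda>b t. u (\<psi> (L - b)) t) (\<lambda>b t. f (\<psi> (L - b)) t)"
  unfolding straight_def
proof (intro allI impI)
  fix a t s :: real
  assume *: "0 \<le> a" "0 \<le> t" "0 \<le> s" "a + s \<le> L" "t + s \<le> T"
  have "(\<forall>r\<in>{0..s}. (\<psi> (L - (a + r)), t + r) \<in> {0..1} \<times> {0..T} \<and>
      ((\<lambda>r. \<psi> (L - (a + r))) has_real_derivative - e (\<psi> (L - (a + r)))) (at r within {0..s}) \<and>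
      ((\<lambda>r. t + r) has_real_derivative 1) (at r within {0..s}))"
  proof
    fix r assume r: "r \<in> {0..s}"
    have "((\<lambda>r. \<psi> (L - (a + r))) has_real_derivative e (\<psi> (L - (a + r))) * (- 1)) (at r within {0..s})"
      by (rule DERIV_chain2[OF d\<psi>]) (auto intro!: derivative_eq_intros)
    moreover have "\<psi> (L - (a + r)) \<in> {0..1}" using * r by (intro \<psi>_in) auto
    ultimately show "(\<psi> (L - (a + r)), t + r) \<in> {0..1} \<times> {0..T} \<and>
      ((\<lambda>r. \<psi> (L - (a + r))) has_real_derivative - e (\<psi> (L - (a + r)))) (at r within {0..s}) \<and>
      ((\<lambda>r. t + r) has_real_derivative 1) (at r within {0..s})"
      using * r by (auto intro!: derivative_eq_intros)
  qed
  from assms[unfolded mild_transport_def, rule_format, OF *(3) this[rule_format]]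
  show "set_integrable lborel {0..s} (\<lambda>r. f (\<psi> (L - (a + r))) (t + r)) \<and>
       u (\<psi> (L - (a + s))) (t + s) - u (\<psi> (L - a)) t = (LBINT r:{0..s}. f (\<psi> (L - (a + r))) (t + r))"
    by simp
qed

end

text \<open>\<open>\<phi>\<close> is an antiderivative of \<open>1 / e\<close>. As
  \<open>1 / e\<close> is at least \<open>1 / M\<close>, it grows at least linearly in both
  directions and is therefore onto.\<close>

lemma speed_exists:
  fixes e :: "real \<Rightarrow> real"
  assumes cont: "continuous_on UNIV e" and m: "0 < m" "\<And>x. m \<le> e x" "\<And>x. e x \<le> M"
  shows "\<exists>\<phi> \<psi>. speed e \<phi> \<psi> m M"
proof -
  have pos: "0 < e x" for x using m by (meson less_le_trans)
  have Mp: "0 < M" using pos m by (meson less_le_trans)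
  have "\<exists>F. \<forall>x::real. - \<infinity> < ereal x \<longrightarrow> ereal x < \<infinity> \<longrightarrow> (F has_vector_derivative 1 / e x) (at x)"
    using cont pos by (intro einterval_antiderivative) (auto intro!: continuous_intros simp: continuous_on_eq_continuous_at less_imp_neq[THEN not_sym])
  then obtain F where F: "\<And>x. (F has_real_derivative 1 / e x) (at x)"
    by (auto simp: has_real_derivative_iff_has_vector_derivative)
  define \<phi> where "\<phi> x = F x - F 0" for x
  have d: "(\<phi> has_real_derivative 1 / e x) (at x)" for x
    unfolding \<phi>_def by (auto intro!: derivative_eq_intros F)
  have phi0: "\<phi> 0 = 0" by (simp add: \<phi>_def)
  have grow: "(y - x) / M \<le> \<phi> y - \<phi> x" if "x \<le> y" for x y
  proof -
    have "\<phi> x - x / M \<le> \<phi> y - y / M"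
      using that
    proof (rule DERIV_nonneg_imp_nondecreasing)
      fix z
      have "((\<lambda>x. \<phi> x - x / M) has_real_derivative 1 / e z - 1 / M) (at z)"
        using Mp by (auto intro!: derivative_eq_intros d)
      moreover have "0 \<le> 1 / e z - 1 / M" using pos[of z] m(3)[of z] Mp by (simp add: field_simps)
      ultimately show "\<exists>D. ((\<lambda>x. \<phi> x - x / M) has_real_derivative D) (at z) \<and> 0 \<le> D" by blast
    qed
    then show ?thesis by (simp add: diff_divide_distrib)
  qed
  have strict: "\<phi> x < \<phi> y" if "x < y" for x y
    using grow[of x y] divide_pos_pos[of "y - x" M] that Mp by linarith
  have inj: "inj \<phi>"
    using strict by (intro injI) (metis less_irrefl linorder_less_linear)
  have c: "continuous_on S \<phi>" for S
    by (meson DERIV_isCont continuous_at_imp_continuous_on d)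
  have surj: "surj \<phi>"
    unfolding surj_def
  proof
    fix a :: real
    let ?R = "M * \<bar>a\<bar>"
    have "\<phi> (- ?R) \<le> a" using grow[of "- ?R" 0] Mp by (simp add: \<phi>_def)
    moreover have "a \<le> \<phi> ?R" using grow[of 0 ?R] Mp by (simp add: \<phi>_def)
    moreover have "- ?R \<le> ?R" using Mp by simp
    ultimately show "\<exists>x. a = \<phi> x"
      using IVT'[of \<phi> "- ?R" a ?R] c by metis
  qed
  have "speed e \<phi> (inv \<phi>) m M"
    using inj surj d m by unfold_locales (auto simp: cont surj_f_inv_f phi0)
  then show ?thesis by blast
qed

section \<open>Energy estimates for the hyperbolic system\<close>

text \<open>The trace \<open>u2 1\<close> is left free: it is the input. The same predicate serves
  the plant and, with the families exchanged, the kernels. The finite space-time norm is the a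
  priori bound for Gronwall's inequality; Borel measurability on the whole plane makes all slices
  and traces measurable.\<close>

definition hsys :: "(real \<Rightarrow> real) \<Rightarrow> (real \<Rightarrow> real) \<Rightarrow> (real \<Rightarrow> real) \<Rightarrow> (real \<Rightarrow> real) \<Rightarrow> real \<Rightarrow> real \<Rightarrow>
    (real \<Rightarrow> real \<Rightarrow> real) \<Rightarrow> (real \<Rightarrow> real \<Rightarrow> real) \<Rightarrow> bool" where
  "hsys e1 e2 d1 d2 q T u1 u2 \<longleftrightarrow>
     case_prod u1 \<in> borel_measurable (borel \<Otimes>\<^sub>M borel) \<and>
     case_prod u2 \<in> borel_measurable (borel \<Otimes>\<^sub>M borel) \<and>
     mild_transport ({0..1} \<times> {0..T}) e1 (\<lambda>t. 1) u1 (\<lambda>x t. d1 x * u2 x t) \<and>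
     mild_transport ({0..1} \<times> {0..T}) (\<lambda>x. - e2 x) (\<lambda>t. 1) u2 (\<lambda>x t. d2 x * u1 x t) \<and>
     (\<forall>t. 0 < t \<longrightarrow> t \<le> T \<longrightarrow> u1 0 t = q * u2 0 t) \<and>
     (\<integral>\<^sup>+t\<in>{0..T}. (sqn {0..1} (\<lambda>x. u1 x t) + sqn {0..1} (\<lambda>x. u2 x t)) \<partial>lborel) < \<infinity>"

lemma mild_transport_subset:
  assumes "mild_transport D a b w f" "D' \<subseteq> D"
  shows "mild_transport D' a b w f"
  using assms unfolding mild_transport_def by (meson subsetD)

lemma mild_transport_shift:
  assumes "mild_transport ({0..1} \<times> {0..T}) a (\<lambda>t. k) u f" "0 \<le> t0"
  shows "mild_transport ({0..1} \<times> {0..T - t0}) a (\<lambda>t. k) (\<lambda>x t. u x (t0 + t)) (\<lambda>x t. f x (t0 + t))"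
  unfolding mild_transport_def
proof (intro allI impI)
  fix X Y S :: "real \<Rightarrow> real" and s :: real
  assume s: "0 \<le> s" and *: "\<forall>r\<in>{0..s}. (X r, Y r) \<in> {0..1} \<times> {0..T - t0} \<and>
     (X has_real_derivative a (X r)) (at r within {0..s}) \<and> (Y has_real_derivative k) (at r within {0..s})"
  have "\<forall>r\<in>{0..s}. (X r, t0 + Y r) \<in> {0..1} \<times> {0..T} \<and>
     (X has_real_derivative a (X r)) (at r within {0..s}) \<and> ((\<lambda>r. t0 + Y r) has_real_derivative k) (at r within {0..s})"
    using * assms(2) by (auto intro!: derivative_eq_intros)
  from assms(1)[unfolded mild_transport_def, rule_format, OF s this[rule_format]]
  show "set_integrable lborel {0..s} (\<lambda>s. f (X s) (t0 + Y s)) \<and>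
       u (X s) (t0 + Y s) - u (X 0) (t0 + Y 0) = (LBINT s:{0..s}. f (X s) (t0 + Y s))" .
qed

lemma hsys_shift:
  assumes h: "hsys e1 e2 d1 d2 q T u1 u2" and t0: "0 \<le> t0"
  shows "hsys e1 e2 d1 d2 q (T - t0) (\<lambda>x t. u1 x (t0 + t)) (\<lambda>x t. u2 x (t0 + t))"
proof -
  have [measurable]: "case_prod u1 \<in> borel_measurable (borel \<Otimes>\<^sub>M borel)"
    "case_prod u2 \<in> borel_measurable (borel \<Otimes>\<^sub>M borel)" using h by (auto simp: hsys_def)
  let ?n = "\<lambda>t. (sqn {0..1} (\<lambda>x. u1 x t) + sqn {0..1} (\<lambda>x. u2 x t)) * indicator {0..T} t"
  have [measurable]: "?n \<in> borel_measurable borel" unfolding sqn_def by measurable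
  have "(\<integral>\<^sup>+t\<in>{0..T - t0}. (sqn {0..1} (\<lambda>x. u1 x (t0 + t)) + sqn {0..1} (\<lambda>x. u2 x (t0 + t))) \<partial>lborel)
      \<le> (\<integral>\<^sup>+t. ?n (t0 + t) \<partial>lborel)"
    using t0 by (intro nn_integral_mono) (auto simp: indicator_def)
  also have "\<dots> = (\<integral>\<^sup>+t. ?n t \<partial>lborel)" by (rule nn_integral_shift) measurable
  also have "\<dots> < \<infinity>" using h by (simp add: hsys_def)
  finally have "(\<integral>\<^sup>+t\<in>{0..T - t0}. (sqn {0..1} (\<lambda>x. u1 x (t0 + t)) + sqn {0..1} (\<lambda>x. u2 x (t0 + t))) \<partial>lborel) < \<infinity>" .
  moreover have "u1 0 (t0 + t) = q * u2 0 (t0 + t)" if "0 < t" "t \<le> T - t0" for t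
    using h that t0 by (auto simp: hsys_def)
  ultimately show ?thesis
    using h mild_transport_shift[where k=1 and T=T and ?t0.0=t0, OF _ t0]
    unfolding hsys_def by auto
qed

lemma hsys_mono:
  assumes h: "hsys e1 e2 d1 d2 q T u1 u2" and T: "T' \<le> T"
  shows "hsys e1 e2 d1 d2 q T' u1 u2"
proof -
  have "(\<integral>\<^sup>+t\<in>{0..T'}. (sqn {0..1} (\<lambda>x. u1 x t) + sqn {0..1} (\<lambda>x. u2 x t)) \<partial>lborel)
     \<le> (\<integral>\<^sup>+t\<in>{0..T}. (sqn {0..1} (\<lambda>x. u1 x t) + sqn {0..1} (\<lambda>x. u2 x t)) \<partial>lborel)"
    using T by (intro nn_integral_mono) (auto simp: indicator_def)
  also have "\<dots> < \<infinity>" using h by (simp add: hsys_def)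
  finally show ?thesis
    using h T unfolding hsys_def
    by (auto elim!: mild_transport_subset)
qed

text \<open>One instant is a null set, which matters because boundary conditions hold for
  \<open>0 < t\<close> only. With \<open>q = 0\<close> this shows that a trace vanishing at positive
  times has norm zero.\<close>

lemma sqn_AE_mult:
  assumes [measurable]: "f \<in> borel_measurable borel" "g \<in> borel_measurable borel"
    and eq: "\<And>t. 0 < t \<Longrightarrow> t \<le> T \<Longrightarrow> g t = q * f t"
  shows "sqn {0..T} g = ennreal (q\<^sup>2) * sqn {0..T} f"
proof -
  have "sqn {0..T} g = sqn {0..T} (\<lambda>t. q * f t)"
    unfolding sqn_def
  proof (rule nn_integral_cong_AE)
    show "AE t in lborel. ennreal ((g t)\<^sup>2) * indicator {0..T} t = ennreal ((q * f t)\<^sup>2) * indicator {0..T} t"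
      using AE_lborel_singleton[of 0] by (rule eventually_mono) (auto simp: indicator_def eq)
  qed
  also have "\<dots> = ennreal (q\<^sup>2) * sqn {0..T} f" by (rule sqn_cmult) auto
  finally show ?thesis .
qed

text \<open>Both speeds share the bounds \<open>m\<close> and \<open>M\<close>, both couplings the
  bound \<open>D\<close>. This symmetry makes the adjoint system, in which \<open>e1\<close> and
  \<open>e2\<close> change places, an instance again.\<close>

locale hyp = s1: speed e1 \<phi>1 \<psi>1 m M + s2: speed e2 \<phi>2 \<psi>2 m M
  for e1 \<phi>1 \<psi>1 e2 \<phi>2 \<psi>2 :: "real \<Rightarrow> real" and m M :: real +
  fixes d1 d2 :: "real \<Rightarrow> real" and q D :: real
  assumes d_cont: "continuous_on UNIV d1" "continuous_on UNIV d2"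
    and d_bound: "\<And>x. \<bar>d1 x\<bar> \<le> D" "\<And>x. \<bar>d2 x\<bar> \<le> D" and q_pos: "0 < q"
begin

abbreviation "sys \<equiv> hsys e1 e2 d1 d2 q"

lemma D_nonneg: "0 \<le> D" using d_bound(1)[of 0] by linarith

lemma d_measurable [measurable]: "d1 \<in> borel_measurable borel" "d2 \<in> borel_measurable borel"
  by (auto intro: borel_measurable_continuous_onI d_cont)

lemma hsysD:
  assumes "sys T u1 u2"
  shows "case_prod u1 \<in> borel_measurable (borel \<Otimes>\<^sub>M borel)"
    "case_prod u2 \<in> borel_measurable (borel \<Otimes>\<^sub>M borel)"
    "straight s1.L T (\<lambda>a t. u1 (\<psi>1 a) t) (\<lambda>a t. d1 (\<psi>1 a) * u2 (\<psi>1 a) t)"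
    "straight s2.L T (\<lambda>b t. u2 (\<psi>2 (s2.L - b)) t) (\<lambda>b t. d2 (\<psi>2 (s2.L - b)) * u1 (\<psi>2 (s2.L - b)) t)"
    "\<And>t. 0 < t \<Longrightarrow> t \<le> T \<Longrightarrow> u1 0 t = q * u2 0 t"
  using assms s1.straight_right s2.straight_left unfolding hsys_def by auto

lemma source_sqn:
  assumes [measurable]: "case_prod u \<in> borel_measurable (borel \<Otimes>\<^sub>M borel)"
  shows "dsq s1.L t (\<lambda>a t. d1 (\<psi>1 a) * u (\<psi>1 a) t)
      \<le> ennreal (D\<^sup>2 / m) * (\<integral>\<^sup>+s\<in>{0..t}. sqn {0..1} (\<lambda>x. u x s) \<partial>lborel)" (is ?th1)
    and "dsq s2.L t (\<lambda>b t. d2 (\<psi>2 (s2.L - b)) * u (\<psi>2 (s2.L - b)) t)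
      \<le> ennreal (D\<^sup>2 / m) * (\<integral>\<^sup>+s\<in>{0..t}. sqn {0..1} (\<lambda>x. u x s) \<partial>lborel)" (is ?th2)
proof -
  have c: "ennreal (D\<^sup>2) * (ennreal (1 / m) * A) = ennreal (D\<^sup>2 / m) * A" for A
    using s1.m(1) by (simp add: ennreal_mult[symmetric] mult.assoc[symmetric])
  have [measurable]: "(\<lambda>s. sqn {0..1} (\<lambda>x. u x s)) \<in> borel_measurable borel"
    unfolding sqn_def by measurable
  have s: "sqn S (\<lambda>a. d a * w a) \<le> ennreal (D\<^sup>2) * sqn S w"
    if [measurable]: "w \<in> borel_measurable borel" "S \<in> sets borel" and "\<And>x. \<bar>d x\<bar> \<le> D" for d w S
  proof -
    have "sqn S (\<lambda>a. d a * w a) \<le> sqn S (\<lambda>a. D * w a)"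
      using that(3) D_nonneg by (intro sqn_mono) (auto simp: abs_mult intro!: mult_right_mono)
    also have "\<dots> = ennreal (D\<^sup>2) * sqn S w" by (rule sqn_cmult) auto
    finally show ?thesis .
  qed
  have 1: "sqn {0..s1.L} (\<lambda>a. d1 (\<psi>1 a) * u (\<psi>1 a) s) \<le> ennreal (D\<^sup>2 / m) * sqn {0..1} (\<lambda>x. u x s)" for s
  proof -
    have "sqn {0..s1.L} (\<lambda>a. d1 (\<psi>1 a) * u (\<psi>1 a) s) \<le> ennreal (D\<^sup>2) * sqn {0..s1.L} (\<lambda>a. u (\<psi>1 a) s)"
      by (rule s) (auto simp: d_bound)
    also have "\<dots> \<le> ennreal (D\<^sup>2) * (ennreal (1 / m) * sqn {0..1} (\<lambda>x. u x s))"
      by (intro mult_left_mono s1.sqn_coord_ge[of "\<lambda>x. u x s"]) auto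
    finally show ?thesis unfolding c .
  qed
  have 2: "sqn {0..s2.L} (\<lambda>b. d2 (\<psi>2 (s2.L - b)) * u (\<psi>2 (s2.L - b)) s) \<le> ennreal (D\<^sup>2 / m) * sqn {0..1} (\<lambda>x. u x s)" for s
  proof -
    have "sqn {0..s2.L} (\<lambda>b. d2 (\<psi>2 (s2.L - b)) * u (\<psi>2 (s2.L - b)) s)
        \<le> ennreal (D\<^sup>2) * sqn {0..s2.L} (\<lambda>b. u (\<psi>2 (s2.L - b)) s)"
      by (rule s) (auto simp: d_bound)
    also have "\<dots> \<le> ennreal (D\<^sup>2) * (ennreal (1 / m) * sqn {0..1} (\<lambda>x. u x s))"
      by (intro mult_left_mono s2.sqn_coord_ge'[of "\<lambda>x. u x s"]) auto
    finally show ?thesis unfolding c .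
  qed
  have "dsq s1.L t (\<lambda>a t. d1 (\<psi>1 a) * u (\<psi>1 a) t)
      \<le> (\<integral>\<^sup>+s. ennreal (D\<^sup>2 / m) * (sqn {0..1} (\<lambda>x. u x s) * indicator {0..t} s) \<partial>lborel)"
    unfolding dsq_def using 1 by (intro nn_integral_mono) (auto simp: indicator_def)
  also have "\<dots> = ennreal (D\<^sup>2 / m) * (\<integral>\<^sup>+s\<in>{0..t}. sqn {0..1} (\<lambda>x. u x s) \<partial>lborel)"
    by (rule nn_integral_cmult) measurable
  finally show ?th1 .
  have "dsq s2.L t (\<lambda>b t. d2 (\<psi>2 (s2.L - b)) * u (\<psi>2 (s2.L - b)) t)
      \<le> (\<integral>\<^sup>+s. ennreal (D\<^sup>2 / m) * (sqn {0..1} (\<lambda>x. u x s) * indicator {0..t} s) \<partial>lborel)"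
    unfolding dsq_def using 2 by (intro nn_integral_mono) (auto simp: indicator_def)
  also have "\<dots> = ennreal (D\<^sup>2 / m) * (\<integral>\<^sup>+s\<in>{0..t}. sqn {0..1} (\<lambda>x. u x s) \<partial>lborel)"
    by (rule nn_integral_cmult) measurable
  finally show ?th2 .
qed

text \<open>The estimates follow the input through the system: \<open>u2\<close> is controlled by
  its input \<open>u2 1\<close>, its trace at \<open>x = 0\<close> times \<open>q\<close> is the
  incoming trace of \<open>u1\<close>, and \<open>u1\<close> comes last. The sources stay on the
  right as a time integral. \<open>C\<close> depends on the system and on \<open>Tm\<close>
  alone.\<close>

lemma energy_step:
  assumes Tm: "0 \<le> Tm"
  obtains C where "0 < C"
    "\<And>u1 u2 t T. 0 \<le> t \<Longrightarrow> t \<le> T \<Longrightarrow> T \<le> Tm \<Longrightarrow> sys T u1 u2 \<Longrightarrow>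
      sqn {0..1} (\<lambda>x. u1 x t) + sqn {0..1} (\<lambda>x. u2 x t) + sqn {0..t} (u2 0) + sqn {0..t} (u1 1)
      \<le> ennreal C * (sqn {0..1} (\<lambda>x. u1 x 0) + sqn {0..1} (\<lambda>x. u2 x 0) + sqn {0..t} (u2 1)
        + (\<integral>\<^sup>+s\<in>{0..t}. (sqn {0..1} (\<lambda>x. u1 x s) + sqn {0..1} (\<lambda>x. u2 x s)) \<partial>lborel))"
proof -
  \<comment> \<open>A common majorant of all factors below: changes of coordinates, sources, elapsed
    time and reflection.\<close>
  define k where "k = max (max 1 M) (max (max (1 / m) (D\<^sup>2 / m)) (max Tm (q\<^sup>2)))"
  have k: "1 \<le> k" "M \<le> k" "1 / m \<le> k" "D\<^sup>2 / m \<le> k" "Tm \<le> k" "q\<^sup>2 \<le> k" by (auto simp: k_def)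
  define K where "K = ennreal k"
  have K1: "1 \<le> K" unfolding K_def using k(1) by simp
  \<comment> \<open>\<open>c2\<close> and \<open>c1\<close> are the constants for \<open>u2\<close>
    and \<open>u1\<close>, read off from \<open>straight_energy\<close>: twice the initial values
    plus incoming trace, plus twice the source. The incoming trace of \<open>u1\<close> costs
    \<open>K * c2\<close>.\<close>
  define c2 where "c2 = 2 * (K + 1) + 2 * (K * K)"
  define c1 where "c1 = 2 * (K + K * c2) + 2 * (K * K)"
  define c where "c = K * c1 + K * c2 + c2 + c1"
  have cfin: "c < top" unfolding c_def c1_def c2_def K_def
    by (simp add: ennreal_mult_less_top ennreal_add_eq_top less_top)
  have main: "sqn {0..1} (\<lambda>x. u1 x t) + sqn {0..1} (\<lambda>x. u2 x t) + sqn {0..t} (u2 0) + sqn {0..t} (u1 1)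
      \<le> c * (sqn {0..1} (\<lambda>x. u1 x 0) + sqn {0..1} (\<lambda>x. u2 x 0) + sqn {0..t} (u2 1)
        + (\<integral>\<^sup>+s\<in>{0..t}. (sqn {0..1} (\<lambda>x. u1 x s) + sqn {0..1} (\<lambda>x. u2 x s)) \<partial>lborel))"
    if t: "0 \<le> t" "t \<le> T" "T \<le> Tm" and h0: "sys T u1 u2" for u1 u2 t T
  proof -
    have h: "sys t u1 u2" using h0 t(2) by (rule hsys_mono)
    note [measurable] = hsysD(1,2)[OF h]
    define I where "I = (\<integral>\<^sup>+s\<in>{0..t}. (sqn {0..1} (\<lambda>x. u1 x s) + sqn {0..1} (\<lambda>x. u2 x s)) \<partial>lborel)"
    define A where "A = sqn {0..1} (\<lambda>x. u1 x 0) + sqn {0..1} (\<lambda>x. u2 x 0) + sqn {0..t} (u2 1) + I"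
    have I1: "(\<integral>\<^sup>+s\<in>{0..t}. sqn {0..1} (\<lambda>x. u1 x s) \<partial>lborel) \<le> A"
      unfolding A_def I_def by (intro add_increasing nn_integral_mono) (auto simp: indicator_def)
    have I2: "(\<integral>\<^sup>+s\<in>{0..t}. sqn {0..1} (\<lambda>x. u2 x s) \<partial>lborel) \<le> A"
      unfolding A_def I_def by (intro add_increasing nn_integral_mono) (auto simp: indicator_def)
    have A1: "sqn {0..1} (\<lambda>x. u1 x 0) \<le> A" unfolding A_def by (simp add: add_increasing2 add.assoc)
    have A2: "sqn {0..1} (\<lambda>x. u2 x 0) \<le> A"
      unfolding A_def by (intro add_increasing2[OF zero_le] add_increasing[OF zero_le]) simp
    have A3: "sqn {0..t} (u2 1) \<le> A"
      unfolding A_def by (intro add_increasing2[OF zero_le] add_increasing[OF zero_le]) simp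
    have tK: "ennreal t \<le> K" unfolding K_def using t k by (intro ennreal_leI) simp
    have src: "X \<le> K * (K * A)" if "X \<le> ennreal t * Y" "Y \<le> ennreal (D\<^sup>2 / m) * Z" "Z \<le> A" for X Y Z
    proof -
      have "ennreal t * Y \<le> K * (ennreal (D\<^sup>2 / m) * Z)" using tK that(2) by (intro mult_mono) auto
      also have "\<dots> \<le> K * (K * A)" using that(3) k unfolding K_def by (intro mult_left_mono mult_mono ennreal_leI) auto
      finally show ?thesis using that(1) by simp
    qed
    have init: "sqn {0..1} w \<le> A \<Longrightarrow> ennreal (1 / m) * sqn {0..1} w \<le> K * A" for w
      using k unfolding K_def by (intro mult_mono ennreal_leI) auto
    have E2: "sqn {0..s2.L} (\<lambda>a. u2 (\<psi>2 (s2.L - a)) t) \<le> 2 * (sqn {0..s2.L} (\<lambda>a. u2 (\<psi>2 (s2.L - a)) 0) + sqn {0..t} (u2 1)) +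
        2 * (ennreal t * dsq s2.L t (\<lambda>b t. d2 (\<psi>2 (s2.L - b)) * u1 (\<psi>2 (s2.L - b)) t))"
      "sqn {0..t} (u2 0) \<le> 2 * (sqn {0..s2.L} (\<lambda>a. u2 (\<psi>2 (s2.L - a)) 0) + sqn {0..t} (u2 1)) +
        2 * (ennreal t * dsq s2.L t (\<lambda>b t. d2 (\<psi>2 (s2.L - b)) * u1 (\<psi>2 (s2.L - b)) t))"
      using straight_energy[OF hsysD(4)[OF h] _ _ t(1) less_imp_le[OF s2.L_pos]] by simp_all
    have E1: "sqn {0..s1.L} (\<lambda>a. u1 (\<psi>1 a) t) \<le> 2 * (sqn {0..s1.L} (\<lambda>a. u1 (\<psi>1 a) 0) + sqn {0..t} (u1 0)) +
        2 * (ennreal t * dsq s1.L t (\<lambda>a t. d1 (\<psi>1 a) * u2 (\<psi>1 a) t))"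
      "sqn {0..t} (u1 1) \<le> 2 * (sqn {0..s1.L} (\<lambda>a. u1 (\<psi>1 a) 0) + sqn {0..t} (u1 0)) +
        2 * (ennreal t * dsq s1.L t (\<lambda>a t. d1 (\<psi>1 a) * u2 (\<psi>1 a) t))"
      using straight_energy[OF hsysD(3)[OF h] _ _ t(1) less_imp_le[OF s1.L_pos]] by simp_all
    have b2: "2 * (sqn {0..s2.L} (\<lambda>a. u2 (\<psi>2 (s2.L - a)) 0) + sqn {0..t} (u2 1)) +
        2 * (ennreal t * dsq s2.L t (\<lambda>b t. d2 (\<psi>2 (s2.L - b)) * u1 (\<psi>2 (s2.L - b)) t)) \<le> c2 * A"
    proof -
      have "sqn {0..s2.L} (\<lambda>a. u2 (\<psi>2 (s2.L - a)) 0) \<le> ennreal (1 / m) * sqn {0..1} (\<lambda>x. u2 x 0)"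
        by (rule s2.sqn_coord_ge') measurable
      also have "\<dots> \<le> K * A" by (rule init[OF A2])
      finally have 1: "sqn {0..s2.L} (\<lambda>a. u2 (\<psi>2 (s2.L - a)) 0) \<le> K * A" .
      have 2: "ennreal t * dsq s2.L t (\<lambda>b t. d2 (\<psi>2 (s2.L - b)) * u1 (\<psi>2 (s2.L - b)) t) \<le> K * (K * A)"
        by (rule src[OF order_refl source_sqn(2) I1]) measurable
      have "c2 * A = 2 * (K * A + A) + 2 * (K * (K * A))" unfolding c2_def by (simp add: algebra_simps)
      then show ?thesis using 1 2 A3 by (auto intro!: add_mono mult_left_mono)
    qed
    have u2t: "sqn {0..1} (\<lambda>x. u2 x t) \<le> K * (c2 * A)"
    proof -
      have "sqn {0..1} (\<lambda>x. u2 x t) \<le> ennreal M * sqn {0..s2.L} (\<lambda>a. u2 (\<psi>2 (s2.L - a)) t)"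
        by (rule s2.sqn_coord_le') measurable
      also have "\<dots> \<le> K * (c2 * A)"
      proof (rule mult_mono)
        show "ennreal M \<le> K" unfolding K_def using k by (intro ennreal_leI) simp
        show "sqn {0..s2.L} (\<lambda>a. u2 (\<psi>2 (s2.L - a)) t) \<le> c2 * A"
          by (rule order_trans[OF E2(1) b2])
      qed auto
      finally show ?thesis .
    qed
    have z: "sqn {0..t} (u2 0) \<le> c2 * A"
      by (rule order_trans[OF E2(2) b2])
    have bnd: "sqn {0..t} (u1 0) \<le> K * (c2 * A)"
    proof -
      have "sqn {0..t} (u1 0) = ennreal (q\<^sup>2) * sqn {0..t} (u2 0)"
        by (rule sqn_AE_mult) (use hsysD(5)[OF h] in auto)
      also have "\<dots> \<le> K * (c2 * A)" unfolding K_def using k z by (intro mult_mono ennreal_leI) auto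
      finally show ?thesis .
    qed
    have b1: "2 * (sqn {0..s1.L} (\<lambda>a. u1 (\<psi>1 a) 0) + sqn {0..t} (u1 0)) +
        2 * (ennreal t * dsq s1.L t (\<lambda>a t. d1 (\<psi>1 a) * u2 (\<psi>1 a) t)) \<le> c1 * A"
    proof -
      have "sqn {0..s1.L} (\<lambda>a. u1 (\<psi>1 a) 0) \<le> ennreal (1 / m) * sqn {0..1} (\<lambda>x. u1 x 0)"
        by (rule s1.sqn_coord_ge) measurable
      also have "\<dots> \<le> K * A" by (rule init[OF A1])
      finally have 1: "sqn {0..s1.L} (\<lambda>a. u1 (\<psi>1 a) 0) \<le> K * A" .
      have 2: "ennreal t * dsq s1.L t (\<lambda>a t. d1 (\<psi>1 a) * u2 (\<psi>1 a) t) \<le> K * (K * A)"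
        by (rule src[OF order_refl source_sqn(1) I2]) measurable
      have "c1 * A = 2 * (K * A + K * (c2 * A)) + 2 * (K * (K * A))" unfolding c1_def by (simp add: algebra_simps)
      then show ?thesis using 1 2 bnd by (auto intro!: add_mono mult_left_mono)
    qed
    have u1t: "sqn {0..1} (\<lambda>x. u1 x t) \<le> K * (c1 * A)"
    proof -
      have "sqn {0..1} (\<lambda>x. u1 x t) \<le> ennreal M * sqn {0..s1.L} (\<lambda>a. u1 (\<psi>1 a) t)"
        by (rule s1.sqn_coord_le) measurable
      also have "\<dots> \<le> K * (c1 * A)"
      proof (rule mult_mono)
        show "ennreal M \<le> K" unfolding K_def using k by (intro ennreal_leI) simp
        show "sqn {0..s1.L} (\<lambda>a. u1 (\<psi>1 a) t) \<le> c1 * A"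
          by (rule order_trans[OF E1(1) b1])
      qed auto
      finally show ?thesis .
    qed
    have tr: "sqn {0..t} (u1 1) \<le> c1 * A"
      by (rule order_trans[OF E1(2) b1])
    have "sqn {0..1} (\<lambda>x. u1 x t) + sqn {0..1} (\<lambda>x. u2 x t) + sqn {0..t} (u2 0) + sqn {0..t} (u1 1)
      \<le> K * (c1 * A) + K * (c2 * A) + c2 * A + c1 * A"
      by (intro add_mono u1t u2t z tr)
    also have "\<dots> = c * A" unfolding c_def by (simp add: algebra_simps)
    finally show ?thesis unfolding A_def I_def .
  qed
  obtain r where r: "c = ennreal r" "0 \<le> r" using cfin by (cases c rule: ennreal_cases) auto
  show thesis
  proof (rule that[of "r + 1"])
    show "0 < r + 1" using r by simp
    have "c \<le> ennreal (r + 1)" unfolding r by (intro ennreal_leI) simp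
    then show "sqn {0..1} (\<lambda>x. u1 x t) + sqn {0..1} (\<lambda>x. u2 x t) + sqn {0..t} (u2 0) + sqn {0..t} (u1 1)
      \<le> ennreal (r + 1) * (sqn {0..1} (\<lambda>x. u1 x 0) + sqn {0..1} (\<lambda>x. u2 x 0) + sqn {0..t} (u2 1)
        + (\<integral>\<^sup>+s\<in>{0..t}. (sqn {0..1} (\<lambda>x. u1 x s) + sqn {0..1} (\<lambda>x. u2 x s)) \<partial>lborel))"
      if "0 \<le> t" "t \<le> T" "T \<le> Tm" "sys T u1 u2" for u1 u2 t T
      by (rule order_trans[OF main[OF that] mult_right_mono]) auto
  qed
qed

text \<open>Gronwall replaces the time integral in \<open>energy_step\<close> by the data;
  \<open>G\<close> is the factor with which the data bound that integral.\<close>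

lemma energy:
  assumes Tm: "0 \<le> Tm"
  obtains C where "0 < C"
    "\<And>u1 u2 T. 0 \<le> T \<Longrightarrow> T \<le> Tm \<Longrightarrow> sys T u1 u2 \<Longrightarrow>
      sqn {0..1} (\<lambda>x. u1 x T) + sqn {0..1} (\<lambda>x. u2 x T) + sqn {0..T} (u2 0) + sqn {0..T} (u1 1)
        + (\<integral>\<^sup>+s\<in>{0..T}. (sqn {0..1} (\<lambda>x. u1 x s) + sqn {0..1} (\<lambda>x. u2 x s)) \<partial>lborel)
      \<le> ennreal C * (sqn {0..1} (\<lambda>x. u1 x 0) + sqn {0..1} (\<lambda>x. u2 x 0) + sqn {0..T} (u2 1))"
proof -
  obtain C where C: "0 < C" and step:
    "\<And>u1 u2 t T. 0 \<le> t \<Longrightarrow> t \<le> T \<Longrightarrow> T \<le> Tm \<Longrightarrow> sys T u1 u2 \<Longrightarrow>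
      sqn {0..1} (\<lambda>x. u1 x t) + sqn {0..1} (\<lambda>x. u2 x t) + sqn {0..t} (u2 0) + sqn {0..t} (u1 1)
      \<le> ennreal C * (sqn {0..1} (\<lambda>x. u1 x 0) + sqn {0..1} (\<lambda>x. u2 x 0) + sqn {0..t} (u2 1)
        + (\<integral>\<^sup>+s\<in>{0..t}. (sqn {0..1} (\<lambda>x. u1 x s) + sqn {0..1} (\<lambda>x. u2 x s)) \<partial>lborel))"
    using energy_step[OF Tm] by blast
  define G where "G = 2 * Tm * exp (2 * C * Tm) * C"
  have G: "0 \<le> G" unfolding G_def using Tm C by simp
  show thesis
  proof (rule that[of "C + C * G + G"])
    show "0 < C + C * G + G" using C G by (simp add: add_pos_nonneg)
    fix u1 u2 T
    assume T: "0 \<le> T" "T \<le> Tm" and h: "sys T u1 u2"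
    note [measurable] = hsysD(1,2)[OF h]
    define n where "n s = sqn {0..1} (\<lambda>x. u1 x s) + sqn {0..1} (\<lambda>x. u2 x s)" for s
    have [measurable]: "n \<in> borel_measurable borel" unfolding n_def sqn_def by measurable
    define B where "B = n 0 + sqn {0..T} (u2 1)"
    define I where "I = (\<integral>\<^sup>+s\<in>{0..T}. n s \<partial>lborel)"
    have le: "n t \<le> ennreal C * B + ennreal C * (\<integral>\<^sup>+s\<in>{0..t}. n s \<partial>lborel)" if t: "t \<in> {0..T}" for t
    proof -
      have "n t \<le> sqn {0..1} (\<lambda>x. u1 x t) + sqn {0..1} (\<lambda>x. u2 x t) + sqn {0..t} (u2 0) + sqn {0..t} (u1 1)"
        unfolding n_def by (simp add: add_increasing2 add.assoc)
      also have "\<dots> \<le> ennreal C * (n 0 + sqn {0..t} (u2 1) + (\<integral>\<^sup>+s\<in>{0..t}. n s \<partial>lborel))"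
        unfolding n_def using t T h by (intro step) auto
      also have "\<dots> \<le> ennreal C * (B + (\<integral>\<^sup>+s\<in>{0..t}. n s \<partial>lborel))"
        unfolding B_def using t by (intro mult_left_mono add_mono sqn_mono_set) auto
      finally show ?thesis by (simp add: distrib_left)
    qed
    have fin: "(\<integral>\<^sup>+s\<in>{0..T}. n s \<partial>lborel) < \<infinity>" using h by (simp add: hsys_def n_def)
    have "I \<le> ennreal (2 * T * exp (2 * C * T)) * (ennreal C * B)"
      unfolding I_def by (rule gronwall_nn[OF _ fin C T(1) le]) measurable
    also have "\<dots> \<le> ennreal (2 * Tm * exp (2 * C * Tm)) * (ennreal C * B)"
      using T C Tm by (intro mult_right_mono ennreal_leI mult_mono) auto
    also have "\<dots> = ennreal G * B"
      unfolding G_def using Tm C by (simp add: ennreal_mult mult.assoc)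
    finally have I: "I \<le> ennreal G * B" .
    have "sqn {0..1} (\<lambda>x. u1 x T) + sqn {0..1} (\<lambda>x. u2 x T) + sqn {0..T} (u2 0) + sqn {0..T} (u1 1) + I
        \<le> ennreal C * (B + I) + I"
      unfolding I_def B_def n_def using T h by (intro add_right_mono step) auto
    also have "\<dots> \<le> ennreal C * (B + ennreal G * B) + ennreal G * B"
      using I by (intro add_mono mult_left_mono) auto
    also have "\<dots> = ennreal (C + C * G + G) * B"
      using C G by (simp add: ennreal_mult algebra_simps)
    finally show "sqn {0..1} (\<lambda>x. u1 x T) + sqn {0..1} (\<lambda>x. u2 x T) + sqn {0..T} (u2 0) + sqn {0..T} (u1 1)
        + (\<integral>\<^sup>+s\<in>{0..T}. (sqn {0..1} (\<lambda>x. u1 x s) + sqn {0..1} (\<lambda>x. u2 x s)) \<partial>lborel)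
      \<le> ennreal (C + C * G + G) * (sqn {0..1} (\<lambda>x. u1 x 0) + sqn {0..1} (\<lambda>x. u2 x 0) + sqn {0..T} (u2 1))"
      unfolding I_def B_def n_def .
  qed
qed

end

section \<open>Duality\<close>

text \<open>The product rule without derivatives: the double integral of \<open>F s * G r\<close>
  over the square is split along the diagonal into \<open>r \<le> s\<close> and
  \<open>s < r\<close>, and the inner integrals of the two halves are the increments of
  \<open>g\<close> and \<open>f\<close>.\<close>

lemma ac_product:
  fixes f g F G :: "real \<Rightarrow> real"
  assumes F: "set_integrable lborel {0..S} F" and G: "set_integrable lborel {0..S} G" and S: "0 \<le> S"
    and f: "\<And>s. s \<in> {0..S} \<Longrightarrow> f s - f 0 = (LBINT r:{0..s}. F r)"
    and g: "\<And>s. s \<in> {0..S} \<Longrightarrow> g s - g 0 = (LBINT r:{0..s}. G r)"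
  shows "f S * g S - f 0 * g 0 = (LBINT s:{0..S}. F s * g s + f s * G s)"
    and "set_integrable lborel {0..S} (\<lambda>s. F s * g s + f s * G s)"
proof -
  define F' where "F' s = indicator {0..S} s * F s" for s
  define G' where "G' s = indicator {0..S} s * G s" for s
  have iF: "integrable lborel F'" and iG: "integrable lborel G'"
    using F G by (simp_all add: F'_def[abs_def] G'_def[abs_def] set_integrable_def)
  have [measurable]: "F' \<in> borel_measurable borel" "G' \<in> borel_measurable borel"
    using iF iG by (auto dest: borel_measurable_integrable)
  have int: "integrable (lborel \<Otimes>\<^sub>M lborel) (\<lambda>(s, r). F' s * G' r)"
    by (rule lborel_pair.Fubini_integrable) (use iF iG in \<open>auto simp: abs_mult\<close>)
  let ?K1 = "\<lambda>s r. F' s * G' r * indicator {r. r \<le> s} r"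
  let ?K2 = "\<lambda>s r. F' s * G' r * indicator {r. s < r} r"
  have i1: "integrable (lborel \<Otimes>\<^sub>M lborel) (\<lambda>(s, r). ?K1 s r)"
    by (rule Bochner_Integration.integrable_bound[OF int]) (auto simp: indicator_def split_beta)
  have i2: "integrable (lborel \<Otimes>\<^sub>M lborel) (\<lambda>(s, r). ?K2 s r)"
    by (rule Bochner_Integration.integrable_bound[OF int]) (auto simp: indicator_def split_beta)
  have fs: "f s = f 0 + (LINT r|lborel. F' r * indicator {r. r < s} r)" if "s \<in> {0..S}" for s
  proof -
    have "(LBINT r:{0..s}. F r) = (LINT r|lborel. F' r * indicator {r. r < s} r)"
      unfolding set_lebesgue_integral_def
    proof (rule integral_cong_AE)
      show "(\<lambda>x. indicat_real {0..s} x *\<^sub>R F x) \<in> borel_measurable lborel"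
        using set_integrable_subset[OF F, of "{0..s}"] that by (auto simp: set_integrable_def dest: borel_measurable_integrable)
      show "AE r in lborel. indicat_real {0..s} r *\<^sub>R F r = F' r * indicator {r. r < s} r"
        using AE_lborel_singleton[of s] by (rule eventually_mono) (use that in \<open>auto simp: F'_def indicator_def\<close>)
    qed measurable
    then show ?thesis using f[OF that] by simp
  qed
  have gs: "g s = g 0 + (LINT r|lborel. G' r * indicator {r. r \<le> s} r)" if "s \<in> {0..S}" for s
  proof -
    have "(LBINT r:{0..s}. G r) = (LINT r|lborel. G' r * indicator {r. r \<le> s} r)"
      unfolding set_lebesgue_integral_def
      by (rule Bochner_Integration.integral_cong) (use that in \<open>auto simp: G'_def indicator_def\<close>)
    then show ?thesis using g[OF that] by simp
  qed
  have e1: "F' s * g s = F' s * g 0 + (LINT r|lborel. ?K1 s r)" for s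
  proof (cases "s \<in> {0..S}")
    case True
    have "(LINT r|lborel. ?K1 s r) = F' s * (LINT r|lborel. G' r * indicator {r. r \<le> s} r)"
      by (simp add: mult.assoc)
    then show ?thesis using gs[OF True] by (simp add: distrib_left)
  qed (simp add: F'_def)
  have e2: "f r * G' r = f 0 * G' r + (LINT s|lborel. ?K2 s r)" for r
  proof (cases "r \<in> {0..S}")
    case True
    have "(LINT s|lborel. ?K2 s r) = (LINT s|lborel. (F' s * indicator {s. s < r} s) * G' r)"
      by (rule Bochner_Integration.integral_cong) (auto simp: indicator_def)
    also have "\<dots> = (LINT s|lborel. F' s * indicator {s. s < r} s) * G' r" by simp
    finally show ?thesis using fs[OF True] by (simp add: distrib_right)
  qed (simp add: G'_def)
  have iK1: "integrable lborel (\<lambda>s. LINT r|lborel. ?K1 s r)"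
    using lborel_pair.integrable_fst[OF i1] by simp
  have iK2: "integrable lborel (\<lambda>r. LINT s|lborel. ?K2 s r)"
    using lborel_pair.integrable_snd[OF i2] by simp
  have eq: "indicator {0..S} s *\<^sub>R (F s * g s + f s * G s)
      = (F' s * g 0 + (LINT r|lborel. ?K1 s r)) + (f 0 * G' s + (LINT r|lborel. ?K2 r s))" for s
    unfolding e1[symmetric] e2[symmetric] by (simp add: F'_def G'_def algebra_simps)
  show "set_integrable lborel {0..S} (\<lambda>s. F s * g s + f s * G s)"
    unfolding set_integrable_def eq
    by (intro Bochner_Integration.integrable_add integrable_mult_left integrable_mult_right iK1 iK2 iF iG)
  have "(LBINT s:{0..S}. F s * g s + f s * G s) = (LINT s|lborel. F' s) * g 0 + (LINT s|lborel. LINT r|lborel. ?K1 s r)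
      + (f 0 * (LINT s|lborel. G' s) + (LINT r|lborel. LINT s|lborel. ?K2 s r))"
    unfolding set_lebesgue_integral_def eq
    using iK1 iK2 iF iG
    by (simp add: Bochner_Integration.integral_add)
  also have "(LINT r|lborel. LINT s|lborel. ?K2 s r) = (LINT s|lborel. LINT r|lborel. ?K2 s r)"
    by (rule lborel_pair.Fubini_integral[OF i2])
  finally have *: "(LBINT s:{0..S}. F s * g s + f s * G s) = (LINT s|lborel. F' s) * g 0 + f 0 * (LINT s|lborel. G' s)
      + ((LINT s|lborel. LINT r|lborel. ?K1 s r) + (LINT s|lborel. LINT r|lborel. ?K2 s r))" by simp
  have "(LINT s|lborel. LINT r|lborel. ?K1 s r) + (LINT s|lborel. LINT r|lborel. ?K2 s r)
      = (LINT p|(lborel \<Otimes>\<^sub>M lborel). (\<lambda>(s, r). ?K1 s r) p) + (LINT p|(lborel \<Otimes>\<^sub>M lborel). (\<lambda>(s, r). ?K2 s r) p)"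
    using lborel_pair.integral_fst[OF i1] lborel_pair.integral_fst[OF i2] by simp
  also have "\<dots> = (LINT p|(lborel \<Otimes>\<^sub>M lborel). (\<lambda>(s, r). ?K1 s r) p + (\<lambda>(s, r). ?K2 s r) p)"
    by (rule Bochner_Integration.integral_add[symmetric, OF i1 i2])
  also have "\<dots> = (LINT p|(lborel \<Otimes>\<^sub>M lborel). (\<lambda>(s, r). F' s * G' r) p)"
    by (rule Bochner_Integration.integral_cong) (auto simp: indicator_def)
  also have "\<dots> = (LINT s|lborel. LINT r|lborel. F' s * G' r)"
    using lborel_pair.integral_fst[OF int] by simp
  also have "\<dots> = (LINT s|lborel. F' s) * (LINT s|lborel. G' s)" by simp
  finally have **: "(LBINT s:{0..S}. F s * g s + f s * G s) = (LINT s|lborel. F' s) * g 0 + f 0 * (LINT s|lborel. G' s)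
     + (LINT s|lborel. F' s) * (LINT s|lborel. G' s)" unfolding * by simp
  have IFG: "(LINT s|lborel. F' s) = f S - f 0" "(LINT s|lborel. G' s) = g S - g 0"
    using f[of S] g[of S] S by (simp_all add: set_lebesgue_integral_def F'_def G'_def)
  show "f S * g S - f 0 * g 0 = (LBINT s:{0..S}. F s * g s + f s * G s)"
    unfolding ** IFG by (simp add: algebra_simps)
qed

lemma integral_shift: "(LINT x|lborel. h (c + x)) = (LINT x|lborel. h x)" for h :: "real \<Rightarrow> real"
  using lborel_integral_real_affine[of 1 h c] by simp

lemma integral_reflect: "(LINT x|lborel. h (c - x)) = (LINT x|lborel. h x)" for h :: "real \<Rightarrow> real"
  using lborel_integral_real_affine[of "-1" h c] by simp

lemma integrable_shift: "integrable lborel h \<Longrightarrow> integrable lborel (\<lambda>x. h (c + x))" for h :: "real \<Rightarrow> real"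
  using lborel_integrable_real_affine[of h 1 c] by simp

lemma integrable_reflect: "integrable lborel h \<Longrightarrow> integrable lborel (\<lambda>x. h (c - x))" for h :: "real \<Rightarrow> real"
  using lborel_integrable_real_affine[of h "-1" c] by simp

text \<open>The shear from \<open>(c, s)\<close> to \<open>(c + s, s)\<close> preserves area. It
  leads from the label of a characteristic back to the space coordinate.\<close>

lemma integral_lborel_pair_shift:
  fixes X :: "real \<Rightarrow> real \<Rightarrow> real"
  assumes iX: "integrable (lborel \<Otimes>\<^sub>M lborel) (\<lambda>(a, s). X a s)"
  shows "integrable (lborel \<Otimes>\<^sub>M lborel) (\<lambda>(c, s). X (c + s) s)"
    and "(LINT c|lborel. LINT s|lborel. X (c + s) s) = (LINT s|lborel. LINT a|lborel. X a s)"
proof -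
  have [measurable]: "case_prod X \<in> borel_measurable (borel \<Otimes>\<^sub>M borel)"
    using borel_measurable_integrable[OF iX] by simp
  show iXc: "integrable (lborel \<Otimes>\<^sub>M lborel) (\<lambda>(c, s). X (c + s) s)"
  proof (rule integrableI_bounded)
    have "(\<integral>\<^sup>+p. ennreal (norm (case p of (c, s) \<Rightarrow> X (c + s) s)) \<partial>(lborel \<Otimes>\<^sub>M lborel))
      = (\<integral>\<^sup>+s. \<integral>\<^sup>+c. ennreal (norm (X (s + c) s)) \<partial>lborel \<partial>lborel)"
      by (subst lborel_pair.nn_integral_snd[symmetric]) (auto simp: add.commute)
    also have "\<dots> = (\<integral>\<^sup>+s. \<integral>\<^sup>+a. ennreal (norm (X a s)) \<partial>lborel \<partial>lborel)"
      by (intro nn_integral_cong nn_integral_shift) measurable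
    also have "\<dots> = (\<integral>\<^sup>+p. ennreal (norm (case p of (a, s) \<Rightarrow> X a s)) \<partial>(lborel \<Otimes>\<^sub>M lborel))"
      by (subst lborel_pair.nn_integral_snd[symmetric]) auto
    also have "\<dots> < \<infinity>" using iX by (simp add: integrable_iff_bounded)
    finally show "(\<integral>\<^sup>+p. ennreal (norm (case p of (c, s) \<Rightarrow> X (c + s) s)) \<partial>(lborel \<Otimes>\<^sub>M lborel)) < \<infinity>" .
  qed measurable
  have "(LINT c|lborel. LINT s|lborel. X (c + s) s) = (LINT s|lborel. LINT c|lborel. X (c + s) s)"
    by (rule lborel_pair.Fubini_integral[symmetric, OF iXc])
  also have "\<dots> = (LINT s|lborel. LINT a|lborel. X a s)"
  proof (rule Bochner_Integration.integral_cong[OF refl])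
    show "(LINT c|lborel. X (c + s) s) = (LINT a|lborel. X a s)" for s
      using integral_shift[of "\<lambda>a. X a s" s] by (simp add: add.commute)
  qed
  finally show "(LINT c|lborel. LINT s|lborel. X (c + s) s) = (LINT s|lborel. LINT a|lborel. X a s)" .
qed

lemma straight_subset: "straight L T f F \<Longrightarrow> T' \<le> T \<Longrightarrow> straight L T' f F"
  unfolding straight_def by auto

text \<open>Reversing space and time together preserves the slope of the characteristics and changes
  the sign of the source.\<close>

lemma straight_reverse:
  assumes st: "straight L h f F"
  shows "straight L h (\<lambda>a s. f (L - a) (h - s)) (\<lambda>a s. - F (L - a) (h - s))"
  unfolding straight_def
proof (intro allI impI)
  fix a t s :: real
  assume *: "0 \<le> a" "0 \<le> t" "0 \<le> s" "a + s \<le> L" "t + s \<le> h"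
  define k where "k r = indicator {0..s} r * F (L - a - s + r) (h - t - s + r)" for r
  have D: "set_integrable lborel {0..s} (\<lambda>r. F (L - a - s + r) (h - t - s + r))"
    "f (L - a - s + s) (h - t - s + s) - f (L - a - s) (h - t - s) = (LBINT r:{0..s}. F (L - a - s + r) (h - t - s + r))"
    using * by (intro straightD[OF st]; simp)+
  have ik: "integrable lborel k" using D(1) by (simp add: k_def[abs_def] set_integrable_def)
  have eq: "indicator {0..s} r *\<^sub>R (- F (L - (a + r)) (h - (t + r))) = - k (s - r)" for r
    by (cases "r \<in> {0..s}") (auto simp: k_def algebra_simps)
  show "set_integrable lborel {0..s} (\<lambda>r. - F (L - (a + r)) (h - (t + r))) \<and>
    f (L - (a + s)) (h - (t + s)) - f (L - a) (h - t) = (LBINT r:{0..s}. - F (L - (a + r)) (h - (t + r)))"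
    unfolding set_integrable_def set_lebesgue_integral_def eq
    using integrable_reflect[OF ik, of s] D(2) integral_reflect[of k s]
    by (simp add: k_def[abs_def] set_lebesgue_integral_def algebra_simps)
qed

lemma sqn_finiteE:
  assumes "sqn S f < top" obtains A where "0 \<le> A" "sqn S f \<le> ennreal A"
  using assms by (cases "sqn S f" rule: ennreal_cases) auto

lemma set_integrable_mult_sqn:
  assumes "f \<in> borel_measurable borel" "g \<in> borel_measurable borel" "S \<in> sets borel"
    and "sqn S f < top" "sqn S g < top"
  shows "set_integrable lborel S (\<lambda>x. f x * g x)"
proof -
  obtain A B where "0 \<le> A" "sqn S f \<le> ennreal A" "0 \<le> B" "sqn S g \<le> ennreal B"
    using assms by (meson sqn_finiteE)
  then show ?thesis using assms(1-3) Cauchy_Schwarz_sqn(1) by blast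
qed

lemma integrable_product_dsq:
  assumes [measurable]: "case_prod f \<in> borel_measurable (borel \<Otimes>\<^sub>M borel)" "case_prod g \<in> borel_measurable (borel \<Otimes>\<^sub>M borel)"
    and fin: "dsq L T f < top" "dsq L T g < top"
  shows "integrable (lborel \<Otimes>\<^sub>M lborel) (\<lambda>(a, s). indicator {0..L} a * indicator {0..T} s * (f a s * g a s))"
proof (rule integrableI_bounded)
  have "(\<integral>\<^sup>+p. ennreal (norm (case p of (a, s) \<Rightarrow> indicator {0..L} a * indicator {0..T} s * (f a s * g a s))) \<partial>(lborel \<Otimes>\<^sub>M lborel))
     = (\<integral>\<^sup>+s. \<integral>\<^sup>+a. ennreal (norm (indicator {0..L} a * indicator {0..T} s * (f a s * g a s))) \<partial>lborel \<partial>lborel)"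
    by (subst lborel_pair.nn_integral_snd[symmetric]) auto
  also have "\<dots> \<le> (\<integral>\<^sup>+s. \<integral>\<^sup>+a. (ennreal ((f a s)\<^sup>2) * indicator {0..L} a * indicator {0..T} s
      + ennreal ((g a s)\<^sup>2) * indicator {0..L} a * indicator {0..T} s) \<partial>lborel \<partial>lborel)"
  proof (intro nn_integral_mono)
    fix s a
    have "\<bar>f a s * g a s\<bar> \<le> (f a s)\<^sup>2 + (g a s)\<^sup>2"
    proof -
      have "0 \<le> \<bar>f a s\<bar> * \<bar>g a s\<bar>" by simp
      then show ?thesis using sum_squares_bound[of "\<bar>f a s\<bar>" "\<bar>g a s\<bar>"]
        unfolding abs_mult power2_abs by linarith
    qed
    then have "ennreal \<bar>f a s * g a s\<bar> \<le> ennreal ((f a s)\<^sup>2) + ennreal ((g a s)\<^sup>2)"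
      by (simp add: ennreal_plus[symmetric] ennreal_leI del: ennreal_plus)
    then show "ennreal (norm (indicator {0..L} a * indicator {0..T} s * (f a s * g a s)))
      \<le> ennreal ((f a s)\<^sup>2) * indicator {0..L} a * indicator {0..T} s + ennreal ((g a s)\<^sup>2) * indicator {0..L} a * indicator {0..T} s"
      by (auto simp: indicator_def)
  qed
  also have "\<dots> = (\<integral>\<^sup>+s. (\<integral>\<^sup>+a. ennreal ((f a s)\<^sup>2) * indicator {0..L} a * indicator {0..T} s \<partial>lborel)
      + (\<integral>\<^sup>+a. ennreal ((g a s)\<^sup>2) * indicator {0..L} a * indicator {0..T} s \<partial>lborel) \<partial>lborel)"
    by (intro nn_integral_cong nn_integral_add) measurable
  also have "\<dots> = dsq L T f + dsq L T g"
    unfolding dsq_eq by (rule nn_integral_add) measurable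
  also have "\<dots> < \<infinity>" using fin by (simp add: less_top)
  finally show "(\<integral>\<^sup>+p. ennreal (norm (case p of (a, s) \<Rightarrow> indicator {0..L} a * indicator {0..T} s * (f a s * g a s))) \<partial>(lborel \<Otimes>\<^sub>M lborel)) < \<infinity>" .
qed measurable

lemma integrable_rect:
  assumes "case_prod f \<in> borel_measurable (borel \<Otimes>\<^sub>M borel)" "case_prod F \<in> borel_measurable (borel \<Otimes>\<^sub>M borel)"
      "case_prod g \<in> borel_measurable (borel \<Otimes>\<^sub>M borel)" "case_prod G \<in> borel_measurable (borel \<Otimes>\<^sub>M borel)"
    and fin: "dsq L h f < top" "dsq L h F < top" "dsq L h g < top" "dsq L h G < top"
  shows "integrable (lborel \<Otimes>\<^sub>M lborel)
    (\<lambda>(a, s). indicator {0..L} a * indicator {0..h} s * (F a s * g a s + f a s * G a s))"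
proof -
  have "(\<lambda>(a, s). indicator {0..L} a * indicator {0..h} s * (F a s * g a s + f a s * G a s))
    = (\<lambda>p. (case p of (a, s) \<Rightarrow> indicator {0..L} a * indicator {0..h} s * (F a s * g a s))
        + (case p of (a, s) \<Rightarrow> indicator {0..L} a * indicator {0..h} s * (f a s * G a s)))"
    by (auto simp: fun_eq_iff distrib_left)
  then show ?thesis
    using Bochner_Integration.integrable_add[OF integrable_product_dsq[OF assms(2,3) fin(2,3)]
      integrable_product_dsq[OF assms(1,4) fin(1,4)]]
    by metis
qed

text \<open>The divergence theorem for \<open>f * g\<close> on a rectangle: the product rule on each
  characteristic, then integration over its label \<open>c\<close>. Characteristics enter through
  the initial side or \<open>a = 0\<close> and leave through the final side or
  \<open>a = L\<close>.\<close>

lemma rect_duality: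
  assumes f: "straight L h f F" and g: "straight L h g G"
    and [measurable]: "case_prod f \<in> borel_measurable (borel \<Otimes>\<^sub>M borel)" "case_prod F \<in> borel_measurable (borel \<Otimes>\<^sub>M borel)"
      "case_prod g \<in> borel_measurable (borel \<Otimes>\<^sub>M borel)" "case_prod G \<in> borel_measurable (borel \<Otimes>\<^sub>M borel)"
    and fin: "dsq L h f < top" "dsq L h F < top" "dsq L h g < top" "dsq L h G < top"
    and finf: "sqn {0..L} (\<lambda>a. f a 0) < top" "sqn {0..L} (\<lambda>a. f a h) < top" "sqn {0..h} (f 0) < top" "sqn {0..h} (f L) < top"
    and fing: "sqn {0..L} (\<lambda>a. g a 0) < top" "sqn {0..L} (\<lambda>a. g a h) < top" "sqn {0..h} (g 0) < top" "sqn {0..h} (g L) < top"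
    and L: "0 \<le> L" "0 \<le> h"
  shows "(LBINT a:{0..L}. f a h * g a h) + (LBINT s:{0..h}. f L s * g L s) =
     (LBINT a:{0..L}. f a 0 * g a 0) + (LBINT s:{0..h}. f 0 s * g 0 s)
     + (LINT s|lborel. LINT a|lborel. indicator {0..L} a * indicator {0..h} s * (F a s * g a s + f a s * G a s))"
proof -
  define X where "X a s = indicator {0..L} a * indicator {0..h} s * (F a s * g a s + f a s * G a s)" for a s
  have iX: "integrable (lborel \<Otimes>\<^sub>M lborel) (\<lambda>(a, s). X a s)"
    unfolding X_def using fin by (intro integrable_rect) auto
  define A1 where "A1 a = indicator {0..L} a * (f a h * g a h)" for a
  define A0 where "A0 a = indicator {0..L} a * (f a 0 * g a 0)" for a
  define B1 where "B1 s = indicator {0..h} s * (f L s * g L s)" for s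
  define B0 where "B0 s = indicator {0..h} s * (f 0 s * g 0 s)" for s
  have iA: "integrable lborel A1" "integrable lborel A0" "integrable lborel B1" "integrable lborel B0"
    using set_integrable_mult_sqn[of "\<lambda>a. f a h" "\<lambda>a. g a h" "{0..L}"] set_integrable_mult_sqn[of "\<lambda>a. f a 0" "\<lambda>a. g a 0" "{0..L}"]
      set_integrable_mult_sqn[of "f L" "g L" "{0..h}"] set_integrable_mult_sqn[of "f 0" "g 0" "{0..h}"] finf fing
    by (auto simp: set_integrable_def A1_def[abs_def] A0_def[abs_def] B1_def[abs_def] B0_def[abs_def])
  \<comment> \<open>The two excluded labels belong to the lines through the corners
    \<open>(0, 0)\<close> and \<open>(L, h)\<close>, where an entry or an exit would be counted on
    two sides. They form a null set.\<close>
  have along: "A1 (h + c) + B1 (L - c) - A0 c - B0 (0 - c) = (LINT s|lborel. X (c + s) s)"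
    if c: "c \<noteq> 0" "c \<noteq> L - h" for c
  proof -
    define s0 where "s0 = max 0 (- c)"
    define s1 where "s1 = min h (L - c)"
    show ?thesis
    proof (cases "s0 \<le> s1")
      case True
      have pos: "0 \<le> c + s0" "0 \<le> s0" "0 \<le> s1 - s0" "(c + s0) + (s1 - s0) \<le> L" "s0 + (s1 - s0) \<le> h"
        using True by (auto simp: s0_def s1_def)
      note st = straightD[OF _ pos(1,2)]
      have pr: "f (c + s0 + (s1 - s0)) (s0 + (s1 - s0)) * g (c + s0 + (s1 - s0)) (s0 + (s1 - s0)) - f (c + s0 + 0) (s0 + 0) * g (c + s0 + 0) (s0 + 0)
        = (LBINT r:{0..s1 - s0}. F (c + s0 + r) (s0 + r) * g (c + s0 + r) (s0 + r) + f (c + s0 + r) (s0 + r) * G (c + s0 + r) (s0 + r))"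
        using st[OF f] st[OF g] pos
        by (intro ac_product(1)) auto
      have "(LINT s|lborel. X (c + s) s) = (LINT r|lborel. X (c + (s0 + r)) (s0 + r))"
        by (rule integral_shift[symmetric])
      also have "\<dots> = (LBINT r:{0..s1 - s0}. F (c + s0 + r) (s0 + r) * g (c + s0 + r) (s0 + r) + f (c + s0 + r) (s0 + r) * G (c + s0 + r) (s0 + r))"
        unfolding set_lebesgue_integral_def
      proof (intro Bochner_Integration.integral_cong refl)
        fix r
        have "(c + (s0 + r) \<in> {0..L} \<and> s0 + r \<in> {0..h}) \<longleftrightarrow> r \<in> {0..s1 - s0}"
          unfolding s0_def s1_def by (auto simp: max_def min_def split: if_splits)
        then have "indicator {0..L} (c + (s0 + r)) * indicator {0..h} (s0 + r) = (indicator {0..s1 - s0} r :: real)"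
          unfolding indicator_def by (metis mult_1 mult_zero_left mult_zero_right of_bool_eq_0_iff of_bool_eq_1_iff)
        then show "X (c + (s0 + r)) (s0 + r) = indicator {0..s1 - s0} r *\<^sub>R
            (F (c + s0 + r) (s0 + r) * g (c + s0 + r) (s0 + r) + f (c + s0 + r) (s0 + r) * G (c + s0 + r) (s0 + r))"
          by (simp only: X_def add.assoc real_scaleR_def)
      qed
      also have "\<dots> = f (c + s1) s1 * g (c + s1) s1 - f (c + s0) s0 * g (c + s0) s0"
        unfolding pr[symmetric] by simp
      also have "f (c + s1) s1 * g (c + s1) s1 = A1 (h + c) + B1 (L - c)"
        using True c by (auto simp: s0_def s1_def A1_def B1_def indicator_def min_def max_def add.commute split: if_splits)
      also have "f (c + s0) s0 * g (c + s0) s0 = A0 c + B0 (0 - c)"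
        using True c by (auto simp: s0_def s1_def A0_def B0_def indicator_def min_def max_def split: if_splits)
      finally show ?thesis by simp
    next
      case False
      then have "X (c + s) s = 0" for s by (auto simp: X_def s0_def s1_def indicator_def)
      moreover have "A1 (h + c) = 0" "B1 (L - c) = 0" "A0 c = 0" "B0 (0 - c) = 0"
        using False L by (auto simp: s0_def s1_def A1_def B1_def A0_def B0_def indicator_def)
      ultimately show ?thesis by simp
    qed
  qed
  have "(LINT c|lborel. A1 (h + c) + B1 (L - c) - A0 c - B0 (0 - c)) = (LINT c|lborel. LINT s|lborel. X (c + s) s)"
  proof (rule integral_cong_AE)
    show "AE c in lborel. A1 (h + c) + B1 (L - c) - A0 c - B0 (0 - c) = (LINT s|lborel. X (c + s) s)"
      using AE_lborel_singleton[of 0] AE_lborel_singleton[of "L - h"] by eventually_elim (rule along)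
  next
    have "case_prod X \<in> borel_measurable (borel \<Otimes>\<^sub>M borel)" unfolding X_def by measurable
    then show "(\<lambda>c. LINT s|lborel. X (c + s) s) \<in> borel_measurable lborel" by measurable
  qed (simp_all add: A1_def A0_def B1_def B0_def)
  also have "\<dots> = (LINT s|lborel. LINT a|lborel. X a s)"
    by (rule integral_lborel_pair_shift(2)[OF iX])
  also have "(LINT c|lborel. A1 (h + c) + B1 (L - c) - A0 c - B0 (0 - c))
      = (LINT c|lborel. A1 (h + c)) + (LINT c|lborel. B1 (L - c)) - (LINT c|lborel. A0 c) - (LINT c|lborel. B0 (0 - c))"
    using integrable_shift[OF iA(1), of h] integrable_reflect[OF iA(3), of L] iA(2) integrable_reflect[OF iA(4), of 0]
    by (simp add: Bochner_Integration.integral_add Bochner_Integration.integral_diff)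
  finally show ?thesis
    unfolding integral_shift integral_reflect
    by (simp add: A1_def[abs_def] A0_def[abs_def] B1_def[abs_def] B0_def[abs_def] set_lebesgue_integral_def X_def[abs_def])
qed

lemma dsq_reverse:
  assumes [measurable]: "case_prod F \<in> borel_measurable (borel \<Otimes>\<^sub>M borel)"
  shows "dsq L h (\<lambda>a s. F (L - a) (h - s)) = dsq L h F"
proof -
  have [measurable]: "(\<lambda>s. sqn {0..L} (\<lambda>a. F a s)) \<in> borel_measurable borel"
    unfolding sqn_def by measurable
  have "dsq L h (\<lambda>a s. F (L - a) (h - s)) = (\<integral>\<^sup>+s\<in>{0..h}. sqn {0..L} (\<lambda>a. F a (h - s)) \<partial>lborel)"
    unfolding dsq_def by (subst sqn_reflect) auto
  also have "\<dots> = (\<integral>\<^sup>+s. (sqn {0..L} (\<lambda>a. F a (h - s)) * indicator {0..h} (h - s)) \<partial>lborel)"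
    by (intro nn_integral_cong) (auto simp: indicator_def)
  also have "\<dots> = (\<integral>\<^sup>+s. (sqn {0..L} (\<lambda>a. F a s) * indicator {0..h} s) \<partial>lborel)"
    by (rule nn_integral_reflect) measurable
  finally show ?thesis unfolding dsq_def .
qed

lemma dsq_uminus: "dsq L h (\<lambda>a s. - F a s) = dsq L h F"
  unfolding dsq_def sqn_def by simp

context speed
begin

lemma dsq_coord:
  assumes [measurable]: "case_prod w \<in> borel_measurable (borel \<Otimes>\<^sub>M borel)"
  shows "dsq L h (\<lambda>a s. w (\<psi> a) s) \<le> ennreal (1 / m) * (\<integral>\<^sup>+s\<in>{0..h}. sqn {0..1} (\<lambda>x. w x s) \<partial>lborel)"
proof -
  have [measurable]: "(\<lambda>s. sqn {0..1} (\<lambda>x. w x s)) \<in> borel_measurable borel"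
    unfolding sqn_def by measurable
  have *: "sqn {0..L} (\<lambda>a. w (\<psi> a) s) \<le> ennreal (1 / m) * sqn {0..1} (\<lambda>x. w x s)" for s
    by (rule sqn_coord_ge) measurable
  have "dsq L h (\<lambda>a s. w (\<psi> a) s)
      \<le> (\<integral>\<^sup>+s. ennreal (1 / m) * (sqn {0..1} (\<lambda>x. w x s) * indicator {0..h} s) \<partial>lborel)"
    unfolding dsq_def using * by (intro nn_integral_mono) (auto simp: indicator_def)
  also have "\<dots> = ennreal (1 / m) * (\<integral>\<^sup>+s\<in>{0..h}. sqn {0..1} (\<lambda>x. w x s) \<partial>lborel)"
    by (rule nn_integral_cmult) measurable
  finally show ?thesis .
qed

lemma dsq_coord':
  assumes [measurable]: "case_prod w \<in> borel_measurable (borel \<Otimes>\<^sub>M borel)"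
  shows "dsq L h (\<lambda>b s. w (\<psi> (L - b)) s) = dsq L h (\<lambda>a s. w (\<psi> a) s)"
proof -
  have "sqn {0..L} (\<lambda>b. w (\<psi> (L - b)) s) = sqn {0..L} (\<lambda>a. w (\<psi> a) s)" for s
    using sqn_reflect[of "\<lambda>a. w (\<psi> a) s" L] by simp
  then show ?thesis unfolding dsq_def by simp
qed

lemma integral_coord:
  assumes K: "set_integrable lborel {0..L} K"
  shows "set_integrable lborel {0..1} (\<lambda>x. K (\<phi> x) / e x)"
    and "(LBINT a:{0..L}. K a) = (LBINT x:{0..1}. K (\<phi> x) / e x)"
proof -
  have c: "continuous_on {0..1} (\<lambda>x. 1 / e x)"
    using e_cont epos by (intro continuous_intros) (auto simp: less_imp_neq[THEN not_sym])
  have K': "set_integrable lborel {\<phi> 0..\<phi> 1} K" using K \<phi>0 by (simp add: L_def)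
  note sub = integral_substitution[OF K' d\<phi> c]
  have "0 \<le> 1 / e x" for x using epos[of x] by simp
  then have s: "set_integrable lborel {0..1} (\<lambda>x. K (\<phi> x) * (1 / e x))"
    "(LBINT x. K x * indicator {\<phi> 0..\<phi> 1} x) = (LBINT x. K (\<phi> x) * (1 / e x) * indicator {0..1} x)"
    by (intro sub; simp)+
  show "set_integrable lborel {0..1} (\<lambda>x. K (\<phi> x) / e x)" using s(1) by simp
  show "(LBINT a:{0..L}. K a) = (LBINT x:{0..1}. K (\<phi> x) / e x)"
    using s(2) \<phi>0 by (simp add: set_lebesgue_integral_def L_def mult.commute)
qed

lemma integral_coord_left:
  assumes K: "set_integrable lborel {0..L} K"
  shows "(LBINT b:{0..L}. K b) = (LBINT x:{0..1}. K (L - \<phi> x) / e x)"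
proof -
  define k where "k b = indicator {0..L} b * K b" for b
  have ik: "integrable lborel k" using K by (simp add: k_def[abs_def] set_integrable_def)
  have eq: "k (L - b) = indicator {0..L} b *\<^sub>R K (L - b)" for b by (auto simp: k_def indicator_def)
  have "set_integrable lborel {0..L} (\<lambda>b. K (L - b))"
    unfolding set_integrable_def using integrable_reflect[OF ik, of L] by (simp add: eq)
  from integral_coord(2)[OF this]
  have "(LBINT x:{0..1}. K (L - \<phi> x) / e x) = (LINT b|lborel. k (L - b))"
    by (simp only: eq set_lebesgue_integral_def)
  also have "\<dots> = (LINT b|lborel. k b)" by (rule integral_reflect)
  finally show ?thesis by (simp add: k_def[abs_def] set_lebesgue_integral_def)
qed

end

section \<open>The adjoint system and the duality pairing\<close>

context hyp
begin

text \<open>In terms of \<open>q1 = e2 * \<alpha>2\<close> and \<open>q2 = e1 * \<alpha>1\<close>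
  the equations for the kernels \<alpha> become a system of type \<open>hsys\<close> with the two
  speeds exchanged; these are its couplings.\<close>

definition "d1' x = e2 x * d1 x / e1 x"
definition "d2' x = e1 x * d2 x / e2 x"

abbreviation "adj \<equiv> hsys e2 e1 d1' d2' q"

lemma adjoint_hyp: "hyp e2 \<phi>2 \<psi>2 e1 \<phi>1 \<psi>1 m M d1' d2' q (M * D / m)"
proof -
  interpret h: hyp e1 \<phi>1 \<psi>1 e2 \<phi>2 \<psi>2 m M d1 d2 q D by (rule hyp_axioms)
  have b: "\<bar>x * y / z\<bar> \<le> M * D / m" if "x \<le> M" "0 < x" "\<bar>y\<bar> \<le> D" "m \<le> z" for x y z
  proof -
    have "\<bar>x * y\<bar> / z \<le> (M * D) / m"
      using that s1.m(1) s1.M_pos D_nonneg by (intro frac_le) (auto simp: abs_mult intro!: mult_mono)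
    then show ?thesis using that s1.m(1) by (simp add: abs_mult)
  qed
  show ?thesis
  proof (unfold_locales)
    show "continuous_on UNIV d1'" "continuous_on UNIV d2'"
      unfolding d1'_def[abs_def] d2'_def[abs_def] using s1.epos s2.epos
      by (auto intro!: continuous_on_divide continuous_on_mult d_cont s1.cont s2.cont simp: less_imp_neq[THEN not_sym])
    show "\<bar>d1' x\<bar> \<le> M * D / m" "\<bar>d2' x\<bar> \<le> M * D / m" for x
      unfolding d1'_def d2'_def by (intro b s1.m s2.m s1.epos s2.epos d_bound)+
  qed (rule q_pos)
qed

text \<open>With \<open>q1 = e2 * \<alpha>2\<close> and \<open>q2 = e1 * \<alpha>1\<close> this is
  the integral of \<open>u1 * \<alpha>1 + u2 * \<alpha>2\<close>; hence the crossed indices and the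
  division by the speeds.\<close>

definition pair :: "(real \<Rightarrow> real) \<Rightarrow> (real \<Rightarrow> real) \<Rightarrow> (real \<Rightarrow> real) \<Rightarrow> (real \<Rightarrow> real) \<Rightarrow> real" where
  "pair u1 u2 q1 q2 = (LBINT x:{0..1}. u1 x * q2 x / e1 x) + (LBINT x:{0..1}. u2 x * q1 x / e2 x)"

lemma sys_finite:
  assumes h: "sys T u1 u2" and T: "0 \<le> T"
    and init: "sqn {0..1} (\<lambda>x. u1 x 0) < top" "sqn {0..1} (\<lambda>x. u2 x 0) < top" and inp: "sqn {0..T} (u2 1) < top"
  shows "sqn {0..1} (\<lambda>x. u1 x T) < top" "sqn {0..1} (\<lambda>x. u2 x T) < top"
    "sqn {0..T} (u2 0) < top" "sqn {0..T} (u1 1) < top" "sqn {0..T} (u1 0) < top"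
    "(\<integral>\<^sup>+s\<in>{0..T}. sqn {0..1} (\<lambda>x. u1 x s) \<partial>lborel) < top"
    "(\<integral>\<^sup>+s\<in>{0..T}. sqn {0..1} (\<lambda>x. u2 x s) \<partial>lborel) < top"
proof -
  note [measurable] = hsysD(1,2)[OF h]
  obtain C where C: "0 < C" and e:
    "\<And>u1 u2 T'. 0 \<le> T' \<Longrightarrow> T' \<le> T \<Longrightarrow> sys T' u1 u2 \<Longrightarrow>
      sqn {0..1} (\<lambda>x. u1 x T') + sqn {0..1} (\<lambda>x. u2 x T') + sqn {0..T'} (u2 0) + sqn {0..T'} (u1 1)
        + (\<integral>\<^sup>+s\<in>{0..T'}. (sqn {0..1} (\<lambda>x. u1 x s) + sqn {0..1} (\<lambda>x. u2 x s)) \<partial>lborel)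
      \<le> ennreal C * (sqn {0..1} (\<lambda>x. u1 x 0) + sqn {0..1} (\<lambda>x. u2 x 0) + sqn {0..T'} (u2 1))"
    using energy[OF T] by blast
  have "ennreal C * (sqn {0..1} (\<lambda>x. u1 x 0) + sqn {0..1} (\<lambda>x. u2 x 0) + sqn {0..T} (u2 1)) < top"
    using init inp by (simp add: ennreal_mult_eq_top_iff ennreal_add_eq_top less_top[symmetric])
  from le_less_trans[OF e[OF T order_refl h] this]
  have fin: "sqn {0..1} (\<lambda>x. u1 x T) < top" "sqn {0..1} (\<lambda>x. u2 x T) < top"
    "sqn {0..T} (u2 0) < top" "sqn {0..T} (u1 1) < top"
    "(\<integral>\<^sup>+s\<in>{0..T}. (sqn {0..1} (\<lambda>x. u1 x s) + sqn {0..1} (\<lambda>x. u2 x s)) \<partial>lborel) < top"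
    by (auto simp: less_top[symmetric])
  show "sqn {0..1} (\<lambda>x. u1 x T) < top" "sqn {0..1} (\<lambda>x. u2 x T) < top"
    "sqn {0..T} (u2 0) < top" "sqn {0..T} (u1 1) < top" by fact+
  have "sqn {0..T} (u1 0) = ennreal (q\<^sup>2) * sqn {0..T} (u2 0)"
    by (rule sqn_AE_mult) (use hsysD(5)[OF h] in auto)
  then show "sqn {0..T} (u1 0) < top" using fin(3) by (simp add: ennreal_mult_less_top)
  show "(\<integral>\<^sup>+s\<in>{0..T}. sqn {0..1} (\<lambda>x. u1 x s) \<partial>lborel) < top"
    by (rule le_less_trans[OF _ fin(5)]) (intro nn_integral_mono, auto simp: indicator_def)
  show "(\<integral>\<^sup>+s\<in>{0..T}. sqn {0..1} (\<lambda>x. u2 x s) \<partial>lborel) < top"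
    by (rule le_less_trans[OF _ fin(5)]) (intro nn_integral_mono, auto simp: indicator_def)
qed

lemma set_integral_AE_zero:
  fixes h :: real
  assumes "\<And>s. 0 < s \<Longrightarrow> s < h \<Longrightarrow> f s = (0 :: real)"
  shows "(LBINT s:{0..h}. f s) = 0"
  unfolding set_lebesgue_integral_def
proof (rule integral_eq_zero_AE)
  show "AE s in lborel. indicator {0..h} s *\<^sub>R f s = 0"
    using AE_lborel_singleton[of 0] AE_lborel_singleton[of h]
  proof eventually_elim
    case (elim s)
    have "f s = 0" if "0 \<le> s" "s \<le> h"
      using elim that by (intro assms) linarith+
    then show ?case by (auto simp: indicator_def)
  qed
qed

text \<open>Pair the state at time \<open>s\<close> with the kernels at time \<open>h - s\<close>.
  The couplings \<open>d1'\<close> and \<open>d2'\<close> are chosen so that the sources cancel. At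
  \<open>x = 0\<close> both systems have the same reflection coefficient; at \<open>x = 1\<close>
  the vanishing of \<open>q2 1\<close> removes the outgoing wave \<open>u1 1\<close> and leaves the
  input against \<open>q1 1\<close>.\<close>

theorem duality:
  assumes u: "sys h u1 u2" and qs: "adj h q1 q2" and h: "0 \<le> h"
    and q0: "\<And>s. 0 < s \<Longrightarrow> s \<le> h \<Longrightarrow> q2 1 s = 0"
    and uinit: "sqn {0..1} (\<lambda>x. u1 x 0) < top" "sqn {0..1} (\<lambda>x. u2 x 0) < top" "sqn {0..h} (u2 1) < top"
    and qinit: "sqn {0..1} (\<lambda>x. q1 x 0) < top" "sqn {0..1} (\<lambda>x. q2 x 0) < top"
  shows "pair (\<lambda>x. u1 x h) (\<lambda>x. u2 x h) (\<lambda>x. q1 x 0) (\<lambda>x. q2 x 0)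
    = pair (\<lambda>x. u1 x 0) (\<lambda>x. u2 x 0) (\<lambda>x. q1 x h) (\<lambda>x. q2 x h) + (LBINT s:{0..h}. u2 1 s * q1 1 (h - s))"
proof -
  interpret a: hyp e2 \<phi>2 \<psi>2 e1 \<phi>1 \<psi>1 m M d1' d2' q "M * D / m" by (rule adjoint_hyp)
  note um [measurable] = hsysD(1,2)[OF u] and qm [measurable] = a.hsysD(1,2)[OF qs]
  have qin: "sqn {0..h} (q2 1) < top"
  proof -
    have "sqn {0..h} (q2 1) = ennreal (0\<^sup>2) * sqn {0..h} (q2 1)"
      by (rule sqn_AE_mult) (use q0 in auto)
    then show ?thesis by simp
  qed
  note ufin = sys_finite[OF u h uinit] and qfin = a.sys_finite[OF qs h qinit qin]
  have rev: "sqn {0..h} (\<lambda>s. w (h - s)) < top" if "sqn {0..h} w < top" "w \<in> borel_measurable borel" for w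
    using sqn_reflect[OF that(2), of h] that(1) by simp
  have mm: "ennreal (1 / m) * A < top" "ennreal (D\<^sup>2 / m) * A < top" "ennreal ((M * D / m)\<^sup>2 / m) * A < top" if "A < top" for A
    using that by (auto simp: ennreal_mult_less_top)
  have c1: "sqn {0..s1.L} (\<lambda>a. w (\<psi>1 a)) < top" "sqn {0..s2.L} (\<lambda>b. w (\<psi>2 (s2.L - b))) < top"
    if "sqn {0..1} w < top" "w \<in> borel_measurable borel" for w
    using le_less_trans[OF s1.sqn_coord_ge[OF that(2)] mm(1)[OF that(1)]]
      le_less_trans[OF s2.sqn_coord_ge'[OF that(2)] mm(1)[OF that(1)]] by auto
  text \<open>The first family pairs \<open>u1\<close> with \<open>q2\<close>, the second one \<open>u2\<close> with \<open>q1\<close>.\<close>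
  define X1 where "X1 a s = indicator {0..s1.L} a * indicator {0..h} s *
    ((d1 (\<psi>1 a) * u2 (\<psi>1 a) s) * q2 (\<psi>1 a) (h - s) + u1 (\<psi>1 a) s * - (d2' (\<psi>1 a) * q1 (\<psi>1 a) (h - s)))" for a s
  define X2 where "X2 b s = indicator {0..s2.L} b * indicator {0..h} s *
    ((d2 (\<psi>2 (s2.L - b)) * u1 (\<psi>2 (s2.L - b)) s) * q1 (\<psi>2 (s2.L - b)) (h - s)
      + u2 (\<psi>2 (s2.L - b)) s * - (d1' (\<psi>2 (s2.L - b)) * q2 (\<psi>2 (s2.L - b)) (h - s)))" for b s
  have st1: "straight s1.L h (\<lambda>a s. u1 (\<psi>1 a) s) (\<lambda>a s. d1 (\<psi>1 a) * u2 (\<psi>1 a) s)"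
    "straight s1.L h (\<lambda>a s. q2 (\<psi>1 a) (h - s)) (\<lambda>a s. - (d2' (\<psi>1 a) * q1 (\<psi>1 a) (h - s)))"
    using hsysD(3)[OF u] straight_reverse[OF a.hsysD(4)[OF qs]] by simp_all
  have st2: "straight s2.L h (\<lambda>b s. u2 (\<psi>2 (s2.L - b)) s) (\<lambda>b s. d2 (\<psi>2 (s2.L - b)) * u1 (\<psi>2 (s2.L - b)) s)"
    "straight s2.L h (\<lambda>b s. q1 (\<psi>2 (s2.L - b)) (h - s)) (\<lambda>b s. - (d1' (\<psi>2 (s2.L - b)) * q2 (\<psi>2 (s2.L - b)) (h - s)))"
    using hsysD(4)[OF u] straight_reverse[OF a.hsysD(3)[OF qs]] by simp_all
  have [measurable]: "d1' \<in> borel_measurable borel" "d2' \<in> borel_measurable borel"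
    by (rule a.d_measurable)+
  have D1: "dsq s1.L h (\<lambda>a s. u1 (\<psi>1 a) s) < top" "dsq s1.L h (\<lambda>a s. d1 (\<psi>1 a) * u2 (\<psi>1 a) s) < top"
    by (rule le_less_trans[OF s1.dsq_coord mm(1)[OF ufin(6)]] le_less_trans[OF source_sqn(1) mm(2)[OF ufin(7)]], measurable)+
  have D2: "dsq s2.L h (\<lambda>b s. u2 (\<psi>2 (s2.L - b)) s) < top" "dsq s2.L h (\<lambda>b s. d2 (\<psi>2 (s2.L - b)) * u1 (\<psi>2 (s2.L - b)) s) < top"
    by (simp only: s2.dsq_coord' um, rule le_less_trans[OF s2.dsq_coord mm(1)[OF ufin(7)]], measurable)
      (rule le_less_trans[OF source_sqn(2) mm(2)[OF ufin(6)]], measurable)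
  have D3: "dsq s1.L h (\<lambda>a s. q2 (\<psi>1 a) (h - s)) < top"
    "dsq s1.L h (\<lambda>a s. - (d2' (\<psi>1 a) * q1 (\<psi>1 a) (h - s))) < top"
  proof -
    have "dsq s1.L h (\<lambda>b s. q2 (\<psi>1 (s1.L - b)) s) < top"
      by (simp only: s1.dsq_coord' qm) (rule le_less_trans[OF s1.dsq_coord mm(1)[OF qfin(7)]], measurable)
    then show "dsq s1.L h (\<lambda>a s. q2 (\<psi>1 a) (h - s)) < top"
      using dsq_reverse[of "\<lambda>b s. q2 (\<psi>1 (s1.L - b)) s" s1.L h] by simp
    have "dsq s1.L h (\<lambda>b s. d2' (\<psi>1 (s1.L - b)) * q1 (\<psi>1 (s1.L - b)) s) < top"
      by (rule le_less_trans[OF a.source_sqn(2) mm(3)[OF qfin(6)]]) measurable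
    then show "dsq s1.L h (\<lambda>a s. - (d2' (\<psi>1 a) * q1 (\<psi>1 a) (h - s))) < top"
      using dsq_reverse[of "\<lambda>b s. d2' (\<psi>1 (s1.L - b)) * q1 (\<psi>1 (s1.L - b)) s" s1.L h] by (simp add: dsq_uminus)
  qed
  have D4: "dsq s2.L h (\<lambda>b s. q1 (\<psi>2 (s2.L - b)) (h - s)) < top"
    "dsq s2.L h (\<lambda>b s. - (d1' (\<psi>2 (s2.L - b)) * q2 (\<psi>2 (s2.L - b)) (h - s))) < top"
  proof -
    have "dsq s2.L h (\<lambda>a s. q1 (\<psi>2 a) s) < top"
      by (rule le_less_trans[OF s2.dsq_coord mm(1)[OF qfin(6)]]) measurable
    then show "dsq s2.L h (\<lambda>b s. q1 (\<psi>2 (s2.L - b)) (h - s)) < top"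
      using dsq_reverse[of "\<lambda>b s. q1 (\<psi>2 b) s" s2.L h] by simp
    have "dsq s2.L h (\<lambda>b s. d1' (\<psi>2 b) * q2 (\<psi>2 b) s) < top"
      by (rule le_less_trans[OF a.source_sqn(1) mm(3)[OF qfin(7)]]) measurable
    then show "dsq s2.L h (\<lambda>b s. - (d1' (\<psi>2 (s2.L - b)) * q2 (\<psi>2 (s2.L - b)) (h - s))) < top"
      using dsq_reverse[of "\<lambda>b s. d1' (\<psi>2 b) * q2 (\<psi>2 b) s" s2.L h] by (simp add: dsq_uminus)
  qed
  have G1: "sqn {0..s1.L} (\<lambda>a. u1 (\<psi>1 a) 0) < top" "sqn {0..s1.L} (\<lambda>a. u1 (\<psi>1 a) h) < top"
    by (rule c1[OF uinit(1)] c1[OF ufin(1)], measurable)+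
  have G1': "sqn {0..h} (u1 (\<psi>1 0)) < top" "sqn {0..h} (u1 (\<psi>1 s1.L)) < top"
    using ufin by simp_all
  have G2: "sqn {0..s1.L} (\<lambda>a. q2 (\<psi>1 a) (h - 0)) < top" "sqn {0..s1.L} (\<lambda>a. q2 (\<psi>1 a) (h - h)) < top"
    using c1(1)[OF qinit(2)] c1(1)[OF qfin(2)] by simp_all
  have G2': "sqn {0..h} (\<lambda>s. q2 (\<psi>1 0) (h - s)) < top" "sqn {0..h} (\<lambda>s. q2 (\<psi>1 s1.L) (h - s)) < top"
    using rev[OF qfin(3)] rev[OF qin] by simp_all
  have G3: "sqn {0..s2.L} (\<lambda>b. u2 (\<psi>2 (s2.L - b)) 0) < top" "sqn {0..s2.L} (\<lambda>b. u2 (\<psi>2 (s2.L - b)) h) < top"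
    by (rule c1[OF uinit(2)] c1[OF ufin(2)], measurable)+
  have G3': "sqn {0..h} (u2 (\<psi>2 (s2.L - 0))) < top" "sqn {0..h} (u2 (\<psi>2 (s2.L - s2.L))) < top"
    using ufin uinit by simp_all
  have G4: "sqn {0..s2.L} (\<lambda>b. q1 (\<psi>2 (s2.L - b)) (h - 0)) < top" "sqn {0..s2.L} (\<lambda>b. q1 (\<psi>2 (s2.L - b)) (h - h)) < top"
    using c1(2)[OF qinit(1)] c1(2)[OF qfin(1)] by simp_all
  have G4': "sqn {0..h} (\<lambda>s. q1 (\<psi>2 (s2.L - 0)) (h - s)) < top" "sqn {0..h} (\<lambda>s. q1 (\<psi>2 (s2.L - s2.L)) (h - s)) < top"
    using rev[OF qfin(4)] rev[OF qfin(5)] by simp_all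
  have E1: "(LBINT a:{0..s1.L}. u1 (\<psi>1 a) h * q2 (\<psi>1 a) (h - h)) + (LBINT s:{0..h}. u1 (\<psi>1 s1.L) s * q2 (\<psi>1 s1.L) (h - s)) =
     (LBINT a:{0..s1.L}. u1 (\<psi>1 a) 0 * q2 (\<psi>1 a) (h - 0)) + (LBINT s:{0..h}. u1 (\<psi>1 0) s * q2 (\<psi>1 0) (h - s))
     + (LINT s|lborel. LINT a|lborel. X1 a s)"
    unfolding X1_def
    by (rule rect_duality[OF st1 _ _ _ _ D1 D3 G1 G1' G2 G2' less_imp_le[OF s1.L_pos] h]) measurable
  have E2: "(LBINT b:{0..s2.L}. u2 (\<psi>2 (s2.L - b)) h * q1 (\<psi>2 (s2.L - b)) (h - h)) + (LBINT s:{0..h}. u2 (\<psi>2 (s2.L - s2.L)) s * q1 (\<psi>2 (s2.L - s2.L)) (h - s)) =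
     (LBINT b:{0..s2.L}. u2 (\<psi>2 (s2.L - b)) 0 * q1 (\<psi>2 (s2.L - b)) (h - 0)) + (LBINT s:{0..h}. u2 (\<psi>2 (s2.L - 0)) s * q1 (\<psi>2 (s2.L - 0)) (h - s))
     + (LINT s|lborel. LINT a|lborel. X2 a s)"
    unfolding X2_def
    by (rule rect_duality[OF st2 _ _ _ _ D2 D4 G3 G3' G4 G4' less_imp_le[OF s2.L_pos] h]) measurable
  have out0: "(LBINT s:{0..h}. u1 1 s * q2 1 (h - s)) = 0"
    by (rule set_integral_AE_zero) (simp add: q0)
  have bnd: "(LBINT s:{0..h}. u1 0 s * q2 0 (h - s)) = (LBINT s:{0..h}. u2 0 s * q1 0 (h - s))"
  proof -
    \<comment> \<open>\<open>u1 0 = q * u2 0\<close> and \<open>q1 0 = q * q2 0\<close> give the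
      equality; both boundary conditions need positive times, hence \<open>0 < s\<close> and
      \<open>s < h\<close>.\<close>
    have eq: "u1 0 s * q2 0 (h - s) = u2 0 s * q1 0 (h - s)" if "0 < s" "s < h" for s
      using hsysD(5)[OF u, of s] a.hsysD(5)[OF qs, of "h - s"] that by simp
    have "AE s in lborel. indicator {0..h} s *\<^sub>R (u1 0 s * q2 0 (h - s)) = indicator {0..h} s *\<^sub>R (u2 0 s * q1 0 (h - s))"
      using AE_lborel_singleton[of 0] AE_lborel_singleton[of h]
    proof eventually_elim
      case (elim s)
      have "u1 0 s * q2 0 (h - s) = u2 0 s * q1 0 (h - s)" if "0 \<le> s" "s \<le> h"
        using elim that by (intro eq) linarith+
      then show ?case by (auto simp: indicator_def)
    qed
    then show ?thesis unfolding set_lebesgue_integral_def by (intro integral_cong_AE) measurable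
  qed
  have iX1: "integrable (lborel \<Otimes>\<^sub>M lborel) (\<lambda>(a, s). X1 a s)"
    unfolding X1_def by (rule integrable_rect) (use D1 D3 in auto)
  have iX2: "integrable (lborel \<Otimes>\<^sub>M lborel) (\<lambda>(a, s). X2 a s)"
    unfolding X2_def by (rule integrable_rect) (use D2 D4 in auto)
  \<comment> \<open>The two sources live in different coordinates and cancel only when both are
    written over \<open>x\<close>, where the Jacobians \<open>1 / e1\<close> and
    \<open>1 / e2\<close> fit the definitions of \<open>d1'\<close> and \<open>d2'\<close>.\<close>
  have X12: "(LINT s|lborel. LINT a|lborel. X1 a s) = - (LINT s|lborel. LINT a|lborel. X2 a s)"
  proof -
    have "(LINT s|lborel. LINT a|lborel. X1 a s) = (LINT s|lborel. - (LINT a|lborel. X2 a s))"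
    proof (rule integral_cong_AE)
      show "(\<lambda>s. LINT a|lborel. X1 a s) \<in> borel_measurable lborel"
        using lborel_pair.integrable_snd[OF iX1] by (auto dest: borel_measurable_integrable)
      show "(\<lambda>s. - (LINT a|lborel. X2 a s)) \<in> borel_measurable lborel"
        using lborel_pair.integrable_snd[OF iX2] by (auto dest: borel_measurable_integrable)
      show "AE s in lborel. (LINT a|lborel. X1 a s) = - (LINT a|lborel. X2 a s)"
        using lborel_pair.AE_integrable_snd[OF iX1] lborel_pair.AE_integrable_snd[OF iX2]
      proof eventually_elim
        case (elim s)
        show ?case
        proof (cases "s \<in> {0..h}")
          case True
          define K1 where "K1 a = (d1 (\<psi>1 a) * u2 (\<psi>1 a) s) * q2 (\<psi>1 a) (h - s) + u1 (\<psi>1 a) s * - (d2' (\<psi>1 a) * q1 (\<psi>1 a) (h - s))" for a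
          define K2 where "K2 b = (d2 (\<psi>2 (s2.L - b)) * u1 (\<psi>2 (s2.L - b)) s) * q1 (\<psi>2 (s2.L - b)) (h - s)
             + u2 (\<psi>2 (s2.L - b)) s * - (d1' (\<psi>2 (s2.L - b)) * q2 (\<psi>2 (s2.L - b)) (h - s))" for b
          have i: "set_integrable lborel {0..s1.L} K1" "set_integrable lborel {0..s2.L} K2"
            using elim True by (simp_all add: X1_def X2_def K1_def[abs_def] K2_def[abs_def] set_integrable_def)
          have "(LINT a|lborel. X1 a s) = (LBINT a:{0..s1.L}. K1 a)" "(LINT a|lborel. X2 a s) = (LBINT a:{0..s2.L}. K2 a)"
            using True by (simp_all add: X1_def X2_def K1_def K2_def set_lebesgue_integral_def)
          moreover have "K1 (\<phi>1 x) / e1 x = - (K2 (s2.L - \<phi>2 x) / e2 x)" for x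
            using s1.epos[of x] s2.epos[of x] unfolding K1_def K2_def d1'_def d2'_def by (simp add: field_simps)
          ultimately show ?thesis
            unfolding s1.integral_coord(2)[OF i(1)] s2.integral_coord_left[OF i(2)]
            by (simp add: set_lebesgue_integral_def)
        qed (simp add: X1_def X2_def)
      qed
    qed
    then show ?thesis by simp
  qed
  have P: "pair (\<lambda>x. u1 x t) (\<lambda>x. u2 x t) (\<lambda>x. q1 x s) (\<lambda>x. q2 x s)
     = (LBINT a:{0..s1.L}. u1 (\<psi>1 a) t * q2 (\<psi>1 a) s) + (LBINT b:{0..s2.L}. u2 (\<psi>2 (s2.L - b)) t * q1 (\<psi>2 (s2.L - b)) s)"
    if "sqn {0..1} (\<lambda>x. u1 x t) < top" "sqn {0..1} (\<lambda>x. u2 x t) < top" "sqn {0..1} (\<lambda>x. q1 x s) < top" "sqn {0..1} (\<lambda>x. q2 x s) < top" for t s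
  proof -
    have "set_integrable lborel {0..s1.L} (\<lambda>a. u1 (\<psi>1 a) t * q2 (\<psi>1 a) s)"
      using c1[OF that(1)] c1[OF that(4)] by (intro set_integrable_mult_sqn) auto
    moreover have "set_integrable lborel {0..s2.L} (\<lambda>b. u2 (\<psi>2 (s2.L - b)) t * q1 (\<psi>2 (s2.L - b)) s)"
      using c1[OF that(2)] c1[OF that(3)] by (intro set_integrable_mult_sqn) auto
    ultimately show ?thesis
      unfolding pair_def by (simp add: s1.integral_coord(2) s2.integral_coord_left)
  qed
  show ?thesis
    unfolding P[OF ufin(1,2) qinit] P[OF uinit(1,2) qfin(1,2)]
    using E1 E2 out0 bnd X12 by simp
qed

end

section \<open>The backstepping identity\<close>

lemma mild_transport_cong:
  assumes mt: "mild_transport D a b w f"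
    and "\<And>x y. (x, y) \<in> D \<Longrightarrow> w x y = w' x y" "\<And>x y. (x, y) \<in> D \<Longrightarrow> f x y = f' x y"
  shows "mild_transport D a b w' f'"
  unfolding mild_transport_def
proof (intro allI impI)
  fix X Y S :: "real \<Rightarrow> real" and s :: real
  assume s: "0 \<le> s" and *: "\<forall>r\<in>{0..s}. (X r, Y r) \<in> D \<and>
     (X has_real_derivative a (X r)) (at r within {0..s}) \<and> (Y has_real_derivative b (Y r)) (at r within {0..s})"
  note mt[unfolded mild_transport_def, rule_format, OF s *[rule_format]]
  moreover have "set_integrable lborel {0..s} (\<lambda>s. f (X s) (Y s)) = set_integrable lborel {0..s} (\<lambda>s. f' (X s) (Y s))"
    using * assms(3) by (intro set_integrable_cong) auto
  moreover have "(LBINT s:{0..s}. f (X s) (Y s)) = (LBINT s:{0..s}. f' (X s) (Y s))"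
    using * assms(3) by (intro set_lebesgue_integral_cong) auto
  moreover have "w (X s) (Y s) = w' (X s) (Y s)" "w (X 0) (Y 0) = w' (X 0) (Y 0)"
    using * s assms(2) by auto
  ultimately show "set_integrable lborel {0..s} (\<lambda>s. f' (X s) (Y s)) \<and>
     w' (X s) (Y s) - w' (X 0) (Y 0) = (LBINT s:{0..s}. f' (X s) (Y s))" by simp
qed

text \<open>The reversed curve is a characteristic in the sense of \<open>mild_transport\<close>. On
  the triangle the kernels are followed from \<open>x = 1\<close> downwards, against their own
  direction.\<close>

lemma mild_transport_backward:
  assumes mt: "mild_transport D a b w f" and S: "0 \<le> S"
    and X: "\<And>s. s \<in> {0..S} \<Longrightarrow> (X s, Y s) \<in> D"
    and dX: "\<And>s. (X has_real_derivative - a (X s)) (at s)" and dY: "\<And>s. (Y has_real_derivative - b (Y s)) (at s)"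
  shows "set_integrable lborel {0..S} (\<lambda>s. - f (X s) (Y s))"
    and "w (X S) (Y S) - w (X 0) (Y 0) = (LBINT s:{0..S}. - f (X s) (Y s))"
proof -
  have D: "((\<lambda>s. X (S - s)) has_real_derivative a (X (S - r))) (at r within {0..S})"
    "((\<lambda>s. Y (S - s)) has_real_derivative b (Y (S - r))) (at r within {0..S})" for r
  proof -
    have "((\<lambda>s. X (S - s)) has_real_derivative - a (X (S - r)) * - 1) (at r within {0..S})"
      by (rule DERIV_chain2[OF dX]) (auto intro!: derivative_eq_intros)
    then show "((\<lambda>s. X (S - s)) has_real_derivative a (X (S - r))) (at r within {0..S})" by simp
    have "((\<lambda>s. Y (S - s)) has_real_derivative - b (Y (S - r)) * - 1) (at r within {0..S})"
      by (rule DERIV_chain2[OF dY]) (auto intro!: derivative_eq_intros)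
    then show "((\<lambda>s. Y (S - s)) has_real_derivative b (Y (S - r))) (at r within {0..S})" by simp
  qed
  have "\<forall>r\<in>{0..S}. (X (S - r), Y (S - r)) \<in> D \<and>
     ((\<lambda>s. X (S - s)) has_real_derivative a (X (S - r))) (at r within {0..S}) \<and>
     ((\<lambda>s. Y (S - s)) has_real_derivative b (Y (S - r))) (at r within {0..S})"
    using X D by auto
  from mt[unfolded mild_transport_def, rule_format, OF S this[rule_format]]
  have *: "set_integrable lborel {0..S} (\<lambda>s. f (X (S - s)) (Y (S - s)))"
    "w (X (S - S)) (Y (S - S)) - w (X (S - 0)) (Y (S - 0)) = (LBINT s:{0..S}. f (X (S - s)) (Y (S - s)))"
    by auto
  define k where "k r = indicator {0..S} r * f (X (S - r)) (Y (S - r))" for r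
  have ik: "integrable lborel k" using *(1) by (simp add: k_def[abs_def] set_integrable_def)
  have eq: "indicator {0..S} s *\<^sub>R - f (X s) (Y s) = - k (S - s)" for s
    by (cases "s \<in> {0..S}") (auto simp: k_def)
  show "set_integrable lborel {0..S} (\<lambda>s. - f (X s) (Y s))"
    unfolding set_integrable_def eq using integrable_reflect[OF ik, of S] by simp
  show "w (X S) (Y S) - w (X 0) (Y 0) = (LBINT s:{0..S}. - f (X s) (Y s))"
    unfolding set_lebesgue_integral_def eq using integral_reflect[of k S] *(2)
    by (simp add: k_def[abs_def] set_lebesgue_integral_def)
qed

lemma dsq_bounded:
  assumes "\<And>a s. \<bar>f a s\<bar> \<le> B" "0 \<le> L" "0 \<le> T"
  shows "dsq L T f < top"
proof -
  have "dsq L T f \<le> (\<integral>\<^sup>+s. ennreal (B\<^sup>2 * (L - 0)) * indicator {0..T} s \<partial>lborel)"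
    unfolding dsq_def using assms by (intro nn_integral_mono mult_right_mono sqn_const) auto
  also have "\<dots> < top" using assms by (simp add: nn_integral_cmult_indicator ennreal_mult_less_top)
  finally show ?thesis .
qed

lemma sqn_bounded:
  assumes "\<And>a. \<bar>f a\<bar> \<le> B" "0 \<le> L"
  shows "sqn {0..L} f < top"
  using le_less_trans[OF sqn_const[of 0 L f B]] assms by auto

context hyp
begin

text \<open>Follow \<open>u2\<close> on its characteristic \<open>x = \<psi>2 (s2.L - t)\<close>
  from \<open>x = 1\<close> to \<open>x = 0\<close>. There \<open>u2 (x, t)\<close> minus the
  integral of \<open>K (x, y) u (y, t)\<close> over \<open>y \<le> x\<close> is constant: in the
  interior the kernel equations are adjoint to the plant, at \<open>y = 0\<close> the traces cancel
  by \<open>kq\<close>, and at the moving end \<open>y = x\<close> the value in \<open>kd\<close>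
  compensates the source of \<open>u2\<close>. At \<open>x = 0\<close> the range of integration has
  shrunk to a point.\<close>

theorem triangle_identity:
  assumes u: "sys s2.L u1 u2"
    and uinit: "sqn {0..1} (\<lambda>x. u1 x 0) < top" "sqn {0..1} (\<lambda>x. u2 x 0) < top" "sqn {0..s2.L} (u2 1) < top"
    and km [measurable]: "case_prod K1 \<in> borel_measurable (borel \<Otimes>\<^sub>M borel)" "case_prod K2 \<in> borel_measurable (borel \<Otimes>\<^sub>M borel)"
    and kb: "\<And>x y. \<bar>K1 x y\<bar> \<le> B" "\<And>x y. \<bar>K2 x y\<bar> \<le> B"
    and k0: "\<And>x y. (x, y) \<notin> triangle \<Longrightarrow> K1 x y = 0 \<and> K2 x y = 0"
    and k1: "mild_transport triangle e2 (\<lambda>y. - e1 y) (\<lambda>x y. e1 y * K1 x y) (\<lambda>x y. e1 y * (d2 y * K2 x y))"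
    and k2: "mild_transport triangle e2 e2 (\<lambda>x y. e2 y * K2 x y) (\<lambda>x y. e2 y * (d1 y * K1 x y))"
    and kd: "\<And>x. x \<in> {0..1} \<Longrightarrow> K1 x x = - d2 x / (e1 x + e2 x)"
    and kq: "\<And>x. x \<in> {0..1} \<Longrightarrow> e2 0 * K2 x 0 = q * e1 0 * K1 x 0"
  shows "u2 0 s2.L = u2 1 0 - pair (\<lambda>x. u1 x 0) (\<lambda>x. u2 x 0) (\<lambda>y. e2 y * K2 1 y) (\<lambda>y. e1 y * K1 1 y)"
proof -
  let ?L = "s2.L"
  have L: "0 \<le> ?L" "0 < ?L" "0 \<le> s1.L" using s1.L_pos s2.L_pos by auto
  note um [measurable] = hsysD(1,2)[OF u]
  note ufin = sys_finite[OF u L(1) uinit]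
  have B0: "0 \<le> B" using kb(1)[of 0 0] by linarith
  have mm: "ennreal (1 / m) * A < top" "ennreal (D\<^sup>2 / m) * A < top" if "A < top" for A
    using that by (auto simp: ennreal_mult_less_top)
  have c1: "sqn {0..s1.L} (\<lambda>a. w (\<psi>1 a)) < top" "sqn {0..s2.L} (\<lambda>b. w (\<psi>2 (s2.L - b))) < top"
    if "sqn {0..1} w < top" "w \<in> borel_measurable borel" for w
    using le_less_trans[OF s1.sqn_coord_ge[OF that(2)] mm(1)[OF that(1)]]
      le_less_trans[OF s2.sqn_coord_ge'[OF that(2)] mm(1)[OF that(1)]] by auto
  have tri1: "(\<psi>2 (?L - t), \<psi>1 a) \<in> triangle \<longleftrightarrow> 0 \<le> a \<and> 0 \<le> t \<and> \<phi>2 (\<psi>1 a) + t \<le> ?L" for a t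
  proof -
    have "0 \<le> \<psi>1 a \<longleftrightarrow> 0 \<le> a" using s1.\<psi>_le_iff[of 0 a] by simp
    moreover have "\<psi>1 a \<le> \<psi>2 (?L - t) \<longleftrightarrow> \<phi>2 (\<psi>1 a) + t \<le> ?L"
      using s2.\<phi>_le_iff[of "\<psi>1 a" "\<psi>2 (?L - t)"] by (simp add: algebra_simps)
    moreover have "\<psi>2 (?L - t) \<le> 1 \<longleftrightarrow> 0 \<le> t" using s2.\<psi>_le_iff[of "?L - t" ?L] by simp
    ultimately show ?thesis by (auto simp: triangle_def)
  qed
  have tri2: "(\<psi>2 (?L - t), \<psi>2 (?L - b)) \<in> triangle \<longleftrightarrow> b \<le> ?L \<and> 0 \<le> t \<and> t \<le> b" for b t
  proof -
    have "0 \<le> \<psi>2 (?L - b) \<longleftrightarrow> b \<le> ?L" using s2.\<psi>_le_iff[of 0 "?L - b"] by simp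
    moreover have "\<psi>2 (?L - b) \<le> \<psi>2 (?L - t) \<longleftrightarrow> t \<le> b" by simp
    moreover have "\<psi>2 (?L - t) \<le> 1 \<longleftrightarrow> 0 \<le> t" using s2.\<psi>_le_iff[of "?L - t" ?L] by simp
    ultimately show ?thesis by (auto simp: triangle_def)
  qed
  have d\<psi>1: "((\<lambda>r. \<psi>1 (c + r)) has_real_derivative e1 (\<psi>1 (c + s))) (at s)" for c s
  proof -
    have "((\<lambda>r. \<psi>1 (c + r)) has_real_derivative e1 (\<psi>1 (c + s)) * 1) (at s)"
      by (rule DERIV_chain2[OF s1.d\<psi>]) (auto intro!: derivative_eq_intros)
    then show ?thesis by simp
  qed
  have d\<psi>2: "((\<lambda>r. \<psi>2 (c - r)) has_real_derivative - e2 (\<psi>2 (c - s))) (at s)" for c s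
  proof -
    have "((\<lambda>r. \<psi>2 (c - r)) has_real_derivative e2 (\<psi>2 (c - s)) * - 1) (at s)"
      by (rule DERIV_chain2[OF s2.d\<psi>]) (auto intro!: derivative_eq_intros)
    then show ?thesis by simp
  qed
  \<comment> \<open>The kernels on this characteristic, as functions of time and travel time and
    scaled by the speeds. Time runs against the \<open>x\<close> of the kernel equations, hence the
    minus signs in \<open>G1\<close> and \<open>G2\<close>.\<close>
  define g1 where "g1 a t = e1 (\<psi>1 a) * K1 (\<psi>2 (?L - t)) (\<psi>1 a)" for a t
  define G1 where "G1 a t = - (e1 (\<psi>1 a) * (d2 (\<psi>1 a) * K2 (\<psi>2 (?L - t)) (\<psi>1 a)))" for a t
  define g2 where "g2 b t = e2 (\<psi>2 (?L - b)) * K2 (\<psi>2 (?L - t)) (\<psi>2 (?L - b))" for b t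
  define G2 where "G2 b t = - (e2 (\<psi>2 (?L - b)) * (d1 (\<psi>2 (?L - b)) * K1 (\<psi>2 (?L - t)) (\<psi>2 (?L - b))))" for b t
  have [measurable]: "case_prod g1 \<in> borel_measurable (borel \<Otimes>\<^sub>M borel)" "case_prod G1 \<in> borel_measurable (borel \<Otimes>\<^sub>M borel)"
    "case_prod g2 \<in> borel_measurable (borel \<Otimes>\<^sub>M borel)" "case_prod G2 \<in> borel_measurable (borel \<Otimes>\<^sub>M borel)"
    unfolding g1_def g2_def G1_def G2_def by measurable
  have MB: "\<bar>x * k\<bar> \<le> M * B" "\<bar>x * (d * k)\<bar> \<le> M * (D * B)" if "0 < x" "x \<le> M" "\<bar>k\<bar> \<le> B" "\<bar>d\<bar> \<le> D" for x k d
    using that D_nonneg B0 s1.M_pos by (auto simp: abs_mult intro!: mult_mono)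
  have bnd: "\<bar>g1 a t\<bar> \<le> M * B" "\<bar>G1 a t\<bar> \<le> M * (D * B)" "\<bar>g2 a t\<bar> \<le> M * B" "\<bar>G2 a t\<bar> \<le> M * (D * B)" for a t
    unfolding g1_def G1_def g2_def G2_def abs_minus_cancel
    by (rule MB s1.epos s2.epos s1.m(3) s2.m(3) kb d_bound)+
  \<comment> \<open>Checking the far end of the segment is enough: \<open>y\<close> increases and
    \<open>x\<close> decreases along it, so it only approaches the diagonal.\<close>
  have fam1: "set_integrable lborel {0..r} (\<lambda>p. G1 (a + p) (t + p))
      \<and> g1 (a + r) (t + r) - g1 a t = (LBINT p:{0..r}. G1 (a + p) (t + p))"
    if *: "0 \<le> a" "0 \<le> t" "0 \<le> r" "\<phi>2 (\<psi>1 (a + r)) + (t + r) \<le> ?L" for a t r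
  proof -
    have T: "(\<psi>2 (?L - t - p), \<psi>1 (a + p)) \<in> triangle" if p: "p \<in> {0..r}" for p
    proof -
      have "\<phi>2 (\<psi>1 (a + p)) \<le> \<phi>2 (\<psi>1 (a + r))" using p by simp
      then have "\<phi>2 (\<psi>1 (a + p)) + (t + p) \<le> ?L" using * p unfolding atLeastAtMost_iff by linarith
      then show ?thesis using tri1[of "t + p" "a + p"] * p by (simp add: algebra_simps)
    qed
    have "((\<lambda>p. \<psi>1 (a + p)) has_real_derivative - (- e1 (\<psi>1 (a + s)))) (at s)" for s using d\<psi>1 by simp
    from mild_transport_backward[OF k1 *(3) T d\<psi>2 this] show ?thesis
      by (simp add: g1_def G1_def algebra_simps)
  qed
  \<comment> \<open>In travel times these lines are parallel to the diagonal: each lies entirely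
    inside the triangle or in the region where the extension is zero. So the jump of the extension
    does no harm and \<open>rect_duality\<close> applies to the full square. The first family
    crosses the diagonal and has to be stopped there.\<close>
  have fam2: "straight ?L ?L g2 G2"
    unfolding straight_def
  proof (intro allI impI)
    fix b t r :: real
    assume *: "0 \<le> b" "0 \<le> t" "0 \<le> r" "b + r \<le> ?L" "t + r \<le> ?L"
    show "set_integrable lborel {0..r} (\<lambda>p. G2 (b + p) (t + p))
      \<and> g2 (b + r) (t + r) - g2 b t = (LBINT p:{0..r}. G2 (b + p) (t + p))"
    proof (cases "t \<le> b")
      case True
      have T: "(\<psi>2 (?L - t - p), \<psi>2 (?L - b - p)) \<in> triangle" if p: "p \<in> {0..r}" for p
        using tri2[of "t + p" "b + p"] * p True by (simp add: algebra_simps)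
      from mild_transport_backward[OF k2 *(3) T d\<psi>2 d\<psi>2] show ?thesis by (simp add: g2_def G2_def algebra_simps)
    next
      case False
      then have "(\<psi>2 (?L - (t + p)), \<psi>2 (?L - (b + p))) \<notin> triangle" for p
        using tri2[of "t + p" "b + p"] by simp
      from k0[OF this] have "g2 (b + p) (t + p) = 0" "G2 (b + p) (t + p) = 0" for p
        by (simp_all add: g2_def G2_def)
      from this this(1)[of 0] show ?thesis by (simp add: set_lebesgue_integral_def set_integrable_def)
    qed
  qed
  define X1 where "X1 a s = indicator {0..s1.L} a * indicator {0..?L} s *
    ((d1 (\<psi>1 a) * u2 (\<psi>1 a) s) * g1 a s + u1 (\<psi>1 a) s * G1 a s)" for a s
  define X2 where "X2 b s = indicator {0..?L} b * indicator {0..?L} s *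
    ((d2 (\<psi>2 (?L - b)) * u1 (\<psi>2 (?L - b)) s) * g2 b s + u2 (\<psi>2 (?L - b)) s * G2 b s)" for b s
  have D1: "dsq s1.L ?L (\<lambda>a s. u1 (\<psi>1 a) s) < top" "dsq s1.L ?L (\<lambda>a s. d1 (\<psi>1 a) * u2 (\<psi>1 a) s) < top"
    by (rule le_less_trans[OF s1.dsq_coord mm(1)[OF ufin(6)]] le_less_trans[OF source_sqn(1) mm(2)[OF ufin(7)]], measurable)+
  have D2: "dsq ?L ?L (\<lambda>b s. u2 (\<psi>2 (?L - b)) s) < top" "dsq ?L ?L (\<lambda>b s. d2 (\<psi>2 (?L - b)) * u1 (\<psi>2 (?L - b)) s) < top"
    by (simp only: s2.dsq_coord' um, rule le_less_trans[OF s2.dsq_coord mm(1)[OF ufin(7)]], measurable)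
      (rule le_less_trans[OF source_sqn(2) mm(2)[OF ufin(6)]], measurable)
  have D3: "dsq s1.L ?L g1 < top" "dsq s1.L ?L G1 < top" "dsq ?L ?L g2 < top" "dsq ?L ?L G2 < top"
    by (rule dsq_bounded[OF bnd(1) L(3,1)] dsq_bounded[OF bnd(2) L(3,1)] dsq_bounded[OF bnd(3) L(1,1)] dsq_bounded[OF bnd(4) L(1,1)])+
  have iX1: "integrable (lborel \<Otimes>\<^sub>M lborel) (\<lambda>(a, s). X1 a s)"
    unfolding X1_def by (rule integrable_rect[OF _ _ _ _ D1 D3(1,2)]) measurable
  have iX2: "integrable (lborel \<Otimes>\<^sub>M lborel) (\<lambda>(a, s). X2 a s)"
    unfolding X2_def by (rule integrable_rect[OF _ _ _ _ D2 D3(3,4)]) measurable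
  have X12: "(LINT s|lborel. LINT a|lborel. X1 a s) = - (LINT s|lborel. LINT a|lborel. X2 a s)"
  proof -
    have "(LINT s|lborel. LINT a|lborel. X1 a s) = (LINT s|lborel. - (LINT a|lborel. X2 a s))"
    proof (rule integral_cong_AE)
      show "(\<lambda>s. LINT a|lborel. X1 a s) \<in> borel_measurable lborel"
        using lborel_pair.integrable_snd[OF iX1] by (auto dest: borel_measurable_integrable)
      show "(\<lambda>s. - (LINT a|lborel. X2 a s)) \<in> borel_measurable lborel"
        using lborel_pair.integrable_snd[OF iX2] by (auto dest: borel_measurable_integrable)
      show "AE s in lborel. (LINT a|lborel. X1 a s) = - (LINT a|lborel. X2 a s)"
        using lborel_pair.AE_integrable_snd[OF iX1] lborel_pair.AE_integrable_snd[OF iX2]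
      proof eventually_elim
        case (elim s)
        show ?case
        proof (cases "s \<in> {0..?L}")
          case True
          define J1 where "J1 a = (d1 (\<psi>1 a) * u2 (\<psi>1 a) s) * g1 a s + u1 (\<psi>1 a) s * G1 a s" for a
          define J2 where "J2 b = (d2 (\<psi>2 (?L - b)) * u1 (\<psi>2 (?L - b)) s) * g2 b s + u2 (\<psi>2 (?L - b)) s * G2 b s" for b
          have i: "set_integrable lborel {0..s1.L} J1" "set_integrable lborel {0..?L} J2"
            using elim True by (simp_all add: X1_def X2_def J1_def[abs_def] J2_def[abs_def] set_integrable_def)
          have "(LINT a|lborel. X1 a s) = (LBINT a:{0..s1.L}. J1 a)" "(LINT a|lborel. X2 a s) = (LBINT a:{0..?L}. J2 a)"
            using True by (simp_all add: X1_def X2_def J1_def J2_def set_lebesgue_integral_def)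
          moreover have "J1 (\<phi>1 x) / e1 x = - (J2 (?L - \<phi>2 x) / e2 x)" for x
            using s1.epos[of x] s2.epos[of x] unfolding J1_def J2_def g1_def G1_def g2_def G2_def by (simp add: field_simps)
          ultimately show ?thesis
            unfolding s1.integral_coord(2)[OF i(1)] s2.integral_coord_left[OF i(2)]
            by (simp add: set_lebesgue_integral_def)
        qed (simp add: X1_def X2_def)
      qed
    qed
    then show ?thesis by simp
  qed
  text \<open>Second family: the kernel vanishes on the characteristics starting at \<open>x = 1\<close>.\<close>
  have E2: "(LBINT t:{0..?L}. u2 0 t * g2 ?L t) = (LBINT b:{0..?L}. u2 (\<psi>2 (?L - b)) 0 * g2 b 0)
      + (LINT s|lborel. LINT a|lborel. X2 a s)"
  proof -
    have R: "(LBINT b:{0..?L}. u2 (\<psi>2 (?L - b)) ?L * g2 b ?L) + (LBINT t:{0..?L}. u2 (\<psi>2 (?L - ?L)) t * g2 ?L t) =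
      (LBINT b:{0..?L}. u2 (\<psi>2 (?L - b)) 0 * g2 b 0) + (LBINT t:{0..?L}. u2 (\<psi>2 (?L - 0)) t * g2 0 t)
      + (LINT s|lborel. LINT a|lborel. X2 a s)"
      unfolding X2_def
    proof (rule rect_duality[OF hsysD(4)[OF u] fam2 _ _ _ _ D2 D3(3,4)])
      show "sqn {0..?L} (\<lambda>a. u2 (\<psi>2 (?L - a)) 0) < top" "sqn {0..?L} (\<lambda>a. u2 (\<psi>2 (?L - a)) ?L) < top"
        by (rule c1[OF uinit(2)] c1[OF ufin(2)], measurable)+
      show "sqn {0..?L} (u2 (\<psi>2 (?L - 0))) < top" "sqn {0..?L} (u2 (\<psi>2 (?L - ?L))) < top"
        using ufin uinit by simp_all
      show "sqn {0..?L} (\<lambda>a. g2 a 0) < top" "sqn {0..?L} (\<lambda>a. g2 a ?L) < top" "sqn {0..?L} (g2 0) < top" "sqn {0..?L} (g2 ?L) < top"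
        by (rule sqn_bounded[OF bnd(3) L(1)])+
    qed (use L in measurable)
    have "(LBINT b:{0..?L}. u2 (\<psi>2 (?L - b)) ?L * g2 b ?L) = 0"
    proof (rule set_integral_AE_zero)
      fix b :: real assume "0 < b" "b < ?L"
      then have "(\<psi>2 (?L - ?L), \<psi>2 (?L - b)) \<notin> triangle" using tri2[of ?L b] by simp
      from k0[OF this] show "u2 (\<psi>2 (?L - b)) ?L * g2 b ?L = 0" by (simp add: g2_def)
    qed
    moreover have "(LBINT t:{0..?L}. u2 (\<psi>2 (?L - 0)) t * g2 0 t) = 0"
    proof (rule set_integral_AE_zero)
      fix t :: real assume "0 < t" "t < ?L"
      then have "(\<psi>2 (?L - t), \<psi>2 (?L - 0)) \<notin> triangle" using tri2[of t 0] by simp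
      from k0[OF this] show "u2 (\<psi>2 (?L - 0)) t * g2 0 t = 0" by (simp add: g2_def)
    qed
    ultimately show ?thesis using R by simp
  qed
  text \<open>First family: its characteristics end on the diagonal, at \<open>a - t = \<gamma> \<sigma>\<close>.\<close>
  define \<gamma> where "\<gamma> \<sigma> = \<phi>1 (\<psi>2 \<sigma>) - (?L - \<sigma>)" for \<sigma>
  \<comment> \<open>\<open>\<gamma>\<close> increases strictly from \<open>- s2.L\<close> to
    \<open>s1.L\<close>, so every characteristic that meets the rectangle is stopped at exactly one
    diagonal point, the one of travel time \<open>\<sigma>\<close>. \<open>\<gamma>'\<close> is the
    Jacobian of this labelling.\<close>
  define \<gamma>' where "\<gamma>' \<sigma> = e2 (\<psi>2 \<sigma>) / e1 (\<psi>2 \<sigma>) + 1" for \<sigma>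
  have d\<gamma>: "(\<gamma> has_real_derivative \<gamma>' \<sigma>) (at \<sigma>)" for \<sigma>
    unfolding \<gamma>_def \<gamma>'_def by (auto intro!: derivative_eq_intros DERIV_chain2[OF s1.d\<phi>] s2.d\<psi>)
  have c\<gamma>: "continuous_on {0..?L} \<gamma>'"
    unfolding \<gamma>'_def using s1.epos
    by (intro continuous_intros continuous_on_compose2[OF s2.cont s2.\<psi>_cont] continuous_on_compose2[OF s1.cont s2.\<psi>_cont])
      (auto simp: less_imp_neq[THEN not_sym])
  have \<gamma>ends: "\<gamma> 0 = - ?L" "\<gamma> ?L = s1.L" by (simp_all add: \<gamma>_def s1.\<phi>0 s1.L_def)
  have \<gamma>'0: "0 \<le> \<gamma>' \<sigma>" for \<sigma>
    unfolding \<gamma>'_def using s1.epos[of "\<psi>2 \<sigma>"] s2.epos[of "\<psi>2 \<sigma>"] by (simp add: add_nonneg_nonneg)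
  define A0 where "A0 a = indicator {0..s1.L} a * (u1 (\<psi>1 a) 0 * g1 a 0)" for a
  \<comment> \<open>Half-open, so that the corner \<open>c = 0\<close> belongs to \<open>A0\<close>
    alone and \<open>along\<close> holds for every \<open>\<sigma>\<close>.\<close>
  define B1 where "B1 t = indicator {0<..?L} t * (u1 0 t * g1 0 t)" for t
  define J where "J c = (LINT s|lborel. X1 (c + s) s)" for c
  have along: "u1 (\<psi>2 \<sigma>) (?L - \<sigma>) * g1 (\<phi>1 (\<psi>2 \<sigma>)) (?L - \<sigma>) = A0 (\<gamma> \<sigma>) + B1 (0 - \<gamma> \<sigma>) + J (\<gamma> \<sigma>)"
    if \<sigma>: "\<sigma> \<in> {0..?L}" for \<sigma>
  proof -
    define c where "c = \<gamma> \<sigma>"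
    define s0 where "s0 = max 0 (- c)"
    define s1 where "s1 = ?L - \<sigma>"
    have cs1: "c + s1 = \<phi>1 (\<psi>2 \<sigma>)" unfolding c_def \<gamma>_def s1_def by simp
    have y: "\<psi>2 \<sigma> \<in> {0..1}" using \<sigma> by (intro s2.\<psi>_in) auto
    then have a1: "0 \<le> c + s1" "c + s1 \<le> s1.L" unfolding cs1 using s1.\<phi>_in[of "\<psi>2 \<sigma>"] by auto
    have pos: "0 \<le> c + s0" "0 \<le> s0" "0 \<le> s1 - s0" "(c + s0) + (s1 - s0) \<le> s1.L" "s0 + (s1 - s0) \<le> ?L"
      using a1 \<sigma> by (auto simp: s0_def s1_def)
    \<comment> \<open>\<open>\<phi>2 (\<psi>1 (c + s)) + s\<close> increases with \<open>s\<close>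
      and takes the value \<open>s2.L\<close> at \<open>s1\<close>; so the line satisfies
      \<open>y \<le> x\<close> exactly up to time \<open>s1\<close>.\<close>
    have edge: "\<phi>2 (\<psi>1 (c + s)) + s \<le> ?L \<longleftrightarrow> s \<le> s1" for s
    proof -
      have e: "\<phi>2 (\<psi>1 (c + s1)) + s1 = ?L" unfolding cs1 by (simp add: s1_def)
      show ?thesis
      proof
        assume "s \<le> s1"
        then have "\<phi>2 (\<psi>1 (c + s)) \<le> \<phi>2 (\<psi>1 (c + s1))" by simp
        then show "\<phi>2 (\<psi>1 (c + s)) + s \<le> ?L" using e \<open>s \<le> s1\<close> by linarith
      next
        assume *: "\<phi>2 (\<psi>1 (c + s)) + s \<le> ?L"
        show "s \<le> s1"
        proof (rule ccontr)
          assume "\<not> s \<le> s1"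
          then have "\<phi>2 (\<psi>1 (c + s1)) \<le> \<phi>2 (\<psi>1 (c + s))" by simp
          then show False using e * \<open>\<not> s \<le> s1\<close> by linarith
        qed
      qed
    qed
    have f1: "set_integrable lborel {0..s1 - s0} (\<lambda>p. G1 (c + s0 + p) (s0 + p))"
      using fam1[of "c + s0" s0 "s1 - s0"] pos edge[of s1] by simp
    have f2: "g1 (c + s0 + r) (s0 + r) - g1 (c + s0 + 0) (s0 + 0) = (LBINT p:{0..r}. G1 (c + s0 + p) (s0 + p))" if "r \<in> {0..s1 - s0}" for r
      using fam1[of "c + s0" s0 r] pos edge[of "s0 + r"] that by (simp add: add.assoc)
    have f3: "set_integrable lborel {0..s1 - s0} (\<lambda>p. d1 (\<psi>1 (c + s0 + p)) * u2 (\<psi>1 (c + s0 + p)) (s0 + p))"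
      using straightD[OF hsysD(3)[OF u], of "c + s0" s0 "s1 - s0"] pos by simp
    have f4: "u1 (\<psi>1 (c + s0 + r)) (s0 + r) - u1 (\<psi>1 (c + s0 + 0)) (s0 + 0)
        = (LBINT p:{0..r}. d1 (\<psi>1 (c + s0 + p)) * u2 (\<psi>1 (c + s0 + p)) (s0 + p))" if "r \<in> {0..s1 - s0}" for r
      using straightD[OF hsysD(3)[OF u], of "c + s0" s0 r] pos that by simp
    note pr = ac_product(1)[where f="\<lambda>r. u1 (\<psi>1 (c + s0 + r)) (s0 + r)" and g="\<lambda>r. g1 (c + s0 + r) (s0 + r)",
        OF f3 f1 pos(3) f4 f2]
    have "J c = (LINT r|lborel. X1 (c + (s0 + r)) (s0 + r))"
      unfolding J_def by (rule integral_shift[symmetric])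
    also have "\<dots> = (LBINT r:{0..s1 - s0}. d1 (\<psi>1 (c + s0 + r)) * u2 (\<psi>1 (c + s0 + r)) (s0 + r) * g1 (c + s0 + r) (s0 + r)
        + u1 (\<psi>1 (c + s0 + r)) (s0 + r) * G1 (c + s0 + r) (s0 + r))"
      unfolding set_lebesgue_integral_def
    proof (intro Bochner_Integration.integral_cong refl)
      fix r
      show "X1 (c + (s0 + r)) (s0 + r) = indicator {0..s1 - s0} r *\<^sub>R
        (d1 (\<psi>1 (c + s0 + r)) * u2 (\<psi>1 (c + s0 + r)) (s0 + r) * g1 (c + s0 + r) (s0 + r)
          + u1 (\<psi>1 (c + s0 + r)) (s0 + r) * G1 (c + s0 + r) (s0 + r))"
      proof (cases "r \<in> {0..s1 - s0}")
        case True
        then have "c + (s0 + r) \<in> {0..s1.L}" "s0 + r \<in> {0..?L}" using pos by auto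
        then show ?thesis using True by (simp add: X1_def add.assoc)
      next
        case False
        have "X1 (c + (s0 + r)) (s0 + r) = 0"
        proof (cases "c + (s0 + r) \<in> {0..s1.L} \<and> s0 + r \<in> {0..?L}")
          case in_rect: True
          then have "\<not> s0 + r \<le> s1" using False by (auto simp: s0_def)
          then have "(\<psi>2 (?L - (s0 + r)), \<psi>1 (c + (s0 + r))) \<notin> triangle"
            using tri1[of "s0 + r" "c + (s0 + r)"] edge[of "s0 + r"] by simp
          from k0[OF this] show ?thesis by (simp add: X1_def g1_def G1_def)
        qed (auto simp: X1_def)
        then show ?thesis using False by simp
      qed
    qed
    also have "\<dots> = u1 (\<psi>1 (c + s1)) s1 * g1 (c + s1) s1 - u1 (\<psi>1 (c + s0)) s0 * g1 (c + s0) s0"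
      using pr by simp
    also have "u1 (\<psi>1 (c + s0)) s0 * g1 (c + s0) s0 = A0 c + B1 (0 - c)"
    proof (cases "0 \<le> c")
      case True
      moreover have "c \<le> s1.L" using a1 \<sigma> by (simp add: s1_def)
      ultimately show ?thesis by (simp add: s0_def A0_def B1_def)
    next
      case False
      moreover have "- c \<le> ?L" using a1 \<sigma> by (simp add: s1_def)
      ultimately show ?thesis by (simp add: s0_def A0_def B1_def)
    qed
    finally show ?thesis unfolding cs1 by (simp add: c_def s1_def)
  qed
  have iA: "integrable lborel A0"
  proof -
    have "set_integrable lborel {0..s1.L} (\<lambda>a. u1 (\<psi>1 a) 0 * g1 a 0)"
      using c1(1)[OF uinit(1)] sqn_bounded[OF bnd(1) L(3)] by (intro set_integrable_mult_sqn) auto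
    then show ?thesis by (simp add: set_integrable_def A0_def[abs_def])
  qed
  have iB0: "set_integrable lborel {0..?L} (\<lambda>t. u1 0 t * g1 0 t)"
    using ufin(5) sqn_bounded[OF bnd(1) L(1)] by (intro set_integrable_mult_sqn) auto
  have iB: "integrable lborel B1"
  proof -
    have "set_integrable lborel {0<..?L} (\<lambda>t. u1 0 t * g1 0 t)"
      by (rule set_integrable_subset[OF iB0]) auto
    then show ?thesis by (simp add: set_integrable_def B1_def[abs_def])
  qed
  have iJ: "integrable lborel J"
    using lborel_pair.integrable_fst[OF integral_lborel_pair_shift(1)[OF iX1]] by (simp add: J_def[abs_def])
  define W where "W c = A0 c + B1 (0 - c) + J c" for c
  have iW: "integrable lborel W"
    unfolding W_def[abs_def] using iA integrable_reflect[OF iB, of 0] iJ by auto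
  have W0: "W c = indicator {- ?L..s1.L} c * W c" for c
  proof (cases "c \<in> {- ?L..s1.L}")
    case False
    have "X1 (c + s) s = 0" for s using False by (auto simp: X1_def indicator_def)
    moreover have "A0 c = 0" "B1 (0 - c) = 0" using False L by (auto simp: A0_def B1_def indicator_def)
    ultimately show ?thesis by (simp add: W_def J_def)
  qed simp
  have sW: "set_integrable lborel {\<gamma> 0..\<gamma> ?L} W"
    unfolding set_integrable_def \<gamma>ends real_scaleR_def W0[symmetric] by (rule iW)
  have "(LBINT x. W x * indicator {\<gamma> 0..\<gamma> ?L} x) = (LBINT \<sigma>. W (\<gamma> \<sigma>) * \<gamma>' \<sigma> * indicator {0..?L} \<sigma>)"
    by (rule integral_substitution(2)[OF sW d\<gamma> c\<gamma> \<gamma>'0 L(1)])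
  moreover have "(LBINT x. W x * indicator {\<gamma> 0..\<gamma> ?L} x) = (LINT c|lborel. W c)"
    unfolding \<gamma>ends by (rule Bochner_Integration.integral_cong[OF refl]) (metis W0 mult.commute)
  moreover have "(LINT c|lborel. W c) = (LINT a|lborel. A0 a) + (LINT t|lborel. B1 t) + (LINT s|lborel. LINT a|lborel. X1 a s)"
    unfolding W_def using iA integrable_reflect[OF iB, of 0] iJ integral_reflect[of B1 0] integral_lborel_pair_shift(2)[OF iX1]
    by (simp add: J_def[symmetric])
  moreover have "(LBINT \<sigma>. W (\<gamma> \<sigma>) * \<gamma>' \<sigma> * indicator {0..?L} \<sigma>) = - (u2 0 ?L - u2 1 0)"
  proof -
    define k where "k r = indicator {0..?L} r * (d2 (\<psi>2 (?L - r)) * u1 (\<psi>2 (?L - r)) r)" for r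
    have "W (\<gamma> \<sigma>) * \<gamma>' \<sigma> * indicator {0..?L} \<sigma> = - k (?L - \<sigma>)" for \<sigma>
    proof (cases "\<sigma> \<in> {0..?L}")
      case True
      have y: "\<psi>2 \<sigma> \<in> {0..1}" using True by (intro s2.\<psi>_in) auto
      have p: "0 < e1 (\<psi>2 \<sigma>)" "0 < e2 (\<psi>2 \<sigma>)" by (rule s1.epos s2.epos)+
      have "W (\<gamma> \<sigma>) * \<gamma>' \<sigma> = u1 (\<psi>2 \<sigma>) (?L - \<sigma>) * (e1 (\<psi>2 \<sigma>) * (- d2 (\<psi>2 \<sigma>) / (e1 (\<psi>2 \<sigma>) + e2 (\<psi>2 \<sigma>)))) * \<gamma>' \<sigma>"
        unfolding W_def along[OF True, symmetric] using kd[OF y] by (simp add: g1_def)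
      also have "\<dots> = - (d2 (\<psi>2 \<sigma>) * u1 (\<psi>2 \<sigma>) (?L - \<sigma>)) * (e1 (\<psi>2 \<sigma>) * \<gamma>' \<sigma> / (e1 (\<psi>2 \<sigma>) + e2 (\<psi>2 \<sigma>)))"
        by simp
      \<comment> \<open>Here the Jacobian cancels the denominator \<open>e1 + e2\<close> of
        \<open>kd\<close>. What remains is minus the source of \<open>u2\<close> on its
        characteristic.\<close>
      also have "e1 (\<psi>2 \<sigma>) * \<gamma>' \<sigma> = e1 (\<psi>2 \<sigma>) + e2 (\<psi>2 \<sigma>)"
        using p by (simp add: \<gamma>'_def field_simps)
      finally show ?thesis using True p by (simp add: k_def)
    qed (auto simp: k_def)
    then have "(LBINT \<sigma>. W (\<gamma> \<sigma>) * \<gamma>' \<sigma> * indicator {0..?L} \<sigma>) = - (LINT \<sigma>|lborel. k (?L - \<sigma>))" by simp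
    also have "(LINT \<sigma>|lborel. k (?L - \<sigma>)) = (LINT r|lborel. k r)" by (rule integral_reflect)
    also have "\<dots> = u2 0 ?L - u2 1 0"
      using straightD(2)[OF hsysD(4)[OF u], of 0 0 ?L] L by (simp add: k_def set_lebesgue_integral_def)
    finally show ?thesis .
  qed
  ultimately have E1: "- (u2 0 ?L - u2 1 0) = (LINT a|lborel. A0 a) + (LINT t|lborel. B1 t) + (LINT s|lborel. LINT a|lborel. X1 a s)"
    by simp
  have B12: "(LINT t|lborel. B1 t) = (LBINT t:{0..?L}. u2 0 t * g2 ?L t)"
    unfolding set_lebesgue_integral_def
  proof (rule integral_cong_AE)
    have eq: "u1 0 t * g1 0 t = u2 0 t * g2 ?L t" if "0 < t" "t \<le> ?L" for t
    proof -
      have "\<psi>2 (?L - t) \<in> {0..1}" using that by (intro s2.\<psi>_in) auto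
      from kq[OF this] hsysD(5)[OF u that] show ?thesis by (simp add: g1_def g2_def)
    qed
    show "AE t in lborel. B1 t = indicator {0..?L} t *\<^sub>R (u2 0 t * g2 ?L t)"
      using AE_lborel_singleton[of 0]
    proof eventually_elim
      case (elim t)
      show ?case
      proof (cases "t \<in> {0<..?L}")
        case True
        then show ?thesis using eq[of t] by (simp add: B1_def)
      next
        case False
        then have "t \<notin> {0..?L}" using elim by auto
        then show ?thesis using False by (simp add: B1_def)
      qed
    qed
  qed (use iB in \<open>auto dest: borel_measurable_integrable\<close>)
  have P1: "(LINT a|lborel. A0 a) = (LBINT x:{0..1}. u1 x 0 * (e1 x * K1 1 x) / e1 x)"
  proof -
    have "set_integrable lborel {0..s1.L} (\<lambda>a. u1 (\<psi>1 a) 0 * g1 a 0)"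
      using iA by (simp add: set_integrable_def A0_def[abs_def])
    from s1.integral_coord(2)[OF this] show ?thesis
      by (simp add: A0_def[abs_def] set_lebesgue_integral_def g1_def)
  qed
  have P2: "(LBINT b:{0..?L}. u2 (\<psi>2 (?L - b)) 0 * g2 b 0) = (LBINT x:{0..1}. u2 x 0 * (e2 x * K2 1 x) / e2 x)"
  proof -
    have "set_integrable lborel {0..?L} (\<lambda>b. u2 (\<psi>2 (?L - b)) 0 * g2 b 0)"
      using c1(2)[OF uinit(2)] sqn_bounded[OF bnd(3) L(1)] by (intro set_integrable_mult_sqn) auto
    from s2.integral_coord_left[OF this] show ?thesis by (simp add: g2_def)
  qed
  show ?thesis
    using E1 E2 B12 P1 P2 X12 unfolding pair_def by simp
qed

end

section \<open>Time translations\<close>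

lemma sqn_const_open:
  assumes ab: "a \<le> b" and f: "\<And>x. a < x \<Longrightarrow> x < b \<Longrightarrow> \<bar>f x\<bar> \<le> c"
  shows "sqn {a..b} f \<le> ennreal (c\<^sup>2 * (b - a))"
proof -
  have "sqn {a..b} f \<le> (\<integral>\<^sup>+x. ennreal (c\<^sup>2) * indicator {a..b} x \<partial>lborel)"
    unfolding sqn_def
  proof (intro nn_integral_mono_AE)
    show "AE x in lborel. ennreal ((f x)\<^sup>2) * indicator {a..b} x \<le> ennreal (c\<^sup>2) * indicator {a..b} x"
      using AE_lborel_singleton[of a] AE_lborel_singleton[of b]
    proof eventually_elim
      case (elim x)
      have "(f x)\<^sup>2 \<le> c\<^sup>2" if "x \<in> {a..b}"
      proof -
        have "\<bar>f x\<bar> \<le> c" using elim that by (intro f) (auto simp: less_le)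
        from power_mono[OF this, of 2] show ?thesis by simp
      qed
      then show ?case by (auto simp: indicator_def intro!: ennreal_leI)
    qed
  qed
  also have "\<dots> = ennreal (c\<^sup>2 * (b - a))"
    using ab by (subst nn_integral_cmult_indicator) (auto simp: ennreal_mult)
  finally show ?thesis .
qed

lemma sqn_split: "a \<le> b \<Longrightarrow> b \<le> c \<Longrightarrow> f \<in> borel_measurable borel \<Longrightarrow> sqn {a..c} f \<le> sqn {a..b} f + sqn {b..c} f"
  unfolding sqn_def by (subst nn_integral_add[symmetric]) (auto intro!: nn_integral_mono simp: indicator_def)

lemma mild_transport_diff:
  assumes 1: "mild_transport D a b w f" and 2: "mild_transport D a b w' f'"
  shows "mild_transport D a b (\<lambda>x y. w x y - w' x y) (\<lambda>x y. f x y - f' x y)"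
  unfolding mild_transport_def
proof (intro allI impI)
  fix X Y S :: "real \<Rightarrow> real" and s :: real
  assume s: "0 \<le> s" and *: "\<forall>r\<in>{0..s}. (X r, Y r) \<in> D \<and>
     (X has_real_derivative a (X r)) (at r within {0..s}) \<and> (Y has_real_derivative b (Y r)) (at r within {0..s})"
  show "set_integrable lborel {0..s} (\<lambda>s. f (X s) (Y s) - f' (X s) (Y s)) \<and>
     w (X s) (Y s) - w' (X s) (Y s) - (w (X 0) (Y 0) - w' (X 0) (Y 0)) = (LBINT s:{0..s}. f (X s) (Y s) - f' (X s) (Y s))"
    using 1[unfolded mild_transport_def, rule_format, OF s *[rule_format]]
      2[unfolded mild_transport_def, rule_format, OF s *[rule_format]]
    by (auto simp: set_integral_diff)
qed

lemma hsys_diff: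
  assumes u: "hsys e1 e2 d1 d2 q T u1 u2" and w: "hsys e1 e2 d1 d2 q T w1 w2"
  shows "hsys e1 e2 d1 d2 q T (\<lambda>x t. u1 x t - w1 x t) (\<lambda>x t. u2 x t - w2 x t)"
proof -
  have [measurable]: "case_prod u1 \<in> borel_measurable (borel \<Otimes>\<^sub>M borel)" "case_prod u2 \<in> borel_measurable (borel \<Otimes>\<^sub>M borel)"
    "case_prod w1 \<in> borel_measurable (borel \<Otimes>\<^sub>M borel)" "case_prod w2 \<in> borel_measurable (borel \<Otimes>\<^sub>M borel)"
    using u w by (auto simp: hsys_def)
  let ?n = "\<lambda>u1 u2 t. sqn {0..1} (\<lambda>x. u1 x t) + sqn {0..1} (\<lambda>x. u2 x t)"
  have [measurable]: "?n u1 u2 \<in> borel_measurable borel" "?n w1 w2 \<in> borel_measurable borel"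
    unfolding sqn_def by measurable
  have d: "sqn {0..1} (\<lambda>x. f x - g x) \<le> 2 * sqn {0..1} f + 2 * sqn {0..1} g"
    if [measurable]: "f \<in> borel_measurable borel" "g \<in> borel_measurable borel" for f g
    using sqn_le2[of f "\<lambda>x. - g x" "{0..1}" "\<lambda>x. f x - g x"] by (simp add: sqn_def)
  have "?n (\<lambda>x t. u1 x t - w1 x t) (\<lambda>x t. u2 x t - w2 x t) t \<le> 2 * ?n u1 u2 t + 2 * ?n w1 w2 t" for t
  proof -
    have "?n (\<lambda>x t. u1 x t - w1 x t) (\<lambda>x t. u2 x t - w2 x t) t
       \<le> (2 * sqn {0..1} (\<lambda>x. u1 x t) + 2 * sqn {0..1} (\<lambda>x. w1 x t)) + (2 * sqn {0..1} (\<lambda>x. u2 x t) + 2 * sqn {0..1} (\<lambda>x. w2 x t))"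
      by (intro add_mono d) measurable
    then show ?thesis by (simp add: algebra_simps)
  qed
  then have "(\<integral>\<^sup>+t\<in>{0..T}. ?n (\<lambda>x t. u1 x t - w1 x t) (\<lambda>x t. u2 x t - w2 x t) t \<partial>lborel)
     \<le> (\<integral>\<^sup>+t. 2 * (?n u1 u2 t * indicator {0..T} t) + 2 * (?n w1 w2 t * indicator {0..T} t) \<partial>lborel)"
    by (intro nn_integral_mono) (auto simp: indicator_def)
  also have "\<dots> = 2 * (\<integral>\<^sup>+t\<in>{0..T}. ?n u1 u2 t \<partial>lborel) + 2 * (\<integral>\<^sup>+t\<in>{0..T}. ?n w1 w2 t \<partial>lborel)"
    by (subst nn_integral_add) (auto simp: nn_integral_cmult)
  also have "\<dots> < \<infinity>" using u w by (auto simp: hsys_def ennreal_mult_less_top)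
  finally have fin: "(\<integral>\<^sup>+t\<in>{0..T}. ?n (\<lambda>x t. u1 x t - w1 x t) (\<lambda>x t. u2 x t - w2 x t) t \<partial>lborel) < \<infinity>" .
  have m1: "mild_transport ({0..1} \<times> {0..T}) e1 (\<lambda>t. 1) (\<lambda>x t. u1 x t - w1 x t) (\<lambda>x t. d1 x * (u2 x t - w2 x t))"
    using mild_transport_diff[of "{0..1} \<times> {0..T}" e1 "\<lambda>t. 1" u1 "\<lambda>x t. d1 x * u2 x t" w1 "\<lambda>x t. d1 x * w2 x t"] u w
    by (simp add: hsys_def right_diff_distrib)
  have m2: "mild_transport ({0..1} \<times> {0..T}) (\<lambda>x. - e2 x) (\<lambda>t. 1) (\<lambda>x t. u2 x t - w2 x t) (\<lambda>x t. d2 x * (u1 x t - w1 x t))"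
    using mild_transport_diff[of "{0..1} \<times> {0..T}" "\<lambda>x. - e2 x" "\<lambda>t. 1" u2 "\<lambda>x t. d2 x * u1 x t" w2 "\<lambda>x t. d2 x * w1 x t"] u w
    by (simp add: hsys_def right_diff_distrib)
  show ?thesis
    unfolding hsys_def using fin m1 m2 u w by (auto simp: hsys_def right_diff_distrib)
qed

context hyp
begin

text \<open>By linearity the difference between a solution and its time translate solves the same
  system with zero input, and \<open>energy\<close> moves the estimate to the initial slice. Applied
  to kernels, this controls translations of a trace that may jump.\<close>

lemma translation_trace:
  assumes Tm: "0 \<le> Tm"
  obtains C where "0 < C"
    "\<And>u1 u2 T \<delta>. 0 \<le> \<delta> \<Longrightarrow> \<delta> \<le> T \<Longrightarrow> T \<le> Tm \<Longrightarrow> sys T u1 u2 \<Longrightarrow> (\<And>t. 0 < t \<Longrightarrow> t \<le> T \<Longrightarrow> u2 1 t = 0) \<Longrightarrow>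
      sqn {0..T - \<delta>} (\<lambda>s. u1 1 (\<delta> + s) - u1 1 s)
      \<le> ennreal C * (sqn {0..1} (\<lambda>x. u1 x \<delta> - u1 x 0) + sqn {0..1} (\<lambda>x. u2 x \<delta> - u2 x 0))"
proof -
  obtain C where C: "0 < C" and e:
    "\<And>u1 u2 T. 0 \<le> T \<Longrightarrow> T \<le> Tm \<Longrightarrow> sys T u1 u2 \<Longrightarrow>
      sqn {0..1} (\<lambda>x. u1 x T) + sqn {0..1} (\<lambda>x. u2 x T) + sqn {0..T} (u2 0) + sqn {0..T} (u1 1)
        + (\<integral>\<^sup>+s\<in>{0..T}. (sqn {0..1} (\<lambda>x. u1 x s) + sqn {0..1} (\<lambda>x. u2 x s)) \<partial>lborel)
      \<le> ennreal C * (sqn {0..1} (\<lambda>x. u1 x 0) + sqn {0..1} (\<lambda>x. u2 x 0) + sqn {0..T} (u2 1))"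
    using energy[OF Tm] by blast
  show thesis
  proof (rule that[OF C])
    fix u1 u2 T \<delta>
    assume d: "0 \<le> \<delta>" "\<delta> \<le> T" "T \<le> Tm" and h: "sys T u1 u2"
      and z: "\<And>t. 0 < t \<Longrightarrow> t \<le> T \<Longrightarrow> u2 1 t = 0"
    note [measurable] = hsysD(1,2)[OF h]
    let ?w1 = "\<lambda>x t. u1 x (\<delta> + t) - u1 x t" and ?w2 = "\<lambda>x t. u2 x (\<delta> + t) - u2 x t"
    have hd: "sys (T - \<delta>) ?w1 ?w2"
      using d by (intro hsys_diff hsys_shift[OF h] hsys_mono[OF h]) auto
    have z0: "sqn {0..T - \<delta>} (?w2 1) = 0"
    proof -
      have "sqn {0..T - \<delta>} (?w2 1) = ennreal (0\<^sup>2) * sqn {0..T - \<delta>} (?w2 1)"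
        using d z by (intro sqn_AE_mult) auto
      then show ?thesis by simp
    qed
    have "sqn {0..T - \<delta>} (?w1 1) \<le> sqn {0..1} (\<lambda>x. ?w1 x (T - \<delta>)) + sqn {0..1} (\<lambda>x. ?w2 x (T - \<delta>)) + sqn {0..T - \<delta>} (?w2 0) + sqn {0..T - \<delta>} (?w1 1)
        + (\<integral>\<^sup>+s\<in>{0..T - \<delta>}. (sqn {0..1} (\<lambda>x. ?w1 x s) + sqn {0..1} (\<lambda>x. ?w2 x s)) \<partial>lborel)"
      by (intro add_increasing2[OF zero_le] add_increasing[OF zero_le]) simp
    also have "\<dots> \<le> ennreal C * (sqn {0..1} (\<lambda>x. ?w1 x 0) + sqn {0..1} (\<lambda>x. ?w2 x 0) + sqn {0..T - \<delta>} (?w2 1))"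
      using d by (intro e hd) auto
    finally show "sqn {0..T - \<delta>} (\<lambda>s. u1 1 (\<delta> + s) - u1 1 s)
      \<le> ennreal C * (sqn {0..1} (\<lambda>x. u1 x \<delta> - u1 x 0) + sqn {0..1} (\<lambda>x. u2 x \<delta> - u2 x 0))"
      unfolding z0 by simp
  qed
qed

text \<open>Up to an error of squared norm at most \<open>C' * \<delta>\<close> from the source, the
  state at time \<open>\<delta>\<close> is the entry value. Beyond the layer of width
  \<open>\<delta>\<close> this is translated initial data, within \<open>\<omega>\<close> of the
  data; inside the layer everything is bounded in square norm by a multiple of
  \<open>\<delta>\<close>. Data that jump at the corners are thus covered.\<close>

lemma initial_estimate:
  assumes S: "0 \<le> S"
  obtains A where "0 \<le> A"
    "\<And>\<delta> \<omega> u1 u2. 0 \<le> \<delta> \<Longrightarrow> \<delta> \<le> 1 \<Longrightarrow> \<delta> \<le> s1.L \<Longrightarrow> \<delta> \<le> s2.L \<Longrightarrow> 0 \<le> \<omega> \<Longrightarrow> sys \<delta> u1 u2 \<Longrightarrow>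
      (\<And>t. 0 < t \<Longrightarrow> t \<le> \<delta> \<Longrightarrow> u2 1 t = 0) \<Longrightarrow>
      (\<And>y. 0 < y \<Longrightarrow> y < 1 \<Longrightarrow> \<bar>u1 y 0\<bar> \<le> S \<and> \<bar>u2 y 0\<bar> \<le> S) \<Longrightarrow>
      (\<And>a. \<delta> < a \<Longrightarrow> a < s1.L \<Longrightarrow> \<bar>u1 (\<psi>1 (a - \<delta>)) 0 - u1 (\<psi>1 a) 0\<bar> \<le> \<omega>) \<Longrightarrow>
      (\<And>b. \<delta> < b \<Longrightarrow> b < s2.L \<Longrightarrow> \<bar>u2 (\<psi>2 (s2.L - (b - \<delta>))) 0 - u2 (\<psi>2 (s2.L - b)) 0\<bar> \<le> \<omega>) \<Longrightarrow>
      sqn {0..1} (\<lambda>x. u1 x \<delta> - u1 x 0) + sqn {0..1} (\<lambda>x. u2 x \<delta> - u2 x 0)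
        \<le> ennreal (A * \<delta> + 2 * M * (s1.L + s2.L) * \<omega>\<^sup>2)"
proof -
  obtain C where C: "0 < C" and e:
    "\<And>u1 u2 T. 0 \<le> T \<Longrightarrow> T \<le> 1 \<Longrightarrow> sys T u1 u2 \<Longrightarrow>
      sqn {0..1} (\<lambda>x. u1 x T) + sqn {0..1} (\<lambda>x. u2 x T) + sqn {0..T} (u2 0) + sqn {0..T} (u1 1)
        + (\<integral>\<^sup>+s\<in>{0..T}. (sqn {0..1} (\<lambda>x. u1 x s) + sqn {0..1} (\<lambda>x. u2 x s)) \<partial>lborel)
      \<le> ennreal C * (sqn {0..1} (\<lambda>x. u1 x 0) + sqn {0..1} (\<lambda>x. u2 x 0) + sqn {0..T} (u2 1))"
    using energy[of 1] by auto
  \<comment> \<open>The factor \<open>D\<^sup>2 / m\<close> stems from coupling and coordinates,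
    \<open>C * (2 * S\<^sup>2)\<close> is the energy up to time 1.\<close>
  define C' where "C' = D\<^sup>2 / m * (C * (2 * S\<^sup>2))"
  have C': "0 \<le> C'" unfolding C'_def using C s1.m(1) by simp
  define A where "A = M * (2 * C' + 2 * (2 * (q\<^sup>2 * (2 * C' + 2 * S\<^sup>2)) + 2 * S\<^sup>2)) + M * (2 * C' + 2 * S\<^sup>2)"
  show thesis
  proof (rule that[of A])
    show "0 \<le> A" unfolding A_def using C' S s1.M_pos by (intro add_nonneg_nonneg mult_nonneg_nonneg) auto
    fix \<delta> \<omega> u1 u2
    assume d: "0 \<le> \<delta>" "\<delta> \<le> 1" "\<delta> \<le> s1.L" "\<delta> \<le> s2.L" and \<omega>: "0 \<le> \<omega>" and h: "sys \<delta> u1 u2"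
      and z: "\<And>t. 0 < t \<Longrightarrow> t \<le> \<delta> \<Longrightarrow> u2 1 t = 0"
      and b: "\<And>y. 0 < y \<Longrightarrow> y < 1 \<Longrightarrow> \<bar>u1 y 0\<bar> \<le> S \<and> \<bar>u2 y 0\<bar> \<le> S"
      and o1: "\<And>a. \<delta> < a \<Longrightarrow> a < s1.L \<Longrightarrow> \<bar>u1 (\<psi>1 (a - \<delta>)) 0 - u1 (\<psi>1 a) 0\<bar> \<le> \<omega>"
      and o2: "\<And>b. \<delta> < b \<Longrightarrow> b < s2.L \<Longrightarrow> \<bar>u2 (\<psi>2 (s2.L - (b - \<delta>))) 0 - u2 (\<psi>2 (s2.L - b)) 0\<bar> \<le> \<omega>"
    note [measurable] = hsysD(1,2)[OF h]
    have z0: "sqn {0..\<delta>} (u2 1) = 0"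
    proof -
      have "sqn {0..\<delta>} (u2 1) = ennreal (0\<^sup>2) * sqn {0..\<delta>} (u2 1)"
        using d z by (intro sqn_AE_mult) auto
      then show ?thesis by simp
    qed
    have n0: "sqn {0..1} (\<lambda>x. u1 x 0) \<le> ennreal (S\<^sup>2)" "sqn {0..1} (\<lambda>x. u2 x 0) \<le> ennreal (S\<^sup>2)"
      using sqn_const_open[of 0 1 "\<lambda>x. u1 x 0" S] sqn_const_open[of 0 1 "\<lambda>x. u2 x 0" S] b by auto
    have I: "(\<integral>\<^sup>+s\<in>{0..\<delta>}. sqn {0..1} (\<lambda>x. u1 x s) \<partial>lborel) \<le> ennreal (C * (2 * S\<^sup>2))"
      "(\<integral>\<^sup>+s\<in>{0..\<delta>}. sqn {0..1} (\<lambda>x. u2 x s) \<partial>lborel) \<le> ennreal (C * (2 * S\<^sup>2))"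
    proof -
      have "(\<integral>\<^sup>+s\<in>{0..\<delta>}. (sqn {0..1} (\<lambda>x. u1 x s) + sqn {0..1} (\<lambda>x. u2 x s)) \<partial>lborel)
        \<le> sqn {0..1} (\<lambda>x. u1 x \<delta>) + sqn {0..1} (\<lambda>x. u2 x \<delta>) + sqn {0..\<delta>} (u2 0) + sqn {0..\<delta>} (u1 1)
        + (\<integral>\<^sup>+s\<in>{0..\<delta>}. (sqn {0..1} (\<lambda>x. u1 x s) + sqn {0..1} (\<lambda>x. u2 x s)) \<partial>lborel)"
        by (intro add_increasing[OF zero_le]) simp
      also have "\<dots> \<le> ennreal C * (sqn {0..1} (\<lambda>x. u1 x 0) + sqn {0..1} (\<lambda>x. u2 x 0) + sqn {0..\<delta>} (u2 1))"
        by (rule e[OF d(1,2) h])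
      also have "\<dots> \<le> ennreal C * (ennreal (S\<^sup>2) + ennreal (S\<^sup>2) + 0)"
        unfolding z0 by (intro mult_left_mono add_mono n0) auto
      also have "\<dots> = ennreal (C * (2 * S\<^sup>2))"
        using C by (simp add: ennreal_mult[symmetric] ennreal_plus[symmetric] del: ennreal_plus)
      finally have *: "(\<integral>\<^sup>+s\<in>{0..\<delta>}. (sqn {0..1} (\<lambda>x. u1 x s) + sqn {0..1} (\<lambda>x. u2 x s)) \<partial>lborel) \<le> ennreal (C * (2 * S\<^sup>2))" .
      show "(\<integral>\<^sup>+s\<in>{0..\<delta>}. sqn {0..1} (\<lambda>x. u1 x s) \<partial>lborel) \<le> ennreal (C * (2 * S\<^sup>2))"
        "(\<integral>\<^sup>+s\<in>{0..\<delta>}. sqn {0..1} (\<lambda>x. u2 x s) \<partial>lborel) \<le> ennreal (C * (2 * S\<^sup>2))"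
        by (rule order_trans[OF _ *], intro nn_integral_mono, auto simp: indicator_def)+
    qed
    have src: "ennreal \<delta> * X \<le> ennreal (C' * \<delta>)" if "X \<le> ennreal (D\<^sup>2 / m) * Z" "Z \<le> ennreal (C * (2 * S\<^sup>2))" for X Z
    proof -
      have "ennreal \<delta> * X \<le> ennreal \<delta> * (ennreal (D\<^sup>2 / m) * ennreal (C * (2 * S\<^sup>2)))"
        by (rule mult_left_mono[OF order_trans[OF that(1) mult_left_mono[OF that(2)]]]) auto
      also have "\<dots> = ennreal (C' * \<delta>)"
        unfolding C'_def using d C s1.m(1) by (simp add: ennreal_mult[symmetric] mult_ac)
      finally show ?thesis .
    qed
    define f1 where "f1 a t = u1 (\<psi>1 a) t" for a t
    define f2 where "f2 b t = u2 (\<psi>2 (s2.L - b)) t" for b t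
    have [measurable]: "case_prod f1 \<in> borel_measurable (borel \<Otimes>\<^sub>M borel)" "case_prod f2 \<in> borel_measurable (borel \<Otimes>\<^sub>M borel)"
      unfolding f1_def f2_def by measurable
    have st1: "straight s1.L \<delta> f1 (\<lambda>a t. d1 (\<psi>1 a) * u2 (\<psi>1 a) t)"
      and st2: "straight s2.L \<delta> f2 (\<lambda>b t. d2 (\<psi>2 (s2.L - b)) * u1 (\<psi>2 (s2.L - b)) t)"
      using hsysD(3,4)[OF h] by (simp_all add: f1_def[abs_def] f2_def[abs_def])
    have s1: "sqn {0..s1.L} (\<lambda>a. f1 a \<delta> - ent f1 (a - \<delta>)) \<le> ennreal (C' * \<delta>)"
      by (rule order_trans[OF straight_slice[OF st1 _ d(1) order_refl] src[OF source_sqn(1) I(2)]]) measurable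
    have s2: "sqn {0..s2.L} (\<lambda>a. f2 a \<delta> - ent f2 (a - \<delta>)) \<le> ennreal (C' * \<delta>)"
      by (rule order_trans[OF straight_slice[OF st2 _ d(1) order_refl] src[OF source_sqn(2) I(1)]]) measurable
    have s3: "sqn {0..\<delta>} (\<lambda>s. f2 s2.L s - ent f2 (s2.L - s)) \<le> ennreal (C' * \<delta>)"
      by (rule order_trans[OF straight_trace[OF st2 _ d(1) less_imp_le[OF s2.L_pos]] src[OF source_sqn(2) I(1)]]) measurable
    have in1: "0 < \<psi>1 a \<and> \<psi>1 a < 1" if "0 < a" "a < s1.L" for a
      using that s1.\<psi>_le_iff[of a 0] s1.\<psi>_le_iff[of s1.L a] by (auto simp: not_le[symmetric] simp del: s1.\<psi>_le_iff)
    have in2: "0 < \<psi>2 a \<and> \<psi>2 a < 1" if "0 < a" "a < s2.L" for a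
      using that s2.\<psi>_le_iff[of a 0] s2.\<psi>_le_iff[of s2.L a] by (auto simp: not_le[symmetric] simp del: s2.\<psi>_le_iff)
    have f1b: "\<bar>f1 a 0\<bar> \<le> S" if "0 < a" "a < s1.L" for a
      unfolding f1_def using in1[OF that] b by blast
    have f2b: "\<bar>f2 a 0\<bar> \<le> S" if "0 < a" "a < s2.L" for a
      unfolding f2_def using in2[of "s2.L - a"] that b by auto
    have plus: "ennreal x + ennreal y = ennreal (x + y)" if "0 \<le> x" "0 \<le> y" for x y
      using that by simp
    have two: "2 * ennreal x = ennreal (2 * x)" if "0 \<le> x" for x
      using that by (simp add: ennreal_mult)
    \<comment> \<open>As \<open>\<delta> \<le> s2.L\<close>, up to time \<open>\<delta>\<close> only
      characteristics starting from initial values reach \<open>x = 0\<close>. This trace, times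
      \<open>q\<close>, fills the layer of \<open>u1\<close>.\<close>
    have tr: "sqn {0..\<delta>} (u2 0) \<le> ennreal ((2 * C' + 2 * S\<^sup>2) * \<delta>)"
    proof -
      have "sqn {0..\<delta>} (u2 0) \<le> 2 * sqn {0..\<delta>} (\<lambda>s. f2 s2.L s - ent f2 (s2.L - s)) + 2 * sqn {0..\<delta>} (\<lambda>s. ent f2 (s2.L - s))"
        by (rule sqn_le2) (auto simp: f2_def)
      also have "\<dots> \<le> 2 * ennreal (C' * \<delta>) + 2 * ennreal (S\<^sup>2 * (\<delta> - 0))"
        using d f2b by (intro add_mono mult_left_mono s3 sqn_const_open) (auto simp: ent_def)
      also have "\<dots> = ennreal ((2 * C' + 2 * S\<^sup>2) * \<delta>)"
        using d C' by (simp add: two plus algebra_simps del: ennreal_plus)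
      finally show ?thesis .
    qed
    have e2: "sqn {0..s2.L} (\<lambda>b. ent f2 (b - \<delta>) - f2 b 0) \<le> ennreal (S\<^sup>2 * \<delta> + s2.L * \<omega>\<^sup>2)"
    proof -
      have "sqn {0..s2.L} (\<lambda>b. ent f2 (b - \<delta>) - f2 b 0)
          \<le> sqn {0..\<delta>} (\<lambda>b. ent f2 (b - \<delta>) - f2 b 0) + sqn {\<delta>..s2.L} (\<lambda>b. ent f2 (b - \<delta>) - f2 b 0)"
        using d by (intro sqn_split) auto
      also have "\<dots> \<le> ennreal (S\<^sup>2 * (\<delta> - 0)) + ennreal (\<omega>\<^sup>2 * (s2.L - \<delta>))"
      proof (intro add_mono sqn_const_open)
        fix x assume x: "0 < x" "x < \<delta>"
        \<comment> \<open>In the layer the entry value is the input, which vanishes.\<close>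
        then have "ent f2 (x - \<delta>) = 0" using z[of "\<delta> - x"] by (simp add: ent_def f2_def)
        then show "\<bar>ent f2 (x - \<delta>) - f2 x 0\<bar> \<le> S" using f2b[of x] x d by simp
      next
        fix x assume x: "\<delta> < x" "x < s2.L"
        then show "\<bar>ent f2 (x - \<delta>) - f2 x 0\<bar> \<le> \<omega>" using o2[OF x] by (simp add: ent_def f2_def)
      qed (use d in auto)
      also have "\<dots> \<le> ennreal (S\<^sup>2 * \<delta> + s2.L * \<omega>\<^sup>2)"
      proof -
        have "\<omega>\<^sup>2 * (s2.L - \<delta>) \<le> \<omega>\<^sup>2 * s2.L" using d by (intro mult_left_mono) auto
        then show ?thesis using d by (simp add: plus mult.commute ennreal_leI del: ennreal_plus)
      qed
      finally show ?thesis .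
    qed
    have e1: "sqn {0..s1.L} (\<lambda>a. ent f1 (a - \<delta>) - f1 a 0)
        \<le> ennreal ((2 * (q\<^sup>2 * (2 * C' + 2 * S\<^sup>2)) + 2 * S\<^sup>2) * \<delta> + s1.L * \<omega>\<^sup>2)"
    proof -
      have q0: "0 \<le> q\<^sup>2 * (2 * C' + 2 * S\<^sup>2)" using C' by simp
      have e10: "sqn {0..\<delta>} (\<lambda>a. ent f1 (a - \<delta>)) \<le> ennreal (q\<^sup>2 * ((2 * C' + 2 * S\<^sup>2) * \<delta>))"
      proof -
        have "sqn {0..\<delta>} (\<lambda>a. ent f1 (a - \<delta>)) = sqn {0..\<delta>} (\<lambda>a. ent f1 ((\<delta> - a) - \<delta>))"
          using sqn_reflect[of "\<lambda>a. ent f1 (a - \<delta>)" \<delta>] by simp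
        also have "\<dots> = ennreal (q\<^sup>2) * sqn {0..\<delta>} (u2 0)"
          using hsysD(5)[OF h] by (intro sqn_AE_mult) (auto simp: ent_def f1_def)
        also have "\<dots> \<le> ennreal (q\<^sup>2) * ennreal ((2 * C' + 2 * S\<^sup>2) * \<delta>)"
          by (intro mult_left_mono tr) auto
        also have "\<dots> = ennreal (q\<^sup>2 * ((2 * C' + 2 * S\<^sup>2) * \<delta>))"
          using C' d by (intro ennreal_mult[symmetric]) auto
        finally show ?thesis .
      qed
      have "sqn {0..s1.L} (\<lambda>a. ent f1 (a - \<delta>) - f1 a 0)
          \<le> sqn {0..\<delta>} (\<lambda>a. ent f1 (a - \<delta>) - f1 a 0) + sqn {\<delta>..s1.L} (\<lambda>a. ent f1 (a - \<delta>) - f1 a 0)"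
        using d by (intro sqn_split) auto
      also have "\<dots> \<le> (2 * ennreal (q\<^sup>2 * ((2 * C' + 2 * S\<^sup>2) * \<delta>)) + 2 * ennreal (S\<^sup>2 * (\<delta> - 0))) + ennreal (\<omega>\<^sup>2 * (s1.L - \<delta>))"
      proof (intro add_mono)
        have "sqn {0..\<delta>} (\<lambda>a. ent f1 (a - \<delta>) - f1 a 0) \<le> 2 * sqn {0..\<delta>} (\<lambda>a. ent f1 (a - \<delta>)) + 2 * sqn {0..\<delta>} (\<lambda>a. - f1 a 0)"
          by (rule sqn_le2) auto
        also have "\<dots> \<le> 2 * ennreal (q\<^sup>2 * ((2 * C' + 2 * S\<^sup>2) * \<delta>)) + 2 * ennreal (S\<^sup>2 * (\<delta> - 0))"
          using d f1b by (intro add_mono mult_left_mono e10 sqn_const_open) auto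
        finally show "sqn {0..\<delta>} (\<lambda>a. ent f1 (a - \<delta>) - f1 a 0) \<le> \<dots>" .
        show "sqn {\<delta>..s1.L} (\<lambda>a. ent f1 (a - \<delta>) - f1 a 0) \<le> ennreal (\<omega>\<^sup>2 * (s1.L - \<delta>))"
        proof (rule sqn_const_open)
          fix x assume x: "\<delta> < x" "x < s1.L"
          then show "\<bar>ent f1 (x - \<delta>) - f1 x 0\<bar> \<le> \<omega>" using o1[OF x] by (simp add: ent_def f1_def)
        qed (use d in auto)
      qed
      also have "\<dots> \<le> ennreal ((2 * (q\<^sup>2 * (2 * C' + 2 * S\<^sup>2)) + 2 * S\<^sup>2) * \<delta> + s1.L * \<omega>\<^sup>2)"
      proof -
        have "\<omega>\<^sup>2 * (s1.L - \<delta>) \<le> \<omega>\<^sup>2 * s1.L" using d by (intro mult_left_mono) auto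
        moreover have "2 * ennreal (q\<^sup>2 * ((2 * C' + 2 * S\<^sup>2) * \<delta>)) + 2 * ennreal (S\<^sup>2 * (\<delta> - 0)) + ennreal (\<omega>\<^sup>2 * (s1.L - \<delta>))
            = ennreal (2 * (q\<^sup>2 * ((2 * C' + 2 * S\<^sup>2) * \<delta>)) + 2 * (S\<^sup>2 * (\<delta> - 0)) + \<omega>\<^sup>2 * (s1.L - \<delta>))"
          using d C' by (simp only: two plus mult_nonneg_nonneg add_nonneg_nonneg zero_le_power2 zero_le_numeral diff_ge_0_iff_ge)
        ultimately show ?thesis by (simp only:) (intro ennreal_leI, simp add: algebra_simps)
      qed
      finally show ?thesis .
    qed
    have u1d: "sqn {0..1} (\<lambda>x. u1 x \<delta> - u1 x 0)
       \<le> ennreal (M * (2 * (C' * \<delta>) + 2 * ((2 * (q\<^sup>2 * (2 * C' + 2 * S\<^sup>2)) + 2 * S\<^sup>2) * \<delta> + s1.L * \<omega>\<^sup>2)))"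
    proof -
      have nn: "0 \<le> (2 * (q\<^sup>2 * (2 * C' + 2 * S\<^sup>2)) + 2 * S\<^sup>2) * \<delta> + s1.L * \<omega>\<^sup>2" "0 \<le> C' * \<delta>"
        using C' d s1.L_pos by (auto intro!: add_nonneg_nonneg mult_nonneg_nonneg)
      have le1: "sqn {0..1} (\<lambda>x. u1 x \<delta> - u1 x 0) \<le> ennreal M * sqn {0..s1.L} (\<lambda>a. u1 (\<psi>1 a) \<delta> - u1 (\<psi>1 a) 0)"
        by (rule s1.sqn_coord_le) measurable
      have "sqn {0..s1.L} (\<lambda>a. u1 (\<psi>1 a) \<delta> - u1 (\<psi>1 a) 0)
          \<le> 2 * sqn {0..s1.L} (\<lambda>a. f1 a \<delta> - ent f1 (a - \<delta>)) + 2 * sqn {0..s1.L} (\<lambda>a. ent f1 (a - \<delta>) - f1 a 0)"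
        by (rule sqn_le2) (auto simp: f1_def)
      also have "\<dots> \<le> 2 * ennreal (C' * \<delta>) + 2 * ennreal ((2 * (q\<^sup>2 * (2 * C' + 2 * S\<^sup>2)) + 2 * S\<^sup>2) * \<delta> + s1.L * \<omega>\<^sup>2)"
        by (intro add_mono mult_left_mono s1 e1) auto
      also have "\<dots> = ennreal (2 * (C' * \<delta>) + 2 * ((2 * (q\<^sup>2 * (2 * C' + 2 * S\<^sup>2)) + 2 * S\<^sup>2) * \<delta> + s1.L * \<omega>\<^sup>2))"
        using nn by (simp only: two plus mult_nonneg_nonneg zero_le_numeral)
      finally show ?thesis
        by (simp only: ennreal_mult'[OF less_imp_le[OF s1.M_pos]]) (rule order_trans[OF le1 mult_left_mono[OF _ zero_le]])
    qed
    have u2d: "sqn {0..1} (\<lambda>x. u2 x \<delta> - u2 x 0) \<le> ennreal (M * (2 * (C' * \<delta>) + 2 * (S\<^sup>2 * \<delta> + s2.L * \<omega>\<^sup>2)))"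
    proof -
      have nn: "0 \<le> S\<^sup>2 * \<delta> + s2.L * \<omega>\<^sup>2" "0 \<le> C' * \<delta>"
        using C' d s2.L_pos by (auto intro!: add_nonneg_nonneg mult_nonneg_nonneg)
      have le1: "sqn {0..1} (\<lambda>x. u2 x \<delta> - u2 x 0) \<le> ennreal M * sqn {0..s2.L} (\<lambda>a. u2 (\<psi>2 (s2.L - a)) \<delta> - u2 (\<psi>2 (s2.L - a)) 0)"
        by (rule s2.sqn_coord_le') measurable
      have "sqn {0..s2.L} (\<lambda>a. u2 (\<psi>2 (s2.L - a)) \<delta> - u2 (\<psi>2 (s2.L - a)) 0)
          \<le> 2 * sqn {0..s2.L} (\<lambda>a. f2 a \<delta> - ent f2 (a - \<delta>)) + 2 * sqn {0..s2.L} (\<lambda>a. ent f2 (a - \<delta>) - f2 a 0)"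
        by (rule sqn_le2) (auto simp: f2_def)
      also have "\<dots> \<le> 2 * ennreal (C' * \<delta>) + 2 * ennreal (S\<^sup>2 * \<delta> + s2.L * \<omega>\<^sup>2)"
        by (intro add_mono mult_left_mono s2 e2) auto
      also have "\<dots> = ennreal (2 * (C' * \<delta>) + 2 * (S\<^sup>2 * \<delta> + s2.L * \<omega>\<^sup>2))"
        using nn by (simp only: two plus mult_nonneg_nonneg zero_le_numeral)
      finally show ?thesis
        by (simp only: ennreal_mult'[OF less_imp_le[OF s1.M_pos]]) (rule order_trans[OF le1 mult_left_mono[OF _ zero_le]])
    qed
    have "sqn {0..1} (\<lambda>x. u1 x \<delta> - u1 x 0) + sqn {0..1} (\<lambda>x. u2 x \<delta> - u2 x 0)
       \<le> ennreal (M * (2 * (C' * \<delta>) + 2 * ((2 * (q\<^sup>2 * (2 * C' + 2 * S\<^sup>2)) + 2 * S\<^sup>2) * \<delta> + s1.L * \<omega>\<^sup>2)))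
        + ennreal (M * (2 * (C' * \<delta>) + 2 * (S\<^sup>2 * \<delta> + s2.L * \<omega>\<^sup>2)))"
      by (intro add_mono u1d u2d)
    also have "\<dots> = ennreal (A * \<delta> + 2 * M * (s1.L + s2.L) * \<omega>\<^sup>2)"
    proof (subst plus)
      show "0 \<le> M * (2 * (C' * \<delta>) + 2 * ((2 * (q\<^sup>2 * (2 * C' + 2 * S\<^sup>2)) + 2 * S\<^sup>2) * \<delta> + s1.L * \<omega>\<^sup>2))"
        "0 \<le> M * (2 * (C' * \<delta>) + 2 * (S\<^sup>2 * \<delta> + s2.L * \<omega>\<^sup>2))"
        using C' d s1.L_pos s2.L_pos s1.M_pos by (auto intro!: add_nonneg_nonneg mult_nonneg_nonneg)
    qed (simp add: A_def algebra_simps)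
    finally show "sqn {0..1} (\<lambda>x. u1 x \<delta> - u1 x 0) + sqn {0..1} (\<lambda>x. u2 x \<delta> - u2 x 0)
        \<le> ennreal (A * \<delta> + 2 * M * (s1.L + s2.L) * \<omega>\<^sup>2)" .
  qed
qed

end

section \<open>Energy in the direction of x\<close>

lemma sqn_shift_subset:
  assumes [measurable]: "w \<in> borel_measurable borel" and sub: "\<And>t. t \<in> {a..b} \<Longrightarrow> c + t \<in> {a'..b'}"
  shows "sqn {a..b} (\<lambda>t. w (c + t)) \<le> sqn {a'..b'} w"
proof -
  have "sqn {a..b} (\<lambda>t. w (c + t)) \<le> (\<integral>\<^sup>+t. ennreal ((w (c + t))\<^sup>2) * indicator {a'..b'} (c + t) \<partial>lborel)"
    unfolding sqn_def using sub by (intro nn_integral_mono) (auto simp: indicator_def)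
  also have "\<dots> = (\<integral>\<^sup>+t. ennreal ((w t)\<^sup>2) * indicator {a'..b'} t \<partial>lborel)"
    by (rule nn_integral_shift) measurable
  finally show ?thesis unfolding sqn_def .
qed

lemma (in speed) nn_integral_coord_le:
  fixes k :: "real \<Rightarrow> ennreal"
  assumes [measurable]: "k \<in> borel_measurable borel" and x: "x \<in> {0..1}"
  shows "(\<integral>\<^sup>+a\<in>{0..\<phi> x}. k a \<partial>lborel) \<le> ennreal (1 / m) * (\<integral>\<^sup>+y\<in>{0..x}. k (\<phi> y) \<partial>lborel)"
proof -
  have i: "indicator {0..\<phi> x} a \<le> (indicator {0..L} a * indicator {0..x} (\<psi> a) :: ennreal)" for a
    using x \<phi>_in[of x] \<psi>_le_iff[of 0 a] \<psi>_le_iff[of a "\<phi> x"] by (auto simp: indicator_def simp del: \<psi>_le_iff)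
  have "(\<integral>\<^sup>+a\<in>{0..\<phi> x}. k a \<partial>lborel) \<le> (\<integral>\<^sup>+a. ennreal (1 / m) * (k (\<phi> (\<psi> a)) * indicator {0..x} (\<psi> a) * ennreal (e (\<psi> a)) * indicator {0..L} a) \<partial>lborel)"
  proof (rule nn_integral_mono)
    fix a
    have "1 \<le> 1 / m * e (\<psi> a)" using m(1) m(2)[of "\<psi> a"] by (simp add: field_simps)
    then have "1 \<le> ennreal (1 / m) * ennreal (e (\<psi> a))"
      using m(1) by (simp add: ennreal_mult'[symmetric])
    then have "1 * (k a * (indicator {0..L} a * indicator {0..x} (\<psi> a)))
        \<le> (ennreal (1 / m) * ennreal (e (\<psi> a))) * (k a * (indicator {0..L} a * indicator {0..x} (\<psi> a)))"
      by (rule mult_right_mono) simp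
    moreover have "k a * indicator {0..\<phi> x} a \<le> k a * (indicator {0..L} a * indicator {0..x} (\<psi> a))"
      by (intro mult_left_mono i) simp
    ultimately show "k a * indicator {0..\<phi> x} a
        \<le> ennreal (1 / m) * (k (\<phi> (\<psi> a)) * indicator {0..x} (\<psi> a) * ennreal (e (\<psi> a)) * indicator {0..L} a)"
      by (simp add: mult_ac)
  qed
  also have "\<dots> = ennreal (1 / m) * (\<integral>\<^sup>+a\<in>{0..L}. k (\<phi> (\<psi> a)) * indicator {0..x} (\<psi> a) * ennreal (e (\<psi> a)) \<partial>lborel)"
    by (rule nn_integral_cmult) measurable
  also have "(\<integral>\<^sup>+a\<in>{0..L}. k (\<phi> (\<psi> a)) * indicator {0..x} (\<psi> a) * ennreal (e (\<psi> a)) \<partial>lborel)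
      = (\<integral>\<^sup>+y\<in>{0..1}. k (\<phi> y) * indicator {0..x} y \<partial>lborel)"
    by (rule nn_integral_coord[symmetric]) measurable
  also have "\<dots> = (\<integral>\<^sup>+y\<in>{0..x}. k (\<phi> y) \<partial>lborel)"
    using x by (intro nn_integral_cong) (auto simp: indicator_def)
  finally show ?thesis .
qed

context hyp
begin

text \<open>Here \<open>x\<close> plays the role of time: the state is controlled by the trace \<open>u2 0\<close> alone.\<close>

lemma output_estimate:
  obtains C where "0 < C"
    "\<And>u1 u2 T p r. sys T u1 u2 \<Longrightarrow> 0 < p \<Longrightarrow> r \<le> T \<Longrightarrow>
      (\<integral>\<^sup>+t\<in>{p + s1.L..r - s2.L}. (sqn {0..1} (\<lambda>x. u1 x t) + sqn {0..1} (\<lambda>x. u2 x t)) \<partial>lborel)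
      \<le> ennreal C * sqn {p..r} (u2 0)"
proof -
  define Q where "Q = 2 * q\<^sup>2 + 2"
  define K where "K = 2 * (max s1.L s2.L * (D\<^sup>2 / m)) + 1"
  have K: "0 < K" unfolding K_def using s1.L_pos s1.m(1) by (simp add: add_nonneg_pos max_def)
  have Q: "0 < Q" unfolding Q_def by (simp add: add_nonneg_pos)
  show thesis
  proof (rule that[of "2 * exp (2 * K) * Q"])
    show "0 < 2 * exp (2 * K) * Q" using Q by simp
    fix u1 u2 :: "real \<Rightarrow> real \<Rightarrow> real" and T p r :: real
    assume h: "sys T u1 u2" and p: "0 < p" and r: "r \<le> T"
    note [measurable] = hsysD(1,2)[OF h]
    \<comment> \<open>The window narrows with \<open>x\<close> so that both characteristics through
      \<open>(x, t)\<close>, followed to \<open>x = 0\<close>, arrive at times in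
      \<open>{p..r}\<close>. At \<open>x = 1\<close> it is the window of the conclusion.\<close>
    define N where "N w x = sqn {p + \<phi>1 x..r - \<phi>2 x} (w x)" for w :: "real \<Rightarrow> real \<Rightarrow> real" and x
    have Nm [measurable]: "N w \<in> borel_measurable borel"
      if [measurable]: "case_prod w \<in> borel_measurable (borel \<Otimes>\<^sub>M borel)" for w
      unfolding N_def sqn_def indicator_def atLeastAtMost_iff by measurable
    define n where "n x = N u1 x + N u2 x" for x
    have [measurable]: "n \<in> borel_measurable borel" unfolding n_def by measurable
    \<comment> \<open>The source on a characteristic is an integral over \<open>y \<le> x\<close> at
      the times \<open>\<tau> y + t\<close>, which lie in the window belonging to \<open>y\<close>.
      After Tonelli only the norms \<open>N w y\<close> are left. Here \<open>\<tau>\<close> is a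
      time shift and not the delay.\<close>
    have source: "sqn {p + \<phi>1 x..r - \<phi>2 x} g \<le> ennreal (max s1.L s2.L * (D\<^sup>2 / m)) * (\<integral>\<^sup>+y\<in>{0..x}. N w y \<partial>lborel)"
      if x: "x \<in> {0..1}" and [measurable]: "case_prod w \<in> borel_measurable (borel \<Otimes>\<^sub>M borel)" "\<tau> \<in> borel_measurable borel"
        and g: "\<And>t. t \<in> {p + \<phi>1 x..r - \<phi>2 x} \<Longrightarrow>
          ennreal ((g t)\<^sup>2) \<le> ennreal (max s1.L s2.L) * (ennreal (1 / m) * (\<integral>\<^sup>+y\<in>{0..x}. ennreal ((d y * w y (\<tau> y + t))\<^sup>2) \<partial>lborel))"
        and d: "\<And>y. \<bar>d y\<bar> \<le> D" and [measurable]: "d \<in> borel_measurable borel"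
        and \<tau>: "\<And>y t. y \<in> {0..x} \<Longrightarrow> t \<in> {p + \<phi>1 x..r - \<phi>2 x} \<Longrightarrow> \<tau> y + t \<in> {p + \<phi>1 y..r - \<phi>2 y}"
      for x g w \<tau> d
    proof -
      let ?W = "{p + \<phi>1 x..r - \<phi>2 x}"
      let ?c = "ennreal (max s1.L s2.L * (D\<^sup>2 / m))"
      let ?k = "\<lambda>t y. ennreal ((w y (\<tau> y + t))\<^sup>2) * indicator {0..x} y * indicator ?W t"
      have "sqn ?W g \<le> (\<integral>\<^sup>+t. ?c * (\<integral>\<^sup>+y. ?k t y \<partial>lborel) \<partial>lborel)"
        unfolding sqn_def
      proof (intro nn_integral_mono)
        fix t
        show "ennreal ((g t)\<^sup>2) * indicator ?W t \<le> ?c * (\<integral>\<^sup>+y. ?k t y \<partial>lborel)"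
        proof (cases "t \<in> ?W")
          case True
          have "(\<integral>\<^sup>+y\<in>{0..x}. ennreal ((d y * w y (\<tau> y + t))\<^sup>2) \<partial>lborel) \<le> (\<integral>\<^sup>+y. ennreal (D\<^sup>2) * ?k t y \<partial>lborel)"
          proof (intro nn_integral_mono)
            fix y
            have "(d y * w y (\<tau> y + t))\<^sup>2 \<le> D\<^sup>2 * (w y (\<tau> y + t))\<^sup>2"
              unfolding power_mult_distrib using power_mono[OF d[of y], of 2] by (intro mult_right_mono) auto
            then have "ennreal ((d y * w y (\<tau> y + t))\<^sup>2) \<le> ennreal (D\<^sup>2) * ennreal ((w y (\<tau> y + t))\<^sup>2)"
              by (simp add: ennreal_mult[symmetric] ennreal_leI)
            then show "ennreal ((d y * w y (\<tau> y + t))\<^sup>2) * indicator {0..x} y \<le> ennreal (D\<^sup>2) * ?k t y"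
              using True by (auto simp: indicator_def)
          qed
          also have "\<dots> = ennreal (D\<^sup>2) * (\<integral>\<^sup>+y. ?k t y \<partial>lborel)" by (rule nn_integral_cmult) measurable
          finally have "ennreal (max s1.L s2.L) * (ennreal (1 / m) * (\<integral>\<^sup>+y\<in>{0..x}. ennreal ((d y * w y (\<tau> y + t))\<^sup>2) \<partial>lborel))
            \<le> ennreal (max s1.L s2.L) * (ennreal (1 / m) * (ennreal (D\<^sup>2) * (\<integral>\<^sup>+y. ?k t y \<partial>lborel)))"
            by (intro mult_left_mono) auto
          also have "\<dots> = ?c * (\<integral>\<^sup>+y. ?k t y \<partial>lborel)"
            using s1.L_pos s1.m(1) by (simp add: ennreal_mult[symmetric] mult.assoc[symmetric] max_def)
          finally show ?thesis using g[OF True] True by simp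
        qed simp
      qed
      also have "\<dots> = ?c * (\<integral>\<^sup>+t. \<integral>\<^sup>+y. ?k t y \<partial>lborel \<partial>lborel)" by (rule nn_integral_cmult) measurable
      also have "(\<integral>\<^sup>+t. \<integral>\<^sup>+y. ?k t y \<partial>lborel \<partial>lborel) = (\<integral>\<^sup>+y. \<integral>\<^sup>+t. ?k t y \<partial>lborel \<partial>lborel)"
        by (rule lborel_pair.Fubini') measurable
      also have "\<dots> \<le> (\<integral>\<^sup>+y\<in>{0..x}. N w y \<partial>lborel)"
      proof (intro nn_integral_mono)
        fix y
        show "(\<integral>\<^sup>+t. ?k t y \<partial>lborel) \<le> N w y * indicator {0..x} y"
        proof (cases "y \<in> {0..x}")
          case True
          then have "(\<integral>\<^sup>+t. ?k t y \<partial>lborel) = sqn ?W (\<lambda>t. w y (\<tau> y + t))" unfolding sqn_def by simp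
          also have "\<dots> \<le> N w y" unfolding N_def by (rule sqn_shift_subset[OF _ \<tau>[OF True]]) measurable
          finally show ?thesis using True by simp
        qed simp
      qed
      finally show ?thesis by (simp add: mult_left_mono)
    qed
    have le: "n x \<le> ennreal Q * sqn {p..r} (u2 0) + ennreal K * (\<integral>\<^sup>+y\<in>{0..x}. n y \<partial>lborel)" if x: "x \<in> {0..1}" for x
    proof -
      let ?W = "{p + \<phi>1 x..r - \<phi>2 x}"
      have ax: "0 \<le> \<phi>1 x" "\<phi>1 x \<le> s1.L" "0 \<le> \<phi>2 x" "\<phi>2 x \<le> s2.L"
        using s1.\<phi>_in[of x] s2.\<phi>_in[of x] x by auto
      have mono: "\<phi>1 y \<le> \<phi>1 x" "\<phi>2 y \<le> \<phi>2 x" if "y \<in> {0..x}" for y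
        using that by auto
      have c1: "sqn ?W (\<lambda>t. u1 x t - u1 0 (- \<phi>1 x + t)) \<le> ennreal (max s1.L s2.L * (D\<^sup>2 / m)) * (\<integral>\<^sup>+y\<in>{0..x}. N u2 y \<partial>lborel)"
      proof (rule source[OF x, where d=d1 and \<tau>="\<lambda>y. - \<phi>1 x + \<phi>1 y"])
        fix t assume t: "t \<in> ?W"
        have "set_integrable lborel {0..\<phi>1 x} (\<lambda>r. d1 (\<psi>1 (0 + r)) * u2 (\<psi>1 (0 + r)) (t - \<phi>1 x + r))"
          "u1 (\<psi>1 (0 + \<phi>1 x)) (t - \<phi>1 x + \<phi>1 x) - u1 (\<psi>1 0) (t - \<phi>1 x) = (LBINT r:{0..\<phi>1 x}. d1 (\<psi>1 (0 + r)) * u2 (\<psi>1 (0 + r)) (t - \<phi>1 x + r))"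
          using t ax p r by (intro straightD[OF hsysD(3)[OF h]]; simp)+
        from set_integral_square_le[OF this(1) ax(1)] this(2)
        have "ennreal ((u1 x t - u1 0 (- \<phi>1 x + t))\<^sup>2) \<le> ennreal (\<phi>1 x) * sqn {0..\<phi>1 x} (\<lambda>r. d1 (\<psi>1 r) * u2 (\<psi>1 r) (t - \<phi>1 x + r))"
          by simp
        also have "\<dots> \<le> ennreal (max s1.L s2.L) * (ennreal (1 / m) * (\<integral>\<^sup>+y\<in>{0..x}. ennreal ((d1 (\<psi>1 (\<phi>1 y)) * u2 (\<psi>1 (\<phi>1 y)) (t - \<phi>1 x + \<phi>1 y))\<^sup>2) \<partial>lborel))"
          unfolding sqn_def using ax x by (intro mult_mono ennreal_leI s1.nn_integral_coord_le) auto
        finally show "ennreal ((u1 x t - u1 0 (- \<phi>1 x + t))\<^sup>2) \<le> ennreal (max s1.L s2.L) *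
          (ennreal (1 / m) * (\<integral>\<^sup>+y\<in>{0..x}. ennreal ((d1 y * u2 y (- \<phi>1 x + \<phi>1 y + t))\<^sup>2) \<partial>lborel))"
          by (simp add: algebra_simps)
      next
        fix y t assume yt: "y \<in> {0..x}" "t \<in> ?W"
        then show "- \<phi>1 x + \<phi>1 y + t \<in> {p + \<phi>1 y..r - \<phi>2 y}" using mono[OF yt(1)] unfolding atLeastAtMost_iff by (intro conjI; linarith)
      qed (auto simp: d_bound)
      \<comment> \<open>\<open>u2\<close> moves to the left, so its characteristic reaches
        \<open>x = 0\<close> at the later time \<open>\<phi>2 x + t\<close>: the state is recovered
        from the future of the trace.\<close>
      have c2: "sqn ?W (\<lambda>t. u2 x t - u2 0 (\<phi>2 x + t)) \<le> ennreal (max s1.L s2.L * (D\<^sup>2 / m)) * (\<integral>\<^sup>+y\<in>{0..x}. N u1 y \<partial>lborel)"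
      proof (rule source[OF x, where d=d2 and \<tau>="\<lambda>y. \<phi>2 x - \<phi>2 y"])
        fix t assume t: "t \<in> ?W"
        have t0: "0 \<le> t" using t ax p by auto
        have si: "set_integrable lborel {0..\<phi>2 x} (\<lambda>r. d2 (\<psi>2 (s2.L - (s2.L - \<phi>2 x + r))) * u1 (\<psi>2 (s2.L - (s2.L - \<phi>2 x + r))) (t + r))"
          "u2 (\<psi>2 (s2.L - (s2.L - \<phi>2 x + \<phi>2 x))) (t + \<phi>2 x) - u2 (\<psi>2 (s2.L - (s2.L - \<phi>2 x))) t = (LBINT r:{0..\<phi>2 x}. d2 (\<psi>2 (s2.L - (s2.L - \<phi>2 x + r))) * u1 (\<psi>2 (s2.L - (s2.L - \<phi>2 x + r))) (t + r))"
          using t ax p r t0 by (intro straightD[OF hsysD(4)[OF h]]; simp)+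
        from set_integral_square_le[OF si(1) ax(3)] si(2)
        have "ennreal ((u2 0 (\<phi>2 x + t) - u2 x t)\<^sup>2) \<le> ennreal (\<phi>2 x) * sqn {0..\<phi>2 x} (\<lambda>r. d2 (\<psi>2 (\<phi>2 x - r)) * u1 (\<psi>2 (\<phi>2 x - r)) (t + r))"
          by (simp add: add.commute)
        also have "sqn {0..\<phi>2 x} (\<lambda>r. d2 (\<psi>2 (\<phi>2 x - r)) * u1 (\<psi>2 (\<phi>2 x - r)) (t + r)) = sqn {0..\<phi>2 x} (\<lambda>a. d2 (\<psi>2 a) * u1 (\<psi>2 a) (t + (\<phi>2 x - a)))"
          using sqn_reflect[of "\<lambda>a. d2 (\<psi>2 a) * u1 (\<psi>2 a) (t + (\<phi>2 x - a))" "\<phi>2 x"] by simp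
        also have "ennreal (\<phi>2 x) * \<dots> \<le> ennreal (max s1.L s2.L) * (ennreal (1 / m) * (\<integral>\<^sup>+y\<in>{0..x}. ennreal ((d2 (\<psi>2 (\<phi>2 y)) * u1 (\<psi>2 (\<phi>2 y)) (t + (\<phi>2 x - \<phi>2 y)))\<^sup>2) \<partial>lborel))"
          unfolding sqn_def using ax x by (intro mult_mono ennreal_leI s2.nn_integral_coord_le) auto
        finally show "ennreal ((u2 x t - u2 0 (\<phi>2 x + t))\<^sup>2) \<le> ennreal (max s1.L s2.L) *
          (ennreal (1 / m) * (\<integral>\<^sup>+y\<in>{0..x}. ennreal ((d2 y * u1 y (\<phi>2 x - \<phi>2 y + t))\<^sup>2) \<partial>lborel))"
          by (simp add: algebra_simps power2_commute)
      next
        fix y t assume yt: "y \<in> {0..x}" "t \<in> ?W"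
        then show "\<phi>2 x - \<phi>2 y + t \<in> {p + \<phi>1 y..r - \<phi>2 y}" using mono[OF yt(1)] unfolding atLeastAtMost_iff by (intro conjI; linarith)
      qed (auto simp: d_bound)
      have b1: "sqn ?W (\<lambda>t. u1 0 (- \<phi>1 x + t)) \<le> ennreal (q\<^sup>2) * sqn {p..r} (u2 0)"
      proof -
        have "sqn ?W (\<lambda>t. u1 0 (- \<phi>1 x + t)) \<le> sqn {p..r} (u1 0)"
          using ax by (intro sqn_shift_subset) auto
        also have "\<dots> = sqn {p..r} (\<lambda>t. q * u2 0 t)"
          using hsysD(5)[OF h] p r by (intro sqn_cong) auto
        also have "\<dots> = ennreal (q\<^sup>2) * sqn {p..r} (u2 0)" by (rule sqn_cmult) auto
        finally show ?thesis .
      qed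
      have b2: "sqn ?W (\<lambda>t. u2 0 (\<phi>2 x + t)) \<le> sqn {p..r} (u2 0)"
        using ax by (intro sqn_shift_subset) auto
      have "N u1 x \<le> 2 * sqn ?W (\<lambda>t. u1 0 (- \<phi>1 x + t)) + 2 * sqn ?W (\<lambda>t. u1 x t - u1 0 (- \<phi>1 x + t))"
        unfolding N_def by (rule sqn_le2) auto
      moreover have "N u2 x \<le> 2 * sqn ?W (\<lambda>t. u2 0 (\<phi>2 x + t)) + 2 * sqn ?W (\<lambda>t. u2 x t - u2 0 (\<phi>2 x + t))"
        unfolding N_def by (rule sqn_le2) auto
      ultimately have "n x \<le> (2 * sqn ?W (\<lambda>t. u1 0 (- \<phi>1 x + t)) + 2 * sqn ?W (\<lambda>t. u1 x t - u1 0 (- \<phi>1 x + t)))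
          + (2 * sqn ?W (\<lambda>t. u2 0 (\<phi>2 x + t)) + 2 * sqn ?W (\<lambda>t. u2 x t - u2 0 (\<phi>2 x + t)))"
        unfolding n_def by (rule add_mono)
      also have "\<dots> \<le> (2 * (ennreal (q\<^sup>2) * sqn {p..r} (u2 0)) + 2 * (ennreal (max s1.L s2.L * (D\<^sup>2 / m)) * (\<integral>\<^sup>+y\<in>{0..x}. N u2 y \<partial>lborel)))
         + (2 * sqn {p..r} (u2 0) + 2 * (ennreal (max s1.L s2.L * (D\<^sup>2 / m)) * (\<integral>\<^sup>+y\<in>{0..x}. N u1 y \<partial>lborel)))"
        by (intro add_mono mult_left_mono b1 b2 c1 c2) auto
      also have "\<dots> = (2 * ennreal (q\<^sup>2) + 2) * sqn {p..r} (u2 0)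
         + 2 * ennreal (max s1.L s2.L * (D\<^sup>2 / m)) * ((\<integral>\<^sup>+y\<in>{0..x}. N u1 y \<partial>lborel) + (\<integral>\<^sup>+y\<in>{0..x}. N u2 y \<partial>lborel))"
        by (simp add: algebra_simps)
      also have "(\<integral>\<^sup>+y\<in>{0..x}. N u1 y \<partial>lborel) + (\<integral>\<^sup>+y\<in>{0..x}. N u2 y \<partial>lborel) = (\<integral>\<^sup>+y\<in>{0..x}. n y \<partial>lborel)"
        unfolding n_def by (subst nn_integral_add[symmetric]) (auto intro!: nn_integral_cong simp: distrib_right)
      also have "2 * ennreal (q\<^sup>2) + 2 = ennreal Q"
        unfolding Q_def by (simp add: ennreal_mult)
      also have "2 * ennreal (max s1.L s2.L * (D\<^sup>2 / m)) * (\<integral>\<^sup>+y\<in>{0..x}. n y \<partial>lborel) \<le> ennreal K * (\<integral>\<^sup>+y\<in>{0..x}. n y \<partial>lborel)"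
      proof (rule mult_right_mono)
        have "2 * ennreal (max s1.L s2.L * (D\<^sup>2 / m)) = ennreal (2 * (max s1.L s2.L * (D\<^sup>2 / m)))"
          by (simp only: ennreal_mult'[of 2] ennreal_numeral zero_le_numeral)
        also have "\<dots> \<le> ennreal K" unfolding K_def by (intro ennreal_leI) simp
        finally show "2 * ennreal (max s1.L s2.L * (D\<^sup>2 / m)) \<le> ennreal K" .
      qed simp
      finally show ?thesis by (simp add: add_left_mono)
    qed
    have swap: "(\<integral>\<^sup>+t\<in>I. (sqn {0..1} (\<lambda>x. u1 x t) + sqn {0..1} (\<lambda>x. u2 x t)) \<partial>lborel)
        = (\<integral>\<^sup>+x\<in>{0..1}. (sqn I (u1 x) + sqn I (u2 x)) \<partial>lborel)" if [measurable]: "I \<in> sets borel" for I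
    proof -
      have *: "(\<integral>\<^sup>+t\<in>I. (sqn {0..1} (\<lambda>x. u1 x t) + sqn {0..1} (\<lambda>x. u2 x t)) \<partial>lborel)
         = (\<integral>\<^sup>+t. \<integral>\<^sup>+x. (ennreal ((u1 x t)\<^sup>2) + ennreal ((u2 x t)\<^sup>2)) * indicator {0..1} x * indicator I t \<partial>lborel \<partial>lborel)"
        unfolding sqn_def
        by (intro nn_integral_cong, subst nn_integral_add[symmetric])
          (auto simp: nn_integral_multc[symmetric] distrib_right simp del: nn_integral_multc intro!: nn_integral_cong)
      also have "\<dots> = (\<integral>\<^sup>+x. \<integral>\<^sup>+t. (ennreal ((u1 x t)\<^sup>2) + ennreal ((u2 x t)\<^sup>2)) * indicator {0..1} x * indicator I t \<partial>lborel \<partial>lborel)"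
        by (rule lborel_pair.Fubini') measurable
      also have "\<dots> = (\<integral>\<^sup>+x\<in>{0..1}. (sqn I (u1 x) + sqn I (u2 x)) \<partial>lborel)"
      proof (rule nn_integral_cong)
        fix x
        have "sqn I (u1 x) + sqn I (u2 x) = (\<integral>\<^sup>+t. (ennreal ((u1 x t)\<^sup>2) + ennreal ((u2 x t)\<^sup>2)) * indicator I t \<partial>lborel)"
          unfolding sqn_def by (subst nn_integral_add[symmetric]) (auto simp: distrib_right)
        then show "(\<integral>\<^sup>+t. (ennreal ((u1 x t)\<^sup>2) + ennreal ((u2 x t)\<^sup>2)) * indicator {0..1} x * indicator I t \<partial>lborel)
          = (sqn I (u1 x) + sqn I (u2 x)) * indicator {0..1} x"
          by (cases "x \<in> {0..1}") auto
      qed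
      finally show ?thesis .
    qed
    \<comment> \<open>Gronwall in \<open>x\<close> asks for finiteness in advance; Tonelli obtains
      it from the space-time norm in \<open>hsys\<close>.\<close>
    have fin: "(\<integral>\<^sup>+x\<in>{0..1}. n x \<partial>lborel) < \<infinity>"
    proof -
      have "(\<integral>\<^sup>+x\<in>{0..1}. n x \<partial>lborel) \<le> (\<integral>\<^sup>+x\<in>{0..1}. (sqn {0..T} (u1 x) + sqn {0..T} (u2 x)) \<partial>lborel)"
      proof (intro nn_integral_mono)
        fix x
        show "n x * indicator {0..1} x \<le> (sqn {0..T} (u1 x) + sqn {0..T} (u2 x)) * indicator {0..1} x"
        proof (cases "x \<in> {0..1}")
          case True
          then have "{p + \<phi>1 x..r - \<phi>2 x} \<subseteq> {0..T}"
            using s1.\<phi>_in[of x] s2.\<phi>_in[of x] p r by auto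
          then show ?thesis using True unfolding n_def N_def by (auto intro!: add_mono sqn_mono_set)
        qed simp
      qed
      also have "\<dots> < \<infinity>" using h swap[of "{0..T}"] by (simp add: hsys_def)
      finally show ?thesis .
    qed
    have "(\<integral>\<^sup>+t\<in>{p + s1.L..r - s2.L}. (sqn {0..1} (\<lambda>x. u1 x t) + sqn {0..1} (\<lambda>x. u2 x t)) \<partial>lborel)
       = (\<integral>\<^sup>+x\<in>{0..1}. (sqn {p + s1.L..r - s2.L} (u1 x) + sqn {p + s1.L..r - s2.L} (u2 x)) \<partial>lborel)"
      by (rule swap) simp
    also have "\<dots> \<le> (\<integral>\<^sup>+x\<in>{0..1}. n x \<partial>lborel)"
    proof (intro nn_integral_mono)
      fix x
      show "(sqn {p + s1.L..r - s2.L} (u1 x) + sqn {p + s1.L..r - s2.L} (u2 x)) * indicator {0..1} x \<le> n x * indicator {0..1} x"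
      proof (cases "x \<in> {0..1}")
        case True
        then have "{p + s1.L..r - s2.L} \<subseteq> {p + \<phi>1 x..r - \<phi>2 x}"
          using s1.\<phi>_in[of x] s2.\<phi>_in[of x] by auto
        then show ?thesis using True unfolding n_def N_def by (auto intro!: add_mono sqn_mono_set)
      qed simp
    qed
    also have "\<dots> \<le> ennreal (2 * 1 * exp (2 * K * 1)) * (ennreal Q * sqn {p..r} (u2 0))"
      by (rule gronwall_nn[OF _ fin K _ le]) auto
    also have "\<dots> = ennreal (2 * exp (2 * K) * Q) * sqn {p..r} (u2 0)"
      using Q by (simp add: ennreal_mult mult.assoc)
    finally show "(\<integral>\<^sup>+t\<in>{p + s1.L..r - s2.L}. (sqn {0..1} (\<lambda>x. u1 x t) + sqn {0..1} (\<lambda>x. u2 x t)) \<partial>lborel)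
      \<le> ennreal (2 * exp (2 * K) * Q) * sqn {p..r} (u2 0)" .
  qed
qed

end

section \<open>Dilations\<close>

lemma sqn_L1:
  assumes [measurable]: "f \<in> borel_measurable borel" and A: "sqn {a..b} f \<le> ennreal A" "0 \<le> A" and ab: "a \<le> b"
  shows "(\<integral>\<^sup>+x\<in>{a..b}. ennreal \<bar>f x\<bar> \<partial>lborel) \<le> ennreal (sqrt ((b - a) * A))"
proof -
  have "(\<integral>\<^sup>+x\<in>{a..b}. ennreal \<bar>f x * 1\<bar> \<partial>lborel) \<le> ennreal (sqrt (A * (b - a)))"
    using A ab sqn_const[of a b "\<lambda>_. 1" 1] by (intro Cauchy_Schwarz_sqn(3)) auto
  then show ?thesis by (simp add: mult.commute)
qed

text \<open>Translations are averaged over \<open>[h, 2 h]\<close>; this absorbs the displacement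
  \<open>(\<kappa> - 1) r\<close> of the dilation, which is at most \<open>h\<close> where the integrand does not vanish.\<close>

lemma dilation_L1:
  fixes Q :: "real \<Rightarrow> real"
  assumes [measurable]: "Q \<in> borel_measurable borel"
    and supp: "\<And>r. r \<notin> {0..R} \<Longrightarrow> Q r = 0" and R: "0 \<le> R"
    and h: "0 < h" and \<kappa>: "1 / 2 \<le> \<kappa>" "\<bar>\<kappa> - 1\<bar> * (2 * R + 2 * h) \<le> h"
    and W: "\<And>\<delta>. 0 \<le> \<delta> \<Longrightarrow> \<delta> \<le> 3 * h \<Longrightarrow> (\<integral>\<^sup>+r. ennreal \<bar>Q (r + \<delta>) - Q r\<bar> \<partial>lborel) \<le> ennreal W" and W0: "0 \<le> W"
  shows "(\<integral>\<^sup>+r. ennreal \<bar>Q (\<kappa> * r) - Q r\<bar> \<partial>lborel) \<le> ennreal (7 * W)"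
proof -
  let ?I = "\<integral>\<^sup>+r. ennreal \<bar>Q (\<kappa> * r) - Q r\<bar> \<partial>lborel"
  let ?g = "\<lambda>r \<delta>. ennreal \<bar>Q (\<kappa> * r) - Q (r + \<delta>)\<bar> * indicator {h..2 * h} \<delta>"
  let ?k = "\<lambda>r \<delta>. ennreal \<bar>Q (\<kappa> * r) - Q (\<kappa> * r + \<delta>)\<bar> * indicator {0..3 * h} \<delta>"
  have shift: "(\<integral>\<^sup>+\<delta>. ?g r \<delta> \<partial>lborel) \<le> (\<integral>\<^sup>+\<delta>. ?k r \<delta> \<partial>lborel)" for r
  \<comment> \<open>Beyond this bound \<open>Q (\<kappa> * r)\<close> and
    \<open>Q (r + \<delta>)\<close> both vanish, because \<open>\<kappa>\<close> is at least
    \<open>1 / 2\<close> and \<open>\<delta>\<close> at most \<open>2 * h\<close>.\<close>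
  proof (cases "\<bar>r\<bar> \<le> 2 * R + 2 * h")
    case True
    have "\<bar>(\<kappa> - 1) * r\<bar> \<le> \<bar>\<kappa> - 1\<bar> * (2 * R + 2 * h)"
      unfolding abs_mult using True by (intro mult_left_mono) auto
    also have "\<dots> \<le> h" by (rule \<kappa>)
    finally have d: "\<bar>(\<kappa> - 1) * r\<bar> \<le> h" .
    have "(\<integral>\<^sup>+\<delta>. ?g r \<delta> \<partial>lborel) = (\<integral>\<^sup>+\<delta>. ?g r ((\<kappa> - 1) * r + \<delta>) \<partial>lborel)"
      by (rule nn_integral_shift[symmetric]) measurable
    also have "\<dots> \<le> (\<integral>\<^sup>+\<delta>. ?k r \<delta> \<partial>lborel)"
    proof (intro nn_integral_mono mult_mono)
      fix \<delta>
      have "r + ((\<kappa> - 1) * r + \<delta>) = \<kappa> * r + \<delta>" by (simp add: algebra_simps)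
      then show "ennreal \<bar>Q (\<kappa> * r) - Q (r + ((\<kappa> - 1) * r + \<delta>))\<bar> \<le> ennreal \<bar>Q (\<kappa> * r) - Q (\<kappa> * r + \<delta>)\<bar>" by (simp only: order_refl)
      have "(\<kappa> - 1) * r + \<delta> \<in> {h..2 * h} \<Longrightarrow> \<delta> \<in> {0..3 * h}"
        using d unfolding atLeastAtMost_iff abs_le_iff by linarith
      then show "indicator {h..2 * h} ((\<kappa> - 1) * r + \<delta>) \<le> (indicator {0..3 * h} \<delta> :: ennreal)"
        by (auto simp: indicator_def)
    qed auto
    finally show ?thesis .
  next
    case False
    have "?g r \<delta> = 0" for \<delta>
    proof (cases "\<delta> \<in> {h..2 * h}")
      case True
      have "\<kappa> * r \<notin> {0..R}"
      proof (cases "0 \<le> r")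
        case pos: True
        have "1 / 2 * r \<le> \<kappa> * r" using pos \<kappa> by (intro mult_right_mono) auto
        then show ?thesis using False pos h by auto
      next
        case neg: False
        then have "\<kappa> * r < 0" using \<kappa> by (intro mult_pos_neg) auto
        then show ?thesis by auto
      qed
      moreover have "r + \<delta> \<notin> {0..R}" using False True h R by auto
      ultimately show ?thesis using supp by simp
    qed simp
    then show ?thesis by (simp only: nn_integral_const) simp
  qed
  \<comment> \<open>Substituting \<open>\<kappa> * r\<close> costs the factor
    \<open>1 / \<kappa>\<close>, which is at most 2.\<close>
  have dil: "(\<integral>\<^sup>+r. ennreal \<bar>Q (\<kappa> * r) - Q (\<kappa> * r + \<delta>)\<bar> \<partial>lborel) \<le> ennreal (2 * W)" if \<delta>: "0 \<le> \<delta>" "\<delta> \<le> 3 * h" for \<delta>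
  proof -
    have "(\<integral>\<^sup>+r. ennreal \<bar>Q r - Q (r + \<delta>)\<bar> \<partial>lborel) = ennreal \<kappa> * (\<integral>\<^sup>+r. ennreal \<bar>Q (\<kappa> * r) - Q (\<kappa> * r + \<delta>)\<bar> \<partial>lborel)"
      using nn_integral_real_affine[of "\<lambda>r. ennreal \<bar>Q r - Q (r + \<delta>)\<bar>" \<kappa> 0] \<kappa> by simp
    then have "(\<integral>\<^sup>+r. ennreal \<bar>Q (\<kappa> * r) - Q (\<kappa> * r + \<delta>)\<bar> \<partial>lborel) = ennreal (1 / \<kappa>) * (\<integral>\<^sup>+r. ennreal \<bar>Q r - Q (r + \<delta>)\<bar> \<partial>lborel)"
      using \<kappa> by (simp add: mult.assoc[symmetric] ennreal_mult[symmetric])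
    also have "\<dots> \<le> ennreal 2 * ennreal W"
      using W[OF \<delta>] \<kappa> by (intro mult_mono ennreal_leI) (auto simp: abs_minus_commute field_simps)
    finally show ?thesis using W0 by (simp add: ennreal_mult)
  qed
  have "ennreal h * ?I = (\<integral>\<^sup>+\<delta>. ?I * indicator {h..2 * h} \<delta> \<partial>lborel)"
    using h by (subst nn_integral_cmult_indicator) (auto simp: mult.commute)
  also have "\<dots> \<le> (\<integral>\<^sup>+\<delta>. (\<integral>\<^sup>+r. ?g r \<delta> \<partial>lborel) + ennreal W * indicator {h..2 * h} \<delta> \<partial>lborel)"
  proof (rule nn_integral_mono)
    fix \<delta>
    show "?I * indicator {h..2 * h} \<delta> \<le> (\<integral>\<^sup>+r. ?g r \<delta> \<partial>lborel) + ennreal W * indicator {h..2 * h} \<delta>"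
    proof (cases "\<delta> \<in> {h..2 * h}")
      case True
      have "?I \<le> (\<integral>\<^sup>+r. ennreal \<bar>Q (\<kappa> * r) - Q (r + \<delta>)\<bar> + ennreal \<bar>Q (r + \<delta>) - Q r\<bar> \<partial>lborel)"
        by (intro nn_integral_mono) (simp add: ennreal_plus[symmetric] ennreal_leI del: ennreal_plus)
      also have "\<dots> = (\<integral>\<^sup>+r. ennreal \<bar>Q (\<kappa> * r) - Q (r + \<delta>)\<bar> \<partial>lborel) + (\<integral>\<^sup>+r. ennreal \<bar>Q (r + \<delta>) - Q r\<bar> \<partial>lborel)"
        by (rule nn_integral_add) measurable
      also have "\<dots> \<le> (\<integral>\<^sup>+r. ennreal \<bar>Q (\<kappa> * r) - Q (r + \<delta>)\<bar> \<partial>lborel) + ennreal W"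
        using True h by (intro add_left_mono W) auto
      finally show ?thesis using True by simp
    qed simp
  qed
  also have "\<dots> = (\<integral>\<^sup>+\<delta>. (\<integral>\<^sup>+r. ?g r \<delta> \<partial>lborel) \<partial>lborel) + (\<integral>\<^sup>+\<delta>. ennreal W * indicator {h..2 * h} \<delta> \<partial>lborel)"
    by (rule nn_integral_add) measurable
  also have "(\<integral>\<^sup>+\<delta>. (\<integral>\<^sup>+r. ?g r \<delta> \<partial>lborel) \<partial>lborel) = (\<integral>\<^sup>+r. (\<integral>\<^sup>+\<delta>. ?g r \<delta> \<partial>lborel) \<partial>lborel)"
    by (rule lborel_pair.Fubini') measurable
  also have "\<dots> \<le> (\<integral>\<^sup>+r. (\<integral>\<^sup>+\<delta>. ?k r \<delta> \<partial>lborel) \<partial>lborel)"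
    by (intro nn_integral_mono shift)
  also have "\<dots> = (\<integral>\<^sup>+\<delta>. (\<integral>\<^sup>+r. ?k r \<delta> \<partial>lborel) \<partial>lborel)"
    by (rule lborel_pair.Fubini'[symmetric]) measurable
  also have "\<dots> \<le> (\<integral>\<^sup>+\<delta>. ennreal (2 * W) * indicator {0..3 * h} \<delta> \<partial>lborel)"
    using dil by (intro nn_integral_mono) (auto simp: indicator_def)
  also have "\<dots> = ennreal (2 * W) * ennreal (3 * h)"
    using h by (simp add: nn_integral_cmult_indicator)
  also have "(\<integral>\<^sup>+\<delta>. ennreal W * indicator {h..2 * h} \<delta> \<partial>lborel) = ennreal W * ennreal h"
    using h by (simp add: nn_integral_cmult_indicator)
  \<comment> \<open>\<open>7 = 2 * 3 + 1\<close>: twice \<open>W\<close> on the enlarged interval of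
    length \<open>3 * h\<close>, and \<open>W\<close> on the averaging interval of length
    \<open>h\<close>.\<close>
  also have "ennreal (2 * W) * ennreal (3 * h) + ennreal W * ennreal h = ennreal h * ennreal (7 * W)"
    using W0 h by (simp add: ennreal_mult[symmetric] ennreal_plus[symmetric] algebra_simps del: ennreal_plus)
  finally have "ennreal h * ?I \<le> ennreal h * ennreal (7 * W)" by (simp add: add_right_mono)
  then have "ennreal (1 / h) * (ennreal h * ?I) \<le> ennreal (1 / h) * (ennreal h * ennreal (7 * W))"
    by (rule mult_left_mono) simp
  then show ?thesis using h by (simp add: mult.assoc[symmetric] ennreal_mult'[symmetric])
qed

context hyp
begin

lemma sqn_divide_speed:
  assumes [measurable]: "f \<in> borel_measurable borel" "e \<in> borel_measurable borel" and e: "\<And>x. m \<le> e x"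
    and b: "sqn {0..1} f \<le> ennreal b" "0 \<le> b"
  shows "sqn {0..1} (\<lambda>x. f x / e x) \<le> ennreal (b / m\<^sup>2)"
proof -
  have "sqn {0..1} (\<lambda>x. f x / e x) \<le> sqn {0..1} (\<lambda>x. 1 / m * f x)"
  proof (rule sqn_mono)
    fix x
    have "\<bar>f x\<bar> / e x \<le> \<bar>f x\<bar> / m" using e[of x] s1.m(1) by (intro divide_left_mono) auto
    then show "\<bar>f x / e x\<bar> \<le> \<bar>1 / m * f x\<bar>" using e[of x] s1.m(1) by (simp add: abs_mult)
  qed
  also have "\<dots> = ennreal ((1 / m)\<^sup>2) * sqn {0..1} f" by (rule sqn_cmult) auto
  also have "\<dots> \<le> ennreal ((1 / m)\<^sup>2) * ennreal b" by (intro mult_left_mono b) auto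
  also have "\<dots> = ennreal (b / m\<^sup>2)" using b by (simp add: ennreal_mult[symmetric] power_divide)
  finally show ?thesis .
qed

lemma pair_integrable:
  assumes [measurable]: "u1 \<in> borel_measurable borel" "u2 \<in> borel_measurable borel" "q1 \<in> borel_measurable borel" "q2 \<in> borel_measurable borel"
    and a: "sqn {0..1} u1 \<le> ennreal a" "sqn {0..1} u2 \<le> ennreal a" "0 \<le> a"
    and b: "sqn {0..1} q1 \<le> ennreal b" "sqn {0..1} q2 \<le> ennreal b" "0 \<le> b"
  shows "set_integrable lborel {0..1} (\<lambda>x. u1 x * q2 x / e1 x)"
    and "set_integrable lborel {0..1} (\<lambda>x. u2 x * q1 x / e2 x)"
    and "\<bar>pair u1 u2 q1 q2\<bar> \<le> 2 / m * sqrt (a * b)"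
proof -
  have q: "sqn {0..1} (\<lambda>x. q2 x / e1 x) \<le> ennreal (b / m\<^sup>2)" "sqn {0..1} (\<lambda>x. q1 x / e2 x) \<le> ennreal (b / m\<^sup>2)"
    by (rule sqn_divide_speed; use b s1.m s2.m in simp)+
  have b': "0 \<le> b / m\<^sup>2" using b by simp
  note 1 = Cauchy_Schwarz_sqn[OF _ _ _ a(1) q(1) a(3) b'] and 2 = Cauchy_Schwarz_sqn[OF _ _ _ a(2) q(2) a(3) b']
  show "set_integrable lborel {0..1} (\<lambda>x. u1 x * q2 x / e1 x)" "set_integrable lborel {0..1} (\<lambda>x. u2 x * q1 x / e2 x)"
    using 1(1) 2(1) by simp_all
  have s: "sqrt (a * (b / m\<^sup>2)) = 1 / m * sqrt (a * b)"
    using s1.m(1) by (simp add: real_sqrt_divide)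
  have "\<bar>LBINT x:{0..1}. u1 x * (q2 x / e1 x)\<bar> \<le> 1 / m * sqrt (a * b)"
    "\<bar>LBINT x:{0..1}. u2 x * (q1 x / e2 x)\<bar> \<le> 1 / m * sqrt (a * b)"
    using 1(2) 2(2) unfolding s by simp_all
  then have "\<bar>pair u1 u2 q1 q2\<bar> \<le> 1 / m * sqrt (a * b) + 1 / m * sqrt (a * b)"
    unfolding pair_def by simp
  then show "\<bar>pair u1 u2 q1 q2\<bar> \<le> 2 / m * sqrt (a * b)" by simp
qed

lemma pair_diff:
  assumes [measurable]: "u1 \<in> borel_measurable borel" "u2 \<in> borel_measurable borel" "q1 \<in> borel_measurable borel" "q2 \<in> borel_measurable borel"
      "r1 \<in> borel_measurable borel" "r2 \<in> borel_measurable borel"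
    and a: "sqn {0..1} u1 < top" "sqn {0..1} u2 < top"
    and b: "sqn {0..1} q1 < top" "sqn {0..1} q2 < top" "sqn {0..1} r1 < top" "sqn {0..1} r2 < top"
  shows "pair u1 u2 q1 q2 - pair u1 u2 r1 r2 = pair u1 u2 (\<lambda>x. q1 x - r1 x) (\<lambda>x. q2 x - r2 x)"
proof -
  have fin: "\<exists>c\<ge>0. sqn {0..1} f \<le> ennreal c \<and> sqn {0..1} g \<le> ennreal c" if fg: "sqn {0..1} f < top" "sqn {0..1} g < top" for f g
  proof -
    obtain c where "0 \<le> c" "sqn {0..1} f \<le> ennreal c" by (rule sqn_finiteE[OF fg(1)])
    moreover obtain d where "0 \<le> d" "sqn {0..1} g \<le> ennreal d" by (rule sqn_finiteE[OF fg(2)])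
    ultimately
    show ?thesis by (intro exI[of _ "max c d"]) (auto intro: order_trans ennreal_leI)
  qed
  obtain a' where a': "0 \<le> a'" "sqn {0..1} u1 \<le> ennreal a'" "sqn {0..1} u2 \<le> ennreal a'" using fin[OF a] by blast
  obtain b' where b': "0 \<le> b'" "sqn {0..1} q1 \<le> ennreal b'" "sqn {0..1} q2 \<le> ennreal b'" using fin[OF b(1,2)] by blast
  obtain c' where c': "0 \<le> c'" "sqn {0..1} r1 \<le> ennreal c'" "sqn {0..1} r2 \<le> ennreal c'" using fin[OF b(3,4)] by blast
  have i: "set_integrable lborel {0..1} (\<lambda>x. u1 x * q2 x / e1 x)" "set_integrable lborel {0..1} (\<lambda>x. u2 x * q1 x / e2 x)"
    "set_integrable lborel {0..1} (\<lambda>x. u1 x * r2 x / e1 x)" "set_integrable lborel {0..1} (\<lambda>x. u2 x * r1 x / e2 x)"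
    using pair_integrable(1,2)[OF assms(1-4) a'(2,3,1) b'(2,3,1)] pair_integrable(1,2)[OF assms(1,2,5,6) a'(2,3,1) c'(2,3,1)] by auto
  show ?thesis
    unfolding pair_def using i
    by (simp add: right_diff_distrib diff_divide_distrib set_integral_diff)
qed

end

lemma sqn_scale:
  assumes [measurable]: "f \<in> borel_measurable borel" and \<theta>: "0 < \<theta>"
  shows "sqn {0..\<theta>} f = ennreal \<theta> * sqn {0..1} (\<lambda>y. f (\<theta> * y))"
proof -
  have i: "indicator {0..\<theta>} (\<theta> * y) = (indicator {0..1} y :: ennreal)" for y
    using \<theta> by (auto simp: indicator_def zero_le_mult_iff)
  have "sqn {0..\<theta>} f = ennreal \<theta> * (\<integral>\<^sup>+y. ennreal ((f (\<theta> * y))\<^sup>2) * indicator {0..\<theta>} (\<theta> * y) \<partial>lborel)"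
    unfolding sqn_def using nn_integral_real_affine[of "\<lambda>x. ennreal ((f x)\<^sup>2) * indicator {0..\<theta>} x" \<theta> 0] \<theta> by simp
  then show ?thesis unfolding i sqn_def .
qed

section \<open>The closed loop\<close>

text \<open>The kernels on the triangle are already extended by zero. \<open>kcont\<close> concerns
  their values at \<open>x = 1\<close>, the initial data for the kernels \<alpha>.\<close>

locale ctrl = hyp +
  fixes K1 K2 :: "real \<Rightarrow> real \<Rightarrow> real" and B \<tau> :: real
  assumes \<tau>: "0 < \<tau>"
    and km: "case_prod K1 \<in> borel_measurable (borel \<Otimes>\<^sub>M borel)" "case_prod K2 \<in> borel_measurable (borel \<Otimes>\<^sub>M borel)"
    and kb: "\<And>x y. \<bar>K1 x y\<bar> \<le> B" "\<And>x y. \<bar>K2 x y\<bar> \<le> B"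
    and k0: "\<And>x y. (x, y) \<notin> triangle \<Longrightarrow> K1 x y = 0 \<and> K2 x y = 0"
    and k1: "mild_transport triangle e2 (\<lambda>y. - e1 y) (\<lambda>x y. e1 y * K1 x y) (\<lambda>x y. e1 y * (d2 y * K2 x y))"
    and k2: "mild_transport triangle e2 e2 (\<lambda>x y. e2 y * K2 x y) (\<lambda>x y. e2 y * (d1 y * K1 x y))"
    and kd: "\<And>x. x \<in> {0..1} \<Longrightarrow> K1 x x = - d2 x / (e1 x + e2 x)"
    and kq: "\<And>x. x \<in> {0..1} \<Longrightarrow> e2 0 * K2 x 0 = q * e1 0 * K1 x 0"
    and kcont: "continuous_on {0..1} (K1 1)" "continuous_on {0..1} (K2 1)"

text \<open>All estimates for the plant become available for the kernels, under the prefix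
  \<open>a\<close>.\<close>

sublocale ctrl \<subseteq> a: hyp e2 \<phi>2 \<psi>2 e1 \<phi>1 \<psi>1 m M d1' d2' q "M * D / m"
  by (rule adjoint_hyp)

context ctrl
begin

text \<open>The kernels \<alpha> scaled by the speeds, with \<open>\<sigma> = \<theta> * x\<close>
  as time and \<open>y\<close> as space. In this form \<open>\<theta>\<close> is just the length of
  the time interval, which is how bounds uniform in \<open>\<theta>\<close> arise. Both conditions
  on \<open>q2\<close> leave out the corner \<open>y = 1\<close>, \<open>\<sigma> = 0\<close>, where
  the data disagree.\<close>

definition kernel :: "real \<Rightarrow> (real \<Rightarrow> real \<Rightarrow> real) \<Rightarrow> (real \<Rightarrow> real \<Rightarrow> real) \<Rightarrow> bool" where
  "kernel \<theta> q1 q2 \<longleftrightarrow> 0 < \<theta> \<and> adj \<theta> q1 q2 \<and> (\<forall>s. 0 < s \<longrightarrow> s \<le> \<theta> \<longrightarrow> q2 1 s = 0) \<and>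
     (\<forall>y. 0 \<le> y \<longrightarrow> y \<le> 1 \<longrightarrow> q1 y 0 = e2 y * K2 1 y) \<and> (\<forall>y. 0 \<le> y \<longrightarrow> y < 1 \<longrightarrow> q2 y 0 = e1 y * K1 1 y)"

lemma B_nonneg: "0 \<le> B" using kb(1)[of 0 0] by linarith

lemma kernelD:
  assumes "kernel \<theta> q1 q2"
  shows "0 < \<theta>" "adj \<theta> q1 q2" "\<And>s. 0 < s \<Longrightarrow> s \<le> \<theta> \<Longrightarrow> q2 1 s = 0"
    "\<And>y. 0 \<le> y \<Longrightarrow> y \<le> 1 \<Longrightarrow> q1 y 0 = e2 y * K2 1 y" "\<And>y. 0 \<le> y \<Longrightarrow> y < 1 \<Longrightarrow> q2 y 0 = e1 y * K1 1 y"
    "case_prod q1 \<in> borel_measurable (borel \<Otimes>\<^sub>M borel)" "case_prod q2 \<in> borel_measurable (borel \<Otimes>\<^sub>M borel)"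
  using assms a.hsysD(1,2) unfolding kernel_def by blast+

lemma eK_bound: "\<bar>e2 y * K2 x y\<bar> \<le> M * B" "\<bar>e1 y * K1 x y\<bar> \<le> M * B"
  using s1.epos[of y] s2.epos[of y] s1.m(3)[of y] s2.m(3)[of y] kb[of x y] s1.M_pos
  by (auto simp: abs_mult intro!: mult_mono)

lemma kernel_init_bound:
  assumes "kernel \<theta> q1 q2" "0 < y" "y < 1"
  shows "\<bar>q1 y 0\<bar> \<le> M * B \<and> \<bar>q2 y 0\<bar> \<le> M * B"
  using kernelD(4,5)[OF assms(1), of y] eK_bound[of y 1] assms(2,3) by auto

text \<open>Equations, input and initial data up to a null set are the same for all
  \<open>\<theta>\<close>, so one energy estimate up to time \<open>\<tau> + 1\<close> serves every
  \<open>\<theta> \<le> \<tau> + 1\<close>.\<close>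

lemma kernel_bound:
  obtains P where "0 < P"
    "\<And>\<theta> q1 q2 \<sigma>. kernel \<theta> q1 q2 \<Longrightarrow> \<theta> \<le> \<tau> + 1 \<Longrightarrow> 0 \<le> \<sigma> \<Longrightarrow> \<sigma> \<le> \<theta> \<Longrightarrow>
      sqn {0..1} (\<lambda>x. q1 x \<sigma>) \<le> ennreal P \<and> sqn {0..1} (\<lambda>x. q2 x \<sigma>) \<le> ennreal P \<and> sqn {0..\<sigma>} (q1 1) \<le> ennreal P"
proof -
  have "0 \<le> \<tau> + 1" using \<tau> by simp
  from a.energy[OF this] obtain C where C: "0 < C" and e:
    "\<And>q1 q2 T. 0 \<le> T \<Longrightarrow> T \<le> \<tau> + 1 \<Longrightarrow> adj T q1 q2 \<Longrightarrow>
      sqn {0..1} (\<lambda>x. q1 x T) + sqn {0..1} (\<lambda>x. q2 x T) + sqn {0..T} (q2 0) + sqn {0..T} (q1 1)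
        + (\<integral>\<^sup>+s\<in>{0..T}. (sqn {0..1} (\<lambda>x. q1 x s) + sqn {0..1} (\<lambda>x. q2 x s)) \<partial>lborel)
      \<le> ennreal C * (sqn {0..1} (\<lambda>x. q1 x 0) + sqn {0..1} (\<lambda>x. q2 x 0) + sqn {0..T} (q2 1))"
    by blast
  define P where "P = C * (2 * (M * B)\<^sup>2) + 1"
  show thesis
  proof (rule that[of P])
    show "0 < P" unfolding P_def using C by (simp add: add_nonneg_pos)
    fix \<theta> q1 q2 \<sigma>
    assume k: "kernel \<theta> q1 q2" and \<theta>: "\<theta> \<le> \<tau> + 1" and \<sigma>: "0 \<le> \<sigma>" "\<sigma> \<le> \<theta>"
    note [measurable] = kernelD(6,7)[OF k]
    have h: "adj \<sigma> q1 q2" by (rule hsys_mono[OF kernelD(2)[OF k] \<sigma>(2)])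
    have z0: "sqn {0..\<sigma>} (q2 1) = 0"
    proof -
      have "sqn {0..\<sigma>} (q2 1) = ennreal (0\<^sup>2) * sqn {0..\<sigma>} (q2 1)"
        using \<sigma> kernelD(3)[OF k] by (intro sqn_AE_mult) auto
      then show ?thesis by simp
    qed
    have n0: "sqn {0..1} (\<lambda>x. q1 x 0) \<le> ennreal ((M * B)\<^sup>2)" "sqn {0..1} (\<lambda>x. q2 x 0) \<le> ennreal ((M * B)\<^sup>2)"
      using sqn_const_open[of 0 1 "\<lambda>x. q1 x 0" "M * B"] sqn_const_open[of 0 1 "\<lambda>x. q2 x 0" "M * B"] kernel_init_bound[OF k] by auto
    have "ennreal C * (sqn {0..1} (\<lambda>x. q1 x 0) + sqn {0..1} (\<lambda>x. q2 x 0) + sqn {0..\<sigma>} (q2 1))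
       \<le> ennreal C * (ennreal ((M * B)\<^sup>2) + ennreal ((M * B)\<^sup>2) + 0)"
      unfolding z0 by (intro mult_left_mono add_mono n0) auto
    also have "\<dots> = ennreal (C * (2 * (M * B)\<^sup>2))"
      using C by (simp add: ennreal_mult[symmetric] ennreal_plus[symmetric] del: ennreal_plus)
    also have "\<dots> \<le> ennreal P" unfolding P_def by (intro ennreal_leI) simp
    finally have tot: "sqn {0..1} (\<lambda>x. q1 x \<sigma>) + sqn {0..1} (\<lambda>x. q2 x \<sigma>) + sqn {0..\<sigma>} (q2 0) + sqn {0..\<sigma>} (q1 1)
        + (\<integral>\<^sup>+s\<in>{0..\<sigma>}. (sqn {0..1} (\<lambda>x. q1 x s) + sqn {0..1} (\<lambda>x. q2 x s)) \<partial>lborel) \<le> ennreal P"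
      using e[OF \<sigma>(1) _ h] \<sigma> \<theta> by (meson order_trans)
    show "sqn {0..1} (\<lambda>x. q1 x \<sigma>) \<le> ennreal P \<and> sqn {0..1} (\<lambda>x. q2 x \<sigma>) \<le> ennreal P \<and> sqn {0..\<sigma>} (q1 1) \<le> ennreal P"
      by (intro conjI; rule order_trans[OF _ tot]; simp add: add.assoc add_increasing add_increasing2)
  qed
qed

text \<open>Uniform continuity of \<open>K1 1\<close> and \<open>K2 1\<close> in travel times
  supplies the modulus \<open>\<omega>\<close> for \<open>initial_estimate\<close>. One half of
  \<open>\<epsilon>\<close> is spent on \<open>\<omega>\<close>, the other on
  \<open>A * \<delta>\<close>. The resulting \<open>\<delta>0\<close> is the same for all
  \<open>\<theta>\<close>.\<close>

lemma kernel_modulus: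
  assumes \<epsilon>: "0 < \<epsilon>"
  obtains \<delta>0 where "0 < \<delta>0"
    "\<And>\<theta> q1 q2 \<delta>. kernel \<theta> q1 q2 \<Longrightarrow> 0 \<le> \<delta> \<Longrightarrow> \<delta> \<le> \<delta>0 \<Longrightarrow> \<delta> \<le> \<theta> \<Longrightarrow>
      sqn {0..1} (\<lambda>x. q1 x \<delta> - q1 x 0) + sqn {0..1} (\<lambda>x. q2 x \<delta> - q2 x 0) \<le> ennreal \<epsilon>"
proof -
  have MB: "0 \<le> M * B" using B_nonneg s1.M_pos by simp
  obtain A where A: "0 \<le> A" and est:
    "\<And>\<delta> \<omega> q1 q2. 0 \<le> \<delta> \<Longrightarrow> \<delta> \<le> 1 \<Longrightarrow> \<delta> \<le> s2.L \<Longrightarrow> \<delta> \<le> s1.L \<Longrightarrow> 0 \<le> \<omega> \<Longrightarrow> adj \<delta> q1 q2 \<Longrightarrow>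
      (\<And>t. 0 < t \<Longrightarrow> t \<le> \<delta> \<Longrightarrow> q2 1 t = 0) \<Longrightarrow>
      (\<And>y. 0 < y \<Longrightarrow> y < 1 \<Longrightarrow> \<bar>q1 y 0\<bar> \<le> M * B \<and> \<bar>q2 y 0\<bar> \<le> M * B) \<Longrightarrow>
      (\<And>a. \<delta> < a \<Longrightarrow> a < s2.L \<Longrightarrow> \<bar>q1 (\<psi>2 (a - \<delta>)) 0 - q1 (\<psi>2 a) 0\<bar> \<le> \<omega>) \<Longrightarrow>
      (\<And>b. \<delta> < b \<Longrightarrow> b < s1.L \<Longrightarrow> \<bar>q2 (\<psi>1 (s1.L - (b - \<delta>))) 0 - q2 (\<psi>1 (s1.L - b)) 0\<bar> \<le> \<omega>) \<Longrightarrow>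
      sqn {0..1} (\<lambda>x. q1 x \<delta> - q1 x 0) + sqn {0..1} (\<lambda>x. q2 x \<delta> - q2 x 0)
        \<le> ennreal (A * \<delta> + 2 * M * (s2.L + s1.L) * \<omega>\<^sup>2)"
    using a.initial_estimate[OF MB] by blast
  define L where "L = 2 * M * (s2.L + s1.L)"
  have L: "0 < L" unfolding L_def using s1.M_pos s1.L_pos s2.L_pos by simp
  define \<omega> where "\<omega> = sqrt (\<epsilon> / (2 * L))"
  have \<omega>: "0 < \<omega>" "L * \<omega>\<^sup>2 = \<epsilon> / 2" unfolding \<omega>_def using \<epsilon> L by auto
  let ?k1 = "\<lambda>a. e2 (\<psi>2 a) * K2 1 (\<psi>2 a)" and ?k2 = "\<lambda>a. e1 (\<psi>1 a) * K1 1 (\<psi>1 a)"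
  have "continuous_on {0..s2.L} ?k1"
    by (intro continuous_intros continuous_on_compose2[OF s2.cont s2.\<psi>_cont] continuous_on_compose2[OF kcont(2) s2.\<psi>_cont])
      (auto simp: s2.\<psi>_in[unfolded atLeastAtMost_iff])
  then have "uniformly_continuous_on {0..s2.L} ?k1" by (intro compact_uniformly_continuous) auto
  then obtain \<delta>1 where \<delta>1: "0 < \<delta>1" "\<And>x y. x \<in> {0..s2.L} \<Longrightarrow> y \<in> {0..s2.L} \<Longrightarrow> dist y x < \<delta>1 \<Longrightarrow> dist (?k1 y) (?k1 x) < \<omega>"
    unfolding uniformly_continuous_on_def using \<omega>(1) by metis
  have "continuous_on {0..s1.L} ?k2"
    by (intro continuous_intros continuous_on_compose2[OF s1.cont s1.\<psi>_cont] continuous_on_compose2[OF kcont(1) s1.\<psi>_cont])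
      (auto simp: s1.\<psi>_in[unfolded atLeastAtMost_iff])
  then have "uniformly_continuous_on {0..s1.L} ?k2" by (intro compact_uniformly_continuous) auto
  then obtain \<delta>2 where \<delta>2: "0 < \<delta>2" "\<And>x y. x \<in> {0..s1.L} \<Longrightarrow> y \<in> {0..s1.L} \<Longrightarrow> dist y x < \<delta>2 \<Longrightarrow> dist (?k2 y) (?k2 x) < \<omega>"
    unfolding uniformly_continuous_on_def using \<omega>(1) by metis
  define \<delta>0 where "\<delta>0 = min (min 1 (min s1.L s2.L)) (min (min (\<delta>1 / 2) (\<delta>2 / 2)) (\<epsilon> / (2 * (A + 1))))"
  have \<delta>0: "0 < \<delta>0" "\<delta>0 \<le> 1" "\<delta>0 \<le> s1.L" "\<delta>0 \<le> s2.L" "\<delta>0 < \<delta>1" "\<delta>0 < \<delta>2" "\<delta>0 \<le> \<epsilon> / (2 * (A + 1))"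
    unfolding \<delta>0_def using \<delta>1(1) \<delta>2(1) \<epsilon> A s1.L_pos s2.L_pos by auto
  show thesis
  proof (rule that[OF \<delta>0(1)])
    fix \<theta> q1 q2 \<delta>
    assume k: "kernel \<theta> q1 q2" and \<delta>: "0 \<le> \<delta>" "\<delta> \<le> \<delta>0" "\<delta> \<le> \<theta>"
    have in1: "0 \<le> \<psi>1 a \<and> \<psi>1 a < 1" if "0 < a" "a < s1.L" for a
      using that s1.\<psi>_le_iff[of a 0] s1.\<psi>_le_iff[of s1.L a] by (auto simp: not_le[symmetric] simp del: s1.\<psi>_le_iff)
    have "sqn {0..1} (\<lambda>x. q1 x \<delta> - q1 x 0) + sqn {0..1} (\<lambda>x. q2 x \<delta> - q2 x 0)
        \<le> ennreal (A * \<delta> + 2 * M * (s2.L + s1.L) * \<omega>\<^sup>2)"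
    proof (rule est)
      show "adj \<delta> q1 q2" by (rule hsys_mono[OF kernelD(2)[OF k] \<delta>(3)])
      show "q2 1 t = 0" if "0 < t" "t \<le> \<delta>" for t using kernelD(3)[OF k, of t] that \<delta> by auto
      show "\<bar>q1 y 0\<bar> \<le> M * B \<and> \<bar>q2 y 0\<bar> \<le> M * B" if "0 < y" "y < 1" for y by (rule kernel_init_bound[OF k that])
      show "\<bar>q1 (\<psi>2 (a - \<delta>)) 0 - q1 (\<psi>2 a) 0\<bar> \<le> \<omega>" if a: "\<delta> < a" "a < s2.L" for a
      proof -
        have "dist (?k1 (a - \<delta>)) (?k1 a) < \<omega>"
          using a \<delta> \<delta>0 by (intro \<delta>1(2)) (auto simp: dist_real_def)
        moreover have "\<psi>2 (a - \<delta>) \<in> {0..1}" "\<psi>2 a \<in> {0..1}" using a \<delta> by (auto intro!: s2.\<psi>_in simp del: atLeastAtMost_iff)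
        ultimately show ?thesis using kernelD(4)[OF k] by (auto simp: dist_real_def)
      qed
      show "\<bar>q2 (\<psi>1 (s1.L - (b - \<delta>))) 0 - q2 (\<psi>1 (s1.L - b)) 0\<bar> \<le> \<omega>" if b: "\<delta> < b" "b < s1.L" for b
      proof -
        have "dist (?k2 (s1.L - (b - \<delta>))) (?k2 (s1.L - b)) < \<omega>"
          using b \<delta> \<delta>0 by (intro \<delta>2(2)) (auto simp: dist_real_def)
        moreover have "0 \<le> \<psi>1 (s1.L - (b - \<delta>)) \<and> \<psi>1 (s1.L - (b - \<delta>)) < 1" using b \<delta> by (intro in1) auto
        moreover have "0 \<le> \<psi>1 (s1.L - b) \<and> \<psi>1 (s1.L - b) < 1" using b \<delta> by (intro in1) auto
        ultimately show ?thesis using kernelD(5)[OF k] by (auto simp: dist_real_def)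
      qed
    qed (use \<delta> \<delta>0 \<omega> in auto)
    also have "\<dots> \<le> ennreal \<epsilon>"
    proof (rule ennreal_leI)
      have "A * \<delta> \<le> (A + 1) * (\<epsilon> / (2 * (A + 1)))" using A \<delta> \<delta>0 by (intro mult_mono) auto
      also have "\<dots> = \<epsilon> / 2" using A by (simp add: field_simps)
      finally show "A * \<delta> + 2 * M * (s2.L + s1.L) * \<omega>\<^sup>2 \<le> \<epsilon>" using \<omega>(2) unfolding L_def by linarith
    qed
    finally show "sqn {0..1} (\<lambda>x. q1 x \<delta> - q1 x 0) + sqn {0..1} (\<lambda>x. q2 x \<delta> - q2 x 0) \<le> ennreal \<epsilon>" .
  qed
qed

text \<open>The control law in terms of \<open>q1\<close> and \<open>q2\<close>: since
  \<open>q1 1 \<sigma>\<close> is \<open>e2 1\<close> times the second kernel at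
  \<open>\<sigma> / \<theta>\<close> and \<open>y = 1\<close>, the weight
  \<open>\<theta> * q1 1 (\<theta> * (1 - y))\<close> is \<open>p_kernel\<close> at
  \<open>1 - y\<close>.\<close>

definition Ulaw where
  "Ulaw \<theta> q1 q2 u1 u2 v t = pair (\<lambda>x. u1 x t) (\<lambda>x. u2 x t) (\<lambda>x. q1 x \<theta>) (\<lambda>x. q2 x \<theta>)
    + (LBINT y:{0..1}. v y t * (\<theta> * q1 1 (\<theta> * (1 - y))))" for \<theta> :: real and q1 q2 u1 u2 v :: "real \<Rightarrow> real \<Rightarrow> real" and t

text \<open>In the delay line \<open>a = \<tau> * (1 - x)\<close> is the travel time from the
  actuated end \<open>x = 1\<close>, so the input enters at \<open>a = 0\<close>.\<close>

definition closed_loop where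
  "closed_loop T \<theta> q1 q2 u1 u2 v \<longleftrightarrow> sys T u1 u2 \<and> case_prod v \<in> borel_measurable (borel \<Otimes>\<^sub>M borel) \<and>
     straight \<tau> T (\<lambda>a t. v (1 - a / \<tau>) t) (\<lambda>_ _. 0) \<and>
     (\<integral>\<^sup>+t\<in>{0..T}. sqn {0..1} (\<lambda>x. v x t) \<partial>lborel) < \<infinity> \<and>
     (\<forall>t. 0 < t \<longrightarrow> t \<le> T \<longrightarrow> u2 1 t = v 0 t \<and> v 1 t = Ulaw \<theta> q1 q2 u1 u2 v t)"

definition nrm :: "(real \<Rightarrow> real \<Rightarrow> real) \<Rightarrow> (real \<Rightarrow> real \<Rightarrow> real) \<Rightarrow> (real \<Rightarrow> real \<Rightarrow> real) \<Rightarrow> real \<Rightarrow> ennreal" where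
  "nrm u1 u2 v t = sqn {0..1} (\<lambda>x. u1 x t) + sqn {0..1} (\<lambda>x. u2 x t) + sqn {0..1} (\<lambda>x. v x t)"

lemma closed_loopD:
  assumes "closed_loop T \<theta> q1 q2 u1 u2 v"
  shows "sys T u1 u2" "case_prod v \<in> borel_measurable (borel \<Otimes>\<^sub>M borel)"
    "straight \<tau> T (\<lambda>a t. v (1 - a / \<tau>) t) (\<lambda>_ _. 0)" "(\<integral>\<^sup>+t\<in>{0..T}. sqn {0..1} (\<lambda>x. v x t) \<partial>lborel) < \<infinity>"
    "\<And>t. 0 < t \<Longrightarrow> t \<le> T \<Longrightarrow> u2 1 t = v 0 t" "\<And>t. 0 < t \<Longrightarrow> t \<le> T \<Longrightarrow> v 1 t = Ulaw \<theta> q1 q2 u1 u2 v t"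
    "case_prod u1 \<in> borel_measurable (borel \<Otimes>\<^sub>M borel)" "case_prod u2 \<in> borel_measurable (borel \<Otimes>\<^sub>M borel)"
  using assms hsysD(1,2) unfolding closed_loop_def by blast+

lemma closed_loop_shift:
  assumes c: "closed_loop T \<theta> q1 q2 u1 u2 v" and t0: "0 \<le> t0"
  shows "closed_loop (T - t0) \<theta> q1 q2 (\<lambda>x t. u1 x (t0 + t)) (\<lambda>x t. u2 x (t0 + t)) (\<lambda>x t. v x (t0 + t))"
proof -
  note [measurable] = closed_loopD(2)[OF c]
  have [measurable]: "(\<lambda>t. sqn {0..1} (\<lambda>x. v x t)) \<in> borel_measurable borel" unfolding sqn_def by measurable
  have "(\<integral>\<^sup>+t\<in>{0..T - t0}. sqn {0..1} (\<lambda>x. v x (t0 + t)) \<partial>lborel) \<le> (\<integral>\<^sup>+t. sqn {0..1} (\<lambda>x. v x (t0 + t)) * indicator {0..T} (t0 + t) \<partial>lborel)"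
    using t0 by (intro nn_integral_mono) (auto simp: indicator_def)
  also have "\<dots> = (\<integral>\<^sup>+t\<in>{0..T}. sqn {0..1} (\<lambda>x. v x t) \<partial>lborel)" by (rule nn_integral_shift) measurable
  also have "\<dots> < \<infinity>" by (rule closed_loopD(4)[OF c])
  finally have fin: "(\<integral>\<^sup>+t\<in>{0..T - t0}. sqn {0..1} (\<lambda>x. v x (t0 + t)) \<partial>lborel) < \<infinity>" .
  have st: "straight \<tau> (T - t0) (\<lambda>a t. v (1 - a / \<tau>) (t0 + t)) (\<lambda>_ _. 0)"
    unfolding straight_def
  proof (intro allI impI)
    fix a t s :: real
    assume "0 \<le> a" "0 \<le> t" "0 \<le> s" "a + s \<le> \<tau>" "t + s \<le> T - t0"
    then show "set_integrable lborel {0..s} (\<lambda>r. 0 :: real) \<and> v (1 - (a + s) / \<tau>) (t0 + (t + s)) - v (1 - a / \<tau>) (t0 + t) = (LBINT r:{0..s}. (0 :: real))"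
      using straightD[OF closed_loopD(3)[OF c], of a "t0 + t" s] t0 by (simp add: add.assoc)
  qed
  show ?thesis
    unfolding closed_loop_def
    using fin st hsys_shift[OF closed_loopD(1)[OF c] t0] closed_loopD(5,6)[OF c] t0 by (auto simp: Ulaw_def)
qed

text \<open>Kernels and trace have uniformly bounded square norms, so the law is a bounded
  functional of the state. This turns a square-integrable state into an input that is bounded at
  every instant.\<close>

lemma Ulaw_bound:
  obtains c where "0 < c"
    "\<And>\<theta> q1 q2 u1 u2 v T t s. kernel \<theta> q1 q2 \<Longrightarrow> \<theta> \<le> \<tau> + 1 \<Longrightarrow> closed_loop T \<theta> q1 q2 u1 u2 v \<Longrightarrow> 0 \<le> s \<Longrightarrow>
      nrm u1 u2 v t \<le> ennreal s \<Longrightarrow> \<bar>Ulaw \<theta> q1 q2 u1 u2 v t\<bar> \<le> c * sqrt s"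
proof -
  obtain P where P: "0 < P" and b: "\<And>\<theta> q1 q2 \<sigma>. kernel \<theta> q1 q2 \<Longrightarrow> \<theta> \<le> \<tau> + 1 \<Longrightarrow> 0 \<le> \<sigma> \<Longrightarrow> \<sigma> \<le> \<theta> \<Longrightarrow>
      sqn {0..1} (\<lambda>x. q1 x \<sigma>) \<le> ennreal P \<and> sqn {0..1} (\<lambda>x. q2 x \<sigma>) \<le> ennreal P \<and> sqn {0..\<sigma>} (q1 1) \<le> ennreal P"
    using kernel_bound by blast
  define c where "c = 2 / m * sqrt P + sqrt ((\<tau> + 1) * P)"
  show thesis
  proof (rule that[of c])
    show "0 < c" unfolding c_def using P \<tau> s1.m(1) by (intro add_pos_pos) auto
    fix \<theta> q1 q2 u1 u2 v T t s
    assume k: "kernel \<theta> q1 q2" and \<theta>: "\<theta> \<le> \<tau> + 1" and c: "closed_loop T \<theta> q1 q2 u1 u2 v" and s: "0 \<le> s" "nrm u1 u2 v t \<le> ennreal s"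
    note [measurable] = kernelD(6,7)[OF k] closed_loopD(2,7,8)[OF c]
    have \<theta>0: "0 < \<theta>" by (rule kernelD(1)[OF k])
    have n: "sqn {0..1} (\<lambda>x. u1 x t) \<le> ennreal s" "sqn {0..1} (\<lambda>x. u2 x t) \<le> ennreal s" "sqn {0..1} (\<lambda>x. v x t) \<le> ennreal s"
      by (rule order_trans[OF _ s(2)]; simp add: nrm_def add.assoc add_increasing add_increasing2)+
    have p: "\<bar>pair (\<lambda>x. u1 x t) (\<lambda>x. u2 x t) (\<lambda>x. q1 x \<theta>) (\<lambda>x. q2 x \<theta>)\<bar> \<le> 2 / m * sqrt (s * P)"
      using b[OF k \<theta>, of \<theta>] \<theta>0 P by (intro pair_integrable(3) n s) auto
    have "sqn {0..1} (\<lambda>y. \<theta> * q1 1 (\<theta> * (1 - y))) = ennreal (\<theta>\<^sup>2) * sqn {0..1} (\<lambda>y. q1 1 (\<theta> * (1 - y)))"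
      by (rule sqn_cmult) measurable
    also have "sqn {0..1} (\<lambda>y. q1 1 (\<theta> * (1 - y))) = sqn {0..1} (\<lambda>y. q1 1 (\<theta> * y))"
      by (rule sqn_reflect) measurable
    \<comment> \<open>One of the two factors \<open>\<theta>\<close> is used up by rescaling the
      trace from \<open>{0..\<theta>}\<close> to the unit interval.\<close>
    also have "ennreal (\<theta>\<^sup>2) * \<dots> = ennreal \<theta> * sqn {0..\<theta>} (q1 1)"
      using \<theta>0 by (subst (2) sqn_scale) (auto simp: mult.assoc[symmetric] ennreal_mult[symmetric] power2_eq_square)
    also have "\<dots> \<le> ennreal (\<tau> + 1) * ennreal P"
      using b[OF k \<theta>, of \<theta>] \<theta>0 \<theta> by (intro mult_mono ennreal_leI) auto
    also have "\<dots> = ennreal ((\<tau> + 1) * P)" using P \<tau> by (simp add: ennreal_mult)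
    finally have qs: "sqn {0..1} (\<lambda>y. \<theta> * q1 1 (\<theta> * (1 - y))) \<le> ennreal ((\<tau> + 1) * P)" .
    have "\<bar>LBINT y:{0..1}. v y t * (\<theta> * q1 1 (\<theta> * (1 - y)))\<bar> \<le> sqrt (s * ((\<tau> + 1) * P))"
      using P \<tau> by (intro Cauchy_Schwarz_sqn(2) n(3) qs s) auto
    with p have "\<bar>Ulaw \<theta> q1 q2 u1 u2 v t\<bar> \<le> 2 / m * sqrt (s * P) + sqrt (s * ((\<tau> + 1) * P))"
      unfolding Ulaw_def by linarith
    also have "\<dots> = c * sqrt s"
      unfolding c_def real_sqrt_mult[of s] by (simp only: distrib_right distrib_left mult.commute mult.left_commute mult.assoc)
    finally show "\<bar>Ulaw \<theta> q1 q2 u1 u2 v t\<bar> \<le> c * sqrt s" .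
  qed
qed

text \<open>The delay line is a transport whose input \<open>v 1\<close> is bounded by the norm
  through \<open>Ulaw_bound\<close>, and its output drives \<open>u2\<close>. So the norm is bounded
  by its initial value plus its time integral, and Gronwall closes the loop.\<close>

lemma closed_loop_energy:
  assumes Tm: "0 \<le> Tm"
  obtains C where "0 < C"
    "\<And>\<theta> q1 q2 u1 u2 v T t. kernel \<theta> q1 q2 \<Longrightarrow> \<theta> \<le> \<tau> + 1 \<Longrightarrow> closed_loop T \<theta> q1 q2 u1 u2 v \<Longrightarrow> 0 \<le> t \<Longrightarrow> t \<le> T \<Longrightarrow> t \<le> Tm \<Longrightarrow>
      nrm u1 u2 v t \<le> ennreal C * nrm u1 u2 v 0"
proof -
  obtain E where E: "0 < E" and e:
    "\<And>u1 u2 T. 0 \<le> T \<Longrightarrow> T \<le> Tm \<Longrightarrow> sys T u1 u2 \<Longrightarrow>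
      sqn {0..1} (\<lambda>x. u1 x T) + sqn {0..1} (\<lambda>x. u2 x T) + sqn {0..T} (u2 0) + sqn {0..T} (u1 1)
        + (\<integral>\<^sup>+s\<in>{0..T}. (sqn {0..1} (\<lambda>x. u1 x s) + sqn {0..1} (\<lambda>x. u2 x s)) \<partial>lborel)
      \<le> ennreal E * (sqn {0..1} (\<lambda>x. u1 x 0) + sqn {0..1} (\<lambda>x. u2 x 0) + sqn {0..T} (u2 1))"
    using energy[OF Tm] by blast
  obtain c where c: "0 < c" and U: "\<And>\<theta> q1 q2 u1 u2 v T t s. kernel \<theta> q1 q2 \<Longrightarrow> \<theta> \<le> \<tau> + 1 \<Longrightarrow> closed_loop T \<theta> q1 q2 u1 u2 v \<Longrightarrow> 0 \<le> s \<Longrightarrow>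
      nrm u1 u2 v t \<le> ennreal s \<Longrightarrow> \<bar>Ulaw \<theta> q1 q2 u1 u2 v t\<bar> \<le> c * sqrt s"
    using Ulaw_bound by blast
  \<comment> \<open>\<open>w\<close> controls the delay line: \<open>straight_energy\<close> gives
    the factor 2, its initial content contributes \<open>\<tau>\<close>, its input
    \<open>c\<^sup>2\<close>. In \<open>A\<close> the summand \<open>E * (1 + w)\<close> belongs to
    \<open>u1\<close> and \<open>u2\<close>, and \<open>w / \<tau>\<close> to
    \<open>v\<close>.\<close>
  define w where "w = 2 * (\<tau> + c\<^sup>2)"
  define A where "A = E * (1 + w) + w / \<tau>"
  have w0: "0 < w" unfolding w_def using \<tau> by (simp add: add_pos_nonneg)
  have A0: "0 < A" unfolding A_def using E w0 \<tau> by (simp add: add_pos_pos)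
  define C where "C = A + A * (2 * Tm * exp (2 * A * Tm) * A)"
  show thesis
  proof (rule that[of C])
    show "0 < C" unfolding C_def using A0 Tm by (simp add: add_pos_nonneg)
    fix \<theta> q1 q2 u1 u2 v T t
    assume k: "kernel \<theta> q1 q2" and \<theta>: "\<theta> \<le> \<tau> + 1" and cl: "closed_loop T \<theta> q1 q2 u1 u2 v" and t: "0 \<le> t" "t \<le> T" "t \<le> Tm"
    note [measurable] = kernelD(6,7)[OF k] closed_loopD(2,7,8)[OF cl]
    let ?n = "nrm u1 u2 v"
    have [measurable]: "?n \<in> borel_measurable borel" unfolding nrm_def sqn_def by measurable
    have U2: "ennreal ((v 1 s)\<^sup>2) \<le> ennreal (c\<^sup>2) * ?n s" if s: "0 < s" "s \<le> T" for s
    proof (cases "?n s" rule: ennreal_cases)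
      case (real r)
      have "\<bar>v 1 s\<bar> \<le> c * sqrt r" using U[OF k \<theta> cl real(1), of s] real closed_loopD(6)[OF cl s] by simp
      then have "(v 1 s)\<^sup>2 \<le> (c * sqrt r)\<^sup>2" using c by (simp add: abs_le_square_iff[symmetric])
      also have "\<dots> = c\<^sup>2 * r" using real by (simp add: power_mult_distrib)
      finally show ?thesis using real by (simp add: ennreal_mult[symmetric] ennreal_leI)
    next
      case top
      then show ?thesis using c by (simp add: ennreal_mult_top)
    qed
    have step: "?n s \<le> ennreal A * (?n 0 + (\<integral>\<^sup>+r\<in>{0..s}. ?n r \<partial>lborel))" if s: "0 \<le> s" "s \<le> t" for s
    proof -
      let ?N = "?n 0 + (\<integral>\<^sup>+r\<in>{0..s}. ?n r \<partial>lborel)"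
      have V: "sqn {0..s} (v 1) \<le> ennreal (c\<^sup>2) * (\<integral>\<^sup>+r\<in>{0..s}. ?n r \<partial>lborel)"
      proof -
        have "sqn {0..s} (v 1) \<le> (\<integral>\<^sup>+r. ennreal (c\<^sup>2) * (?n r * indicator {0..s} r) \<partial>lborel)"
          unfolding sqn_def
        proof (rule nn_integral_mono_AE)
          show "AE r in lborel. ennreal ((v 1 r)\<^sup>2) * indicator {0..s} r \<le> ennreal (c\<^sup>2) * (?n r * indicator {0..s} r)"
            using AE_lborel_singleton[of 0]
          proof eventually_elim
            case (elim r)
            show ?case
            proof (cases "r \<in> {0..s}")
              case True
              then have "0 < r" "r \<le> T" using elim s t by auto
              from U2[OF this] show ?thesis using True by simp
            qed simp
          qed
        qed
        also have "\<dots> = ennreal (c\<^sup>2) * (\<integral>\<^sup>+r\<in>{0..s}. ?n r \<partial>lborel)" by (rule nn_integral_cmult) measurable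
        finally show ?thesis .
      qed
      have sts: "straight \<tau> s (\<lambda>a t. v (1 - a / \<tau>) t) (\<lambda>_ _. 0)"
        using straight_subset[OF closed_loopD(3)[OF cl]] s t by simp
      have d0: "dsq \<tau> s (\<lambda>_ _. 0) = 0" by (simp add: dsq_def sqn_def)
      have vt: "sqn {0..\<tau>} (\<lambda>a. v (1 - a / \<tau>) r) = ennreal \<tau> * sqn {0..1} (\<lambda>x. v x r)" for r
      proof -
        have "sqn {0..\<tau>} (\<lambda>a. v (1 - a / \<tau>) r) = ennreal \<tau> * sqn {0..1} (\<lambda>y. v (1 - (\<tau> * y) / \<tau>) r)"
          using \<tau> by (intro sqn_scale) auto
        also have "sqn {0..1} (\<lambda>y. v (1 - (\<tau> * y) / \<tau>) r) = sqn {0..1} (\<lambda>y. v (1 - y) r)" using \<tau> by simp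
        also have "\<dots> = sqn {0..1} (\<lambda>x. v x r)" by (rule sqn_reflect) measurable
        finally show ?thesis .
      qed
      have X: "2 * (sqn {0..\<tau>} (\<lambda>a. v (1 - a / \<tau>) 0) + sqn {0..s} (v 1)) \<le> ennreal w * ?N"
      proof -
        have "2 * (sqn {0..\<tau>} (\<lambda>a. v (1 - a / \<tau>) 0) + sqn {0..s} (v 1))
          \<le> 2 * (ennreal \<tau> * ?N + ennreal (c\<^sup>2) * ?N)"
        proof (intro mult_left_mono add_mono)
          show "sqn {0..\<tau>} (\<lambda>a. v (1 - a / \<tau>) 0) \<le> ennreal \<tau> * ?N"
            unfolding vt nrm_def by (intro mult_left_mono add_increasing2[OF zero_le] add_increasing[OF zero_le]) auto
          show "sqn {0..s} (v 1) \<le> ennreal (c\<^sup>2) * ?N"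
            by (rule order_trans[OF V]) (intro mult_left_mono add_increasing[OF zero_le], auto)
        qed auto
        also have "\<dots> = ennreal w * ?N"
          unfolding w_def using \<tau> by (simp add: ennreal_mult distrib_right mult.assoc)
        finally show ?thesis .
      qed
      have S1: "sqn {0..\<tau>} (\<lambda>a. v (1 - a / \<tau>) s) \<le> ennreal w * ?N"
        and S2: "sqn {0..s} (v 0) \<le> ennreal w * ?N"
        using straight_energy[OF sts _ _ s(1) less_imp_le[OF \<tau>]] X \<tau> unfolding d0 by auto
      have W: "sqn {0..s} (u2 1) \<le> ennreal w * ?N"
      proof -
        have "sqn {0..s} (u2 1) = ennreal (1\<^sup>2) * sqn {0..s} (v 0)"
          using closed_loopD(5)[OF cl] s t by (intro sqn_AE_mult) auto
        then show ?thesis using S2 by simp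
      qed
      have "sqn {0..1} (\<lambda>x. u1 x s) + sqn {0..1} (\<lambda>x. u2 x s)
        \<le> sqn {0..1} (\<lambda>x. u1 x s) + sqn {0..1} (\<lambda>x. u2 x s) + sqn {0..s} (u2 0) + sqn {0..s} (u1 1)
        + (\<integral>\<^sup>+r\<in>{0..s}. (sqn {0..1} (\<lambda>x. u1 x r) + sqn {0..1} (\<lambda>x. u2 x r)) \<partial>lborel)"
        by (simp add: add.assoc add_increasing2)
      also have "\<dots> \<le> ennreal E * (sqn {0..1} (\<lambda>x. u1 x 0) + sqn {0..1} (\<lambda>x. u2 x 0) + sqn {0..s} (u2 1))"
        using s t hsys_mono[OF closed_loopD(1)[OF cl], of s] by (intro e) auto
      also have "\<dots> \<le> ennreal E * (?N + ennreal w * ?N)"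
      proof (intro mult_left_mono add_mono[OF _ W])
        show "sqn {0..1} (\<lambda>x. u1 x 0) + sqn {0..1} (\<lambda>x. u2 x 0) \<le> ?N"
          unfolding nrm_def[of u1 u2 v 0] by (intro add_increasing2[OF zero_le] order_refl)
      qed simp
      also have "\<dots> = ennreal (E * (1 + w)) * ?N"
        using E w0 by (simp add: ennreal_mult distrib_left distrib_right mult.assoc)
      finally have n1: "sqn {0..1} (\<lambda>x. u1 x s) + sqn {0..1} (\<lambda>x. u2 x s) \<le> ennreal (E * (1 + w)) * ?N" .
      have n2: "sqn {0..1} (\<lambda>x. v x s) \<le> ennreal (w / \<tau>) * ?N"
      proof -
        have "sqn {0..1} (\<lambda>x. v x s) = ennreal (1 / \<tau>) * (ennreal \<tau> * sqn {0..1} (\<lambda>x. v x s))"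
          using \<tau> by (simp add: mult.assoc[symmetric] ennreal_mult[symmetric])
        also have "\<dots> \<le> ennreal (1 / \<tau>) * (ennreal w * ?N)"
          using S1 unfolding vt by (intro mult_left_mono) auto
        also have "\<dots> = ennreal (w / \<tau>) * ?N"
          using \<tau> w0 by (simp add: mult.assoc[symmetric] ennreal_mult[symmetric])
        finally show ?thesis .
      qed
      have "?n s \<le> ennreal (E * (1 + w)) * ?N + ennreal (w / \<tau>) * ?N"
        unfolding nrm_def[of u1 u2 v s] by (intro add_mono n1 n2)
      also have "\<dots> = ennreal A * ?N"
        unfolding A_def using E w0 \<tau> by (simp add: distrib_right)
      finally show ?thesis .
    qed
    have fin: "(\<integral>\<^sup>+r\<in>{0..t}. ?n r \<partial>lborel) < \<infinity>"
    proof -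
      have [measurable]: "(\<lambda>s. sqn {0..1} (\<lambda>x. v x s)) \<in> borel_measurable borel"
        "(\<lambda>s. sqn {0..1} (\<lambda>x. u1 x s)) \<in> borel_measurable borel" "(\<lambda>s. sqn {0..1} (\<lambda>x. u2 x s)) \<in> borel_measurable borel"
        unfolding sqn_def by measurable
      have "(\<integral>\<^sup>+r\<in>{0..t}. ?n r \<partial>lborel) \<le> (\<integral>\<^sup>+r. (sqn {0..1} (\<lambda>x. u1 x r) + sqn {0..1} (\<lambda>x. u2 x r)) * indicator {0..T} r
          + sqn {0..1} (\<lambda>x. v x r) * indicator {0..T} r \<partial>lborel)"
        using t by (intro nn_integral_mono) (auto simp: indicator_def nrm_def)
      also have "\<dots> = (\<integral>\<^sup>+r\<in>{0..T}. (sqn {0..1} (\<lambda>x. u1 x r) + sqn {0..1} (\<lambda>x. u2 x r)) \<partial>lborel) + (\<integral>\<^sup>+r\<in>{0..T}. sqn {0..1} (\<lambda>x. v x r) \<partial>lborel)"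
        by (rule nn_integral_add) measurable
      also have "\<dots> < \<infinity>" using closed_loopD(1,4)[OF cl] by (simp add: hsys_def)
      finally show ?thesis .
    qed
    have G: "(\<integral>\<^sup>+r\<in>{0..t}. ?n r \<partial>lborel) \<le> ennreal (2 * t * exp (2 * A * t)) * (ennreal A * ?n 0)"
      using step by (intro gronwall_nn[OF _ fin A0 t(1)]) (auto simp: distrib_left)
    also have "\<dots> \<le> ennreal (2 * Tm * exp (2 * A * Tm)) * (ennreal A * ?n 0)"
      using t A0 Tm by (intro mult_right_mono ennreal_leI mult_mono) auto
    finally have "?n t \<le> ennreal A * (?n 0 + ennreal (2 * Tm * exp (2 * A * Tm)) * (ennreal A * ?n 0))"
      using step[OF t(1) order_refl] by (meson add_left_mono mult_left_mono order_trans zero_le)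
    also have "\<dots> = ennreal C * ?n 0"
      unfolding C_def using A0 Tm by (simp add: ennreal_mult distrib_left distrib_right mult.assoc)
    finally show "?n t \<le> ennreal C * ?n 0" .
  qed
qed

end

text \<open>The denominators \<open>a + 1\<close> and \<open>c + 1\<close> stay positive when
  \<open>a\<close> or \<open>c\<close> is 0. Since the bound holds for all
  \<open>\<epsilon> \<le> \<epsilon>0\<close>, several such demands are met by a minimum.\<close>

lemma small_sqrt:
  fixes a c \<eta> :: real
  assumes "0 \<le> a" "0 \<le> c" "0 < \<eta>"
  obtains \<epsilon>0 where "0 < \<epsilon>0" "\<And>\<epsilon>. \<epsilon> \<le> \<epsilon>0 \<Longrightarrow> a * sqrt (c * \<epsilon>) \<le> \<eta>"
proof (rule that[of "(\<eta> / (a + 1))\<^sup>2 / (c + 1)"])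
  show "0 < (\<eta> / (a + 1))\<^sup>2 / (c + 1)" using assms by (auto intro!: divide_pos_pos)
  fix \<epsilon> assume "\<epsilon> \<le> (\<eta> / (a + 1))\<^sup>2 / (c + 1)"
  then have "c * \<epsilon> \<le> c * ((\<eta> / (a + 1))\<^sup>2 / (c + 1))" using assms by (intro mult_left_mono) auto
  also have "\<dots> \<le> 1 * (\<eta> / (a + 1))\<^sup>2"
  proof -
    have "c / (c + 1) * (\<eta> / (a + 1))\<^sup>2 \<le> 1 * (\<eta> / (a + 1))\<^sup>2" using assms by (intro mult_right_mono) auto
    then show ?thesis by simp
  qed
  finally have "sqrt (c * \<epsilon>) \<le> sqrt ((\<eta> / (a + 1))\<^sup>2)" by (intro real_sqrt_le_mono) simp
  also have "\<dots> = \<eta> / (a + 1)" using assms by simp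
  finally have "a * sqrt (c * \<epsilon>) \<le> a * (\<eta> / (a + 1))" using assms by (intro mult_left_mono) auto
  also have "\<dots> = a / (a + 1) * \<eta>" by simp
  also have "\<dots> \<le> 1 * \<eta>" using assms by (intro mult_right_mono) auto
  finally show "a * sqrt (c * \<epsilon>) \<le> \<eta>" by simp
qed

section \<open>The control law as an approximate prediction\<close>

context ctrl
begin

text \<open>The integral of \<open>K (1, y) u (y, t)\<close>, which \<beta> subtracts from the input
  trace; the factors \<open>e1\<close> and \<open>e2\<close> cancel those in
  \<open>pair\<close>.\<close>

definition gK where
  "gK u1 u2 t = pair (\<lambda>x. u1 x t) (\<lambda>x. u2 x t) (\<lambda>y. e2 y * K2 1 y) (\<lambda>y. e1 y * K1 1 y)"
  for u1 u2 :: "real \<Rightarrow> real \<Rightarrow> real" and t :: real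

lemma gK_kernel:
  assumes k: "kernel \<theta> q1 q2"
    and [measurable]: "case_prod u1 \<in> borel_measurable (borel \<Otimes>\<^sub>M borel)" "case_prod u2 \<in> borel_measurable (borel \<Otimes>\<^sub>M borel)"
  shows "gK u1 u2 t = pair (\<lambda>x. u1 x t) (\<lambda>x. u2 x t) (\<lambda>x. q1 x 0) (\<lambda>x. q2 x 0)"
proof -
  note [measurable] = kernelD(6,7)[OF k] km
  have "(LBINT x:{0..1}. u2 x t * (e2 x * K2 1 x) / e2 x) = (LBINT x:{0..1}. u2 x t * q1 x 0 / e2 x)"
    using kernelD(4)[OF k] by (intro set_lebesgue_integral_cong) auto
  moreover have "(LBINT x:{0..1}. u1 x t * (e1 x * K1 1 x) / e1 x) = (LBINT x:{0..1}. u1 x t * q2 x 0 / e1 x)"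
    unfolding set_lebesgue_integral_def
  proof (rule integral_cong_AE)
    show "AE x in lborel. indicator {0..1} x *\<^sub>R (u1 x t * (e1 x * K1 1 x) / e1 x) = indicator {0..1} x *\<^sub>R (u1 x t * q2 x 0 / e1 x)"
      using AE_lborel_singleton[of 1]
    proof eventually_elim
      case (elim x)
      show ?case
      proof (cases "x \<in> {0..1}")
        case True
        then have "x < 1" using elim by simp
        then show ?thesis using True kernelD(5)[OF k, of x] by simp
      qed simp
    qed
  qed measurable
  ultimately show ?thesis unfolding gK_def pair_def by simp
qed

text \<open>Both claims follow one characteristic of the delay line to \<open>x = 0\<close>,
  starting inside the line or at its actuated end.\<close>

lemma trace_delay:
  assumes c: "closed_loop T \<theta> q1 q2 u1 u2 v" and t: "0 \<le> t"
  shows "0 \<le> y \<Longrightarrow> y \<le> 1 \<Longrightarrow> t + \<tau> * y \<le> T \<Longrightarrow> v y t = v 0 (t + \<tau> * y)"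
    and "0 < t \<Longrightarrow> t + \<tau> \<le> T \<Longrightarrow> u2 1 (t + \<tau>) = Ulaw \<theta> q1 q2 u1 u2 v t"
proof -
  show a: "v y t = v 0 (t + \<tau> * y)" if "0 \<le> y" "y \<le> 1" "t + \<tau> * y \<le> T" for y
  proof -
    have "v (1 - (\<tau> * (1 - y) + \<tau> * y) / \<tau>) (t + \<tau> * y) - v (1 - \<tau> * (1 - y) / \<tau>) t = (LBINT r:{0..\<tau> * y}. (0 :: real))"
      using that t \<tau> by (intro straightD(2)[OF closed_loopD(3)[OF c]]) (auto simp: algebra_simps)
    moreover have "(\<tau> * (1 - y) + \<tau> * y) / \<tau> = 1" "\<tau> * (1 - y) / \<tau> = 1 - y" using \<tau> by (auto simp: field_simps)
    ultimately show ?thesis by simp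
  qed
  show "u2 1 (t + \<tau>) = Ulaw \<theta> q1 q2 u1 u2 v t" if "0 < t" "t + \<tau> \<le> T"
    using a[of 1] closed_loopD(5)[OF c, of "t + \<tau>"] closed_loopD(6)[OF c, of t] that \<tau> by simp
qed

text \<open>\<open>duality\<close> between the times \<open>t\<close> and \<open>t + h\<close>: the
  kernels at time \<open>h\<close> predict \<open>gK\<close> a time \<open>h\<close> ahead, given
  the input in between. The bound \<open>b\<close> makes that input square integrable.\<close>

lemma g_duality:
  assumes k: "kernel \<theta> q1 q2" and c: "closed_loop T \<theta> q1 q2 u1 u2 v"
    and t: "0 \<le> t" "t + h \<le> T" and h: "0 \<le> h" "h \<le> \<theta>"
    and fin: "nrm u1 u2 v t < top" and b: "\<And>s. t \<le> s \<Longrightarrow> s \<le> t + h \<Longrightarrow> \<bar>u2 1 s\<bar> \<le> b"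
  shows "gK u1 u2 (t + h) = pair (\<lambda>x. u1 x t) (\<lambda>x. u2 x t) (\<lambda>x. q1 x h) (\<lambda>x. q2 x h)
    + (LBINT s:{0..h}. u2 1 (t + s) * q1 1 (h - s))"
proof -
  have s: "sys h (\<lambda>x s. u1 x (t + s)) (\<lambda>x s. u2 x (t + s))"
    by (rule hsys_mono[OF hsys_shift[OF closed_loopD(1)[OF c] t(1)]]) (use t in simp)
  have q: "adj h q1 q2" by (rule hsys_mono[OF kernelD(2)[OF k] h(2)])
  have f: "sqn {0..1} (\<lambda>x. u1 x t) < top" "sqn {0..1} (\<lambda>x. u2 x t) < top"
    using fin by (auto simp: nrm_def less_top[symmetric])
  have w: "sqn {0..h} (\<lambda>s. u2 1 (t + s)) < top"
    using le_less_trans[OF sqn_const[of 0 h "\<lambda>s. u2 1 (t + s)" b]] h b by auto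
  have qf: "sqn {0..1} (\<lambda>x. q1 x 0) < top" "sqn {0..1} (\<lambda>x. q2 x 0) < top"
    using le_less_trans[OF sqn_const_open[of 0 1 "\<lambda>x. q1 x 0" "M * B"]] le_less_trans[OF sqn_const_open[of 0 1 "\<lambda>x. q2 x 0" "M * B"]]
      kernel_init_bound[OF k] by auto
  have "pair (\<lambda>x. u1 x (t + h)) (\<lambda>x. u2 x (t + h)) (\<lambda>x. q1 x 0) (\<lambda>x. q2 x 0)
    = pair (\<lambda>x. u1 x (t + 0)) (\<lambda>x. u2 x (t + 0)) (\<lambda>x. q1 x h) (\<lambda>x. q2 x h) + (LBINT s:{0..h}. u2 1 (t + s) * q1 1 (h - s))"
    using f w qf h kernelD(3)[OF k] by (intro duality[OF s q h(1)]) auto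
  then show ?thesis
    using gK_kernel[OF k closed_loopD(7,8)[OF c]] by simp
qed

text \<open>The kernel trace reversed in time and extended by zero. The input term of
  \<open>g_duality\<close> for \<open>h = \<theta>\<close> becomes the integral of the input against
  \<open>Qk\<close>, and translations and dilations act on the whole line.\<close>

definition Qk :: "real \<Rightarrow> (real \<Rightarrow> real \<Rightarrow> real) \<Rightarrow> real \<Rightarrow> real" where
  "Qk \<theta> q1 r = indicator {0..\<theta>} r * q1 1 (\<theta> - r)"

lemma Qk_L1:
  assumes k: "kernel \<theta> q1 q2" and P: "sqn {0..\<theta>} (q1 1) \<le> ennreal P" "0 \<le> P"
  shows "(\<integral>\<^sup>+r. ennreal \<bar>Qk \<theta> q1 r\<bar> \<partial>lborel) \<le> ennreal (sqrt (\<theta> * P))"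
    and "integrable lborel (Qk \<theta> q1)"
proof -
  note [measurable] = kernelD(6,7)[OF k]
  have "(\<integral>\<^sup>+r. ennreal \<bar>Qk \<theta> q1 r\<bar> \<partial>lborel) = (\<integral>\<^sup>+r. ennreal \<bar>q1 1 (\<theta> - r)\<bar> * indicator {0..\<theta>} (\<theta> - r) \<partial>lborel)"
    by (intro nn_integral_cong) (auto simp: Qk_def indicator_def)
  also have "\<dots> = (\<integral>\<^sup>+r. ennreal \<bar>q1 1 r\<bar> * indicator {0..\<theta>} r \<partial>lborel)" by (rule nn_integral_reflect) measurable
  also have "\<dots> \<le> ennreal (sqrt ((\<theta> - 0) * P))"
    using kernelD(1)[OF k] by (intro sqn_L1 P) auto
  finally show *: "(\<integral>\<^sup>+r. ennreal \<bar>Qk \<theta> q1 r\<bar> \<partial>lborel) \<le> ennreal (sqrt (\<theta> * P))" by simp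
  show "integrable lborel (Qk \<theta> q1)"
  proof (rule integrableI_bounded)
    show "Qk \<theta> q1 \<in> borel_measurable lborel" unfolding Qk_def[abs_def] by measurable
    show "(\<integral>\<^sup>+r. ennreal (norm (Qk \<theta> q1 r)) \<partial>lborel) < \<infinity>" using le_less_trans[OF *] by simp
  qed
qed

text \<open>Where both arguments lie in the support, the difference is that of the trace and its
  translate, the subject of \<open>translation_trace\<close>. The two end pieces have length
  \<open>\<delta>\<close> and contribute \<open>sqrt (\<delta> * P)\<close> each by
  Cauchy-Schwarz.\<close>

lemma Qk_translation:
  assumes k: "kernel \<theta> q1 q2" and P: "sqn {0..\<theta>} (q1 1) \<le> ennreal P" "0 \<le> P"
    and \<delta>: "0 \<le> \<delta>" "\<delta> \<le> \<theta>" and D: "sqn {0..\<theta> - \<delta>} (\<lambda>s. q1 1 (\<delta> + s) - q1 1 s) \<le> ennreal E" "0 \<le> E"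
  shows "(\<integral>\<^sup>+r. ennreal \<bar>Qk \<theta> q1 (r + \<delta>) - Qk \<theta> q1 r\<bar> \<partial>lborel) \<le> ennreal (2 * sqrt (\<delta> * P) + sqrt (\<theta> * E))"
proof -
  note [measurable] = kernelD(6,7)[OF k]
  let ?f = "q1 1"
  let ?A = "\<lambda>y. ennreal \<bar>?f y\<bar> * indicator {\<theta> - \<delta>..\<theta>} y"
  let ?B = "\<lambda>y. ennreal \<bar>?f y\<bar> * indicator {0..\<delta>} y"
  let ?C = "\<lambda>s. ennreal \<bar>?f (\<delta> + s) - ?f s\<bar> * indicator {0..\<theta> - \<delta>} s"
  have "(\<integral>\<^sup>+r. ennreal \<bar>Qk \<theta> q1 (r + \<delta>) - Qk \<theta> q1 r\<bar> \<partial>lborel)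
      \<le> (\<integral>\<^sup>+r. ?A ((\<theta> - \<delta>) - r) + ?B (\<theta> - r) + ?C ((\<theta> - \<delta>) - r) \<partial>lborel)"
  proof (rule nn_integral_mono)
    fix r
    consider "r < - \<delta>" | "- \<delta> \<le> r" "r < 0" | "0 \<le> r" "r \<le> \<theta> - \<delta>" | "\<theta> - \<delta> < r" "0 \<le> r" "r \<le> \<theta>" | "\<theta> < r" by linarith
    then show "ennreal \<bar>Qk \<theta> q1 (r + \<delta>) - Qk \<theta> q1 r\<bar> \<le> ?A ((\<theta> - \<delta>) - r) + ?B (\<theta> - r) + ?C ((\<theta> - \<delta>) - r)"
    proof cases
      case 2
      have "Qk \<theta> q1 r = 0" using 2 by (simp add: Qk_def)
      moreover have "\<bar>Qk \<theta> q1 (r + \<delta>)\<bar> = \<bar>?f ((\<theta> - \<delta>) - r)\<bar>" using 2 \<delta> by (auto simp: Qk_def algebra_simps)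
      moreover have "?A ((\<theta> - \<delta>) - r) = ennreal \<bar>?f ((\<theta> - \<delta>) - r)\<bar>" using 2 \<delta> by simp
      ultimately show ?thesis by (simp add: add_increasing2 add.assoc)
    next
      case 3
      have "Qk \<theta> q1 r = ?f (\<delta> + ((\<theta> - \<delta>) - r))" using 3 \<delta> by (simp add: Qk_def)
      moreover have "Qk \<theta> q1 (r + \<delta>) = ?f ((\<theta> - \<delta>) - r)" using 3 \<delta> by (simp add: Qk_def algebra_simps)
      moreover have "?C ((\<theta> - \<delta>) - r) = ennreal \<bar>?f (\<delta> + ((\<theta> - \<delta>) - r)) - ?f ((\<theta> - \<delta>) - r)\<bar>" using 3 by simp
      ultimately show ?thesis by (simp add: abs_minus_commute add_increasing)
    next
      case 4
      have "\<bar>Qk \<theta> q1 r\<bar> = \<bar>?f (\<theta> - r)\<bar>" using 4 by (simp add: Qk_def)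
      moreover have "Qk \<theta> q1 (r + \<delta>) = 0" using 4 by (simp add: Qk_def)
      moreover have "?B (\<theta> - r) = ennreal \<bar>?f (\<theta> - r)\<bar>" using 4 by simp
      ultimately show ?thesis by (simp add: add_increasing2 add_increasing add.assoc)
    qed (use \<delta> in \<open>auto simp: Qk_def\<close>)
  qed
  also have "\<dots> = (\<integral>\<^sup>+r. ?A ((\<theta> - \<delta>) - r) \<partial>lborel) + (\<integral>\<^sup>+r. ?B (\<theta> - r) \<partial>lborel) + (\<integral>\<^sup>+r. ?C ((\<theta> - \<delta>) - r) \<partial>lborel)"
    by (simp add: nn_integral_add)
  also have "(\<integral>\<^sup>+r. ?A ((\<theta> - \<delta>) - r) \<partial>lborel) = (\<integral>\<^sup>+r. ?A r \<partial>lborel)" by (rule nn_integral_reflect) measurable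
  also have "(\<integral>\<^sup>+r. ?B (\<theta> - r) \<partial>lborel) = (\<integral>\<^sup>+r. ?B r \<partial>lborel)" by (rule nn_integral_reflect) measurable
  also have "(\<integral>\<^sup>+r. ?C ((\<theta> - \<delta>) - r) \<partial>lborel) = (\<integral>\<^sup>+r. ?C r \<partial>lborel)" by (rule nn_integral_reflect) measurable
  also have "(\<integral>\<^sup>+r. ?A r \<partial>lborel) + (\<integral>\<^sup>+r. ?B r \<partial>lborel) + (\<integral>\<^sup>+r. ?C r \<partial>lborel)
    \<le> ennreal (sqrt ((\<theta> - (\<theta> - \<delta>)) * P)) + ennreal (sqrt ((\<delta> - 0) * P)) + ennreal (sqrt ((\<theta> - \<delta> - 0) * E))"
  proof (intro add_mono sqn_L1)
    show "sqn {\<theta> - \<delta>..\<theta>} (q1 1) \<le> ennreal P" "sqn {0..\<delta>} (q1 1) \<le> ennreal P"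
      by (rule order_trans[OF sqn_mono_set P(1)]; use \<delta> in auto)+
  qed (use P D \<delta> in auto)
  also have "\<dots> \<le> ennreal (2 * sqrt (\<delta> * P) + sqrt (\<theta> * E))"
  proof -
    have "(\<theta> - \<delta>) * E \<le> \<theta> * E" using D \<delta> by (intro mult_right_mono) auto
    then have "sqrt ((\<theta> - \<delta>) * E) \<le> sqrt (\<theta> * E)" by simp
    then show ?thesis using P D \<delta> by (simp add: ennreal_plus[symmetric] ennreal_leI del: ennreal_plus)
  qed
  finally show ?thesis .
qed

text \<open>Both sides contain the same pairing with the state, so only the input integrals differ.
  The delay line stores the coming input, \<open>v y t = u2 1 (t + \<tau> * y)\<close>; with
  \<open>\<kappa> = \<theta> / \<tau>\<close> the law weights it with \<open>\<kappa> * Qk\<close>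
  at \<open>\<kappa> * r\<close>, the prediction with \<open>Qk\<close> at \<open>r\<close>. As the
  input is bounded, the \<open>L^1\<close> distance of the weights decides.\<close>

lemma Ulaw_minus_g:
  assumes k: "kernel \<theta> q1 q2" and \<theta>: "\<theta> \<le> \<tau> + 1" and c: "closed_loop T \<theta> q1 q2 u1 u2 v"
    and t: "0 < t" "t + \<tau> + 1 \<le> T" and fin: "nrm u1 u2 v t < top"
    and b: "\<And>s. t \<le> s \<Longrightarrow> s \<le> T \<Longrightarrow> \<bar>u2 1 s\<bar> \<le> b" and b0: "0 \<le> b"
    and P: "sqn {0..\<theta>} (q1 1) \<le> ennreal P" "0 \<le> P"
    and W: "(\<integral>\<^sup>+r. ennreal \<bar>Qk \<theta> q1 (\<theta> / \<tau> * r) - Qk \<theta> q1 r\<bar> \<partial>lborel) \<le> ennreal W" "0 \<le> W"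
  shows "\<bar>Ulaw \<theta> q1 q2 u1 u2 v t - gK u1 u2 (t + \<theta>)\<bar> \<le> b * (\<theta> / \<tau> * W + \<bar>\<theta> / \<tau> - 1\<bar> * sqrt (\<theta> * P))"
proof -
  note [measurable] = kernelD(6,7)[OF k] closed_loopD(2,7,8)[OF c]
  have \<theta>0: "0 < \<theta>" by (rule kernelD(1)[OF k])
  let ?\<kappa> = "\<theta> / \<tau>" and ?Q = "Qk \<theta> q1"
  have \<kappa>0: "0 < ?\<kappa>" using \<theta>0 \<tau> by simp
  have [measurable]: "?Q \<in> borel_measurable borel" unfolding Qk_def[abs_def] by measurable
  \<comment> \<open>The cut at \<open>\<tau> + 1\<close> lies beyond both supports, which end at
    \<open>\<tau>\<close> and at \<open>\<theta>\<close>.\<close>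
  define w where "w r = indicator {0..\<tau> + 1} r * u2 1 (t + r)" for r
  have wm [measurable]: "w \<in> borel_measurable borel" unfolding w_def by measurable
  have wb: "\<bar>w r\<bar> \<le> b" for r
    using b[of "t + r"] t b0 \<tau> by (auto simp: w_def indicator_def)
  have iQ: "integrable lborel ?Q" by (rule Qk_L1(2)[OF k P])
  have iQ\<kappa>: "integrable lborel (\<lambda>r. ?Q (?\<kappa> * r))"
    using lborel_integrable_real_affine[OF iQ, of ?\<kappa> 0] \<theta>0 \<tau> by simp
  have iw: "integrable lborel (\<lambda>r. w r * f r)" if "integrable lborel f" for f
  proof (rule Bochner_Integration.integrable_bound[of lborel "\<lambda>r. b * f r"])
    show "integrable lborel (\<lambda>r. b * f r)" using that by simp
    show "(\<lambda>r. w r * f r) \<in> borel_measurable lborel" using that by (auto dest: borel_measurable_integrable)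
    show "AE r in lborel. norm (w r * f r) \<le> norm (b * f r)"
      using wb b0 by (auto simp: abs_mult intro!: mult_right_mono)
  qed
  have "(LBINT y:{0..1}. v y t * (\<theta> * q1 1 (\<theta> * (1 - y)))) = (LINT y|lborel. \<tau> * (w (\<tau> * y) * (?\<kappa> * ?Q (?\<kappa> * (\<tau> * y)))))"
    unfolding set_lebesgue_integral_def
  proof (rule Bochner_Integration.integral_cong[OF refl])
    fix y
    show "indicator {0..1} y *\<^sub>R (v y t * (\<theta> * q1 1 (\<theta> * (1 - y)))) = \<tau> * (w (\<tau> * y) * (?\<kappa> * ?Q (?\<kappa> * (\<tau> * y))))"
    proof (cases "y \<in> {0..1}")
      case True
      have y: "0 \<le> \<tau> * y" "\<tau> * y \<le> \<tau> * 1" using True \<tau> by (auto intro!: mult_left_mono)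
      have 1: "v y t = u2 1 (t + \<tau> * y)"
        using trace_delay(1)[OF c, of t y] closed_loopD(5)[OF c, of "t + \<tau> * y"] True t y by simp
      have 2: "w (\<tau> * y) = u2 1 (t + \<tau> * y)" using y by (simp add: w_def)
      have "\<theta> * y \<le> \<theta> * 1" using True \<theta>0 by (intro mult_left_mono) auto
      then have 3: "?Q (?\<kappa> * (\<tau> * y)) = q1 1 (\<theta> * (1 - y))"
        using True \<theta>0 \<tau> by (simp add: Qk_def algebra_simps)
      show ?thesis unfolding 1 2 3 using True \<tau> by simp
    next
      case False
      then have "\<theta> * y \<notin> {0..\<theta>}" using \<theta>0 by (auto simp: zero_le_mult_iff)
      then have "?Q (?\<kappa> * (\<tau> * y)) = 0" using \<tau> by (simp add: Qk_def)
      then show ?thesis using False by simp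
    qed
  qed
  also have "\<dots> = (LINT r|lborel. w r * (?\<kappa> * ?Q (?\<kappa> * r)))"
    using lborel_integral_real_affine[of \<tau> "\<lambda>r. w r * (?\<kappa> * ?Q (?\<kappa> * r))" 0] \<tau> by simp
  finally have I1: "(LBINT y:{0..1}. v y t * (\<theta> * q1 1 (\<theta> * (1 - y)))) = (LINT r|lborel. w r * (?\<kappa> * ?Q (?\<kappa> * r)))" .
  have I2: "(LBINT s:{0..\<theta>}. u2 1 (t + s) * q1 1 (\<theta> - s)) = (LINT r|lborel. w r * ?Q r)"
    unfolding set_lebesgue_integral_def
    by (rule Bochner_Integration.integral_cong) (use \<theta> in \<open>auto simp: w_def Qk_def indicator_def\<close>)
  have G: "gK u1 u2 (t + \<theta>) = pair (\<lambda>x. u1 x t) (\<lambda>x. u2 x t) (\<lambda>x. q1 x \<theta>) (\<lambda>x. q2 x \<theta>)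
    + (LBINT s:{0..\<theta>}. u2 1 (t + s) * q1 1 (\<theta> - s))"
    using t \<theta> \<theta>0 by (intro g_duality[OF k c _ _ _ _ fin b]) auto
  have "Ulaw \<theta> q1 q2 u1 u2 v t - gK u1 u2 (t + \<theta>) = (LINT r|lborel. w r * (?\<kappa> * ?Q (?\<kappa> * r))) - (LINT r|lborel. w r * ?Q r)"
    unfolding Ulaw_def G I1 I2 by simp
  also have "\<dots> = (LINT r|lborel. w r * (?\<kappa> * ?Q (?\<kappa> * r)) - w r * ?Q r)"
    using iw[OF iQ] iw[OF integrable_mult_right[OF iQ\<kappa>, of ?\<kappa>]] by (intro Bochner_Integration.integral_diff[symmetric]) auto
  finally have eq: "Ulaw \<theta> q1 q2 u1 u2 v t - gK u1 u2 (t + \<theta>) = (LINT r|lborel. w r * (?\<kappa> * ?Q (?\<kappa> * r)) - w r * ?Q r)" .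
  have int: "integrable lborel (\<lambda>r. w r * (?\<kappa> * ?Q (?\<kappa> * r)) - w r * ?Q r)"
    using iw[OF iQ] iw[OF integrable_mult_right[OF iQ\<kappa>, of ?\<kappa>]] by (intro Bochner_Integration.integrable_diff) auto
  have "ennreal \<bar>Ulaw \<theta> q1 q2 u1 u2 v t - gK u1 u2 (t + \<theta>)\<bar> \<le> (\<integral>\<^sup>+r. ennreal \<bar>w r * (?\<kappa> * ?Q (?\<kappa> * r)) - w r * ?Q r\<bar> \<partial>lborel)"
    unfolding eq using integral_norm_bound_ennreal[OF int] by simp
  also have "\<dots> \<le> (\<integral>\<^sup>+r. ennreal b * (ennreal ?\<kappa> * ennreal \<bar>?Q (?\<kappa> * r) - ?Q r\<bar> + ennreal \<bar>?\<kappa> - 1\<bar> * ennreal \<bar>?Q r\<bar>) \<partial>lborel)"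
  proof (rule nn_integral_mono)
    fix r
    \<comment> \<open>The difference of the weights is split into a dilation error and a change of
      amplitude.\<close>
    have "\<bar>w r * (?\<kappa> * ?Q (?\<kappa> * r)) - w r * ?Q r\<bar> = \<bar>w r\<bar> * \<bar>?\<kappa> * (?Q (?\<kappa> * r) - ?Q r) + (?\<kappa> - 1) * ?Q r\<bar>"
      unfolding abs_mult[symmetric] by (simp add: algebra_simps)
    also have "\<dots> \<le> b * (?\<kappa> * \<bar>?Q (?\<kappa> * r) - ?Q r\<bar> + \<bar>?\<kappa> - 1\<bar> * \<bar>?Q r\<bar>)"
    proof (intro mult_mono wb b0)
      have "\<bar>?\<kappa> * (?Q (?\<kappa> * r) - ?Q r) + (?\<kappa> - 1) * ?Q r\<bar> \<le> \<bar>?\<kappa> * (?Q (?\<kappa> * r) - ?Q r)\<bar> + \<bar>(?\<kappa> - 1) * ?Q r\<bar>"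
        by (rule abs_triangle_ineq)
      also have "\<dots> = ?\<kappa> * \<bar>?Q (?\<kappa> * r) - ?Q r\<bar> + \<bar>?\<kappa> - 1\<bar> * \<bar>?Q r\<bar>"
        unfolding abs_mult using \<theta>0 \<tau> by simp
      finally show "\<bar>?\<kappa> * (?Q (?\<kappa> * r) - ?Q r) + (?\<kappa> - 1) * ?Q r\<bar> \<le> ?\<kappa> * \<bar>?Q (?\<kappa> * r) - ?Q r\<bar> + \<bar>?\<kappa> - 1\<bar> * \<bar>?Q r\<bar>" .
    qed auto
    finally have "ennreal \<bar>w r * (?\<kappa> * ?Q (?\<kappa> * r)) - w r * ?Q r\<bar> \<le> ennreal (b * (?\<kappa> * \<bar>?Q (?\<kappa> * r) - ?Q r\<bar> + \<bar>?\<kappa> - 1\<bar> * \<bar>?Q r\<bar>))"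
      by (rule ennreal_leI)
    also have "\<dots> = ennreal b * (ennreal ?\<kappa> * ennreal \<bar>?Q (?\<kappa> * r) - ?Q r\<bar> + ennreal \<bar>?\<kappa> - 1\<bar> * ennreal \<bar>?Q r\<bar>)"
      using b0 \<kappa>0 by (simp only: ennreal_mult[symmetric] ennreal_plus[symmetric] mult_nonneg_nonneg add_nonneg_nonneg abs_ge_zero less_imp_le)
    finally show "ennreal \<bar>w r * (?\<kappa> * ?Q (?\<kappa> * r)) - w r * ?Q r\<bar>
      \<le> ennreal b * (ennreal ?\<kappa> * ennreal \<bar>?Q (?\<kappa> * r) - ?Q r\<bar> + ennreal \<bar>?\<kappa> - 1\<bar> * ennreal \<bar>?Q r\<bar>)" .
  qed
  also have "\<dots> = ennreal b * (ennreal ?\<kappa> * (\<integral>\<^sup>+r. ennreal \<bar>?Q (?\<kappa> * r) - ?Q r\<bar> \<partial>lborel) + ennreal \<bar>?\<kappa> - 1\<bar> * (\<integral>\<^sup>+r. ennreal \<bar>?Q r\<bar> \<partial>lborel))"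
    by (simp add: nn_integral_cmult nn_integral_add)
  also have "\<dots> \<le> ennreal b * (ennreal ?\<kappa> * ennreal W + ennreal \<bar>?\<kappa> - 1\<bar> * ennreal (sqrt (\<theta> * P)))"
    by (intro mult_left_mono add_mono W Qk_L1(1)[OF k P]) auto
  also have "\<dots> = ennreal (b * (?\<kappa> * W + \<bar>?\<kappa> - 1\<bar> * sqrt (\<theta> * P)))"
    using b0 \<kappa>0 W P \<theta>0 by (simp only: ennreal_mult[symmetric] ennreal_plus[symmetric] mult_nonneg_nonneg add_nonneg_nonneg abs_ge_zero less_imp_le real_sqrt_ge_zero)
  finally show ?thesis
    using b0 \<tau> W P \<theta>0 by (subst (asm) ennreal_le_iff) (auto intro!: mult_nonneg_nonneg add_nonneg_nonneg)
qed

end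

section \<open>Smallness of the trace \<beta>\<close>

context ctrl
begin

text \<open>The input at \<open>t + \<tau>\<close> is the law at time \<open>t\<close>, which
  approximates \<open>gK\<close> at \<open>t + \<theta>\<close>. Passing from
  \<open>t + \<theta>\<close> to \<open>t + \<tau>\<close> is again a prediction, over the short
  time \<open>\<bar>\<theta> - \<tau>\<bar>\<close>, for which the kernels are close to their
  initial values. As \<open>\<tau> < t\<close>, all inputs involved are values of the law and hence
  bounded.\<close>

lemma beta_small:
  assumes \<eta>: "0 < \<eta>" and Tm: "0 \<le> Tm"
  obtains \<Delta> where "0 < \<Delta>" "\<Delta> \<le> 1"
    "\<And>\<theta> q1 q2 u1 u2 v T t s. kernel \<theta> q1 q2 \<Longrightarrow> \<bar>\<theta> - \<tau>\<bar> \<le> \<Delta> \<Longrightarrow> closed_loop T \<theta> q1 q2 u1 u2 v \<Longrightarrow> T \<le> Tm \<Longrightarrow>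
      0 \<le> s \<Longrightarrow> nrm u1 u2 v 0 \<le> ennreal s \<Longrightarrow> \<tau> < t \<Longrightarrow> t + \<tau> + 1 \<le> T \<Longrightarrow>
      \<bar>u2 1 (t + \<tau>) - gK u1 u2 (t + \<tau>)\<bar> \<le> \<eta> * sqrt s"
proof -
  obtain P where P: "0 < P" and kb: "\<And>\<theta> q1 q2 \<sigma>. kernel \<theta> q1 q2 \<Longrightarrow> \<theta> \<le> \<tau> + 1 \<Longrightarrow> 0 \<le> \<sigma> \<Longrightarrow> \<sigma> \<le> \<theta> \<Longrightarrow>
      sqn {0..1} (\<lambda>x. q1 x \<sigma>) \<le> ennreal P \<and> sqn {0..1} (\<lambda>x. q2 x \<sigma>) \<le> ennreal P \<and> sqn {0..\<sigma>} (q1 1) \<le> ennreal P"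
    using kernel_bound by blast
  obtain CE where CE: "0 < CE" and ce: "\<And>\<theta> q1 q2 u1 u2 v T t. kernel \<theta> q1 q2 \<Longrightarrow> \<theta> \<le> \<tau> + 1 \<Longrightarrow> closed_loop T \<theta> q1 q2 u1 u2 v \<Longrightarrow> 0 \<le> t \<Longrightarrow> t \<le> T \<Longrightarrow> t \<le> Tm \<Longrightarrow>
      nrm u1 u2 v t \<le> ennreal CE * nrm u1 u2 v 0"
    using closed_loop_energy[OF Tm] by blast
  obtain cU where cU: "0 < cU" and U: "\<And>\<theta> q1 q2 u1 u2 v T t s. kernel \<theta> q1 q2 \<Longrightarrow> \<theta> \<le> \<tau> + 1 \<Longrightarrow> closed_loop T \<theta> q1 q2 u1 u2 v \<Longrightarrow> 0 \<le> s \<Longrightarrow>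
      nrm u1 u2 v t \<le> ennreal s \<Longrightarrow> \<bar>Ulaw \<theta> q1 q2 u1 u2 v t\<bar> \<le> cU * sqrt s"
    using Ulaw_bound by blast
  have "0 \<le> \<tau> + 1" using \<tau> by simp
  from a.translation_trace[OF this] obtain CT where CT: "0 < CT" and ct:
    "\<And>q1 q2 T \<delta>. 0 \<le> \<delta> \<Longrightarrow> \<delta> \<le> T \<Longrightarrow> T \<le> \<tau> + 1 \<Longrightarrow> adj T q1 q2 \<Longrightarrow> (\<And>t. 0 < t \<Longrightarrow> t \<le> T \<Longrightarrow> q2 1 t = 0) \<Longrightarrow>
      sqn {0..T - \<delta>} (\<lambda>s. q1 1 (\<delta> + s) - q1 1 s)
      \<le> ennreal CT * (sqn {0..1} (\<lambda>x. q1 x \<delta> - q1 x 0) + sqn {0..1} (\<lambda>x. q2 x \<delta> - q2 x 0))"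
    by blast
  define b where "b = cU * sqrt CE"
  have b0: "0 < b" unfolding b_def using cU CE by simp
  \<comment> \<open>There are five errors: two in the passage from \<open>t + \<theta>\<close> to
    \<open>t + \<tau>\<close> (state and input), two from the dilation (interior and end pieces),
    and one from the factor \<open>\<theta> / \<tau> - 1\<close>.\<close>
  have e5: "0 < \<eta> / 5" using \<eta> by simp
  obtain \<epsilon>1 where \<epsilon>1: "0 < \<epsilon>1" "\<And>\<epsilon>. \<epsilon> \<le> \<epsilon>1 \<Longrightarrow> 2 / m * sqrt (CE * \<epsilon>) \<le> \<eta> / 5"
    using small_sqrt[of "2 / m" CE "\<eta> / 5"] s1.m(1) CE e5 by auto
  \<comment> \<open>\<open>14 = 2 * 7\<close>: the 7 of \<open>dilation_L1\<close> and the bound 2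
    for \<open>\<theta> / \<tau>\<close>. In the 28 below a further 2 counts the end pieces in
    \<open>Qk_translation\<close>.\<close>
  obtain \<epsilon>2 where \<epsilon>2: "0 < \<epsilon>2" "\<And>\<epsilon>. \<epsilon> \<le> \<epsilon>2 \<Longrightarrow> 14 * b * sqrt ((\<tau> + 1) * CT * \<epsilon>) \<le> \<eta> / 5"
    using small_sqrt[of "14 * b" "(\<tau> + 1) * CT" "\<eta> / 5"] b0 \<tau> CT e5 by auto
  \<comment> \<open>The order of choices matters: \<open>\<delta>0\<close> depends on
    \<open>\<epsilon>\<close>, \<open>h\<close> on \<open>\<delta>0\<close>, and
    \<open>\<Delta>\<close> on all of them.\<close>
  define \<epsilon> where "\<epsilon> = min \<epsilon>1 \<epsilon>2"
  have \<epsilon>: "0 < \<epsilon>" "2 / m * sqrt (CE * \<epsilon>) \<le> \<eta> / 5" "14 * b * sqrt ((\<tau> + 1) * CT * \<epsilon>) \<le> \<eta> / 5"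
    using \<epsilon>1 \<epsilon>2 by (auto simp: \<epsilon>_def)
  obtain \<delta>0 where \<delta>0: "0 < \<delta>0" and mo: "\<And>\<theta> q1 q2 \<delta>. kernel \<theta> q1 q2 \<Longrightarrow> 0 \<le> \<delta> \<Longrightarrow> \<delta> \<le> \<delta>0 \<Longrightarrow> \<delta> \<le> \<theta> \<Longrightarrow>
      sqn {0..1} (\<lambda>x. q1 x \<delta> - q1 x 0) + sqn {0..1} (\<lambda>x. q2 x \<delta> - q2 x 0) \<le> ennreal \<epsilon>"
    using kernel_modulus[OF \<epsilon>(1)] by blast
  obtain h1 where h1: "0 < h1" "\<And>h. h \<le> h1 \<Longrightarrow> 28 * b * sqrt (3 * P * h) \<le> \<eta> / 5"
    using small_sqrt[of "28 * b" "3 * P" "\<eta> / 5"] b0 P e5 by auto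
  \<comment> \<open>\<open>6 * h \<le> \<tau>\<close> gives \<open>3 * h \<le> \<theta>\<close>,
    because \<open>\<theta>\<close> will be at least \<open>\<tau> / 2\<close>; so all translations
    needed stay within the time interval of the kernel.\<close>
  define h where "h = min h1 (min (\<delta>0 / 3) (\<tau> / 6))"
  have h: "0 < h" "28 * b * sqrt (3 * P * h) \<le> \<eta> / 5" "3 * h \<le> \<delta>0" "6 * h \<le> \<tau>"
    using h1 \<delta>0 \<tau> by (auto simp: h_def min_def)
  obtain \<Delta>1 where \<Delta>1: "0 < \<Delta>1" "\<And>\<Delta>. \<Delta> \<le> \<Delta>1 \<Longrightarrow> b * sqrt (P * \<Delta>) \<le> \<eta> / 5"
    using small_sqrt[of b P "\<eta> / 5"] b0 P e5 by auto
  \<comment> \<open>\<open>\<Delta> \<le> \<tau> * h / k1\<close> will ensure the displacement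
    condition of \<open>dilation_L1\<close>. \<open>k2\<close> dominates the coefficient of
    \<open>\<bar>\<theta> / \<tau> - 1\<bar>\<close>; its summand 1 makes it positive.\<close>
  define k1 where "k1 = 2 * (\<tau> + 1) + 2 * h"
  define k2 where "k2 = b * sqrt ((\<tau> + 1) * P) + 1"
  have kk: "0 < k1" "0 < k2" unfolding k1_def k2_def using \<tau> h b0 P by (auto intro!: add_nonneg_pos)
  define \<Delta> where "\<Delta> = min (min \<Delta>1 \<delta>0) (min (min (\<tau> / 2) 1) (min (\<tau> * h / k1) (\<tau> * (\<eta> / 5) / k2)))"
  have "0 < \<Delta>" unfolding \<Delta>_def using \<Delta>1(1) \<delta>0 \<tau> h(1) kk \<eta> by simp
  moreover have "\<Delta> \<le> \<Delta>1" "\<Delta> \<le> \<delta>0" "\<Delta> \<le> \<tau> / 2" "\<Delta> \<le> 1" "\<Delta> \<le> \<tau> * h / k1" "\<Delta> \<le> \<tau> * (\<eta> / 5) / k2"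
    unfolding \<Delta>_def by (simp_all only: min_le_iff_disj order_refl simp_thms)
  ultimately have \<Delta>: "0 < \<Delta>" "\<Delta> \<le> \<Delta>1" "\<Delta> \<le> \<delta>0" "\<Delta> \<le> \<tau> / 2" "\<Delta> \<le> 1" "\<Delta> \<le> \<tau> * h / k1" "\<Delta> \<le> \<tau> * (\<eta> / 5) / k2"
    by blast+
  show thesis
  proof (rule that[OF \<Delta>(1,5)])
    fix \<theta> q1 q2 u1 u2 v T t s
    assume k: "kernel \<theta> q1 q2" and \<theta>\<Delta>: "\<bar>\<theta> - \<tau>\<bar> \<le> \<Delta>" and c: "closed_loop T \<theta> q1 q2 u1 u2 v" and T: "T \<le> Tm"
      and s: "0 \<le> s" "nrm u1 u2 v 0 \<le> ennreal s" and t: "\<tau> < t" "t + \<tau> + 1 \<le> T"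
    note [measurable] = kernelD(6,7)[OF k] closed_loopD(2,7,8)[OF c]
    have \<theta>: "\<theta> \<le> \<tau> + 1" "\<tau> / 2 \<le> \<theta>" "0 < \<theta>" using \<theta>\<Delta> \<Delta> \<tau> by linarith+
    have nr: "nrm u1 u2 v x \<le> ennreal (CE * s)" if "0 \<le> x" "x \<le> T" for x
    proof -
      have "nrm u1 u2 v x \<le> ennreal CE * nrm u1 u2 v 0" using that T by (intro ce[OF k \<theta>(1) c]) auto
      also have "\<dots> \<le> ennreal CE * ennreal s" by (intro mult_left_mono s) auto
      finally show ?thesis using CE s by (simp add: ennreal_mult)
    qed
    have w: "\<bar>u2 1 x\<bar> \<le> b * sqrt s" if "\<tau> < x" "x \<le> T" for x
    proof -
      have "u2 1 x = Ulaw \<theta> q1 q2 u1 u2 v (x - \<tau>)" using trace_delay(2)[OF c, of "x - \<tau>"] that by simp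
      moreover have "\<bar>Ulaw \<theta> q1 q2 u1 u2 v (x - \<tau>)\<bar> \<le> cU * sqrt (CE * s)"
        using that \<tau> CE s by (intro U[OF k \<theta>(1) c] nr) auto
      ultimately show ?thesis by (simp add: b_def real_sqrt_mult mult.assoc)
    qed
    have fin: "nrm u1 u2 v x < top" if "0 \<le> x" "x \<le> T" for x
      using le_less_trans[OF nr[OF that]] by simp
    have t0: "0 < t" using t \<tau> by simp
    have bs0: "0 \<le> b * sqrt s" using b0 s by simp
    have mod: "sqn {0..1} (\<lambda>x. q1 x \<delta> - q1 x 0) + sqn {0..1} (\<lambda>x. q2 x \<delta> - q2 x 0) \<le> ennreal \<epsilon>"
      if "0 \<le> \<delta>" "\<delta> \<le> \<delta>0" "\<delta> \<le> \<theta>" for \<delta> by (rule mo[OF k that])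
    have Pq: "sqn {0..\<theta>} (q1 1) \<le> ennreal P" using kb[OF k \<theta>(1), of \<theta>] \<theta> by auto
    define \<delta> where "\<delta> = \<bar>\<theta> - \<tau>\<bar>"
    \<comment> \<open>The earlier of \<open>t + \<theta>\<close> and \<open>t + \<tau>\<close>: a
      single forward prediction then covers both signs of \<open>\<theta> - \<tau>\<close>.\<close>
    define t1 where "t1 = t + min \<theta> \<tau>"
    have \<delta>: "0 \<le> \<delta>" "\<delta> \<le> \<Delta>" "\<delta> \<le> \<theta>" using \<theta>\<Delta> \<theta> \<Delta> by (auto simp: \<delta>_def)
    have t1: "\<tau> < t1" "t1 + \<delta> \<le> T" "0 \<le> t1" "t1 \<le> T"
      using t \<tau> \<theta> \<theta>\<Delta> \<Delta> by (auto simp: t1_def \<delta>_def min_def abs_if split: if_splits)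
    have g1: "\<bar>gK u1 u2 (t1 + \<delta>) - gK u1 u2 t1\<bar> \<le> (2 / m * sqrt (CE * \<epsilon>) + b * sqrt (P * \<delta>)) * sqrt s"
    proof -
      have n1: "sqn {0..1} (\<lambda>x. u1 x t1) \<le> ennreal (CE * s)" "sqn {0..1} (\<lambda>x. u2 x t1) \<le> ennreal (CE * s)"
        by (rule order_trans[OF _ nr[OF t1(3,4)]]; simp add: nrm_def add.assoc add_increasing add_increasing2)+
      have m1: "sqn {0..1} (\<lambda>x. q1 x \<delta> - q1 x 0) \<le> ennreal \<epsilon>" "sqn {0..1} (\<lambda>x. q2 x \<delta> - q2 x 0) \<le> ennreal \<epsilon>"
        by (rule order_trans[OF _ mod]; use \<delta> \<Delta> in \<open>simp add: add_increasing add_increasing2\<close>)+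
      have fq: "sqn {0..1} (\<lambda>x. q1 x \<delta>) < top" "sqn {0..1} (\<lambda>x. q2 x \<delta>) < top" "sqn {0..1} (\<lambda>x. q1 x 0) < top" "sqn {0..1} (\<lambda>x. q2 x 0) < top"
        using kb[OF k \<theta>(1), of \<delta>] kb[OF k \<theta>(1), of 0] \<delta> \<theta> by (auto intro: le_less_trans)
      have fu: "sqn {0..1} (\<lambda>x. u1 x t1) < top" "sqn {0..1} (\<lambda>x. u2 x t1) < top"
        using n1 by (auto intro: le_less_trans)
      have "gK u1 u2 (t1 + \<delta>) = pair (\<lambda>x. u1 x t1) (\<lambda>x. u2 x t1) (\<lambda>x. q1 x \<delta>) (\<lambda>x. q2 x \<delta>)
          + (LBINT s:{0..\<delta>}. u2 1 (t1 + s) * q1 1 (\<delta> - s))"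
        using t1 \<delta> by (intro g_duality[OF k c, where b="b * sqrt s"] fin w) auto
      moreover have "gK u1 u2 t1 = pair (\<lambda>x. u1 x t1) (\<lambda>x. u2 x t1) (\<lambda>x. q1 x 0) (\<lambda>x. q2 x 0)"
        by (rule gK_kernel[OF k]) measurable
      moreover have "pair (\<lambda>x. u1 x t1) (\<lambda>x. u2 x t1) (\<lambda>x. q1 x \<delta>) (\<lambda>x. q2 x \<delta>) - pair (\<lambda>x. u1 x t1) (\<lambda>x. u2 x t1) (\<lambda>x. q1 x 0) (\<lambda>x. q2 x 0)
        = pair (\<lambda>x. u1 x t1) (\<lambda>x. u2 x t1) (\<lambda>x. q1 x \<delta> - q1 x 0) (\<lambda>x. q2 x \<delta> - q2 x 0)"
        by (rule pair_diff[OF _ _ _ _ _ _ fu fq]) measurable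
      moreover have "\<bar>pair (\<lambda>x. u1 x t1) (\<lambda>x. u2 x t1) (\<lambda>x. q1 x \<delta> - q1 x 0) (\<lambda>x. q2 x \<delta> - q2 x 0)\<bar> \<le> 2 / m * sqrt (CE * s * \<epsilon>)"
        using CE s \<epsilon> by (intro pair_integrable(3) n1 m1) auto
      moreover have "\<bar>LBINT s:{0..\<delta>}. u2 1 (t1 + s) * q1 1 (\<delta> - s)\<bar> \<le> sqrt (((b * sqrt s)\<^sup>2 * \<delta>) * P)"
      proof (rule Cauchy_Schwarz_sqn(2))
        show "sqn {0..\<delta>} (\<lambda>s. u2 1 (t1 + s)) \<le> ennreal ((b * sqrt s)\<^sup>2 * \<delta>)"
          using sqn_const[of 0 \<delta> "\<lambda>s. u2 1 (t1 + s)" "b * sqrt s"] w t1 \<delta> by auto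
        show "sqn {0..\<delta>} (\<lambda>s. q1 1 (\<delta> - s)) \<le> ennreal P"
          using sqn_reflect[of "q1 1" \<delta>] kb[OF k \<theta>(1), of \<delta>] \<delta> by simp
      qed (use \<delta> P in auto)
      moreover have "sqrt (((b * sqrt s)\<^sup>2 * \<delta>) * P) = b * sqrt (P * \<delta>) * sqrt s"
        using b0 s by (simp add: real_sqrt_mult)
      moreover have "2 / m * sqrt (CE * s * \<epsilon>) = 2 / m * sqrt (CE * \<epsilon>) * sqrt s"
        by (simp add: real_sqrt_mult)
      ultimately show ?thesis by (simp only: distrib_right)
    qed
    have g2: "\<bar>gK u1 u2 (t + \<theta>) - gK u1 u2 (t + \<tau>)\<bar> = \<bar>gK u1 u2 (t1 + \<delta>) - gK u1 u2 t1\<bar>"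
    proof (cases "\<theta> \<le> \<tau>")
      case True
      then have e: "t1 + \<delta> = t + \<tau>" "t1 = t + \<theta>" by (auto simp: t1_def \<delta>_def)
      show ?thesis unfolding e(1) unfolding e(2) by (rule abs_minus_commute)
    next
      case False
      then have e: "t1 + \<delta> = t + \<theta>" "t1 = t + \<tau>" by (auto simp: t1_def \<delta>_def)
      show ?thesis unfolding e(1) unfolding e(2) ..
    qed
    define W where "W = 2 * sqrt (3 * h * P) + sqrt (\<theta> * (CT * \<epsilon>))"
    have W0: "0 \<le> W" unfolding W_def using h P \<theta> CT \<epsilon> by simp
    have tr: "(\<integral>\<^sup>+r. ennreal \<bar>Qk \<theta> q1 (r + d) - Qk \<theta> q1 r\<bar> \<partial>lborel) \<le> ennreal W" if d: "0 \<le> d" "d \<le> 3 * h" for d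
    proof -
      have d': "d \<le> \<delta>0" "d \<le> \<theta>" using d h \<theta> by auto
      have "sqn {0..\<theta> - d} (\<lambda>s. q1 1 (d + s) - q1 1 s)
        \<le> ennreal CT * (sqn {0..1} (\<lambda>x. q1 x d - q1 x 0) + sqn {0..1} (\<lambda>x. q2 x d - q2 x 0))"
        by (rule ct[OF d(1) d'(2) \<theta>(1) kernelD(2,3)[OF k]])
      also have "\<dots> \<le> ennreal CT * ennreal \<epsilon>" by (intro mult_left_mono mod d d') auto
      also have "\<dots> = ennreal (CT * \<epsilon>)" using CT \<epsilon> by (simp add: ennreal_mult)
      finally have "(\<integral>\<^sup>+r. ennreal \<bar>Qk \<theta> q1 (r + d) - Qk \<theta> q1 r\<bar> \<partial>lborel) \<le> ennreal (2 * sqrt (d * P) + sqrt (\<theta> * (CT * \<epsilon>)))"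
        using P CT \<epsilon> by (intro Qk_translation[OF k Pq _ d(1) d'(2)]) auto
      also have "\<dots> \<le> ennreal W"
        unfolding W_def using d P \<theta> CT \<epsilon> by (intro ennreal_leI add_mono mult_left_mono real_sqrt_le_mono mult_right_mono) auto
      finally show ?thesis .
    qed
    have \<kappa>: "\<bar>\<theta> / \<tau> - 1\<bar> \<le> \<Delta> / \<tau>"
    proof -
      have "\<theta> / \<tau> - 1 = (\<theta> - \<tau>) / \<tau>" using \<tau> by (simp add: diff_divide_distrib)
      then show ?thesis using \<theta>\<Delta> \<tau> by (simp add: divide_right_mono)
    qed
    have \<kappa>2: "1 / 2 \<le> \<theta> / \<tau>" "\<theta> / \<tau> \<le> 2"
      using \<theta> \<tau> \<theta>\<Delta> \<Delta>(4) by (simp_all add: field_simps abs_le_iff)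
    have dl: "(\<integral>\<^sup>+r. ennreal \<bar>Qk \<theta> q1 (\<theta> / \<tau> * r) - Qk \<theta> q1 r\<bar> \<partial>lborel) \<le> ennreal (7 * W)"
    proof (rule dilation_L1[OF _ _ _ h(1) \<kappa>2(1) _ tr W0])
      show "Qk \<theta> q1 \<in> borel_measurable borel" unfolding Qk_def[abs_def] by measurable
      have "\<bar>\<theta> / \<tau> - 1\<bar> * (2 * \<theta> + 2 * h) \<le> (h / k1) * k1"
      proof (rule mult_mono)
        have "\<Delta> / \<tau> \<le> (\<tau> * h / k1) / \<tau>" using \<Delta> \<tau> by (intro divide_right_mono) auto
        also have "\<dots> = h / k1" using \<tau> by simp
        finally show "\<bar>\<theta> / \<tau> - 1\<bar> \<le> h / k1" using \<kappa> by linarith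
        show "2 * \<theta> + 2 * h \<le> k1" using \<theta> by (simp add: k1_def)
      qed (use h kk \<theta> in auto)
      then show "\<bar>\<theta> / \<tau> - 1\<bar> * (2 * \<theta> + 2 * h) \<le> h" using kk by simp
    qed (use \<theta> in \<open>auto simp: Qk_def\<close>)
    have Ug: "\<bar>Ulaw \<theta> q1 q2 u1 u2 v t - gK u1 u2 (t + \<theta>)\<bar> \<le> (b * sqrt s) * (\<theta> / \<tau> * (7 * W) + \<bar>\<theta> / \<tau> - 1\<bar> * sqrt (\<theta> * P))"
      using t t0 \<tau> P W0 bs0 by (intro Ulaw_minus_g[OF k \<theta>(1) c t0 t(2) _ _ _ Pq _ dl] fin w) auto
    have "b * (\<theta> / \<tau> * (7 * W) + \<bar>\<theta> / \<tau> - 1\<bar> * sqrt (\<theta> * P)) \<le> 3 * (\<eta> / 5)"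
    proof -
      have "\<theta> / \<tau> * (7 * W) \<le> 2 * (7 * W)" using \<kappa>2 W0 by (intro mult_right_mono) auto
      then have "b * (\<theta> / \<tau> * (7 * W)) \<le> b * (2 * (7 * W))" using b0 by (intro mult_left_mono) auto
      also have "\<dots> = 28 * b * sqrt (3 * P * h) + 14 * b * sqrt (\<theta> * (CT * \<epsilon>))"
        unfolding W_def by (simp add: algebra_simps)
      also have "\<dots> \<le> \<eta> / 5 + \<eta> / 5"
      proof (rule add_mono[OF h(2)])
        have "\<theta> * (CT * \<epsilon>) \<le> (\<tau> + 1) * CT * \<epsilon>" using \<theta> CT \<epsilon> by (simp add: mult.assoc mult_right_mono)
        then have "14 * b * sqrt (\<theta> * (CT * \<epsilon>)) \<le> 14 * b * sqrt ((\<tau> + 1) * CT * \<epsilon>)"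
          using b0 by (intro mult_left_mono real_sqrt_le_mono) auto
        then show "14 * b * sqrt (\<theta> * (CT * \<epsilon>)) \<le> \<eta> / 5" using \<epsilon>(3) by linarith
      qed
      finally have 1: "b * (\<theta> / \<tau> * (7 * W)) \<le> 2 * (\<eta> / 5)" by simp
      have "\<bar>\<theta> / \<tau> - 1\<bar> * (b * sqrt (\<theta> * P)) \<le> ((\<eta> / 5) / k2) * k2"
      proof (rule mult_mono)
        have "\<Delta> / \<tau> \<le> (\<tau> * (\<eta> / 5) / k2) / \<tau>" using \<Delta> \<tau> by (intro divide_right_mono) auto
        also have "\<dots> = (\<eta> / 5) / k2" using \<tau> by simp
        finally show "\<bar>\<theta> / \<tau> - 1\<bar> \<le> (\<eta> / 5) / k2" using \<kappa> by linarith
        have "b * sqrt (\<theta> * P) \<le> b * sqrt ((\<tau> + 1) * P)"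
          using \<theta> P b0 by (intro mult_left_mono real_sqrt_le_mono mult_right_mono) auto
        then show "b * sqrt (\<theta> * P) \<le> k2" by (simp add: k2_def)
      qed (use \<eta> kk b0 \<theta> P in auto)
      then have 2: "b * (\<bar>\<theta> / \<tau> - 1\<bar> * sqrt (\<theta> * P)) \<le> \<eta> / 5" using kk by (simp add: mult.left_commute)
      show ?thesis using 1 2 by (simp add: distrib_left)
    qed
    then have "(b * (\<theta> / \<tau> * (7 * W) + \<bar>\<theta> / \<tau> - 1\<bar> * sqrt (\<theta> * P))) * sqrt s \<le> (3 * (\<eta> / 5)) * sqrt s"
      using s by (intro mult_right_mono) auto
    with Ug have A1: "\<bar>Ulaw \<theta> q1 q2 u1 u2 v t - gK u1 u2 (t + \<theta>)\<bar> \<le> (3 * (\<eta> / 5)) * sqrt s"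
      by (simp only: mult.commute mult.left_commute mult.assoc)
    have "2 / m * sqrt (CE * \<epsilon>) + b * sqrt (P * \<delta>) \<le> 2 * (\<eta> / 5)"
      using \<epsilon>(2) \<Delta>1(2)[of \<delta>] \<delta> \<Delta> by simp
    then have "(2 / m * sqrt (CE * \<epsilon>) + b * sqrt (P * \<delta>)) * sqrt s \<le> (2 * (\<eta> / 5)) * sqrt s"
      using s by (intro mult_right_mono) auto
    with g1 g2 have A2: "\<bar>gK u1 u2 (t + \<theta>) - gK u1 u2 (t + \<tau>)\<bar> \<le> (2 * (\<eta> / 5)) * sqrt s" by linarith
    have "u2 1 (t + \<tau>) = Ulaw \<theta> q1 q2 u1 u2 v t" using t t0 by (intro trace_delay(2)[OF c]) auto
    then have "\<bar>u2 1 (t + \<tau>) - gK u1 u2 (t + \<tau>)\<bar> \<le> (3 * (\<eta> / 5)) * sqrt s + (2 * (\<eta> / 5)) * sqrt s"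
      using A1 A2 by linarith
    then show "\<bar>u2 1 (t + \<tau>) - gK u1 u2 (t + \<tau>)\<bar> \<le> \<eta> * sqrt s" by (simp add: distrib_right[symmetric])
  qed
qed

text \<open>\<open>pair_integrable\<close> in squared form, which can be integrated over time
  without finiteness at each instant.\<close>

lemma gK_square:
  obtains c where "0 < c"
    "\<And>u1 u2 t. case_prod u1 \<in> borel_measurable (borel \<Otimes>\<^sub>M borel) \<Longrightarrow> case_prod u2 \<in> borel_measurable (borel \<Otimes>\<^sub>M borel) \<Longrightarrow>
      ennreal ((gK u1 u2 t)\<^sup>2) \<le> ennreal c * (sqn {0..1} (\<lambda>x. u1 x t) + sqn {0..1} (\<lambda>x. u2 x t))"
proof -
  define P where "P = (M * B)\<^sup>2 + 1"
  have P: "0 < P" unfolding P_def by (simp add: add_nonneg_pos)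
  have PK: "sqn {0..1} (\<lambda>y. e2 y * K2 1 y) \<le> ennreal P" "sqn {0..1} (\<lambda>y. e1 y * K1 1 y) \<le> ennreal P"
    by (rule order_trans[OF sqn_const[of 0 1 _ "M * B"]]; use eK_bound in \<open>auto simp: P_def intro!: ennreal_leI\<close>)+
  show thesis
  proof (rule that[of "(2 / m)\<^sup>2 * P"])
    show "0 < (2 / m)\<^sup>2 * P" using P s1.m(1) by simp
    fix u1 u2 :: "real \<Rightarrow> real \<Rightarrow> real" and t :: real
    assume [measurable]: "case_prod u1 \<in> borel_measurable (borel \<Otimes>\<^sub>M borel)" "case_prod u2 \<in> borel_measurable (borel \<Otimes>\<^sub>M borel)"
    note [measurable] = km
    show "ennreal ((gK u1 u2 t)\<^sup>2) \<le> ennreal ((2 / m)\<^sup>2 * P) * (sqn {0..1} (\<lambda>x. u1 x t) + sqn {0..1} (\<lambda>x. u2 x t))"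
    proof (cases "sqn {0..1} (\<lambda>x. u1 x t) + sqn {0..1} (\<lambda>x. u2 x t)" rule: ennreal_cases)
      case (real r)
      have "sqn {0..1} (\<lambda>x. u1 x t) \<le> ennreal r" "sqn {0..1} (\<lambda>x. u2 x t) \<le> ennreal r"
        unfolding real(2)[symmetric] by (simp_all add: add_increasing add_increasing2)
      then have "\<bar>gK u1 u2 t\<bar> \<le> 2 / m * sqrt (r * P)"
        unfolding gK_def using real P by (intro pair_integrable(3) PK) auto
      then have "(gK u1 u2 t)\<^sup>2 \<le> (2 / m * sqrt (r * P))\<^sup>2"
        using power_mono[of "\<bar>gK u1 u2 t\<bar>" "2 / m * sqrt (r * P)" 2] by simp
      also have "\<dots> = (2 / m)\<^sup>2 * P * r" using real P by (simp add: power_mult_distrib power_divide)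
      finally show ?thesis using real P by (simp add: ennreal_mult[symmetric] ennreal_leI)
    next
      case top
      show ?thesis unfolding top using P s1.m(1) by (simp add: ennreal_mult_top)
    qed
  qed
qed

lemma output_beta:
  assumes c: "closed_loop T \<theta> q1 q2 u1 u2 v" and t: "s2.L < t" "t \<le> T"
    and fin: "nrm u1 u2 v (t - s2.L) < top" and b: "\<And>s. t - s2.L \<le> s \<Longrightarrow> s \<le> t \<Longrightarrow> \<bar>u2 1 s\<bar> \<le> b"
  shows "u2 0 t = u2 1 (t - s2.L) - gK u1 u2 (t - s2.L)"
proof -
  let ?t = "t - s2.L"
  have t0: "0 \<le> ?t" using t by simp
  have s: "sys s2.L (\<lambda>x s. u1 x (?t + s)) (\<lambda>x s. u2 x (?t + s))"
    by (rule hsys_mono[OF hsys_shift[OF closed_loopD(1)[OF c] t0]]) (use t in simp)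
  have f: "sqn {0..1} (\<lambda>x. u1 x ?t) < top" "sqn {0..1} (\<lambda>x. u2 x ?t) < top"
    using fin by (auto simp: nrm_def less_top[symmetric])
  have w: "sqn {0..s2.L} (\<lambda>s. u2 1 (?t + s)) < top"
    using le_less_trans[OF sqn_const[of 0 s2.L "\<lambda>s. u2 1 (?t + s)" b]] s2.L_pos b by auto
  have "u2 0 (?t + s2.L) = u2 1 (?t + 0) - pair (\<lambda>x. u1 x (?t + 0)) (\<lambda>x. u2 x (?t + 0)) (\<lambda>y. e2 y * K2 1 y) (\<lambda>y. e1 y * K1 1 y)"
    using f w by (intro triangle_identity[OF s _ _ _ km kb k0 k1 k2 kd kq]) auto
  then show ?thesis by (simp add: gK_def)
qed

end

section \<open>Contraction over a fixed time and exponential decay\<close>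

context ctrl
begin

text \<open>\<beta> is small after time \<open>2 * \<tau>\<close>, hence so is \<open>u2 0\<close>
  on \<open>{p..r}\<close>, and then the space-time norm of \<open>u1\<close> and \<open>u2\<close>
  on \<open>{s1..s2}\<close>. There the input is \<beta> plus \<open>gK\<close>, so it is small in
  \<open>L^2\<close>, and with it \<open>v\<close>. Averaging over a unit window and the forward
  estimate lead to time \<open>H\<close>. The total factor is
  \<open>CE * Z * \<eta>\<^sup>2\<close>, and \<open>\<eta>\<close> makes it
  \<open>1 / 4\<close>.\<close>

lemma contraction:
  obtains \<Delta> H C where "0 < \<Delta>" "0 < H" "0 < C"
    "\<And>\<theta> q1 q2 u1 u2 v. kernel \<theta> q1 q2 \<Longrightarrow> \<bar>\<theta> - \<tau>\<bar> \<le> \<Delta> \<Longrightarrow> closed_loop H \<theta> q1 q2 u1 u2 v \<Longrightarrow>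
      nrm u1 u2 v H \<le> ennreal (1 / 4) * nrm u1 u2 v 0"
    "\<And>\<theta> q1 q2 u1 u2 v t. kernel \<theta> q1 q2 \<Longrightarrow> \<bar>\<theta> - \<tau>\<bar> \<le> \<Delta> \<Longrightarrow> closed_loop H \<theta> q1 q2 u1 u2 v \<Longrightarrow> 0 \<le> t \<Longrightarrow> t \<le> H \<Longrightarrow>
      nrm u1 u2 v t \<le> ennreal C * nrm u1 u2 v 0"
proof -
  \<comment> \<open>For \<open>t \<ge> p\<close> the time \<open>t - s2.L\<close> exceeds
    \<open>2 * \<tau>\<close>, as the bound on \<beta> requires. \<open>r\<close> gives
    \<open>{s1..s2}\<close> the length \<open>1 + \<tau>\<close>: a unit for averaging, and
    \<open>\<tau>\<close> for the input stored in the delay line. \<open>H = r + 1\<close> because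
    \<open>beta_small\<close> asks for one more unit of time.\<close>
  define p where "p = 2 * \<tau> + s2.L + 1"
  define r where "r = p + s1.L + s2.L + 1 + \<tau>"
  define H where "H = r + 1"
  define s1 where "s1 = p + s1.L"
  define s2 where "s2 = r - s2.L"
  have L: "0 < s1.L" "0 < s2.L" by (rule s1.L_pos s2.L_pos)+
  have pr: "0 < p" "p < r" "0 < H" "s2 = s1 + 1 + \<tau>" using \<tau> L by (auto simp: p_def r_def H_def s1_def s2_def)
  obtain CE where CE: "0 < CE" and ce: "\<And>\<theta> q1 q2 u1 u2 v T t. kernel \<theta> q1 q2 \<Longrightarrow> \<theta> \<le> \<tau> + 1 \<Longrightarrow> closed_loop T \<theta> q1 q2 u1 u2 v \<Longrightarrow> 0 \<le> t \<Longrightarrow> t \<le> T \<Longrightarrow> t \<le> H \<Longrightarrow>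
      nrm u1 u2 v t \<le> ennreal CE * nrm u1 u2 v 0"
    using closed_loop_energy[OF less_imp_le[OF pr(3)]] by blast
  obtain cU where cU: "0 < cU" and U: "\<And>\<theta> q1 q2 u1 u2 v T t s. kernel \<theta> q1 q2 \<Longrightarrow> \<theta> \<le> \<tau> + 1 \<Longrightarrow> closed_loop T \<theta> q1 q2 u1 u2 v \<Longrightarrow> 0 \<le> s \<Longrightarrow>
      nrm u1 u2 v t \<le> ennreal s \<Longrightarrow> \<bar>Ulaw \<theta> q1 q2 u1 u2 v t\<bar> \<le> cU * sqrt s"
    using Ulaw_bound by blast
  obtain CO where CO: "0 < CO" and co: "\<And>u1 u2 T p r. sys T u1 u2 \<Longrightarrow> 0 < p \<Longrightarrow> r \<le> T \<Longrightarrow>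
      (\<integral>\<^sup>+t\<in>{p + s1.L..r - s2.L}. (sqn {0..1} (\<lambda>x. u1 x t) + sqn {0..1} (\<lambda>x. u2 x t)) \<partial>lborel)
      \<le> ennreal CO * sqn {p..r} (u2 0)"
    using output_estimate by blast
  obtain cg where cg: "0 < cg" and g2: "\<And>u1 u2 t. case_prod u1 \<in> borel_measurable (borel \<Otimes>\<^sub>M borel) \<Longrightarrow> case_prod u2 \<in> borel_measurable (borel \<Otimes>\<^sub>M borel) \<Longrightarrow>
      ennreal ((gK u1 u2 t)\<^sup>2) \<le> ennreal cg * (sqn {0..1} (\<lambda>x. u1 x t) + sqn {0..1} (\<lambda>x. u2 x t))"
    using gK_square by blast
  \<comment> \<open>In units of \<open>\<eta>\<^sup>2 * s\<close>: \<open>y\<close> bounds the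
    space-time norm of \<open>u1\<close> and \<open>u2\<close>, \<open>z\<close> the squared norm of
    the input on \<open>{s1..s2}\<close>, and \<open>Z\<close> the mean of \<open>nrm\<close> over
    the unit window.\<close>
  define y where "y = CO * (r - p)"
  define z where "z = 2 * (1 + \<tau>) + 2 * cg * y"
  define Z where "Z = y + 1 / \<tau> * z"
  have y: "0 < y" unfolding y_def using CO pr by simp
  have z: "0 < z" unfolding z_def using \<tau> cg y by (intro add_pos_pos) auto
  have Z: "0 < Z" unfolding Z_def using y z \<tau> by (intro add_pos_pos) auto
  define \<eta> where "\<eta> = sqrt (1 / (4 * (CE * Z)))"
  have \<eta>: "0 < \<eta>" "CE * Z * \<eta>\<^sup>2 = 1 / 4" unfolding \<eta>_def using CE Z by auto
  obtain \<Delta> where \<Delta>: "0 < \<Delta>" "\<Delta> \<le> 1" and beta: "\<And>\<theta> q1 q2 u1 u2 v T t s. kernel \<theta> q1 q2 \<Longrightarrow> \<bar>\<theta> - \<tau>\<bar> \<le> \<Delta> \<Longrightarrow> closed_loop T \<theta> q1 q2 u1 u2 v \<Longrightarrow> T \<le> H \<Longrightarrow>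
      0 \<le> s \<Longrightarrow> nrm u1 u2 v 0 \<le> ennreal s \<Longrightarrow> \<tau> < t \<Longrightarrow> t + \<tau> + 1 \<le> T \<Longrightarrow>
      \<bar>u2 1 (t + \<tau>) - gK u1 u2 (t + \<tau>)\<bar> \<le> \<eta> * sqrt s"
    using beta_small[OF \<eta>(1) less_imp_le[OF pr(3)]] by blast
  show thesis
  proof (rule that[OF \<Delta>(1) pr(3) CE])
    fix \<theta> q1 q2 u1 u2 v t
    assume k: "kernel \<theta> q1 q2" and \<theta>\<Delta>: "\<bar>\<theta> - \<tau>\<bar> \<le> \<Delta>" and c: "closed_loop H \<theta> q1 q2 u1 u2 v" and t: "0 \<le> t" "t \<le> H"
    have "\<theta> \<le> \<tau> + 1" using \<theta>\<Delta> \<Delta> by linarith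
    then show "nrm u1 u2 v t \<le> ennreal CE * nrm u1 u2 v 0" by (intro ce[OF k _ c t t(2)])
  next
    fix \<theta> q1 q2 u1 u2 v
    assume k: "kernel \<theta> q1 q2" and \<theta>\<Delta>: "\<bar>\<theta> - \<tau>\<bar> \<le> \<Delta>" and c: "closed_loop H \<theta> q1 q2 u1 u2 v"
    note [measurable] = kernelD(6,7)[OF k] closed_loopD(2,7,8)[OF c]
    have \<theta>: "\<theta> \<le> \<tau> + 1" using \<theta>\<Delta> \<Delta> by linarith
    let ?n = "\<lambda>t. sqn {0..1} (\<lambda>x. u1 x t) + sqn {0..1} (\<lambda>x. u2 x t)"
    have [measurable]: "?n \<in> borel_measurable borel" unfolding sqn_def by measurable
    show "nrm u1 u2 v H \<le> ennreal (1 / 4) * nrm u1 u2 v 0"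
    proof (cases "nrm u1 u2 v 0" rule: ennreal_cases)
      case top
      show ?thesis unfolding top by (simp add: ennreal_mult_top)
    next
      case (real s)
      note s = real
      have nr: "nrm u1 u2 v x \<le> ennreal (CE * s)" if "0 \<le> x" "x \<le> H" for x
        using ce[OF k \<theta> c that that(2)] CE s by (simp add: ennreal_mult)
      have fin: "nrm u1 u2 v x < top" if "0 \<le> x" "x \<le> H" for x
        using le_less_trans[OF nr[OF that]] by simp
      have w: "\<bar>u2 1 x\<bar> \<le> cU * sqrt (CE * s)" if "\<tau> < x" "x \<le> H" for x
      proof -
        have "u2 1 x = Ulaw \<theta> q1 q2 u1 u2 v (x - \<tau>)" using trace_delay(2)[OF c, of "x - \<tau>"] that by simp
        then show ?thesis using that \<tau> CE s by (auto intro!: U[OF k \<theta> c] nr)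
      qed
      have \<beta>: "\<bar>u2 1 x - gK u1 u2 x\<bar> \<le> \<eta> * sqrt s" if "2 * \<tau> < x" "x \<le> H - 1" for x
        using beta[OF k \<theta>\<Delta> c order_refl s(1), of "x - \<tau>"] s that by simp
      have es: "0 \<le> \<eta>\<^sup>2 * s" using s by simp
      have "sqn {p..r} (u2 0) \<le> ennreal ((\<eta> * sqrt s)\<^sup>2 * (r - p))"
      proof (rule sqn_const)
        fix t assume t: "t \<in> {p..r}"
        have "u2 0 t = u2 1 (t - s2.L) - gK u1 u2 (t - s2.L)"
        proof (rule output_beta[OF c])
          show "nrm u1 u2 v (t - s2.L) < top" using t \<tau> L by (intro fin) (auto simp: p_def H_def)
          show "\<bar>u2 1 x\<bar> \<le> cU * sqrt (CE * s)" if "t - s2.L \<le> x" "x \<le> t" for x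
            using t that \<tau> L by (intro w) (auto simp: p_def H_def)
        qed (use t \<tau> L in \<open>auto simp: p_def H_def\<close>)
        moreover have "\<bar>u2 1 (t - s2.L) - gK u1 u2 (t - s2.L)\<bar> \<le> \<eta> * sqrt s"
          using t \<tau> L by (intro \<beta>) (auto simp: p_def H_def)
        ultimately show "\<bar>u2 0 t\<bar> \<le> \<eta> * sqrt s" by simp
      qed (use pr in auto)
      also have "(\<eta> * sqrt s)\<^sup>2 * (r - p) = (r - p) * (\<eta>\<^sup>2 * s)" using s by (simp add: power_mult_distrib)
      finally have out: "sqn {p..r} (u2 0) \<le> ennreal ((r - p) * (\<eta>\<^sup>2 * s))" .
      have I: "(\<integral>\<^sup>+t\<in>{s1..s2}. ?n t \<partial>lborel) \<le> ennreal (y * (\<eta>\<^sup>2 * s))"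
      proof -
        have "(\<integral>\<^sup>+t\<in>{s1..s2}. ?n t \<partial>lborel) \<le> ennreal CO * sqn {p..r} (u2 0)"
          unfolding s1_def s2_def by (rule co[OF closed_loopD(1)[OF c] pr(1)]) (simp add: H_def)
        also have "\<dots> \<le> ennreal CO * ennreal ((r - p) * (\<eta>\<^sup>2 * s))" by (intro mult_left_mono out) auto
        also have "\<dots> = ennreal (y * (\<eta>\<^sup>2 * s))" using CO pr es by (simp add: ennreal_mult[symmetric] y_def mult.assoc)
        finally show ?thesis .
      qed
      have Wn: "sqn {s1..s2} (u2 1) \<le> ennreal (z * (\<eta>\<^sup>2 * s))"
      proof -
        have "sqn {s1..s2} (u2 1) \<le> (\<integral>\<^sup>+x. ennreal (2 * (\<eta>\<^sup>2 * s)) * indicator {s1..s2} x + ennreal (2 * cg) * (?n x * indicator {s1..s2} x) \<partial>lborel)"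
          unfolding sqn_def[of "{s1..s2}"]
        proof (rule nn_integral_mono)
          fix x
          show "ennreal ((u2 1 x)\<^sup>2) * indicator {s1..s2} x
            \<le> ennreal (2 * (\<eta>\<^sup>2 * s)) * indicator {s1..s2} x + ennreal (2 * cg) * (?n x * indicator {s1..s2} x)"
          proof (cases "x \<in> {s1..s2}")
            case True
            have "\<bar>u2 1 x - gK u1 u2 x\<bar> \<le> \<eta> * sqrt s"
              using True \<tau> L by (intro \<beta>) (auto simp: s1_def s2_def p_def H_def)
            from power_mono[OF this, of 2] have b2: "(u2 1 x - gK u1 u2 x)\<^sup>2 \<le> \<eta>\<^sup>2 * s" using s by (simp add: power_mult_distrib)
            have "(u2 1 x)\<^sup>2 \<le> 2 * (u2 1 x - gK u1 u2 x)\<^sup>2 + 2 * (gK u1 u2 x)\<^sup>2"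
              using sum_squares_bound[of "u2 1 x - gK u1 u2 x" "gK u1 u2 x"] power2_sum[of "u2 1 x - gK u1 u2 x" "gK u1 u2 x"] by simp
            then have "(u2 1 x)\<^sup>2 \<le> 2 * (\<eta>\<^sup>2 * s) + 2 * (gK u1 u2 x)\<^sup>2" using b2 by linarith
            then have "ennreal ((u2 1 x)\<^sup>2) \<le> ennreal (2 * (\<eta>\<^sup>2 * s) + 2 * (gK u1 u2 x)\<^sup>2)" by (rule ennreal_leI)
            also have "\<dots> = ennreal (2 * (\<eta>\<^sup>2 * s)) + 2 * ennreal ((gK u1 u2 x)\<^sup>2)"
              using es by (simp add: ennreal_mult)
            also have "\<dots> \<le> ennreal (2 * (\<eta>\<^sup>2 * s)) + 2 * (ennreal cg * ?n x)"
              by (intro add_left_mono mult_left_mono g2 closed_loopD(7,8)[OF c]) simp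
            also have "\<dots> = ennreal (2 * (\<eta>\<^sup>2 * s)) + ennreal (2 * cg) * ?n x"
              using cg by (simp add: ennreal_mult mult.assoc)
            finally show ?thesis using True by simp
          qed simp
        qed
        also have "\<dots> = (\<integral>\<^sup>+x. ennreal (2 * (\<eta>\<^sup>2 * s)) * indicator {s1..s2} x \<partial>lborel) + (\<integral>\<^sup>+x. ennreal (2 * cg) * (?n x * indicator {s1..s2} x) \<partial>lborel)"
          by (rule nn_integral_add) measurable
        also have "(\<integral>\<^sup>+x. ennreal (2 * (\<eta>\<^sup>2 * s)) * indicator {s1..s2} x \<partial>lborel) = ennreal (2 * (\<eta>\<^sup>2 * s)) * ennreal (1 + \<tau>)"
          using pr \<tau> by (simp add: nn_integral_cmult_indicator)
        also have "(\<integral>\<^sup>+x. ennreal (2 * cg) * (?n x * indicator {s1..s2} x) \<partial>lborel) = ennreal (2 * cg) * (\<integral>\<^sup>+x\<in>{s1..s2}. ?n x \<partial>lborel)"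
          by (rule nn_integral_cmult) measurable
        also have "ennreal (2 * (\<eta>\<^sup>2 * s)) * ennreal (1 + \<tau>) + ennreal (2 * cg) * (\<integral>\<^sup>+x\<in>{s1..s2}. ?n x \<partial>lborel)
            \<le> ennreal (2 * (\<eta>\<^sup>2 * s)) * ennreal (1 + \<tau>) + ennreal (2 * cg) * ennreal (y * (\<eta>\<^sup>2 * s))"
          by (intro add_left_mono mult_left_mono I) auto
        also have "\<dots> = ennreal (2 * (\<eta>\<^sup>2 * s) * (1 + \<tau>) + 2 * cg * (y * (\<eta>\<^sup>2 * s)))"
          using es \<tau> cg y by (simp only: ennreal_mult[symmetric] ennreal_plus[symmetric] mult_nonneg_nonneg add_nonneg_nonneg zero_le_numeral zero_le_one less_imp_le)
        also have "2 * (\<eta>\<^sup>2 * s) * (1 + \<tau>) + 2 * cg * (y * (\<eta>\<^sup>2 * s)) = z * (\<eta>\<^sup>2 * s)"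
          unfolding z_def by (simp add: algebra_simps)
        finally show ?thesis .
      qed
      have vt: "sqn {0..1} (\<lambda>x. v x t) \<le> ennreal (1 / \<tau> * z * (\<eta>\<^sup>2 * s))" if t: "t \<in> {s1..s1 + 1}" for t
      proof -
        have pos: "0 < t" "t + \<tau> \<le> H" using t \<tau> L by (auto simp: s1_def p_def H_def r_def)
        have "sqn {0..1} (\<lambda>x. v x t) = sqn {0..1} (\<lambda>x. u2 1 (t + \<tau> * x))"
        proof (rule sqn_cong)
          fix x :: real assume x: "x \<in> {0..1}"
          then have "0 \<le> \<tau> * x" "\<tau> * x \<le> \<tau> * 1" using \<tau> by (auto intro!: mult_left_mono)
          then show "v x t = u2 1 (t + \<tau> * x)"
            using trace_delay(1)[OF c, of t x] closed_loopD(5)[OF c, of "t + \<tau> * x"] x pos by simp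
        qed
        also have "\<dots> = ennreal (1 / \<tau>) * (ennreal \<tau> * sqn {0..1} (\<lambda>x. u2 1 (t + \<tau> * x)))"
          using \<tau> by (simp add: mult.assoc[symmetric] ennreal_mult[symmetric])
        also have "ennreal \<tau> * sqn {0..1} (\<lambda>x. u2 1 (t + \<tau> * x)) = sqn {0..\<tau>} (\<lambda>x. u2 1 (t + x))"
          using \<tau> by (intro sqn_scale[symmetric]) auto
        also have "ennreal (1 / \<tau>) * sqn {0..\<tau>} (\<lambda>x. u2 1 (t + x)) \<le> ennreal (1 / \<tau>) * ennreal (z * (\<eta>\<^sup>2 * s))"
          using t pr by (intro mult_left_mono order_trans[OF sqn_shift_subset Wn]) auto
        also have "\<dots> = ennreal (1 / \<tau> * z * (\<eta>\<^sup>2 * s))"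
          using \<tau> z es by (simp add: ennreal_mult[symmetric])
        finally show ?thesis .
      qed
      have later: "nrm u1 u2 v H \<le> ennreal CE * nrm u1 u2 v t" if t: "t \<in> {s1..s1 + 1}" for t
      proof -
        have pos: "0 \<le> t" "t \<le> H" using t \<tau> L by (auto simp: s1_def p_def H_def r_def)
        have "nrm (\<lambda>x s. u1 x (t + s)) (\<lambda>x s. u2 x (t + s)) (\<lambda>x s. v x (t + s)) (H - t)
            \<le> ennreal CE * nrm (\<lambda>x s. u1 x (t + s)) (\<lambda>x s. u2 x (t + s)) (\<lambda>x s. v x (t + s)) 0"
          using pos by (intro ce[OF k \<theta> closed_loop_shift[OF c pos(1)]]) auto
        then show ?thesis by (simp add: nrm_def)
      qed
      \<comment> \<open>No single slice is known to be small, so the norm at \<open>H\<close> is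
        compared with the norm at every time of the unit window and the comparison is
        integrated.\<close>
      have "nrm u1 u2 v H = (\<integral>\<^sup>+t. nrm u1 u2 v H * indicator {s1..s1 + 1} t \<partial>lborel)"
        by (simp add: nn_integral_cmult_indicator)
      also have "\<dots> \<le> (\<integral>\<^sup>+t. ennreal CE * (?n t * indicator {s1..s2} t + ennreal (1 / \<tau> * z * (\<eta>\<^sup>2 * s)) * indicator {s1..s1 + 1} t) \<partial>lborel)"
      proof (rule nn_integral_mono)
        fix t
        show "nrm u1 u2 v H * indicator {s1..s1 + 1} t
          \<le> ennreal CE * (?n t * indicator {s1..s2} t + ennreal (1 / \<tau> * z * (\<eta>\<^sup>2 * s)) * indicator {s1..s1 + 1} t)"
        proof (cases "t \<in> {s1..s1 + 1}")
          case True
          then have t2: "t \<in> {s1..s2}" using pr \<tau> by auto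
          have "nrm u1 u2 v H \<le> ennreal CE * nrm u1 u2 v t" by (rule later[OF True])
          also have "\<dots> \<le> ennreal CE * (?n t + ennreal (1 / \<tau> * z * (\<eta>\<^sup>2 * s)))"
            unfolding nrm_def by (intro mult_left_mono add_left_mono vt True) auto
          finally show ?thesis using True t2 by simp
        qed simp
      qed
      also have "\<dots> = ennreal CE * ((\<integral>\<^sup>+t\<in>{s1..s2}. ?n t \<partial>lborel) + (\<integral>\<^sup>+t. ennreal (1 / \<tau> * z * (\<eta>\<^sup>2 * s)) * indicator {s1..s1 + 1} t \<partial>lborel))"
        by (simp add: nn_integral_cmult nn_integral_add)
      also have "(\<integral>\<^sup>+t. ennreal (1 / \<tau> * z * (\<eta>\<^sup>2 * s)) * indicator {s1..s1 + 1} t \<partial>lborel) = ennreal (1 / \<tau> * z * (\<eta>\<^sup>2 * s))"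
        by (simp add: nn_integral_cmult_indicator)
      also have "ennreal CE * ((\<integral>\<^sup>+t\<in>{s1..s2}. ?n t \<partial>lborel) + ennreal (1 / \<tau> * z * (\<eta>\<^sup>2 * s)))
          \<le> ennreal CE * (ennreal (y * (\<eta>\<^sup>2 * s)) + ennreal (1 / \<tau> * z * (\<eta>\<^sup>2 * s)))"
        by (intro mult_left_mono add_right_mono I) auto
      also have "\<dots> = ennreal (CE * (y * (\<eta>\<^sup>2 * s) + 1 / \<tau> * z * (\<eta>\<^sup>2 * s)))"
        using CE y z \<tau> es by (simp only: ennreal_mult[symmetric] ennreal_plus[symmetric] mult_nonneg_nonneg add_nonneg_nonneg zero_le_one divide_nonneg_nonneg less_imp_le)
      also have "CE * (y * (\<eta>\<^sup>2 * s) + 1 / \<tau> * z * (\<eta>\<^sup>2 * s)) = (CE * Z * \<eta>\<^sup>2) * s"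
        unfolding Z_def by (simp add: algebra_simps)
      also have "\<dots> = 1 / 4 * s" unfolding \<eta>(2) ..
      also have "ennreal (1 / 4 * s) = ennreal (1 / 4) * nrm u1 u2 v 0"
        unfolding s(2) by (rule ennreal_mult') simp
      finally show ?thesis .
    qed
  qed
qed

text \<open>The closed loop is time invariant, so the contraction iterates; the bound on
  \<open>{0..H}\<close> covers the times in between.\<close>

lemma decay:
  obtains \<Delta> H C where "0 < \<Delta>" "0 < H" "0 < C"
    "\<And>\<theta> q1 q2 u1 u2 v t k. kernel \<theta> q1 q2 \<Longrightarrow> \<bar>\<theta> - \<tau>\<bar> \<le> \<Delta> \<Longrightarrow> (\<And>T. closed_loop T \<theta> q1 q2 u1 u2 v) \<Longrightarrow> real k * H \<le> t \<Longrightarrow> t \<le> real (Suc k) * H \<Longrightarrow>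
      nrm u1 u2 v t \<le> ennreal (C * (1 / 4) ^ k) * nrm u1 u2 v 0"
proof -
  obtain \<Delta> H C where 0: "0 < \<Delta>" "0 < H" "0 < C"
    and half: "\<And>\<theta> q1 q2 u1 u2 v. kernel \<theta> q1 q2 \<Longrightarrow> \<bar>\<theta> - \<tau>\<bar> \<le> \<Delta> \<Longrightarrow> closed_loop H \<theta> q1 q2 u1 u2 v \<Longrightarrow>
      nrm u1 u2 v H \<le> ennreal (1 / 4) * nrm u1 u2 v 0"
    and bd: "\<And>\<theta> q1 q2 u1 u2 v t. kernel \<theta> q1 q2 \<Longrightarrow> \<bar>\<theta> - \<tau>\<bar> \<le> \<Delta> \<Longrightarrow> closed_loop H \<theta> q1 q2 u1 u2 v \<Longrightarrow> 0 \<le> t \<Longrightarrow> t \<le> H \<Longrightarrow>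
      nrm u1 u2 v t \<le> ennreal C * nrm u1 u2 v 0"
    using contraction by blast
  show thesis
  proof (rule that[OF 0])
    fix \<theta> q1 q2 u1 u2 v t k
    assume k: "kernel \<theta> q1 q2" "\<bar>\<theta> - \<tau>\<bar> \<le> \<Delta>" and c: "\<And>T. closed_loop T \<theta> q1 q2 u1 u2 v"
      and t: "real k * H \<le> t" "t \<le> real (Suc k) * H"
    have sh: "closed_loop H \<theta> q1 q2 (\<lambda>x s. u1 x (t0 + s)) (\<lambda>x s. u2 x (t0 + s)) (\<lambda>x s. v x (t0 + s))" if "0 \<le> t0" for t0
      using closed_loop_shift[OF c[of "H + t0"] that] by simp
    have it: "nrm u1 u2 v (real n * H) \<le> ennreal ((1 / 4) ^ n) * nrm u1 u2 v 0" for n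
    proof (induction n)
      case (Suc n)
      have "nrm u1 u2 v (real (Suc n) * H) \<le> ennreal (1 / 4) * nrm u1 u2 v (real n * H)"
        using half[OF k sh[of "real n * H"]] 0 by (simp add: nrm_def algebra_simps)
      also have "\<dots> \<le> ennreal (1 / 4) * (ennreal ((1 / 4) ^ n) * nrm u1 u2 v 0)"
        by (intro mult_left_mono Suc) auto
      also have "\<dots> = ennreal ((1 / 4) ^ Suc n) * nrm u1 u2 v 0"
        unfolding power_Suc by (subst ennreal_mult) (auto simp: mult.assoc)
      finally show ?case .
    qed simp
    have "nrm u1 u2 v t \<le> ennreal C * nrm u1 u2 v (real k * H)"
      using bd[OF k sh[of "real k * H"], of "t - real k * H"] 0 t by (simp add: nrm_def algebra_simps)
    also have "\<dots> \<le> ennreal C * (ennreal ((1 / 4) ^ k) * nrm u1 u2 v 0)"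
      by (intro mult_left_mono it) auto
    also have "\<dots> = ennreal (C * (1 / 4) ^ k) * nrm u1 u2 v 0"
      using 0 by (subst ennreal_mult) (auto simp: mult.assoc)
    finally show "nrm u1 u2 v t \<le> ennreal (C * (1 / 4) ^ k) * nrm u1 u2 v 0" .
  qed
qed

end

section \<open>Mild solutions in closed loop\<close>

lemma mild_transport_speed_cong:
  assumes mt: "mild_transport D a b w f"
    and "\<And>x y. (x, y) \<in> D \<Longrightarrow> a' x = a x" "\<And>x y. (x, y) \<in> D \<Longrightarrow> b' y = b y"
  shows "mild_transport D a' b' w f"
  unfolding mild_transport_def
proof (intro allI impI)
  fix X Y S :: "real \<Rightarrow> real" and s :: real
  assume s: "0 \<le> s" and *: "\<forall>r\<in>{0..s}. (X r, Y r) \<in> D \<and>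
     (X has_real_derivative a' (X r)) (at r within {0..s}) \<and> (Y has_real_derivative b' (Y r)) (at r within {0..s})"
  have "\<forall>r\<in>{0..s}. (X r, Y r) \<in> D \<and>
     (X has_real_derivative a (X r)) (at r within {0..s}) \<and> (Y has_real_derivative b (Y r)) (at r within {0..s})"
    using * assms(2,3) by metis
  from mt[unfolded mild_transport_def, rule_format, OF s this[rule_format]]
  show "set_integrable lborel {0..s} (\<lambda>s. f (X s) (Y s)) \<and>
       w (X s) (Y s) - w (X 0) (Y 0) = (LBINT s:{0..s}. f (X s) (Y s))" .
qed

text \<open>The first argument of the kernel moves with constant speed \<open>1 / \<theta>\<close>,
  so \<open>\<sigma> = \<theta> * x\<close> can serve as time. This is the passage to the variables
  of \<open>kernel\<close>.\<close>

lemma mild_transport_swap: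
  assumes mt: "mild_transport ({0..1} \<times> {0..1}) (\<lambda>x. 1 / \<theta>) b w f" and \<theta>: "0 < \<theta>"
  shows "mild_transport ({0..1} \<times> {0..\<theta>}) b (\<lambda>t. 1) (\<lambda>y \<sigma>. w (\<sigma> / \<theta>) y) (\<lambda>y \<sigma>. f (\<sigma> / \<theta>) y)"
  unfolding mild_transport_def
proof (intro allI impI)
  fix X Y S :: "real \<Rightarrow> real" and s :: real
  assume s: "0 \<le> s" and *: "\<forall>r\<in>{0..s}. (X r, Y r) \<in> {0..1} \<times> {0..\<theta>} \<and>
     (X has_real_derivative b (X r)) (at r within {0..s}) \<and> (Y has_real_derivative 1) (at r within {0..s})"
  have "\<forall>r\<in>{0..s}. (Y r / \<theta>, X r) \<in> {0..1} \<times> {0..1} \<and>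
     ((\<lambda>r. Y r / \<theta>) has_real_derivative 1 / \<theta>) (at r within {0..s}) \<and> (X has_real_derivative b (X r)) (at r within {0..s})"
    using * \<theta> by (auto intro!: DERIV_cdivide)
  from mt[unfolded mild_transport_def, rule_format, OF s this[rule_format]]
  show "set_integrable lborel {0..s} (\<lambda>s. f (Y s / \<theta>) (X s)) \<and>
       w (Y s / \<theta>) (X s) - w (Y 0 / \<theta>) (X 0) = (LBINT s:{0..s}. f (Y s / \<theta>) (X s))" .
qed

text \<open>Time advances at rate \<open>\<tau>\<close> along the characteristic, so an elapsed time
  \<open>s\<close> corresponds to the parameter \<open>s / \<tau>\<close>.\<close>

lemma straight_delay:
  assumes mt: "mild_transport ({0..1} \<times> {0..}) (\<lambda>x. - 1) (\<lambda>t. \<tau>) v (\<lambda>x t. 0)" and \<tau>: "0 < \<tau>"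
  shows "straight \<tau> T (\<lambda>a t. v (1 - a / \<tau>) t) (\<lambda>_ _. 0)"
  unfolding straight_def
proof (intro allI impI)
  fix a t s :: real
  assume *: "0 \<le> a" "0 \<le> t" "0 \<le> s" "a + s \<le> \<tau>" "t + s \<le> T"
  have S: "0 \<le> s / \<tau>" using * \<tau> by simp
  have "\<forall>r\<in>{0..s / \<tau>}. (1 - a / \<tau> - r, t + \<tau> * r) \<in> {0..1} \<times> {0..} \<and>
     ((\<lambda>r. 1 - a / \<tau> - r) has_real_derivative - 1) (at r within {0..s / \<tau>}) \<and>
     ((\<lambda>r. t + \<tau> * r) has_real_derivative \<tau>) (at r within {0..s / \<tau>})"
  proof
    fix r assume r: "r \<in> {0..s / \<tau>}"
    have "a / \<tau> + r \<le> a / \<tau> + s / \<tau>" using r by simp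
    also have "\<dots> \<le> 1" using * \<tau> by (simp add: add_divide_distrib[symmetric])
    finally have "0 \<le> 1 - a / \<tau> - r" by simp
    moreover have "1 - a / \<tau> - r \<le> 1"
    proof -
      have "0 \<le> a / \<tau>" using * \<tau> by simp
      then show ?thesis using r unfolding atLeastAtMost_iff by linarith
    qed
    moreover have "0 \<le> \<tau> * r" using r \<tau> by simp
    ultimately show "(1 - a / \<tau> - r, t + \<tau> * r) \<in> {0..1} \<times> {0..} \<and>
     ((\<lambda>r. 1 - a / \<tau> - r) has_real_derivative - 1) (at r within {0..s / \<tau>}) \<and>
     ((\<lambda>r. t + \<tau> * r) has_real_derivative \<tau>) (at r within {0..s / \<tau>})"
      using r * by (auto intro!: derivative_eq_intros)
  qed
  from mt[unfolded mild_transport_def, rule_format, OF S this[rule_format]]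
  have "v (1 - a / \<tau> - s / \<tau>) (t + \<tau> * (s / \<tau>)) - v (1 - a / \<tau> - 0) (t + \<tau> * 0) = (LBINT r:{0..s / \<tau>}. (0 :: real))"
    by blast
  moreover have "set_integrable lborel {0..s} (\<lambda>r. 0 :: real)" by (simp add: set_integrable_def)
  ultimately show "set_integrable lborel {0..s} (\<lambda>r. 0 :: real) \<and> v (1 - (a + s) / \<tau>) (t + s) - v (1 - a / \<tau>) t = (LBINT r:{0..s}. (0 :: real))"
    using \<tau> by (simp add: diff_diff_eq add_divide_distrib[symmetric])
qed

lemma set_integrable_sqn:
  assumes [measurable]: "f \<in> borel_measurable borel"
  shows "set_integrable lborel {0..1} (\<lambda>x. (f x)\<^sup>2) \<longleftrightarrow> sqn {0..1} f < top"
proof -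
  have "sqn {0..1} f = (\<integral>\<^sup>+x. ennreal (norm (indicator {0..1} x *\<^sub>R (f x)\<^sup>2)) \<partial>lborel)"
    unfolding sqn_def by (intro nn_integral_cong) (auto simp: indicator_def)
  then show ?thesis by (simp add: set_integrable_def integrable_iff_bounded)
qed

lemma L2_norm3_square:
  assumes [measurable]: "f \<in> borel_measurable borel" "g \<in> borel_measurable borel" "h \<in> borel_measurable borel"
    and fin: "sqn {0..1} f < top" "sqn {0..1} g < top" "sqn {0..1} h < top"
  shows "ennreal ((L2_norm3 f g h)\<^sup>2) = sqn {0..1} f + sqn {0..1} g + sqn {0..1} h"
proof -
  have i: "set_integrable lborel {0..1} (\<lambda>x. (f x)\<^sup>2)" "set_integrable lborel {0..1} (\<lambda>x. (g x)\<^sup>2)" "set_integrable lborel {0..1} (\<lambda>x. (h x)\<^sup>2)"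
    using fin by (simp_all add: set_integrable_sqn)
  have nn: "0 \<le> (LBINT x:{0..1}. (f x)\<^sup>2 + (g x)\<^sup>2 + (h x)\<^sup>2)"
    unfolding set_lebesgue_integral_def by (intro integral_nonneg_AE) auto
  have e: "ennreal (LBINT x:{0..1}. (k x)\<^sup>2) = sqn {0..1} k" if "set_integrable lborel {0..1} (\<lambda>x. (k x)\<^sup>2)" for k :: "real \<Rightarrow> real"
  proof -
    have "(\<integral>\<^sup>+x. ennreal (indicator {0..1} x *\<^sub>R (k x)\<^sup>2) \<partial>lborel) = ennreal (LBINT x:{0..1}. (k x)\<^sup>2)"
      unfolding set_lebesgue_integral_def using that
      by (intro nn_integral_eq_integral) (auto simp: set_integrable_def)
    moreover have "(\<integral>\<^sup>+x. ennreal (indicator {0..1} x *\<^sub>R (k x)\<^sup>2) \<partial>lborel) = sqn {0..1} k"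
      unfolding sqn_def by (intro nn_integral_cong) (auto simp: indicator_def)
    ultimately show ?thesis by simp
  qed
  have p: "0 \<le> (LBINT x:{0..1}. (k x)\<^sup>2)" for k :: "real \<Rightarrow> real"
    unfolding set_lebesgue_integral_def by (intro integral_nonneg_AE) auto
  have "(L2_norm3 f g h)\<^sup>2 = (LBINT x:{0..1}. (f x)\<^sup>2 + (g x)\<^sup>2 + (h x)\<^sup>2)"
    unfolding L2_norm3_def using nn by simp
  also have "\<dots> = (LBINT x:{0..1}. (f x)\<^sup>2) + (LBINT x:{0..1}. (g x)\<^sup>2) + (LBINT x:{0..1}. (h x)\<^sup>2)"
    using i by (simp add: set_integral_add)
  finally show ?thesis using p by (simp add: e[OF i(1)] e[OF i(2)] e[OF i(3)])
qed

lemma L2_norm3_cong: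
  "(\<And>x. x \<in> {0..1} \<Longrightarrow> f x = f' x) \<Longrightarrow> (\<And>x. x \<in> {0..1} \<Longrightarrow> g x = g' x) \<Longrightarrow> (\<And>x. x \<in> {0..1} \<Longrightarrow> h x = h' x) \<Longrightarrow>
    L2_norm3 f g h = L2_norm3 f' g' h'"
  unfolding L2_norm3_def by (intro arg_cong[where f=sqrt] set_lebesgue_integral_cong) auto

lemma L2_norm3_nonneg: "0 \<le> L2_norm3 f g h"
  unfolding L2_norm3_def set_lebesgue_integral_def by (intro real_sqrt_ge_zero integral_nonneg_AE) auto

text \<open>Continuity in \<open>L^2\<close> bounds the norm near each time, and bisection extends
  the bound to \<open>{0..T}\<close>. This provides the a priori finiteness demanded by
  \<open>hsys\<close> and \<open>closed_loop\<close>.\<close>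

lemma trajectory_locally_bounded:
  fixes w1 w2 w3 :: "real \<Rightarrow> real \<Rightarrow> real"
  assumes [measurable]: "case_prod w1 \<in> borel_measurable (borel \<Otimes>\<^sub>M borel)" "case_prod w2 \<in> borel_measurable (borel \<Otimes>\<^sub>M borel)"
      "case_prod w3 \<in> borel_measurable (borel \<Otimes>\<^sub>M borel)"
    and fin: "\<And>t. 0 \<le> t \<Longrightarrow> sqn {0..1} (\<lambda>x. w1 x t) < top \<and> sqn {0..1} (\<lambda>x. w2 x t) < top \<and> sqn {0..1} (\<lambda>x. w3 x t) < top"
    and lim: "\<And>t. 0 \<le> t \<Longrightarrow> ((\<lambda>s. L2_norm3 (\<lambda>x. w1 x s - w1 x t) (\<lambda>x. w2 x s - w2 x t) (\<lambda>x. w3 x s - w3 x t)) \<longlongrightarrow> 0) (at t within {0..})"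
    and T: "0 \<le> T"
  shows "(\<integral>\<^sup>+t\<in>{0..T}. (sqn {0..1} (\<lambda>x. w1 x t) + sqn {0..1} (\<lambda>x. w2 x t) + sqn {0..1} (\<lambda>x. w3 x t)) \<partial>lborel) < top"
proof -
  let ?N = "\<lambda>t. sqn {0..1} (\<lambda>x. w1 x t) + sqn {0..1} (\<lambda>x. w2 x t) + sqn {0..1} (\<lambda>x. w3 x t)"
  \<comment> \<open>The small intervals around a time may reach below 0, where nothing is known
    about the norm; hence the intersection.\<close>
  let ?P = "\<lambda>a b. \<exists>B. \<forall>s\<in>{a..b} \<inter> {0..}. ?N s \<le> ennreal B"
  have "?P 0 T"
  proof (rule Bolzano[OF T, where P = ?P])
    fix a b c :: real
    assume "\<exists>B. \<forall>s\<in>{a..b} \<inter> {0..}. ?N s \<le> ennreal B" "\<exists>B. \<forall>s\<in>{b..c} \<inter> {0..}. ?N s \<le> ennreal B"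
    then obtain B B' where B: "\<forall>s\<in>{a..b} \<inter> {0..}. ?N s \<le> ennreal B" "\<forall>s\<in>{b..c} \<inter> {0..}. ?N s \<le> ennreal B'" by blast
    show "\<exists>B. \<forall>s\<in>{a..c} \<inter> {0..}. ?N s \<le> ennreal B"
    proof (intro exI ballI)
      fix s assume s: "s \<in> {a..c} \<inter> {0..}"
      have "?N s \<le> ennreal B \<or> ?N s \<le> ennreal B'" using B s by (cases "s \<le> b") auto
      then show "?N s \<le> ennreal (max B B')"
        by (elim disjE; elim order_trans; intro ennreal_leI; simp)
    qed
  next
    fix t :: real assume t: "0 \<le> t" "t \<le> T"
    have "eventually (\<lambda>s. L2_norm3 (\<lambda>x. w1 x s - w1 x t) (\<lambda>x. w2 x s - w2 x t) (\<lambda>x. w3 x s - w3 x t) < 1) (at t within {0..})"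
      using order_tendstoD(2)[OF lim[OF t(1)], of 1] by simp
    then obtain d where d: "0 < d" "\<And>s. s \<in> {0..} \<Longrightarrow> s \<noteq> t \<Longrightarrow> dist s t < d \<Longrightarrow>
        L2_norm3 (\<lambda>x. w1 x s - w1 x t) (\<lambda>x. w2 x s - w2 x t) (\<lambda>x. w3 x s - w3 x t) < 1"
      unfolding eventually_at by auto
    obtain r where r: "?N t = ennreal r" "0 \<le> r"
      using fin[OF t(1)] by (cases "?N t" rule: ennreal_cases) auto
    have "?N s \<le> ennreal (2 * r + 2)" if s: "0 \<le> s" "dist s t < d" for s
    proof (cases "s = t")
      case True
      then show ?thesis using r by (simp only: True) (intro ennreal_leI, simp)
    next
      case False
      have l: "L2_norm3 (\<lambda>x. w1 x s - w1 x t) (\<lambda>x. w2 x s - w2 x t) (\<lambda>x. w3 x s - w3 x t) < 1" (is "?l < 1")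
        by (rule d(2)) (use s False in auto)
      have df: "sqn {0..1} (\<lambda>x. w x s - w x t) < top"
        if [measurable]: "case_prod w \<in> borel_measurable (borel \<Otimes>\<^sub>M borel)" and f: "sqn {0..1} (\<lambda>x. w x s) < top" "sqn {0..1} (\<lambda>x. w x t) < top" for w
      proof -
        have "sqn {0..1} (\<lambda>x. w x s - w x t) \<le> 2 * sqn {0..1} (\<lambda>x. w x s) + 2 * sqn {0..1} (\<lambda>x. - w x t)"
          by (rule sqn_le2) auto
        also have "\<dots> < top" using f by (simp add: sqn_def ennreal_mult_less_top)
        finally show ?thesis .
      qed
      have sq: "ennreal (?l\<^sup>2) = sqn {0..1} (\<lambda>x. w1 x s - w1 x t) + sqn {0..1} (\<lambda>x. w2 x s - w2 x t) + sqn {0..1} (\<lambda>x. w3 x s - w3 x t)"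
        using fin[OF s(1)] fin[OF t(1)] by (intro L2_norm3_square df) auto
      have "?l\<^sup>2 \<le> 1" using l L2_norm3_nonneg by (simp add: power_le_one)
      then have sq1: "ennreal (?l\<^sup>2) \<le> 1" by simp
      have tri: "sqn {0..1} (\<lambda>x. w x s) \<le> 2 * sqn {0..1} (\<lambda>x. w x t) + 2 * sqn {0..1} (\<lambda>x. w x s - w x t)"
        if [measurable]: "case_prod w \<in> borel_measurable (borel \<Otimes>\<^sub>M borel)" for w
        by (rule sqn_le2) auto
      have "?N s \<le> (2 * sqn {0..1} (\<lambda>x. w1 x t) + 2 * sqn {0..1} (\<lambda>x. w1 x s - w1 x t))
         + (2 * sqn {0..1} (\<lambda>x. w2 x t) + 2 * sqn {0..1} (\<lambda>x. w2 x s - w2 x t))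
         + (2 * sqn {0..1} (\<lambda>x. w3 x t) + 2 * sqn {0..1} (\<lambda>x. w3 x s - w3 x t))"
        by (intro add_mono tri) measurable
      also have "\<dots> = 2 * ?N t + 2 * ennreal (?l\<^sup>2)" unfolding sq by (simp add: algebra_simps)
      also have "\<dots> \<le> 2 * ?N t + 2 * 1" by (intro add_left_mono mult_left_mono sq1) auto
      also have "\<dots> = ennreal (2 * r + 2)" unfolding r(1) using r(2) by (simp add: ennreal_mult)
      finally show ?thesis .
    qed
    then have "\<forall>s\<in>{a..b} \<inter> {0..}. ?N s \<le> ennreal (2 * r + 2)" if "a \<le> t \<and> t \<le> b \<and> b - a < d" for a b
      using that by (auto simp: dist_real_def)
    then show "\<exists>d>0. \<forall>a b. a \<le> t \<and> t \<le> b \<and> b - a < d \<longrightarrow> (\<exists>B. \<forall>s\<in>{a..b} \<inter> {0..}. ?N s \<le> ennreal B)"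
      using d(1) by blast
  qed
  then obtain B where B: "\<forall>s\<in>{0..T}. ?N s \<le> ennreal B" by auto
  have "(\<integral>\<^sup>+t\<in>{0..T}. ?N t \<partial>lborel) \<le> (\<integral>\<^sup>+t. ennreal B * indicator {0..T} t \<partial>lborel)"
    using B by (intro nn_integral_mono) (auto simp: indicator_def)
  also have "\<dots> < top" using T by (simp add: nn_integral_cmult_indicator ennreal_mult_less_top)
  finally show ?thesis .
qed

text \<open>Measurability and bounds are given on a domain only. The extension makes them global and
  leaves mild transport alone, which sees the domain only.\<close>

definition zero_ext :: "(real \<times> real) set \<Rightarrow> (real \<Rightarrow> real \<Rightarrow> real) \<Rightarrow> real \<Rightarrow> real \<Rightarrow> real" where
  "zero_ext D w x t = (if (x, t) \<in> D then w x t else 0)"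

lemma zero_ext_measurable:
  assumes "set_borel_measurable borel D (\<lambda>(x, t). w x t)"
  shows "case_prod (zero_ext D w) \<in> borel_measurable (borel \<Otimes>\<^sub>M borel)"
proof -
  have "case_prod (zero_ext D w) = (\<lambda>p. indicator D p *\<^sub>R (case p of (x, t) \<Rightarrow> w x t))"
    by (intro ext) (simp add: zero_ext_def indicator_def split: prod.split)
  with assms show ?thesis unfolding set_borel_measurable_def borel_prod by (simp only:)
qed

lemma zero_ext_continuous_measurable:
  assumes "continuous_on D (\<lambda>(x, t). w x t)" "closed D"
  shows "case_prod (zero_ext D w) \<in> borel_measurable (borel \<Otimes>\<^sub>M borel)"
  using assms by (intro zero_ext_measurable set_measurable_continuous_on) (auto simp: borel_closed)

lemma zero_ext_bounded:
  assumes "bounded ((\<lambda>(x, t). w x t) ` D)"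
  obtains B where "\<And>x t. \<bar>zero_ext D w x t\<bar> \<le> B"
proof -
  obtain B where B: "\<forall>z\<in>(\<lambda>(x, t). w x t) ` D. norm z \<le> B" using assms unfolding bounded_iff by blast
  have "\<bar>zero_ext D w x t\<bar> \<le> max 0 B" for x t
  proof (cases "(x, t) \<in> D")
    case True
    then show ?thesis using bspec[OF B imageI[OF True]] by (simp add: zero_ext_def)
  qed (simp add: zero_ext_def)
  then show thesis by (rule that)
qed

text \<open>The retraction onto the unit interval: composition with it extends a continuous
  coefficient to the line within the same bounds.\<close>

definition clamp01 :: "real \<Rightarrow> real" where "clamp01 x = max 0 (min 1 x)"

lemma clamp01_in: "clamp01 x \<in> {0..1}" and clamp01_id: "x \<in> {0..1} \<Longrightarrow> clamp01 x = x"
  by (auto simp: clamp01_def)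

lemma continuous_clamp01: "continuous_on {0..1} f \<Longrightarrow> continuous_on UNIV (\<lambda>x. f (clamp01 x))" for f :: "real \<Rightarrow> real"
  by (rule continuous_on_compose2[of "{0..1}" f]) (auto simp: clamp01_def intro!: continuous_intros)

lemma closed_triangle: "closed triangle"
proof -
  have *: "triangle = {p. 0 \<le> snd p} \<inter> {p. snd p \<le> fst p} \<inter> {p. fst p \<le> 1}" by (auto simp: triangle_def)
  show ?thesis unfolding * by (intro closed_Int closed_Collect_le continuous_intros)
qed

lemma compact_triangle: "compact triangle"
proof -
  have sub: "triangle \<subseteq> {0..1} \<times> {0..1}" by (auto simp: triangle_def)
  have "compact ({0..1::real} \<times> {0..1::real})" by (intro compact_Times compact_Icc)
  then have "compact ({0..1} \<times> {0..1} \<inter> triangle)" using closed_triangle by (intro compact_Int_closed)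
  then show ?thesis by (simp only: Int_absorb1[OF sub])
qed

lemma bounded_on_triangle:
  assumes "continuous_on triangle (\<lambda>(x, y). K x y)"
  obtains B where "\<And>x y. (x, y) \<in> triangle \<Longrightarrow> \<bar>K x y :: real\<bar> \<le> B"
proof -
  have "bounded ((\<lambda>(x, y). K x y) ` triangle)"
    using compact_triangle assms by (intro compact_imp_bounded compact_continuous_image)
  then obtain B where B: "\<forall>z\<in>(\<lambda>(x, y). K x y) ` triangle. norm z \<le> B" unfolding bounded_iff by blast
  show thesis
  proof (rule that)
    fix x y assume "(x, y) \<in> triangle"
    from bspec[OF B imageI[OF this]] show "\<bar>K x y\<bar> \<le> B" by simp
  qed
qed

section \<open>From the given equations to the abstract closed loop\<close>

context ctrl
begin

text \<open>The families change places: the second kernel, whose \<open>y\<close> moves with speed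
  \<open>\<epsilon>2\<close>, becomes the right-moving \<open>q1\<close>, and the first one the
  left-moving \<open>q2\<close>. Multiplication by the speeds turns the products in the equations
  into the unknowns.\<close>

lemma \<alpha>_kernels_kernel:
  assumes \<alpha>: "\<alpha>_kernels \<epsilon>1 \<epsilon>2 c1 c2 q K21 K22 \<theta> \<alpha>1 \<alpha>2" and \<theta>: "0 < \<theta>"
    and e: "\<And>x. x \<in> {0..1} \<Longrightarrow> e1 x = \<epsilon>1 x" "\<And>x. x \<in> {0..1} \<Longrightarrow> e2 x = \<epsilon>2 x"
    and d: "\<And>x. x \<in> {0..1} \<Longrightarrow> d1 x = c1 x" "\<And>x. x \<in> {0..1} \<Longrightarrow> d2 x = c2 x"
    and K: "\<And>y. y \<in> {0..1} \<Longrightarrow> K1 1 y = K21 1 y" "\<And>y. y \<in> {0..1} \<Longrightarrow> K2 1 y = K22 1 y"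
  shows "kernel \<theta> (\<lambda>y \<sigma>. e2 y * zero_ext ({0..1} \<times> {0..1}) \<alpha>2 (\<sigma> / \<theta>) y)
    (\<lambda>y \<sigma>. e1 y * zero_ext ({0..1} \<times> {0..1}) \<alpha>1 (\<sigma> / \<theta>) y)"
proof -
  let ?Q = "{0..1} \<times> {0..1} :: (real \<times> real) set"
  let ?a1 = "zero_ext ?Q \<alpha>1" and ?a2 = "zero_ext ?Q \<alpha>2"
  let ?q1 = "\<lambda>y \<sigma>. e2 y * ?a2 (\<sigma> / \<theta>) y" and ?q2 = "\<lambda>y \<sigma>. e1 y * ?a1 (\<sigma> / \<theta>) y"
  note A = \<alpha>[unfolded \<alpha>_kernels_def]
  have [measurable]: "case_prod ?a1 \<in> borel_measurable (borel \<Otimes>\<^sub>M borel)" "case_prod ?a2 \<in> borel_measurable (borel \<Otimes>\<^sub>M borel)"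
    using A by (auto intro!: zero_ext_measurable)
  have m: "case_prod ?q1 \<in> borel_measurable (borel \<Otimes>\<^sub>M borel)" "case_prod ?q2 \<in> borel_measurable (borel \<Otimes>\<^sub>M borel)"
    by measurable
  note [measurable] = m
  have "bounded ((\<lambda>(x, y). \<alpha>1 x y) ` ?Q)" "bounded ((\<lambda>(x, y). \<alpha>2 x y) ` ?Q)" using A by auto
  then obtain B1 B2 where B1: "\<And>x y. \<bar>?a1 x y\<bar> \<le> B1" and B2: "\<And>x y. \<bar>?a2 x y\<bar> \<le> B2"
    using zero_ext_bounded by metis
  have qb: "\<bar>?q1 y \<sigma>\<bar> \<le> M * B2" "\<bar>?q2 y \<sigma>\<bar> \<le> M * B1" for y \<sigma>
    using s1.epos[of y] s2.epos[of y] s1.m(3)[of y] s2.m(3)[of y] B1[of "\<sigma> / \<theta>" y] B2[of "\<sigma> / \<theta>" y] s1.M_pos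
    by (auto simp: abs_mult intro!: mult_mono)
  have fin: "(\<integral>\<^sup>+t\<in>{0..\<theta>}. (sqn {0..1} (\<lambda>x. ?q1 x t) + sqn {0..1} (\<lambda>x. ?q2 x t)) \<partial>lborel) < \<infinity>"
  proof -
    have "(\<integral>\<^sup>+t\<in>{0..\<theta>}. (sqn {0..1} (\<lambda>x. ?q1 x t) + sqn {0..1} (\<lambda>x. ?q2 x t)) \<partial>lborel)
      \<le> (\<integral>\<^sup>+t. (ennreal ((M * B2)\<^sup>2 * (1 - 0)) + ennreal ((M * B1)\<^sup>2 * (1 - 0))) * indicator {0..\<theta>} t \<partial>lborel)"
      using qb by (intro nn_integral_mono mult_right_mono add_mono sqn_const) auto
    also have "\<dots> < \<infinity>" using \<theta> by (simp add: nn_integral_cmult_indicator ennreal_mult_less_top)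
    finally show ?thesis .
  qed
  have D: "x \<in> {0..1} \<Longrightarrow> t \<in> {0..\<theta>} \<Longrightarrow> (t / \<theta>, x) \<in> ?Q" for x t :: real using \<theta> by auto
  have t1: "mild_transport ({0..1} \<times> {0..\<theta>}) e2 (\<lambda>t. 1) ?q1 (\<lambda>x t. d1' x * ?q2 x t)"
  proof (rule mild_transport_cong)
    have "mild_transport ({0..1} \<times> {0..\<theta>}) \<epsilon>2 (\<lambda>t. 1) (\<lambda>y \<sigma>. \<epsilon>2 y * \<alpha>2 (\<sigma> / \<theta>) y) (\<lambda>y \<sigma>. \<epsilon>2 y * (c1 y * \<alpha>1 (\<sigma> / \<theta>) y))"
      using A by (intro mild_transport_swap \<theta>) auto
    then show "mild_transport ({0..1} \<times> {0..\<theta>}) e2 (\<lambda>t. 1) (\<lambda>y \<sigma>. \<epsilon>2 y * \<alpha>2 (\<sigma> / \<theta>) y) (\<lambda>y \<sigma>. \<epsilon>2 y * (c1 y * \<alpha>1 (\<sigma> / \<theta>) y))"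
      by (rule mild_transport_speed_cong) (use e in auto)
    fix x t :: real assume xt: "(x, t) \<in> {0..1} \<times> {0..\<theta>}"
    then have Q: "(t / \<theta>, x) \<in> ?Q" using D by blast
    show "\<epsilon>2 x * \<alpha>2 (t / \<theta>) x = e2 x * ?a2 (t / \<theta>) x" using xt Q e by (simp add: zero_ext_def)
    show "\<epsilon>2 x * (c1 x * \<alpha>1 (t / \<theta>) x) = d1' x * (e1 x * ?a1 (t / \<theta>) x)"
      using xt Q e d s1.epos[of x] by (simp add: zero_ext_def d1'_def)
  qed
  have t2: "mild_transport ({0..1} \<times> {0..\<theta>}) (\<lambda>x. - e1 x) (\<lambda>t. 1) ?q2 (\<lambda>x t. d2' x * ?q1 x t)"
  proof (rule mild_transport_cong)
    have "mild_transport ({0..1} \<times> {0..\<theta>}) (\<lambda>x. - \<epsilon>1 x) (\<lambda>t. 1) (\<lambda>y \<sigma>. \<epsilon>1 y * \<alpha>1 (\<sigma> / \<theta>) y) (\<lambda>y \<sigma>. \<epsilon>1 y * (c2 y * \<alpha>2 (\<sigma> / \<theta>) y))"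
      using A by (intro mild_transport_swap \<theta>) auto
    then show "mild_transport ({0..1} \<times> {0..\<theta>}) (\<lambda>x. - e1 x) (\<lambda>t. 1) (\<lambda>y \<sigma>. \<epsilon>1 y * \<alpha>1 (\<sigma> / \<theta>) y) (\<lambda>y \<sigma>. \<epsilon>1 y * (c2 y * \<alpha>2 (\<sigma> / \<theta>) y))"
      by (rule mild_transport_speed_cong) (use e in auto)
    fix x t :: real assume xt: "(x, t) \<in> {0..1} \<times> {0..\<theta>}"
    then have Q: "(t / \<theta>, x) \<in> ?Q" using D by blast
    show "\<epsilon>1 x * \<alpha>1 (t / \<theta>) x = e1 x * ?a1 (t / \<theta>) x" using xt Q e by (simp add: zero_ext_def)
    show "\<epsilon>1 x * (c2 x * \<alpha>2 (t / \<theta>) x) = d2' x * (e2 x * ?a2 (t / \<theta>) x)"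
      using xt Q e d s2.epos[of x] by (simp add: zero_ext_def d2'_def)
  qed
  have bc: "?q1 0 t = q * ?q2 0 t" if "0 < t" "t \<le> \<theta>" for t
  proof -
    have "t / \<theta> \<in> {0..1}" using that \<theta> by simp
    then show ?thesis using A e by (simp add: zero_ext_def)
  qed
  have z: "?q2 1 t = 0" if "0 < t" "t \<le> \<theta>" for t
  proof -
    have "t / \<theta> \<in> {0<..1}" using that \<theta> by simp
    then show ?thesis using A by (simp add: zero_ext_def)
  qed
  show ?thesis
    unfolding kernel_def hsys_def
  proof (intro conjI allI impI)
    fix y :: real assume y: "0 \<le> y"
    show "?q1 y 0 = e2 y * K2 1 y" if "y \<le> 1" using A K y that by (simp add: zero_ext_def)
    show "?q2 y 0 = e1 y * K1 1 y" if "y < 1" using A K y that by (simp add: zero_ext_def)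
  qed (use \<theta> m fin t1 t2 bc z in auto)
qed

text \<open>The extensions agree with the solution on the unit interval for nonnegative times, and
  transport, traces, law and norm see nothing else. The finite space-time norms come from
  \<open>trajectory_locally_bounded\<close>.\<close>

lemma closed_loop_of_solution:
  assumes sol: "closed_loop_solution \<epsilon>1 \<epsilon>2 c1 c2 q \<tau> \<theta> \<alpha>1 \<alpha>2 u1 u2 v" and \<theta>: "0 < \<theta>"
    and e: "\<And>x. x \<in> {0..1} \<Longrightarrow> e1 x = \<epsilon>1 x" "\<And>x. x \<in> {0..1} \<Longrightarrow> e2 x = \<epsilon>2 x"
    and d: "\<And>x. x \<in> {0..1} \<Longrightarrow> d1 x = c1 x" "\<And>x. x \<in> {0..1} \<Longrightarrow> d2 x = c2 x"
  defines "w1 \<equiv> zero_ext ({0..1} \<times> {0..}) u1" and "w2 \<equiv> zero_ext ({0..1} \<times> {0..}) u2" and "w3 \<equiv> zero_ext ({0..1} \<times> {0..}) v"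
  shows "closed_loop T \<theta> (\<lambda>y \<sigma>. e2 y * zero_ext ({0..1} \<times> {0..1}) \<alpha>2 (\<sigma> / \<theta>) y)
      (\<lambda>y \<sigma>. e1 y * zero_ext ({0..1} \<times> {0..1}) \<alpha>1 (\<sigma> / \<theta>) y) w1 w2 w3"
    and "0 \<le> t \<Longrightarrow> ennreal ((L2_norm3 (\<lambda>x. u1 x t) (\<lambda>x. u2 x t) (\<lambda>x. v x t))\<^sup>2) = nrm w1 w2 w3 t"
proof -
  let ?D = "{0..1} \<times> {0..} :: (real \<times> real) set"
  let ?q1 = "\<lambda>y \<sigma>. e2 y * zero_ext ({0..1} \<times> {0..1}) \<alpha>2 (\<sigma> / \<theta>) y"
  let ?q2 = "\<lambda>y \<sigma>. e1 y * zero_ext ({0..1} \<times> {0..1}) \<alpha>1 (\<sigma> / \<theta>) y"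
  note P = sol[unfolded closed_loop_solution_def plant_solution_def]
  note Tr = P[THEN conjunct1, unfolded L2_trajectory_def]
  have m [measurable]: "case_prod w1 \<in> borel_measurable (borel \<Otimes>\<^sub>M borel)" "case_prod w2 \<in> borel_measurable (borel \<Otimes>\<^sub>M borel)"
    "case_prod w3 \<in> borel_measurable (borel \<Otimes>\<^sub>M borel)"
    unfolding w1_def w2_def w3_def using Tr by (auto intro!: zero_ext_measurable)
  have eq: "w1 x t = u1 x t" "w2 x t = u2 x t" "w3 x t = v x t" if "x \<in> {0..1}" "0 \<le> t" for x t
    using that by (auto simp: w1_def w2_def w3_def zero_ext_def)
  have sq: "set_integrable lborel {0..1} (\<lambda>x. (w1 x t)\<^sup>2) \<and> set_integrable lborel {0..1} (\<lambda>x. (w2 x t)\<^sup>2) \<and> set_integrable lborel {0..1} (\<lambda>x. (w3 x t)\<^sup>2)"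
    if t: "0 \<le> t" for t
  proof -
    have "set_integrable lborel {0..1} (\<lambda>x. (u1 x t)\<^sup>2)" "set_integrable lborel {0..1} (\<lambda>x. (u2 x t)\<^sup>2)" "set_integrable lborel {0..1} (\<lambda>x. (v x t)\<^sup>2)"
      using Tr t by auto
    moreover have "set_integrable lborel {0..1} (\<lambda>x. (w1 x t)\<^sup>2) = set_integrable lborel {0..1} (\<lambda>x. (u1 x t)\<^sup>2)"
      "set_integrable lborel {0..1} (\<lambda>x. (w2 x t)\<^sup>2) = set_integrable lborel {0..1} (\<lambda>x. (u2 x t)\<^sup>2)"
      "set_integrable lborel {0..1} (\<lambda>x. (w3 x t)\<^sup>2) = set_integrable lborel {0..1} (\<lambda>x. (v x t)\<^sup>2)"
      by (rule set_integrable_cong; use eq t in simp)+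
    ultimately show ?thesis by simp
  qed
  have fin: "sqn {0..1} (\<lambda>x. w1 x t) < top \<and> sqn {0..1} (\<lambda>x. w2 x t) < top \<and> sqn {0..1} (\<lambda>x. w3 x t) < top" if t: "0 \<le> t" for t
    using sq[OF t] set_integrable_sqn[of "\<lambda>x. w1 x t"] set_integrable_sqn[of "\<lambda>x. w2 x t"] set_integrable_sqn[of "\<lambda>x. w3 x t"] by simp
  show "ennreal ((L2_norm3 (\<lambda>x. u1 x t) (\<lambda>x. u2 x t) (\<lambda>x. v x t))\<^sup>2) = nrm w1 w2 w3 t" if t: "0 \<le> t"
  proof -
    have "L2_norm3 (\<lambda>x. u1 x t) (\<lambda>x. u2 x t) (\<lambda>x. v x t) = L2_norm3 (\<lambda>x. w1 x t) (\<lambda>x. w2 x t) (\<lambda>x. w3 x t)"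
      using t by (intro L2_norm3_cong) (auto simp: eq)
    then show ?thesis unfolding nrm_def using fin[OF t] by (simp add: L2_norm3_square)
  qed
  have lim: "((\<lambda>s. L2_norm3 (\<lambda>x. w1 x s - w1 x t) (\<lambda>x. w2 x s - w2 x t) (\<lambda>x. w3 x s - w3 x t)) \<longlongrightarrow> 0) (at t within {0..})"
    if t: "0 \<le> t" for t
  proof -
    have "((\<lambda>s. L2_norm3 (\<lambda>x. u1 x s - u1 x t) (\<lambda>x. u2 x s - u2 x t) (\<lambda>x. v x s - v x t)) \<longlongrightarrow> 0) (at t within {0..})"
      using Tr t by blast
    then show ?thesis
    proof (rule Lim_transform_eventually)
      show "\<forall>\<^sub>F s in at t within {0..}. L2_norm3 (\<lambda>x. u1 x s - u1 x t) (\<lambda>x. u2 x s - u2 x t) (\<lambda>x. v x s - v x t)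
        = L2_norm3 (\<lambda>x. w1 x s - w1 x t) (\<lambda>x. w2 x s - w2 x t) (\<lambda>x. w3 x s - w3 x t)"
        unfolding eventually_at_filter
        by (rule always_eventually) (use t in \<open>auto intro!: L2_norm3_cong simp: eq\<close>)
    qed
  qed
  have spacetime: "(\<integral>\<^sup>+t\<in>{0..T}. (sqn {0..1} (\<lambda>x. w1 x t) + sqn {0..1} (\<lambda>x. w2 x t) + sqn {0..1} (\<lambda>x. w3 x t)) \<partial>lborel) < top"
  proof (cases "0 \<le> T")
    case True
    then show ?thesis using fin lim by (intro trajectory_locally_bounded) auto
  qed simp
  have f12: "(\<integral>\<^sup>+t\<in>{0..T}. (sqn {0..1} (\<lambda>x. w1 x t) + sqn {0..1} (\<lambda>x. w2 x t)) \<partial>lborel) < \<infinity>"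
    by (simp, rule le_less_trans[OF _ spacetime]) (intro nn_integral_mono mult_right_mono, auto simp: add_increasing2)
  have f3: "(\<integral>\<^sup>+t\<in>{0..T}. sqn {0..1} (\<lambda>x. w3 x t) \<partial>lborel) < \<infinity>"
    by (simp, rule le_less_trans[OF _ spacetime]) (intro nn_integral_mono mult_right_mono, auto simp: add_increasing)
  have sub: "{0..1} \<times> {0..T} \<subseteq> ?D" by auto
  have t1: "mild_transport ({0..1} \<times> {0..T}) e1 (\<lambda>t. 1) w1 (\<lambda>x t. d1 x * w2 x t)"
  proof (rule mild_transport_cong[OF mild_transport_speed_cong[OF mild_transport_subset[OF _ sub]]])
    show "mild_transport ?D \<epsilon>1 (\<lambda>t. 1) u1 (\<lambda>x t. c1 x * u2 x t)" using P by blast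
  qed (auto simp: eq e d)
  have t2: "mild_transport ({0..1} \<times> {0..T}) (\<lambda>x. - e2 x) (\<lambda>t. 1) w2 (\<lambda>x t. d2 x * w1 x t)"
  proof (rule mild_transport_cong[OF mild_transport_speed_cong[OF mild_transport_subset[OF _ sub]]])
    show "mild_transport ?D (\<lambda>x. - \<epsilon>2 x) (\<lambda>t. 1) u2 (\<lambda>x t. c2 x * u1 x t)" using P by blast
  qed (auto simp: eq e d)
  have t3: "straight \<tau> T (\<lambda>a t. w3 (1 - a / \<tau>) t) (\<lambda>_ _. 0)"
  proof (rule straight_delay[OF _ \<tau>], rule mild_transport_cong)
    show "mild_transport ?D (\<lambda>x. - 1) (\<lambda>t. \<tau>) v (\<lambda>x t. 0)" using P by blast
  qed (auto simp: eq)
  have U: "control_law \<epsilon>2 \<theta> \<alpha>1 \<alpha>2 u1 u2 v t = Ulaw \<theta> ?q1 ?q2 w1 w2 w3 t" if t: "0 \<le> t" for t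
  proof -
    have "(LBINT y:{0..1}. p_kernel \<epsilon>2 \<theta> \<alpha>2 (1 - y) * v y t) = (LBINT y:{0..1}. w3 y t * (\<theta> * ?q1 1 (\<theta> * (1 - y))))"
    proof (intro set_lebesgue_integral_cong ballI allI impI)
      fix y :: real assume "y \<in> {0..1}"
      then show "p_kernel \<epsilon>2 \<theta> \<alpha>2 (1 - y) * v y t = w3 y t * (\<theta> * ?q1 1 (\<theta> * (1 - y)))"
        using \<theta> eq(3)[OF _ t] e(2)[of 1] by (simp add: p_kernel_def zero_ext_def)
    qed simp
    moreover have "(LBINT y:{0..1}. \<alpha>1 1 y * u1 y t) = (LBINT y:{0..1}. w1 y t * ?q2 y \<theta> / e1 y)"
    proof (intro set_lebesgue_integral_cong ballI allI impI)
      fix y :: real assume "y \<in> {0..1}"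
      then show "\<alpha>1 1 y * u1 y t = w1 y t * ?q2 y \<theta> / e1 y"
        using \<theta> eq(1)[OF _ t] s1.epos[of y] by (simp add: zero_ext_def)
    qed simp
    moreover have "(LBINT y:{0..1}. \<alpha>2 1 y * u2 y t) = (LBINT y:{0..1}. w2 y t * ?q1 y \<theta> / e2 y)"
    proof (intro set_lebesgue_integral_cong ballI allI impI)
      fix y :: real assume "y \<in> {0..1}"
      then show "\<alpha>2 1 y * u2 y t = w2 y t * ?q1 y \<theta> / e2 y"
        using \<theta> eq(2)[OF _ t] s2.epos[of y] by (simp add: zero_ext_def)
    qed simp
    ultimately show ?thesis unfolding control_law_def Ulaw_def pair_def by simp
  qed
  have bc: "u1 0 t = q * u2 0 t \<and> u2 1 t = v 0 t \<and> v 1 t = control_law \<epsilon>2 \<theta> \<alpha>1 \<alpha>2 u1 u2 v t" if "0 < t" for t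
    using P that by blast
  show "closed_loop T \<theta> ?q1 ?q2 w1 w2 w3"
    unfolding closed_loop_def hsys_def
    using m t1 t2 t3 f12 f3 bc eq U by auto
qed

text \<open>An arbitrary predicate \<open>sol\<close> whose norms are realised by closed loops keeps
  the extension by zero out of the argument. The norm is the root of \<open>nrm\<close>, whence the
  ratio \<open>1 / 2\<close> per period \<open>H\<close> and the constant
  \<open>sqrt C\<close>.\<close>

theorem robust_stability:
  obtains \<Delta> where "0 < \<Delta>"
    "\<And>\<theta> q1 q2 sol. kernel \<theta> q1 q2 \<Longrightarrow> \<bar>\<theta> - \<tau>\<bar> \<le> \<Delta> \<Longrightarrow>
      (\<And>u1 u2 v. sol u1 u2 v \<Longrightarrow> \<exists>w1 w2 w3. (\<forall>T. closed_loop T \<theta> q1 q2 w1 w2 w3) \<and>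
        (\<forall>t\<ge>0. ennreal ((L2_norm3 (\<lambda>x. u1 x t) (\<lambda>x. u2 x t) (\<lambda>x. v x t))\<^sup>2) = nrm w1 w2 w3 t)) \<Longrightarrow>
      asymptotically_stable sol"
proof -
  obtain \<Delta> H C where 0: "0 < \<Delta>" "0 < H" "0 < C"
    and dec: "\<And>\<theta> q1 q2 u1 u2 v t k. kernel \<theta> q1 q2 \<Longrightarrow> \<bar>\<theta> - \<tau>\<bar> \<le> \<Delta> \<Longrightarrow> (\<And>T. closed_loop T \<theta> q1 q2 u1 u2 v) \<Longrightarrow> real k * H \<le> t \<Longrightarrow> t \<le> real (Suc k) * H \<Longrightarrow>
      nrm u1 u2 v t \<le> ennreal (C * (1 / 4) ^ k) * nrm u1 u2 v 0"
    using decay by blast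
  show thesis
  proof (rule that[OF 0(1)])
    fix \<theta> q1 q2 sol
    assume k: "kernel \<theta> q1 q2" "\<bar>\<theta> - \<tau>\<bar> \<le> \<Delta>"
      and sol: "\<And>u1 u2 v. sol u1 u2 v \<Longrightarrow> \<exists>w1 w2 w3. (\<forall>T. closed_loop T \<theta> q1 q2 w1 w2 w3) \<and>
        (\<forall>t\<ge>0. ennreal ((L2_norm3 (\<lambda>x. u1 x t) (\<lambda>x. u2 x t) (\<lambda>x. v x t))\<^sup>2) = nrm w1 w2 w3 t)"
    let ?N = "\<lambda>u1 u2 v t. L2_norm3 (\<lambda>x. u1 x t) (\<lambda>x. u2 x t) (\<lambda>x. v x t)"
    have bound: "?N u1 u2 v t \<le> sqrt C * (1 / 2) ^ n * ?N u1 u2 v 0" if s: "sol u1 u2 v" and t: "real n * H \<le> t" for u1 u2 v t n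
    proof -
      obtain w1 w2 w3 where w: "\<And>T. closed_loop T \<theta> q1 q2 w1 w2 w3"
        "\<And>t. 0 \<le> t \<Longrightarrow> ennreal ((?N u1 u2 v t)\<^sup>2) = nrm w1 w2 w3 t" using sol[OF s] by blast
      \<comment> \<open>The index of a period containing \<open>t\<close>. As
        \<open>n \<le> j\<close>, the decay after \<open>j\<close> periods is at least that after
        \<open>n\<close>.\<close>
      define j where "j = nat \<lfloor>t / H\<rfloor>"
      have t0: "0 \<le> t" using t 0(2) by (meson mult_nonneg_nonneg of_nat_0_le_iff less_imp_le order_trans)
      have tH: "0 \<le> t / H" using t0 0 by simp
      have "real j \<le> t / H" "t / H \<le> real j + 1" unfolding j_def using tH by (simp_all add: of_nat_nat floor_le_iff)
      then have j: "real j * H \<le> t" "t \<le> real (Suc j) * H" using 0(2) by (simp_all add: field_simps)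
      have "real n \<le> t / H" using t 0(2) by (simp add: field_simps)
      then have nj: "n \<le> j" unfolding j_def using tH by (simp add: le_nat_floor)
      have "ennreal ((?N u1 u2 v t)\<^sup>2) \<le> ennreal (C * (1 / 4) ^ j) * ennreal ((?N u1 u2 v 0)\<^sup>2)"
        using dec[OF k w(1) j] w(2)[OF t0] w(2)[of 0] by simp
      also have "\<dots> = ennreal (C * (1 / 4) ^ j * (?N u1 u2 v 0)\<^sup>2)" using 0 by (simp add: ennreal_mult)
      finally have "(?N u1 u2 v t)\<^sup>2 \<le> C * (1 / 4) ^ j * (?N u1 u2 v 0)\<^sup>2"
        using 0 by (subst (asm) ennreal_le_iff) auto
      also have "\<dots> \<le> C * (1 / 4) ^ n * (?N u1 u2 v 0)\<^sup>2"
        using 0 nj by (intro mult_right_mono mult_left_mono power_decreasing) auto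
      also have "\<dots> = (sqrt C * (1 / 2) ^ n * ?N u1 u2 v 0)\<^sup>2"
      proof -
        have "((1 / 2) ^ n)\<^sup>2 = (1 / 4 :: real) ^ n"
          by (simp add: power_mult[symmetric] mult.commute[of n] power_mult power_divide)
        then show ?thesis using 0 by (simp add: power_mult_distrib)
      qed
      finally show ?thesis
        by (rule power2_le_imp_le) (use 0 in \<open>intro mult_nonneg_nonneg L2_norm3_nonneg real_sqrt_ge_zero zero_le_power, simp_all\<close>)
    qed
    have sC: "0 < sqrt C" using 0 by simp
    show "asymptotically_stable sol"
      unfolding asymptotically_stable_def
    proof (intro conjI allI impI)
      fix \<epsilon> :: real assume \<epsilon>: "0 < \<epsilon>"
      show "\<exists>d>0. \<forall>u1 u2 v. sol u1 u2 v \<longrightarrow> ?N u1 u2 v 0 < d \<longrightarrow> (\<forall>t\<ge>0. ?N u1 u2 v t < \<epsilon>)"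
      proof (intro exI conjI allI impI)
        show "0 < \<epsilon> / sqrt C" using \<epsilon> sC by simp
        fix u1 u2 v t assume s: "sol u1 u2 v" "?N u1 u2 v 0 < \<epsilon> / sqrt C" and t: "(0 :: real) \<le> t"
        have "?N u1 u2 v t \<le> sqrt C * ?N u1 u2 v 0" using bound[OF s(1), of 0 t] t by simp
        also have "\<dots> < \<epsilon>" using s(2) sC by (simp add: field_simps)
        finally show "?N u1 u2 v t < \<epsilon>" .
      qed
    next
      fix u1 u2 v assume s: "sol u1 u2 v"
      show "((\<lambda>t. ?N u1 u2 v t) \<longlongrightarrow> 0) at_top"
      proof (rule order_tendstoI)
        fix a :: real assume "a < 0"
        then show "\<forall>\<^sub>F t in at_top. a < ?N u1 u2 v t"
          by (intro always_eventually allI) (meson L2_norm3_nonneg less_le_trans)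
      next
        fix a :: real assume a: "0 < a"
        have "(\<lambda>n. sqrt C * (1 / 2) ^ n * ?N u1 u2 v 0) \<longlonglongrightarrow> sqrt C * 0 * ?N u1 u2 v 0"
          by (intro tendsto_intros LIMSEQ_power_zero) simp
        then have "\<forall>\<^sub>F n in sequentially. sqrt C * (1 / 2) ^ n * ?N u1 u2 v 0 < a"
          using a by (intro order_tendstoD(2)) auto
        then obtain n where n: "sqrt C * (1 / 2) ^ n * ?N u1 u2 v 0 < a"
          unfolding eventually_sequentially by blast
        show "\<forall>\<^sub>F t in at_top. ?N u1 u2 v t < a"
          unfolding eventually_at_top_linorder
          using bound[OF s, of n] n by (meson le_less_trans)
      qed
    qed
  qed
qed

end

theorem theorem3:
  fixes \<tau> q :: real
    and \<epsilon>\<^sub>1 \<epsilon>\<^sub>2 c\<^sub>1 c\<^sub>2 :: "real \<Rightarrow> real"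
    and K21 K22 :: "real \<Rightarrow> real \<Rightarrow> real"
  assumes "\<tau> > 0" and "q > 0"
    and "continuous_on {0..1} \<epsilon>\<^sub>1" and "continuous_on {0..1} \<epsilon>\<^sub>2"
    and "continuous_on {0..1} c\<^sub>1" and "continuous_on {0..1} c\<^sub>2"
    and "\<forall>x\<in>{0..1}. \<epsilon>\<^sub>1 x > 0" and "\<forall>x\<in>{0..1}. \<epsilon>\<^sub>2 x > 0"
    and "K_kernels \<epsilon>\<^sub>1 \<epsilon>\<^sub>2 c\<^sub>1 c\<^sub>2 q K21 K22"
  shows "\<exists>\<Delta>\<tau>\<^sub>0>0. \<forall>\<theta>>0. \<bar>\<theta> - \<tau>\<bar> \<le> \<Delta>\<tau>\<^sub>0 \<longrightarrow>
    (\<forall>\<alpha>\<^sub>1 \<alpha>\<^sub>2. \<alpha>_kernels \<epsilon>\<^sub>1 \<epsilon>\<^sub>2 c\<^sub>1 c\<^sub>2 q K21 K22 \<theta> \<alpha>\<^sub>1 \<alpha>\<^sub>2 \<longrightarrow>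
       asymptotically_stable (closed_loop_solution \<epsilon>\<^sub>1 \<epsilon>\<^sub>2 c\<^sub>1 c\<^sub>2 q \<tau> \<theta> \<alpha>\<^sub>1 \<alpha>\<^sub>2))"
proof -
  \<comment> \<open>The coefficients are continued as constants beyond both ends, since
    \<open>speed\<close> and \<open>hyp\<close> ask for functions on the line.\<close>
  define e1 where "e1 x = \<epsilon>\<^sub>1 (clamp01 x)" for x
  define e2 where "e2 x = \<epsilon>\<^sub>2 (clamp01 x)" for x
  define d1 where "d1 x = c\<^sub>1 (clamp01 x)" for x
  define d2 where "d2 x = c\<^sub>2 (clamp01 x)" for x
  have cont: "continuous_on UNIV e1" "continuous_on UNIV e2" "continuous_on UNIV d1" "continuous_on UNIV d2"
    unfolding e1_def[abs_def] e2_def[abs_def] d1_def[abs_def] d2_def[abs_def] using assms(3-6) by (auto intro: continuous_clamp01)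
  have on01: "e1 x = \<epsilon>\<^sub>1 x" "e2 x = \<epsilon>\<^sub>2 x" "d1 x = c\<^sub>1 x" "d2 x = c\<^sub>2 x" if "x \<in> {0..1}" for x
    using clamp01_id[OF that] by (simp_all add: e1_def e2_def d1_def d2_def)
  have I: "compact {0..1::real}" "{0..1::real} \<noteq> {}" by auto
  obtain a1 where a1: "a1 \<in> {0..1}" "\<And>y. y \<in> {0..1} \<Longrightarrow> \<epsilon>\<^sub>1 a1 \<le> \<epsilon>\<^sub>1 y" using continuous_attains_inf[OF I assms(3)] by blast
  obtain a2 where a2: "a2 \<in> {0..1}" "\<And>y. y \<in> {0..1} \<Longrightarrow> \<epsilon>\<^sub>2 a2 \<le> \<epsilon>\<^sub>2 y" using continuous_attains_inf[OF I assms(4)] by blast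
  obtain b1 where b1: "b1 \<in> {0..1}" "\<And>y. y \<in> {0..1} \<Longrightarrow> \<epsilon>\<^sub>1 y \<le> \<epsilon>\<^sub>1 b1" using continuous_attains_sup[OF I assms(3)] by blast
  obtain b2 where b2: "b2 \<in> {0..1}" "\<And>y. y \<in> {0..1} \<Longrightarrow> \<epsilon>\<^sub>2 y \<le> \<epsilon>\<^sub>2 b2" using continuous_attains_sup[OF I assms(4)] by blast
  define m where "m = min (\<epsilon>\<^sub>1 a1) (\<epsilon>\<^sub>2 a2)"
  define M where "M = max (\<epsilon>\<^sub>1 b1) (\<epsilon>\<^sub>2 b2)"
  have m: "0 < m" using assms(7,8) a1(1) a2(1) by (auto simp: m_def)
  have em: "m \<le> e1 x" "m \<le> e2 x" "e1 x \<le> M" "e2 x \<le> M" for x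
    using a1(2)[OF clamp01_in[of x]] a2(2)[OF clamp01_in[of x]] b1(2)[OF clamp01_in[of x]] b2(2)[OF clamp01_in[of x]]
    by (auto simp: e1_def e2_def m_def M_def)
  have "bounded (c\<^sub>1 ` {0..1})" "bounded (c\<^sub>2 ` {0..1})"
    using assms(5,6) by (auto intro!: compact_imp_bounded compact_continuous_image)
  then obtain D1 D2 where D12: "\<And>x. x \<in> {0..1} \<Longrightarrow> \<bar>c\<^sub>1 x\<bar> \<le> D1" "\<And>x. x \<in> {0..1} \<Longrightarrow> \<bar>c\<^sub>2 x\<bar> \<le> D2"
    unfolding bounded_iff by (metis imageI real_norm_def)
  define D where "D = max D1 D2"
  have dD: "\<bar>d1 x\<bar> \<le> D" "\<bar>d2 x\<bar> \<le> D" for x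
    using D12(1)[OF clamp01_in[of x]] D12(2)[OF clamp01_in[of x]] by (auto simp: d1_def d2_def D_def)
  obtain \<phi>1 \<psi>1 where S1: "speed e1 \<phi>1 \<psi>1 m M" using speed_exists[OF cont(1) m em(1,3)] by blast
  obtain \<phi>2 \<psi>2 where S2: "speed e2 \<phi>2 \<psi>2 m M" using speed_exists[OF cont(2) m em(2,4)] by blast
  note K = assms(9)[unfolded K_kernels_def]
  define K1 where "K1 = zero_ext triangle K21"
  define K2 where "K2 = zero_ext triangle K22"
  have Kin: "K1 x y = K21 x y" "K2 x y = K22 x y" if "(x, y) \<in> triangle" for x y
    using that by (simp_all add: K1_def K2_def zero_ext_def)
  have tri: "0 \<le> y \<and> y \<le> 1 \<and> y \<in> {0..1} \<and> x \<in> {0..1}" if "(x, y) \<in> triangle" for x y using that by (auto simp: triangle_def)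
  obtain B1 where B1: "\<And>x y. (x, y) \<in> triangle \<Longrightarrow> \<bar>K21 x y\<bar> \<le> B1" using bounded_on_triangle K by blast
  obtain B2 where B2: "\<And>x y. (x, y) \<in> triangle \<Longrightarrow> \<bar>K22 x y\<bar> \<le> B2" using bounded_on_triangle K by blast
  define B where "B = max 0 (max B1 B2)"
  have edge: "(1, y) \<in> triangle" if "y \<in> {0..1}" for y using that by (auto simp: triangle_def)
  have "ctrl e1 \<phi>1 \<psi>1 e2 \<phi>2 \<psi>2 m M d1 d2 q D K1 K2 B \<tau>"
  proof (intro ctrl.intro hyp.intro hyp_axioms.intro ctrl_axioms.intro S1 S2 cont dD assms(1,2))
    show "case_prod K1 \<in> borel_measurable (borel \<Otimes>\<^sub>M borel)" "case_prod K2 \<in> borel_measurable (borel \<Otimes>\<^sub>M borel)"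
      unfolding K1_def K2_def using K closed_triangle by (auto intro!: zero_ext_continuous_measurable)
    show "\<bar>K1 x y\<bar> \<le> B" "\<bar>K2 x y\<bar> \<le> B" for x y
      using B1[of x y] B2[of x y] by (auto simp: K1_def K2_def zero_ext_def B_def)
    show "K1 x y = 0 \<and> K2 x y = 0" if "(x, y) \<notin> triangle" for x y
      using that by (simp add: K1_def K2_def zero_ext_def)
    show "mild_transport triangle e2 (\<lambda>y. - e1 y) (\<lambda>x y. e1 y * K1 x y) (\<lambda>x y. e1 y * (d2 y * K2 x y))"
    proof (rule mild_transport_cong[OF mild_transport_speed_cong])
      show "mild_transport triangle \<epsilon>\<^sub>2 (\<lambda>y. - \<epsilon>\<^sub>1 y) (\<lambda>x y. \<epsilon>\<^sub>1 y * K21 x y) (\<lambda>x y. \<epsilon>\<^sub>1 y * (c\<^sub>2 y * K22 x y))" using K by blast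
    qed (use tri on01 Kin in auto)
    show "mild_transport triangle e2 e2 (\<lambda>x y. e2 y * K2 x y) (\<lambda>x y. e2 y * (d1 y * K1 x y))"
    proof (rule mild_transport_cong[OF mild_transport_speed_cong])
      show "mild_transport triangle \<epsilon>\<^sub>2 \<epsilon>\<^sub>2 (\<lambda>x y. \<epsilon>\<^sub>2 y * K22 x y) (\<lambda>x y. \<epsilon>\<^sub>2 y * (c\<^sub>1 y * K21 x y))" using K by blast
    qed (use tri on01 Kin in auto)
    show "K1 x x = - d2 x / (e1 x + e2 x)" if x: "x \<in> {0..1}" for x
    proof -
      have "(x, x) \<in> triangle" using x by (auto simp: triangle_def)
      then show ?thesis using K x on01[OF x] Kin by auto
    qed
    show "e2 0 * K2 x 0 = q * e1 0 * K1 x 0" if x: "x \<in> {0..1}" for x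
    proof -
      have "(x, 0) \<in> triangle" using x by (auto simp: triangle_def)
      then show ?thesis using K x on01[of 0] Kin by auto
    qed
    have "continuous_on {0..1} (Pair (1 :: real) :: real \<Rightarrow> _)" by (intro continuous_intros)
    moreover have "Pair 1 ` {0..1} \<subseteq> triangle" using edge by blast
    ultimately have "continuous_on {0..1} (\<lambda>y. K21 1 y)" "continuous_on {0..1} (\<lambda>y. K22 1 y)"
      using K continuous_on_compose2[of triangle "\<lambda>(x, y). K21 x y" "{0..1}" "\<lambda>y. (1, y)"]
        continuous_on_compose2[of triangle "\<lambda>(x, y). K22 x y" "{0..1}" "\<lambda>y. (1, y)"]
      by simp_all
    moreover have "continuous_on {0..1} (K1 1) = continuous_on {0..1} (K21 1)" "continuous_on {0..1} (K2 1) = continuous_on {0..1} (K22 1)"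
      by (rule continuous_on_cong; use edge Kin in simp)+
    ultimately show "continuous_on {0..1} (K1 1)" "continuous_on {0..1} (K2 1)" by simp_all
  qed
  then interpret ctrl e1 \<phi>1 \<psi>1 e2 \<phi>2 \<psi>2 m M d1 d2 q D K1 K2 B \<tau> .
  obtain \<Delta> where \<Delta>: "0 < \<Delta>"
    "\<And>\<theta> q1 q2 sol. kernel \<theta> q1 q2 \<Longrightarrow> \<bar>\<theta> - \<tau>\<bar> \<le> \<Delta> \<Longrightarrow>
      (\<And>u1 u2 v. sol u1 u2 v \<Longrightarrow> \<exists>w1 w2 w3. (\<forall>T. closed_loop T \<theta> q1 q2 w1 w2 w3) \<and>
        (\<forall>t\<ge>0. ennreal ((L2_norm3 (\<lambda>x. u1 x t) (\<lambda>x. u2 x t) (\<lambda>x. v x t))\<^sup>2) = nrm w1 w2 w3 t)) \<Longrightarrow>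
      asymptotically_stable sol"
    using robust_stability by blast
  show ?thesis
  proof (intro exI conjI allI impI)
    show "0 < \<Delta>" by (rule \<Delta>)
    fix \<theta> \<alpha>\<^sub>1 \<alpha>\<^sub>2
    assume \<theta>: "0 < \<theta>" "\<bar>\<theta> - \<tau>\<bar> \<le> \<Delta>" and \<alpha>: "\<alpha>_kernels \<epsilon>\<^sub>1 \<epsilon>\<^sub>2 c\<^sub>1 c\<^sub>2 q K21 K22 \<theta> \<alpha>\<^sub>1 \<alpha>\<^sub>2"
    have k: "kernel \<theta> (\<lambda>y \<sigma>. e2 y * zero_ext ({0..1} \<times> {0..1}) \<alpha>\<^sub>2 (\<sigma> / \<theta>) y)
      (\<lambda>y \<sigma>. e1 y * zero_ext ({0..1} \<times> {0..1}) \<alpha>\<^sub>1 (\<sigma> / \<theta>) y)"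
      by (rule \<alpha>_kernels_kernel[OF \<alpha> \<theta>(1) on01]) (use Kin edge in auto)
    show "asymptotically_stable (closed_loop_solution \<epsilon>\<^sub>1 \<epsilon>\<^sub>2 c\<^sub>1 c\<^sub>2 q \<tau> \<theta> \<alpha>\<^sub>1 \<alpha>\<^sub>2)"
    proof (rule \<Delta>(2)[OF k \<theta>(2)])
      fix u1 u2 v
      assume sol: "closed_loop_solution \<epsilon>\<^sub>1 \<epsilon>\<^sub>2 c\<^sub>1 c\<^sub>2 q \<tau> \<theta> \<alpha>\<^sub>1 \<alpha>\<^sub>2 u1 u2 v"
      note cl = closed_loop_of_solution[OF sol \<theta>(1) on01]
      show "\<exists>w1 w2 w3. (\<forall>T. closed_loop T \<theta> (\<lambda>y \<sigma>. e2 y * zero_ext ({0..1} \<times> {0..1}) \<alpha>\<^sub>2 (\<sigma> / \<theta>) y)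
          (\<lambda>y \<sigma>. e1 y * zero_ext ({0..1} \<times> {0..1}) \<alpha>\<^sub>1 (\<sigma> / \<theta>) y) w1 w2 w3) \<and>
        (\<forall>t\<ge>0. ennreal ((L2_norm3 (\<lambda>x. u1 x t) (\<lambda>x. u2 x t) (\<lambda>x. v x t))\<^sup>2) = nrm w1 w2 w3 t)"
        by (intro exI conjI allI impI) (rule cl; assumption)+
    qed
  qed
qed

end
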